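(* There is a $\bar\gamma$-dimensional subspace (namely $\mathrm{Ker}\,\bar R_{(1,0)}(s^\gamma,\vartheta_s/\gamma)$) of the solution space $\mathrm{Ker}\,R_{(1,0)}(s,\vartheta_s)$ whose global monodromy group $\bar H_{\gamma,\mathbf B}$ is given by the generators $$M_{\omega^0}=h_1=(h_0h_\infty)^{-1},\qquad M_\infty=h_\infty^\gamma,\qquad M_{\omega^i}=h_\infty^{-i}h_1h_\infty^i\quad(i=1,2,\dots,\gamma-1).$$ Here $M_{\omega^i}$ denotes the monodromy action around the point $\omega^i\in\mathbb P^1_s$. In particular $\bar H_{\gamma,\mathbf B}$ is a discrete subgroup of $GL(\bar\gamma,\mathbb Z)$, and $h_1^2=\mathrm{id}$ for $n$ odd.
   Context: Let $n\ge 1$. Let $\alpha(1),\dots,\alpha(n+2)\in\mathbb Z^n$ with $\alpha(n+1)=0$, such that the convex hull $\Delta$ of $\alpha(1),\dots,\alpha(n+1)$ is an $n$-dimensional simplex and $\alpha(n+2)$ lies in its interior. Put $\gamma=n!\,\mathrm{vol}(\Delta)$ and, for $1\le q\le n+1$, $B_q=n!\,\mathrm{vol}$ of the convex hull of $\{\alpha(i)\}_{i=1}^{n+2}\setminus\{\alpha(q)\}$; these are positive integers with $\sum_{q=1}^{n+1}B_q=\gamma$, $\mathbf B=(B_1,\dots,B_{n+1})$. It is assumed that $\gcd(B_1,\dots,B_{n+1})=1$. With $(a)_m=a(a+1)\cdots(a+m-1)$, $\vartheta_s=s\,\partial_s$ and $\mathcal L_q(0,z,1)=-\frac{B_qz}\gamma+\delta_{q,n+1}$,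 put $$R_{(1,0)}(s,\vartheta_s)=(-\vartheta_s)_\gamma-s^\gamma(-1)^\gamma\prod_{q=1}^{n+1}\bigl(\mathcal L_q(0,-\vartheta_s,1)\bigr)_{B_q}.$$ This is the operator annihilating the period integrals $\int_{\mathsf t\delta(s)}\frac{1}{f}\frac{dx_1\wedge\dots\wedge dx_n}{x_1\cdots x_n}$ ($\mathsf t\delta(s)$ the Leray tube over a cycle $\delta(s)\in H_{n-1}(Z_f)$) of $Z_f=\{f=0\}\subset(\mathbb C^\times)^n$, $f=\sum_{j=1}^nx^{\alpha(j)}+1+sx^{\alpha(n+2)}$. Its nonzero finite singular points, i.e. the solutions of $\bigl(\prod_{q=1}^{n+1}B_q^{B_q}\bigr)(s/\gamma)^\gamma=1$, are denoted $\omega^i$, $i=0,1,\dots,\gamma-1$. Define the multisets $C^+=\{0,\frac1\gamma,\dots,\frac{\gamma-1}\gamma\}$, $C^-(1,0)=\{\frac j{B_q}:1\le q\le n+1,\ 0\le j\le B_q-1\}$ (with multiplicity), $C^0(1,0)=C^+\cap C^-(1,0)$ (multiset intersection), and $\bar\gamma=\sharp|C^+\setminus C^0(1,0)|=\sharp|C^-(1,0)\setminus C^0(1,0)|$. Put $$\bar R_{(1,0)}(t,\vartheta_t)=\prod_{\alpha^+\in C^+\setminus C^0(1,0)}(\vartheta_t+\alpha^+)-t\prod_{\alpha^-\in C^-(1,0)\setminus C^0(1,0)}(\vartheta_t+\alpha^-+1),\quad\vartheta_t=t\,\partial_t.$$ The substitution $t=s^\gamma$ (Kummer covering) is understood up to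 multiplication of $t$ by a nonzero constant, so that the point $t=1$ corresponds to the points $s=\omega^i$. The integers $\mathcal A_i,\mathcal B_i$ are defined by $\prod_{\alpha^-\in C^-(1,0)\setminus C^0(1,0)}(\mathsf t-e^{2\pi i\alpha^-})=\mathsf t^{\bar\gamma}+\mathcal A_1\mathsf t^{\bar\gamma-1}+\dots+\mathcal A_{\bar\gamma}$ and $\prod_{\alpha^+\in C^+\setminus C^0(1,0)}(\mathsf t-e^{2\pi i\alpha^+})=\mathsf t^{\bar\gamma}+\mathcal B_1\mathsf t^{\bar\gamma-1}+\dots+\mathcal B_{\bar\gamma}$, with $\mathcal A_{\bar\gamma}=(-1)^n$, $\mathcal B_{\bar\gamma}=1$. The matrices are $$h_\infty=\begin{pmatrix}0&0&\cdots&0&(-1)^{n+1}\\1&0&\cdots&0&-\mathcal A_{\bar\gamma-1}\\0&1&\cdots&0&-\mathcal A_{\bar\gamma-2}\\\vdots&\vdots&\ddots&\vdots&\vdots\\0&0&\cdots&1&-\mathcal A_1\end{pmatrix},\qquad(h_0)^{-1}=\begin{pmatrix}0&0&\cdots&0&-1\\1&0&\cdots&0&-\mathcal B_{\bar\gamma-1}\\0&1&\cdots&0&-\mathcal B_{\bar\gamma-2}\\\vdots&\vdots&\ddots&\vdots&\vdots\\0&0&\cdots&1&-\mathcal B_1\end{pmatrix},\qquad h_1=(h_0h_\infty)^{-1}.$$ They are the local monodromies of $\mathrm{Ker}\,\bar R_{(1,0)}(t,\vartheta_t)$ at $t=\infty,0,1$ (anticlockwise loops at $t=0,\infty$) in a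 suitable basis.
   Formalization: The subspace of Ker R is s^γ·Ker R̄(s^γ,ϑ_s/γ) instead of Ker R̄ itself, which is never contained in Ker R (its exponents at s=0 are negative, those of R are 0,…,γ−1); the monodromy claims are stated for both Ker R̄ and s^γ·Ker R̄. *)

theory Defs
  imports
    "HOL-Complex_Analysis.Complex_Analysis"
    "HOL-Library.Function_Algebras"
    "HOL-Algebra.Generated_Groups"
    "Jordan_Normal_Form.Matrix"
begin

section \<open>Lattice points\<close>

definition real_pt :: "int ^ 'n \<Rightarrow> real ^ 'n" where
  "real_pt a = (\<chi> i. real_of_int (vec_nth a i))"


section \<open>Differential operators in one complex variable\<close>

definition euler_op :: "(complex \<Rightarrow> complex) \<Rightarrow> complex \<Rightarrow> complex" where
  "euler_op f s = s * deriv f s"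

text \<open>\<open>poly_op p T\<close> is the operator \<open>p(T)\<close> for a polynomial \<open>p\<close> with constant coefficients.
  The polynomial \<open>[:0, 1:]\<close> thus stands for the operator \<open>T\<close> itself.\<close>

definition poly_op ::
    "complex poly \<Rightarrow> ((complex \<Rightarrow> complex) \<Rightarrow> complex \<Rightarrow> complex) \<Rightarrow>
     (complex \<Rightarrow> complex) \<Rightarrow> complex \<Rightarrow> complex" where
  "poly_op p T f s = (\<Sum>k\<le>Polynomial.degree p. Polynomial.coeff p k * (T ^^ k) f s)"

text \<open>Here \<open>B 1, \<dots>, B (n + 1)\<close> are the normalized volumes; \<open>L_form n \<gamma> B q z\<close> is
  \<open>\<L>\<^sub>q(0, z, 1)\<close>, with a polynomial in the Euler operator substituted for \<open>z\<close>.\<close>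

definition L_form :: "nat \<Rightarrow> nat \<Rightarrow> (nat \<Rightarrow> nat) \<Rightarrow> nat \<Rightarrow> complex poly \<Rightarrow> complex poly" where
  "L_form n \<gamma> B q z =
     - Polynomial.smult (of_nat (B q) / of_nat \<gamma>) z + (if q = n + 1 then 1 else 0)"

definition R_op ::
    "nat \<Rightarrow> nat \<Rightarrow> (nat \<Rightarrow> nat) \<Rightarrow> (complex \<Rightarrow> complex) \<Rightarrow> complex \<Rightarrow> complex" where
  "R_op n \<gamma> B f s =
     poly_op (pochhammer (- [:0, 1:]) \<gamma>) euler_op f s
     - s ^ \<gamma> * (-1) ^ \<gamma> *
       poly_op (\<Prod>q=1..n+1. pochhammer (L_form n \<gamma> B q (- [:0, 1:])) (B q)) euler_op f s"

definition C_plus :: "nat \<Rightarrow> real multiset" where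
  "C_plus \<gamma> = image_mset (\<lambda>j. real j / real \<gamma>) (mset_set {0..<\<gamma>})"

definition C_minus :: "nat \<Rightarrow> (nat \<Rightarrow> nat) \<Rightarrow> real multiset" where
  "C_minus n B = (\<Sum>q=1..n+1. image_mset (\<lambda>j. real j / real (B q)) (mset_set {0..<B q}))"

definition C_zero :: "nat \<Rightarrow> nat \<Rightarrow> (nat \<Rightarrow> nat) \<Rightarrow> real multiset" where
  "C_zero n \<gamma> B = C_plus \<gamma> \<inter># C_minus n B"

definition gamma_bar :: "nat \<Rightarrow> nat \<Rightarrow> (nat \<Rightarrow> nat) \<Rightarrow> nat" where
  "gamma_bar n \<gamma> B = size (C_plus \<gamma> - C_zero n \<gamma> B)"

text \<open>\<open>Rbar_op n \<gamma> B t T\<close> is the reduced operator, where the function \<open>t\<close> is substituted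
  for the coordinate and the operator \<open>T\<close> for its Euler operator.\<close>

definition Rbar_op ::
    "nat \<Rightarrow> nat \<Rightarrow> (nat \<Rightarrow> nat) \<Rightarrow> (complex \<Rightarrow> complex) \<Rightarrow>
     ((complex \<Rightarrow> complex) \<Rightarrow> complex \<Rightarrow> complex) \<Rightarrow>
     (complex \<Rightarrow> complex) \<Rightarrow> complex \<Rightarrow> complex" where
  "Rbar_op n \<gamma> B t T f s =
     poly_op (\<Prod>a\<in>#C_plus \<gamma> - C_zero n \<gamma> B. [:of_real a, 1:]) T f s
     - t s * poly_op (\<Prod>a\<in>#C_minus n B - C_zero n \<gamma> B. [:of_real a + 1, 1:]) T f s"

text \<open>The Kummer covering, normalized so that \<open>t = 1\<close> exactly at the points of
  \<open>sing_pts\<close> below.\<close>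

definition kummer :: "nat \<Rightarrow> nat \<Rightarrow> (nat \<Rightarrow> nat) \<Rightarrow> complex \<Rightarrow> complex" where
  "kummer n \<gamma> B s = (\<Prod>q=1..n+1. of_nat (B q) ^ B q) * (s / of_nat \<gamma>) ^ \<gamma>"

definition sing_pts :: "nat \<Rightarrow> nat \<Rightarrow> (nat \<Rightarrow> nat) \<Rightarrow> complex set" where
  "sing_pts n \<gamma> B = {s. (\<Prod>q=1..n+1. of_nat (B q) ^ B q) * (s / of_nat \<gamma>) ^ \<gamma> = 1}"

text \<open>The singular points are numbered clockwise, starting with the positive real one. This
  is the numbering that fits the matrices \<open>h\<^sub>\<infinity>\<^sup>-\<^sup>i h\<^sub>1 h\<^sub>\<infinity>\<^sup>i\<close> when these act as linear maps
  on coordinate columns (so that \<open>h\<^sub>\<infinity>\<^sup>i\<close> is applied first): an anticlockwise loop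
  at \<open>t = \<infinity>\<close> runs clockwise in the plane.\<close>

definition omega_pt :: "nat \<Rightarrow> nat \<Rightarrow> (nat \<Rightarrow> nat) \<Rightarrow> nat \<Rightarrow> complex" where
  "omega_pt n \<gamma> B i =
     of_real (real \<gamma> / root \<gamma> (\<Prod>q=1..n+1. real (B q) ^ B q)) * cis (- 2 * pi * real i / real \<gamma>)"


section \<open>Local solutions and monodromy\<close>

text \<open>Complex-valued functions on the plane as a complex vector space; this provides
  \<open>cfun.subspace\<close>, \<open>cfun.span\<close>, \<open>cfun.independent\<close> and \<open>cfun.dim\<close>.\<close>

interpretation cfun: vector_space "\<lambda>(c::complex) (f::complex \<Rightarrow> complex) z. c * f z"
  by unfold_locales (auto simp: fun_eq_iff algebra_simps)

text \<open>Solutions on an open set \<open>U\<close>, extended by zero so that a solution is determined by its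
  values on \<open>U\<close>.\<close>

definition ker_on ::
    "complex set \<Rightarrow> ((complex \<Rightarrow> complex) \<Rightarrow> complex \<Rightarrow> complex) \<Rightarrow> (complex \<Rightarrow> complex) set" where
  "ker_on U D = {f. f holomorphic_on U \<and> (\<forall>s\<in>U. D f s = 0) \<and> (\<forall>s. s \<notin> U \<longrightarrow> f s = 0)}"

definition is_basis :: "(complex \<Rightarrow> complex) set \<Rightarrow> nat \<Rightarrow> (nat \<Rightarrow> complex \<Rightarrow> complex) \<Rightarrow> bool" where
  "is_basis W m b \<longleftrightarrow>
     inj_on b {..<m} \<and> cfun.independent (b ` {..<m}) \<and> cfun.span (b ` {..<m}) = W"

text \<open>The germ of \<open>g\<close> at the end of the path \<open>p\<close> is the analytic continuation along \<open>p\<close> of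
  the germ of \<open>f\<close> at its start: there is a family of function elements \<open>(F t, D t)\<close>
  centred at \<open>p t\<close> whose germs are locally compatible.\<close>

definition continues_along ::
    "(real \<Rightarrow> complex) \<Rightarrow> (complex \<Rightarrow> complex) \<Rightarrow> (complex \<Rightarrow> complex) \<Rightarrow> bool" where
  "continues_along p f g \<longleftrightarrow>
     (\<exists>F D.
        (\<forall>t\<in>{0..1}. open (D t) \<and> p t \<in> D t \<and> F t holomorphic_on D t) \<and>
        (\<forall>t\<in>{0..1}. \<exists>\<delta>>0. \<forall>u\<in>{0..1}. \<bar>u - t\<bar> < \<delta> \<longrightarrow>
             p u \<in> D t \<and> (\<forall>\<^sub>F z in nhds (p u). F u z = F t z)) \<and>
        (\<forall>\<^sub>F z in nhds (pathstart p). f z = F 0 z) \<and>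
        (\<forall>\<^sub>F z in nhds (pathfinish p). g z = F 1 z))"

definition loop_in :: "complex set \<Rightarrow> complex \<Rightarrow> (real \<Rightarrow> complex) \<Rightarrow> bool" where
  "loop_in X s0 p \<longleftrightarrow> path p \<and> path_image p \<subseteq> X \<and> pathstart p = s0 \<and> pathfinish p = s0"

text \<open>Column \<open>j\<close> of the monodromy matrix holds the coordinates of the continuation of \<open>b j\<close>.\<close>

definition has_monodromy ::
    "nat \<Rightarrow> (nat \<Rightarrow> complex \<Rightarrow> complex) \<Rightarrow> (real \<Rightarrow> complex) \<Rightarrow> complex mat \<Rightarrow> bool" where
  "has_monodromy m b p M \<longleftrightarrow>
     M \<in> carrier_mat m m \<and>
     (\<forall>j<m. continues_along p (b j) (\<lambda>z. \<Sum>i<m. M $$ (i, j) * b i z))"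

definition monodromy_group ::
    "complex set \<Rightarrow> complex \<Rightarrow> nat \<Rightarrow> (nat \<Rightarrow> complex \<Rightarrow> complex) \<Rightarrow> complex mat set" where
  "monodromy_group X s0 m b = {M. \<exists>p. loop_in X s0 p \<and> has_monodromy m b p M}"

text \<open>Simple loops around a finite point, respectively around infinity, both anticlockwise
  on the Riemann sphere: as seen in the plane the loop around infinity runs clockwise.\<close>

definition loop_around :: "complex set \<Rightarrow> complex \<Rightarrow> complex \<Rightarrow> (real \<Rightarrow> complex) \<Rightarrow> bool" where
  "loop_around X s0 z p \<longleftrightarrow>
     (\<exists>d \<epsilon>. \<epsilon> > 0 \<and> cball z \<epsilon> - {z} \<subseteq> X \<and>
        path d \<and> path_image d \<subseteq> X \<and> pathstart d = s0 \<and> pathfinish d = z + of_real \<epsilon> \<and>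
        p = d +++ circlepath z \<epsilon> +++ reversepath d)"

definition loop_around_infinity :: "complex set \<Rightarrow> complex \<Rightarrow> (real \<Rightarrow> complex) \<Rightarrow> bool" where
  "loop_around_infinity X s0 p \<longleftrightarrow>
     (\<exists>d \<rho>. \<rho> > 0 \<and> - ball 0 \<rho> \<subseteq> X \<and>
        path d \<and> path_image d \<subseteq> X \<and> pathstart d = s0 \<and> pathfinish d = of_real \<rho> \<and>
        p = d +++ reversepath (circlepath 0 \<rho>) +++ reversepath d)"


section \<open>The hypergeometric matrices\<close>

definition GL :: "'a::comm_ring_1 itself \<Rightarrow> nat \<Rightarrow> 'a mat monoid" where
  "GL ty m = units_of (ring_mat ty m ())"

text \<open>In the matrices below, row \<open>i\<close> of the last column for \<open>i > 0\<close> is minus the coefficient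
  of \<open>\<t>\<^sup>i\<close>, i.e. minus the one with index \<open>m - i\<close> in the numbering by descending powers.\<close>

definition poly_minus :: "nat \<Rightarrow> nat \<Rightarrow> (nat \<Rightarrow> nat) \<Rightarrow> complex poly" where
  "poly_minus n \<gamma> B = (\<Prod>a\<in>#C_minus n B - C_zero n \<gamma> B. [:- cis (2 * pi * a), 1:])"

definition poly_plus :: "nat \<Rightarrow> nat \<Rightarrow> (nat \<Rightarrow> nat) \<Rightarrow> complex poly" where
  "poly_plus n \<gamma> B = (\<Prod>a\<in>#C_plus \<gamma> - C_zero n \<gamma> B. [:- cis (2 * pi * a), 1:])"

definition h_infinity :: "nat \<Rightarrow> nat \<Rightarrow> (nat \<Rightarrow> nat) \<Rightarrow> complex mat" where
  "h_infinity n \<gamma> B = (let m = gamma_bar n \<gamma> B in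
     Matrix.mat m m (\<lambda>(i, j).
       if j = m - 1 then (if i = 0 then (-1) ^ (n + 1) else - Polynomial.coeff (poly_minus n \<gamma> B) i)
       else if i = j + 1 then 1 else 0))"

definition h_zero_inverse :: "nat \<Rightarrow> nat \<Rightarrow> (nat \<Rightarrow> nat) \<Rightarrow> complex mat" where
  "h_zero_inverse n \<gamma> B = (let m = gamma_bar n \<gamma> B in
     Matrix.mat m m (\<lambda>(i, j).
       if j = m - 1 then (if i = 0 then -1 else - Polynomial.coeff (poly_plus n \<gamma> B) i)
       else if i = j + 1 then 1 else 0))"

definition h_zero :: "nat \<Rightarrow> nat \<Rightarrow> (nat \<Rightarrow> nat) \<Rightarrow> complex mat" where
  "h_zero n \<gamma> B = inv\<^bsub>GL TYPE(complex) (gamma_bar n \<gamma> B)\<^esub> (h_zero_inverse n \<gamma> B)"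

definition h_one :: "nat \<Rightarrow> nat \<Rightarrow> (nat \<Rightarrow> nat) \<Rightarrow> complex mat" where
  "h_one n \<gamma> B = (let G = GL TYPE(complex) (gamma_bar n \<gamma> B) in
     inv\<^bsub>G\<^esub> (h_zero n \<gamma> B \<otimes>\<^bsub>G\<^esub> h_infinity n \<gamma> B))"

definition M_omega :: "nat \<Rightarrow> nat \<Rightarrow> (nat \<Rightarrow> nat) \<Rightarrow> nat \<Rightarrow> complex mat" where
  "M_omega n \<gamma> B i = (let G = GL TYPE(complex) (gamma_bar n \<gamma> B); h = h_infinity n \<gamma> B in
     if i = 0 then h_one n \<gamma> B
     else inv\<^bsub>G\<^esub> (h [^]\<^bsub>G\<^esub> i) \<otimes>\<^bsub>G\<^esub> h_one n \<gamma> B \<otimes>\<^bsub>G\<^esub> (h [^]\<^bsub>G\<^esub> i))"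

definition M_infinity :: "nat \<Rightarrow> nat \<Rightarrow> (nat \<Rightarrow> nat) \<Rightarrow> complex mat" where
  "M_infinity n \<gamma> B = h_infinity n \<gamma> B [^]\<^bsub>GL TYPE(complex) (gamma_bar n \<gamma> B)\<^esub> \<gamma>"

definition H_bar :: "nat \<Rightarrow> nat \<Rightarrow> (nat \<Rightarrow> nat) \<Rightarrow> complex mat set" where
  "H_bar n \<gamma> B = generate (GL TYPE(complex) (gamma_bar n \<gamma> B))
     (insert (M_infinity n \<gamma> B) (M_omega n \<gamma> B ` {..<\<gamma>}))"

text \<open>Matrices carry no topology in the library; here they get the one of entrywise
  convergence.\<close>

definition discrete_mats :: "nat \<Rightarrow> complex mat set \<Rightarrow> bool" where
  "discrete_mats m H \<longleftrightarrow>
     discrete ((\<lambda>M (i, j). if i < m \<and> j < m then M $$ (i, j) else 0) ` H)"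

end

theory Submission
  imports Defs "Jordan_Normal_Form.Determinant"
begin

text \<open>The reduced operator is hypergeometric: in the coordinate \<open>u\<close> with \<open>t = exp u\<close> its solutions are, up to the
  factor \<open>t\<close>, the functions \<open>g\<close> with \<open>\<Prod>(\<partial> + a - 1) g = exp u * \<Prod>(\<partial> + b) g\<close>, where \<open>a\<close> and \<open>b\<close> run through the
  exponents that are left after the cancellation. A Mellin--Barnes integral
  \<open>\<integral> \<Prod> \<Gamma>(w + b) \<Gamma>(1 - a - w) exp (w u) dw\<close> solves this equation in a horizontal strip, up to a translation of \<open>u\<close>.
  Closing the contour to the right or to the left expresses it by residues, and continues it to the half-planes
  \<open>Re u < 0\<close> and \<open>Re u > 0\<close>, which are neighbourhoods of \<open>t = 0\<close> and \<open>t = \<infinity>\<close> (theorem \<open>mellin_barnes_solution\<close>).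

  Translating \<open>u\<close> by \<open>-2 \<pi> \<i>\<close> multiplies the integrand by \<open>exp (-2 \<pi> \<i> w)\<close>. On either side, a polynomial in this
  exponential cancels all the poles, so the translates satisfy linear recurrences whose characteristic
  polynomials are \<open>poly_plus\<close> on the left and \<open>poly_minus\<close> on the right. Consecutive translates therefore form
  a frame on which one turn acts by the companion matrix of one of these polynomials; these are the matrices
  \<open>h_zero_inverse\<close> and \<open>h_infinity\<close> (lemma \<open>hypergeometric_frame\<close>). Residue asymptotics show that the frame is
  linearly independent, because the exponents at \<open>t = 0\<close> are distinct.

  The Kummer covering \<open>s = \<kappa> exp (u / \<gamma>)\<close> sends the points \<open>2 \<pi> \<i> k\<close> to the singular points. Between two of them
  lies a segment of the imaginary axis, and over each segment the frame can be translated and normalized so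
  that all these frames agree on the right half-plane. On the left half-plane, neighbouring ones differ by a
  conjugate of \<open>h_one\<close>. Continuation along a path only passes between such frames, so the monodromy lies in the
  group generated by the matrices of the statement; small circles and a large circle, cut into parts that
  stay over one segment, realize the generators (theorem \<open>monodromy_group_eq\<close>).

  The remaining parts are algebraic. On functions \<open>s ^ \<gamma> * v s\<close> the operator \<open>R_op\<close> factors through the reduced
  one, because the cancelled exponents form a left factor (lemma \<open>reduced_kernel_subset\<close>). Uniqueness for
  linear differential equations bounds the dimension of the solution space by \<open>gamma_bar\<close>, which the frame
  attains. The reduced polynomials are products of cyclotomic polynomials and their quotients, so their
  coefficients are integers and their constant terms are \<open>1\<close> and \<open>(-1) ^ n\<close>; hence the matrices lie in
  \<open>GL\<close> over the integers and generate a discrete group. Finally \<open>h_one\<close> is a quotient of two companion matrices,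
  that is the identity up to its last column, and for odd \<open>n\<close> its last diagonal entry is \<open>-1\<close>.\<close>

section \<open>Subdividing the simplex\<close>

text \<open>Coning the facets from \<open>p\<close> covers the simplex, and two cones meet in the hull of at
  most \<open>CARD('n)\<close> points, which is a null set.\<close>

lemma simplex_subdivision_measure:
  fixes P :: "(real ^ 'n) set"
  assumes aff: "\<not> affine_dependent P" and p: "p \<in> convex hull P" and card: "card P = CARD('n) + 1"
  shows "measure lebesgue (convex hull P) = (\<Sum>x\<in>P. measure lebesgue (convex hull (insert p (P - {x}))))"
proof -
  have fin: "finite P" using aff by (rule aff_independent_finite)
  have neg: "negligible (convex hull (insert p (P - {x})) \<inter> convex hull (insert p (P - {y})))"
    if "x \<in> P" "y \<in> P" "x \<noteq> y" for x y
  proof -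
    have "convex hull (insert p (P - {x})) \<inter> convex hull (insert p (P - {y}))
        = convex hull (insert p ((P - {x}) \<inter> (P - {y})))"
      by (rule convex_hull_exchange_Int[OF aff p]) auto
    also have "(P - {x}) \<inter> (P - {y}) = P - {x, y}" by auto
    finally have eq: "convex hull (insert p (P - {x})) \<inter> convex hull (insert p (P - {y}))
        = convex hull (insert p (P - {x, y}))" .
    have "card (P - {x, y}) = CARD('n) - 1"
      using that fin card by (simp add: card_Diff_subset)
    moreover have "CARD('n) \<ge> 1" by (simp add: Suc_leI)
    ultimately have "card (insert p (P - {x, y})) \<le> DIM(real ^ 'n)"
      using card_insert_le_m1[of "CARD('n)" "P - {x,y}" p] by simp
    then have "interior (convex hull (insert p (P - {x, y}))) = {}"
      using fin by (intro empty_interior_convex_hull) auto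
    then show ?thesis unfolding eq by (simp add: negligible_convex_interior)
  qed
  have "measure lebesgue (convex hull P) = measure lebesgue (\<Union>x\<in>P. convex hull (insert p (P - {x})))"
    by (subst convex_hull_exchange_Union[OF p]) simp
  also have "\<dots> = (\<Sum>x\<in>P. measure lebesgue (convex hull (insert p (P - {x}))))"
    using fin neg
    by (intro measure_negligible_finite_Union_image)
       (auto simp: pairwise_def intro!: lmeasurable_compact finite_imp_compact_convex_hull)
  finally show ?thesis .
qed

lemma measure_simplex_pos:
  fixes P :: "(real ^ 'n) set"
  assumes "interior (convex hull P) \<noteq> {}" "finite P"
  shows "measure lebesgue (convex hull P) > 0"
proof -
  have "convex hull P \<in> lmeasurable"
    using assms by (intro lmeasurable_compact finite_imp_compact_convex_hull)
  moreover have "\<not> negligible (convex hull P)"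
    using assms by (simp add: negligible_convex_interior)
  ultimately have "measure lebesgue (convex hull P) \<noteq> 0"
    by (simp add: negligible_iff_measure)
  then show ?thesis by (simp add: less_le)
qed

text \<open>An interior point cannot lie in the hull of fewer vertices, so every cone has non-empty
  interior. The volumes hence have the positivity and the additivity that all later parts rely on.\<close>

lemma volumes:
  fixes \<alpha> :: "nat \<Rightarrow> int ^ 'n" and B :: "nat \<Rightarrow> nat" and \<gamma> n :: nat
  assumes n: "n = CARD('n)"
    and interior: "real_pt (\<alpha> (n + 2)) \<in> interior (convex hull ((\<lambda>i. real_pt (\<alpha> i)) ` {1..n+1}))"
    and vol: "real \<gamma> = fact n * measure lebesgue (convex hull ((\<lambda>i. real_pt (\<alpha> i)) ` {1..n+1}))"
    and vol_B: "\<forall>q\<in>{1..n+1}. real (B q) = fact n *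
        measure lebesgue (convex hull ((\<lambda>i. real_pt (\<alpha> i)) ` ({1..n+2} - {q})))"
  shows "\<gamma> > 0" "\<forall>q\<in>{1..n+1}. B q > 0" "(\<Sum>q=1..n+1. B q) = \<gamma>"
proof -
  define a where "a = (\<lambda>i. real_pt (\<alpha> i))"
  define p where "p = a (n + 2)"
  define P where "P = a ` {1..n+1}"
  have pint: "p \<in> interior (convex hull P)" using interior by (simp add: p_def P_def a_def)
  have finP: "finite P" by (simp add: P_def)
  have "\<not> card P \<le> DIM(real ^ 'n)"
    using pint empty_interior_convex_hull[OF finP] by auto
  moreover have "card P \<le> n + 1" unfolding P_def using card_image_le[of "{1..n+1}" a] by simp
  ultimately have cardP: "card P = n + 1" using n by simp
  have inj: "inj_on a {1..n+1}"
    using cardP unfolding P_def by (intro eq_card_imp_inj_on) auto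
  have aff: "\<not> affine_dependent P"
    using interior_convex_hull_eq_empty[of P] pint cardP n by auto
  have pin: "p \<in> convex hull P" using pint interior_subset by blast
  have hull_eq: "a ` ({1..n+2} - {q}) = insert p (P - {a q})" if "q \<in> {1..n+1}" for q
  proof -
    have "{1..n+2} - {q} = insert (n+2) ({1..n+1} - {q})" using that by auto
    moreover have "a ` ({1..n+1} - {q}) = P - {a q}"
      using inj that unfolding P_def by (subst inj_on_image_set_diff[OF inj]) auto
    ultimately show ?thesis by (simp add: p_def)
  qed
  have Bq: "real (B q) = fact n * measure lebesgue (convex hull (insert p (P - {a q})))"
    if "q \<in> {1..n+1}" for q
    using vol_B that hull_eq[OF that] by (auto simp: a_def)
  have "real \<gamma> = fact n * measure lebesgue (convex hull P)" using vol by (simp add: P_def a_def)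
  also have "\<dots> = (\<Sum>x\<in>P. fact n * measure lebesgue (convex hull (insert p (P - {x}))))"
    using simplex_subdivision_measure[OF aff pin] cardP n by (simp add: sum_distrib_left)
  also have "\<dots> = (\<Sum>q\<in>{1..n+1}. fact n * measure lebesgue (convex hull (insert p (P - {a q}))))"
    unfolding P_def by (subst sum.reindex[OF inj]) simp
  also have "\<dots> = (\<Sum>q\<in>{1..n+1}. real (B q))" using Bq by simp
  finally have "real (\<Sum>q=1..n+1. B q) = real \<gamma>" by simp
  then show "(\<Sum>q=1..n+1. B q) = \<gamma>" by linarith
  have "measure lebesgue (convex hull P) > 0" using measure_simplex_pos[of P] pint finP by auto
  then have "real \<gamma> > 0" using vol by (simp add: P_def a_def)
  then show "\<gamma> > 0" by simp
  show "\<forall>q\<in>{1..n+1}. B q > 0"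
  proof
    fix q assume q: "q \<in> {1..n+1}"
    have aq: "a q \<in> P" using q by (auto simp: P_def)
    have "\<not> affine_dependent (P - {a q})" using aff affine_independent_subset by blast
    moreover have "p \<notin> affine hull (P - {a q})"
    proof
      assume p': "p \<in> affine hull (P - {a q})"
      have "\<exists>u. (\<forall>x\<in>P. 0 < u x) \<and> sum u P = 1 \<and> (\<Sum>x\<in>P. u x *\<^sub>R x) = p"
        using pint interior_convex_hull_explicit_minimal[OF aff] cardP n by auto
      then obtain u where u: "\<And>x. x \<in> P \<Longrightarrow> 0 < u x" "sum u P = 1" "(\<Sum>x\<in>P. u x *\<^sub>R x) = p" by blast
      obtain v where v: "sum v (P - {a q}) = 1" "(\<Sum>x\<in>P - {a q}. v x *\<^sub>R x) = p"
        using p' affine_hull_finite[of "P - {a q}"] finP by auto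
      define d where "d = (\<lambda>x. u x - (if x = a q then 0 else v x))"
      have e1: "(\<Sum>x\<in>P. if x = a q then 0 else v x) = sum v (P - {a q})"
        using finP aq by (subst sum.remove[of P "a q"]) (auto intro: sum.cong)
      have "sum d P = 0"
        unfolding d_def sum_subtractf e1 using u(2) v(1) by simp
      have dq: "d (a q) \<noteq> 0" using u(1)[OF aq] by (simp add: d_def)
      have "(\<Sum>x\<in>P. (if x = a q then 0 else v x) *\<^sub>R x) = (\<Sum>x\<in>P - {a q}. v x *\<^sub>R x)"
        using finP aq by (subst sum.remove[of P "a q"]) (auto intro: sum.cong)
      then have "(\<Sum>x\<in>P. d x *\<^sub>R x) = 0"
        unfolding d_def scaleR_left_diff_distrib sum_subtractf using u(3) v(2) by simp
      with \<open>sum d P = 0\<close> dq aq have "affine_dependent P"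
        using affine_dependent_explicit_finite[OF finP] by auto
      with aff show False by simp
    qed
    ultimately have "\<not> affine_dependent (insert p (P - {a q}))" by (rule affine_independent_insert)
    moreover have "card (insert p (P - {a q})) = Suc (DIM(real ^ 'n))"
    proof -
      have "p \<notin> P - {a q}" using \<open>p \<notin> affine hull (P - {a q})\<close> hull_inc[of p "P - {a q}" affine] by blast
      then show ?thesis using finP aq cardP n by simp
    qed
    ultimately have "interior (convex hull (insert p (P - {a q}))) \<noteq> {}"
      using interior_convex_hull_eq_empty by blast
    then have "measure lebesgue (convex hull (insert p (P - {a q}))) > 0"
      using finP by (intro measure_simplex_pos) auto
    then show "B q > 0" using Bq[OF q] by (metis fact_gt_zero mult_pos_pos of_nat_0_less_iff)
  qed
qed

section \<open>Estimates for the gamma function and the sine\<close>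

text \<open>In the product formulas of both functions every factor of the quotient is largest in modulus at
  \<open>z = 0\<close>. The quotient is therefore bounded on the half-plane, which replaces the
  Stirling formula in the estimates below.\<close>

lemma norm_Gamma_ratio_le:
  fixes z :: complex and p q :: real
  assumes p: "0 < p" and pq: "p \<le> q" and z: "Re z \<ge> 0"
  shows "norm (Gamma (z + of_real p) * rGamma (z + of_real q)) \<le> Gamma p * rGamma q"
proof (rule LIMSEQ_le)
  show "(\<lambda>n. norm (Gamma_series (z + of_real p) n * rGamma_series (z + of_real q) n))
          \<longlonglongrightarrow> norm (Gamma (z + of_real p) * rGamma (z + of_real q))"
    by (intro tendsto_norm tendsto_mult Gamma_series_LIMSEQ rGamma_series_LIMSEQ)
  show "(\<lambda>n. Gamma_series p n * rGamma_series q n) \<longlonglongrightarrow> Gamma p * rGamma q"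
    by (intro tendsto_mult Gamma_series_LIMSEQ rGamma_series_LIMSEQ)
  have main: "norm (Gamma_series (z + of_real p) n * rGamma_series (z + of_real q) n)
      \<le> Gamma_series p n * rGamma_series q n" if n: "n \<ge> 1" for n
  proof -
    have fac: "norm (z + of_real q + of_nat k) / norm (z + of_real p + of_nat k) \<le> (q + real k) / (p + real k)" for k
    proof -
      have pos: "0 < p + real k" using p by simp
      have nz: "norm (z + of_real p + of_nat k) \<ge> p + real k"
        using complex_Re_le_cmod[of "z + of_real p + of_nat k"] z by simp
      have "norm (z + of_real q + of_nat k) \<le> norm (z + of_real p + of_nat k) + norm (of_real (q - p) :: complex)"
        using norm_triangle_ineq[of "z + of_real p + of_nat k" "of_real (q - p)"] by (simp add: algebra_simps)
      then have "norm (z + of_real q + of_nat k) \<le> norm (z + of_real p + of_nat k) + (q - p)"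
        using pq by (simp del: of_real_diff)
      then have "norm (z + of_real q + of_nat k) / norm (z + of_real p + of_nat k)
          \<le> (norm (z + of_real p + of_nat k) + (q - p)) / norm (z + of_real p + of_nat k)"
        by (intro divide_right_mono) auto
      also have "\<dots> = 1 + (q - p) / norm (z + of_real p + of_nat k)"
        using nz pos by (subst add_divide_distrib) (auto simp del: norm_le_zero_iff)
      also have "\<dots> \<le> 1 + (q - p) / (p + real k)"
        using nz pos pq by (intro add_left_mono divide_left_mono) (auto intro!: mult_pos_pos)
      also have "\<dots> = (q + real k) / (p + real k)" using pos by (simp add: field_simps)
      finally show ?thesis .
    qed
    have E: "exp (complex_of_real (ln (real n)) * (z + of_real p)) / exp (complex_of_real (ln (real n)) * (z + of_real q))
         = of_real (exp (ln (real n) * p) / exp (ln (real n) * q))"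
      by (simp add: exp_of_real[symmetric] exp_diff[symmetric] algebra_simps)
    have "norm (Gamma_series (z + of_real p) n * rGamma_series (z + of_real q) n)
       = norm (exp (complex_of_real (ln (real n)) * (z + of_real p)) / exp (complex_of_real (ln (real n)) * (z + of_real q)))
         * (norm (pochhammer (z + of_real q) (n+1)) / norm (pochhammer (z + of_real p) (n+1)))"
      by (simp add: Gamma_series_def rGamma_series_def norm_mult norm_divide mult.commute)
    also have "\<dots> = exp (ln (real n) * p) / exp (ln (real n) * q)
         * (\<Prod>k=0..<n+1. norm (z + of_real q + of_nat k) / norm (z + of_real p + of_nat k))"
      unfolding E by (simp add: pochhammer_prod prod_norm prod_dividef norm_divide del: prod.op_ivl_Suc)
    also have "\<dots> \<le> exp (ln (real n) * p) / exp (ln (real n) * q)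
         * (\<Prod>k=0..<n+1. (q + real k) / (p + real k))"
      by (intro mult_left_mono prod_mono) (use fac in auto)
    also have "\<dots> = Gamma_series p n * rGamma_series q n"
      by (simp add: Gamma_series_def rGamma_series_def pochhammer_prod prod_dividef mult.commute del: prod.op_ivl_Suc)
    finally show ?thesis .
  qed
  then show "\<exists>N. \<forall>n\<ge>N. norm (Gamma_series (z + of_real p) n * rGamma_series (z + of_real q) n)
      \<le> Gamma_series p n * rGamma_series q n" by blast
qed

lemma norm_sin_ge_exp_of_large_Im:
  fixes z :: complex
  assumes "\<bar>Im z\<bar> \<ge> 1"
  shows "exp \<bar>Im z\<bar> / 4 \<le> norm (sin z)"
proof -
  define y where "y = \<bar>Im z\<bar>"
  have y: "y \<ge> 1" using assms by (simp add: y_def)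
  have "norm (sin z) = norm (exp (\<i> * z) - exp (- (\<i> * z))) / 2"
    by (simp add: sin_exp_eq norm_divide norm_mult)
  moreover have "\<bar>norm (exp (\<i> * z)) - norm (exp (- (\<i> * z)))\<bar> \<le> norm (exp (\<i> * z) - exp (- (\<i> * z)))"
    by (rule norm_triangle_ineq3)
  moreover have "\<bar>norm (exp (\<i> * z)) - norm (exp (- (\<i> * z)))\<bar> = exp y - exp (-y)"
    using y unfolding y_def by (cases "Im z \<ge> 0") auto
  ultimately have "norm (sin z) \<ge> (exp y - exp (-y)) / 2" by simp
  moreover have "exp (-y) \<le> 1" using y by simp
  moreover have "exp y \<ge> 2" using exp_ge_add_one_self[of y] y by linarith
  moreover have "a / 4 \<le> N" if "(a - b) / 2 \<le> N" "b \<le> 1" "2 \<le> a" for a b N :: real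
    using that by (simp add: field_simps)
  ultimately have "norm (sin z) \<ge> exp y / 4" by blast
  then show ?thesis by (simp add: y_def)
qed

lemma norm_sin_ge_exp:
  fixes z :: complex and \<delta> :: real
  assumes "\<delta> \<le> norm (sin z)" "0 \<le> \<delta>" "\<delta> \<le> 1"
  shows "\<delta> / 4 * exp \<bar>Im z\<bar> \<le> norm (sin z)"
proof (cases "\<bar>Im z\<bar> \<le> 1")
  case True
  then have "exp \<bar>Im z\<bar> \<le> exp 1" by simp
  also have "\<dots> \<le> (4::real)" using exp_le by simp
  finally have "\<delta> / 4 * exp \<bar>Im z\<bar> \<le> \<delta> / 4 * 4" using assms by (intro mult_left_mono) auto
  then show ?thesis using assms by simp
next
  case False
  have "\<delta> / 4 * exp \<bar>Im z\<bar> \<le> 1 / 4 * exp \<bar>Im z\<bar>" using assms by (intro mult_right_mono) auto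
  also have "\<dots> \<le> norm (sin z)" using norm_sin_ge_exp_of_large_Im[of z] False by simp
  finally show ?thesis .
qed

lemma abs_sin_Re_le_norm_sin: "\<bar>sin (Re z)\<bar> \<le> norm (sin z)" for z :: complex
proof -
  have "1 \<le> (exp (Im z) + exp (- Im z)) / 2"
    using cosh_real_ge_1[of "Im z"] by (simp add: cosh_def)
  then have "\<bar>sin (Re z)\<bar> * 1 \<le> \<bar>sin (Re z)\<bar> * ((exp (Im z) + exp (- Im z)) / 2)"
    by (intro mult_left_mono) auto
  also have "\<dots> = \<bar>Re (sin z)\<bar>" by (simp add: Re_sin abs_mult)
  also have "\<dots> \<le> norm (sin z)" by (rule abs_Re_le_cmod)
  finally show ?thesis by simp
qed

lemma Gamma_reflect:
  fixes z :: complex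
  assumes "Re z < 1"
  shows "Gamma z = of_real pi / sin (of_real pi * z) * rGamma (1 - z)"
proof -
  have "Gamma (1 - z) \<noteq> 0" using assms by (force simp: Gamma_eq_zero_iff elim!: nonpos_Ints_cases dest: arg_cong[where f = Re])
  then have "Gamma z = Gamma z * Gamma (1 - z) * rGamma (1 - z)" by (simp add: rGamma_inverse_Gamma)
  then show ?thesis using Gamma_reflection_complex[of z] by simp
qed

text \<open>By reflection, \<open>\<Gamma>(w + b) \<Gamma>(c - w)\<close> is the quotient of
  \<open>\<Gamma>(w + b)\<close> and \<open>\<Gamma>(1 - c + w)\<close>, times \<open>\<pi> / sin
  (\<pi> (c - w))\<close>. The quotient grows at most linearly, and the sine provides the decay in
  the imaginary direction.\<close>

lemma norm_Gamma_pair_le: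
  fixes b c \<epsilon> \<delta> :: real
  assumes b: "- \<epsilon> < b" "b < 1 - \<epsilon>" and c: "\<epsilon> < c" "c < 1 + \<epsilon>" and \<delta>: "0 < \<delta>"
  shows "\<exists>C. \<forall>w. Re w \<ge> \<epsilon> \<longrightarrow> norm (sin (of_real pi * (of_real c - w))) \<ge> \<delta> \<longrightarrow>
           norm (Gamma (w + of_real b) * Gamma (of_real c - w)) \<le> C * (1 + norm w) * exp (- pi * \<bar>Im w\<bar>)"
proof -
  define d where "d = min \<delta> 1"
  define K where "K = Gamma (\<epsilon> + b) * rGamma (\<epsilon> + (2 - c))"
  have d: "0 < d" "d \<le> 1" using \<delta> by (auto simp: d_def)
  have K0: "K \<ge> 0" unfolding K_def rGamma_inverse_Gamma using b c
    by (intro mult_nonneg_nonneg) (auto intro!: less_imp_le[OF Gamma_real_pos])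
  show ?thesis
  proof (intro exI allI impI)
    fix w assume w: "Re w \<ge> \<epsilon>" and s: "norm (sin (of_real pi * (of_real c - w))) \<ge> \<delta>"
    have "d / 4 * exp \<bar>Im (of_real pi * (of_real c - w))\<bar> \<le> norm (sin (of_real pi * (of_real c - w)))"
      using s d by (intro norm_sin_ge_exp) (auto simp: d_def)
    then have sin_ge: "d / 4 * exp (pi * \<bar>Im w\<bar>) \<le> norm (sin (of_real pi * (of_real c - w)))"
      by (simp add: abs_mult)
    have "Gamma (of_real c - w) = of_real pi / sin (of_real pi * (of_real c - w)) * rGamma (1 - (of_real c - w))"
      using w c by (intro Gamma_reflect) auto
    also have "rGamma (1 - (of_real c - w)) = (1 - of_real c + w) * rGamma (w + of_real (2 - c))"
      using rGamma_plus1[of "1 - (of_real c - w)"] by (simp add: algebra_simps)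
    finally have "norm (Gamma (w + of_real b) * Gamma (of_real c - w))
      = pi / norm (sin (of_real pi * (of_real c - w))) * norm (1 - of_real c + w)
         * norm (Gamma (w + of_real b) * rGamma (w + of_real (2 - c)))"
      by (simp add: norm_mult norm_divide)
    also have "\<dots> \<le> (pi * 4 / d) * exp (- pi * \<bar>Im w\<bar>) * ((1 + \<bar>1 - c\<bar>) * (1 + norm w)) * K"
    proof (intro mult_mono mult_nonneg_nonneg)
      have "pi / norm (sin (of_real pi * (of_real c - w))) \<le> pi / (d / 4 * exp (pi * \<bar>Im w\<bar>))"
        using sin_ge less_le_trans[OF _ sin_ge, of 0] d
        by (intro divide_left_mono mult_pos_pos) (auto simp del: zero_less_norm_iff)
      also have "\<dots> = (pi * 4 / d) * exp (- pi * \<bar>Im w\<bar>)" by (simp add: exp_minus field_simps)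
      finally show "pi / norm (sin (of_real pi * (of_real c - w))) \<le> (pi * 4 / d) * exp (- pi * \<bar>Im w\<bar>)" .
      have "norm (1 - of_real c + w) \<le> norm (of_real (1 - c) :: complex) + norm w"
        using norm_triangle_ineq[of "of_real (1 - c)" w] by simp
      also have "\<dots> = \<bar>1 - c\<bar> + norm w" by (simp only: norm_of_real)
      also have "\<dots> \<le> (1 + \<bar>1 - c\<bar>) * (1 + norm w)" by (simp add: algebra_simps)
      finally show "norm (1 - of_real c + w) \<le> (1 + \<bar>1 - c\<bar>) * (1 + norm w)" .
      have "norm (Gamma ((w - of_real \<epsilon>) + of_real (\<epsilon> + b)) * rGamma ((w - of_real \<epsilon>) + of_real (\<epsilon> + (2 - c)))) \<le> K"
        unfolding K_def using b c w by (intro norm_Gamma_ratio_le) auto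
      then show "norm (Gamma (w + of_real b) * rGamma (w + of_real (2 - c))) \<le> K"
        by (simp add: algebra_simps)
    qed (use d in auto)
    finally show "norm (Gamma (w + of_real b) * Gamma (of_real c - w))
       \<le> ((pi * 4 / d) * (1 + \<bar>1 - c\<bar>) * K) * (1 + norm w) * exp (- pi * \<bar>Im w\<bar>)"
      by (simp only: mult_ac)
  qed
qed

lemma power_le_exp: 
  fixes \<eta> a :: real assumes "\<eta> > 0" "a \<ge> 0"
  shows "\<exists>C>0. \<forall>x\<ge>0. (a + x) ^ m \<le> C * exp (\<eta> * x)"
proof (intro exI conjI allI impI)
  show "exp (\<eta> * a) * fact m / \<eta> ^ m > 0" using assms by simp
  fix x :: real assume x: "x \<ge> 0"
  define y where "y = \<eta> * (a + x)"
  have y: "y \<ge> 0" using assms x by (simp add: y_def)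
  have "y ^ m / fact m = (\<Sum>k\<in>{m}. inverse (fact k) *\<^sub>R y ^ k)" by (simp add: field_simps)
  also have "\<dots> \<le> (\<Sum>k. inverse (fact k) *\<^sub>R y ^ k)"
    using y summable_exp_generic[of y] by (intro sum_le_suminf) auto
  also have "\<dots> = exp y" by (simp add: exp_def)
  finally have "y ^ m \<le> fact m * exp y" by (simp add: field_simps)
  moreover have "(a + x) ^ m = y ^ m / \<eta> ^ m" using assms by (simp add: y_def power_mult_distrib)
  ultimately have "(a + x) ^ m \<le> fact m * exp y / \<eta> ^ m" using assms by (simp add: divide_right_mono)
  also have "\<dots> = exp (\<eta> * a) * fact m / \<eta> ^ m * exp (\<eta> * x)"
    by (simp add: y_def algebra_simps exp_add)
  finally show "(a + x) ^ m \<le> exp (\<eta> * a) * fact m / \<eta> ^ m * exp (\<eta> * x)" .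
qed

lemma summable_power_exp:
  fixes \<eta> a :: real assumes "\<eta> > 0" "a \<ge> 0"
  shows "summable (\<lambda>k::nat. (a + real k) ^ m * exp (- \<eta> * real k))"
proof -
  obtain C where C: "C > 0" "\<And>x. x \<ge> 0 \<Longrightarrow> (a + x) ^ m \<le> C * exp (\<eta> / 2 * x)"
    using power_le_exp[of "\<eta>/2" a m] assms by auto
  show ?thesis
  proof (rule summable_comparison_test')
    show "summable (\<lambda>k. C * exp (- \<eta> / 2) ^ k)"
      using assms by (intro summable_mult summable_geometric) auto
    fix k :: nat
    have "(a + real k) ^ m * exp (- \<eta> * real k) \<le> C * exp (\<eta> / 2 * real k) * exp (- \<eta> * real k)"
      using C by (intro mult_right_mono) auto
    also have "\<dots> = C * exp (- \<eta> / 2) ^ k" by (simp add: exp_of_nat_mult[symmetric] exp_add[symmetric] mult.assoc mult.commute)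
       (simp add: field_simps)?
    finally show "norm ((a + real k) ^ m * exp (- \<eta> * real k)) \<le> C * exp (- \<eta> / 2) ^ k"
      using assms by simp
  qed
qed

lemma poly_norm_bound:
  fixes p :: "complex poly"
  shows "\<exists>C d. C \<ge> 0 \<and> (\<forall>w. norm (poly p w) \<le> C * (1 + norm w) ^ d)"
proof (induction p)
  case 0
  show ?case by (intro exI[of _ 0]) auto
next
  case (pCons a p)
  then obtain C d where C: "C \<ge> 0" "\<And>w. norm (poly p w) \<le> C * (1 + norm w) ^ d" by blast
  have "norm (poly (pCons a p) w) \<le> (norm a + C) * (1 + norm w) ^ Suc d" for w
  proof -
    have "norm (poly (pCons a p) w) \<le> norm a + norm w * norm (poly p w)"
      by (simp add: norm_mult[symmetric] norm_triangle_ineq)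
    also have "\<dots> \<le> norm a * (1 + norm w) ^ Suc d + (1 + norm w) * (C * (1 + norm w) ^ d)"
    proof (intro add_mono mult_mono)
      have "1 \<le> (1 + norm w) ^ Suc d" by (rule one_le_power) simp
      then show "norm a \<le> norm a * (1 + norm w) ^ Suc d" using mult_left_mono[of 1 _ "norm a"] by simp
    qed (use C in auto)
    finally show ?thesis by (simp add: algebra_simps)
  qed
  then show ?case using C(1) by (intro exI[of _ "norm a + C"] exI[of _ "Suc d"]) auto
qed

section \<open>Mellin--Barnes integrands\<close>

lemma has_field_derivative_integral_exp:
  fixes k g :: "real \<Rightarrow> complex"
  assumes "continuous_on {0..1} k" "continuous_on {0..1} g"
  shows "((\<lambda>u. integral {0..1} (\<lambda>t. k t * exp (g t * u))) has_field_derivative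
           integral {0..1} (\<lambda>t. k t * g t * exp (g t * u))) (at u)"
proof -
  have "((\<lambda>u. integral (cbox 0 1) (\<lambda>t. k t * exp (g t * u))) has_field_derivative
           integral (cbox 0 1) (\<lambda>t. k t * g t * exp (g t * u))) (at u within UNIV)"
  proof (rule leibniz_rule_field_derivative)
    show "((\<lambda>u. k t * exp (g t * u)) has_field_derivative k t * g t * exp (g t * u)) (at u within UNIV)" for u t
      by (auto intro!: derivative_eq_intros)
    show "(\<lambda>t. k t * exp (g t * u)) integrable_on cbox 0 1" for u
      by (intro integrable_continuous continuous_intros) (use assms in auto)
    have "continuous_on (UNIV \<times> {0..1}) (\<lambda>x. k (snd x))" "continuous_on (UNIV \<times> {0..1}) (\<lambda>x. g (snd x))"
      by (auto intro!: continuous_on_compose2[OF assms(1)] continuous_on_compose2[OF assms(2)] continuous_intros)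
    then show "continuous_on (UNIV \<times> cbox 0 1) (\<lambda>(u, t). k t * g t * exp (g t * u))"
      unfolding case_prod_unfold by (auto intro!: continuous_intros)
  qed auto
  then show ?thesis by simp
qed

lemma has_field_derivative_contour_integral_exp:
  fixes F :: "complex \<Rightarrow> complex"
  assumes F: "continuous_on (path_image p) F" and p: "p = linepath a b \<or> p = circlepath z r"
  shows "((\<lambda>u. contour_integral p (\<lambda>w. F w * exp (w * u))) has_field_derivative
           contour_integral p (\<lambda>w. w * F w * exp (w * u))) (at u)"
proof -
  define D where "D = (\<lambda>t. vector_derivative p (at t))"
  have cD: "continuous_on {0..1} D"
    using p unfolding D_def by (auto simp: vector_derivative_circlepath intro!: continuous_intros)
  have cp: "continuous_on {0..1} p" using p
    by (metis path_def path_linepath valid_path_circlepath valid_path_imp_path)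
  have "continuous_on {0..1} (\<lambda>t. F (p t))"
    by (rule continuous_on_compose2[OF F cp]) (auto simp: path_image_def)
  then have "((\<lambda>u. integral {0..1} (\<lambda>t. (F (p t) * D t) * exp (p t * u))) has_field_derivative
           integral {0..1} (\<lambda>t. (F (p t) * D t) * p t * exp (p t * u))) (at u)"
    by (intro has_field_derivative_integral_exp continuous_intros cD cp)
  then show ?thesis unfolding contour_integral_integral D_def by (simp add: mult_ac)
qed

lemma contour_integral_circlepath_shift:
  "contour_integral (circlepath (z + a) r) f = contour_integral (circlepath z r) (\<lambda>w. f (w + a))"
proof -
  have "circlepath (z + a) r t = circlepath z r t + a" for t
    by (simp add: circlepath)
  then show ?thesis unfolding contour_integral_integral by (simp add: vector_derivative_circlepath)
qed

text \<open>The poles of \<open>\<Gamma>(c j - w)\<close> lie at \<open>c j + k\<close> for natural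
  \<open>k\<close>. The two closeness assumptions say that, after a shift by
  \<open>\<epsilon>\<close>, all of them with the same \<open>k\<close> lie within one circle of
  radius \<open>r < 1/2\<close>, so that circles for different \<open>k\<close> are disjoint,
  while the poles of \<open>\<Gamma>(w + b j)\<close> stay to the left of the line \<open>Re w =
  \<epsilon>\<close>. The assumptions are symmetric under exchanging \<open>b\<close> and
  \<open>c\<close> together with \<open>\<epsilon>\<close> and \<open>-\<epsilon>\<close>.\<close>

locale mellin_barnes =
  fixes m :: nat and b c :: "nat \<Rightarrow> real" and \<epsilon> r :: real
  assumes r: "0 < r" "r < 1/2"
    and b_near: "\<And>j. j < m \<Longrightarrow> \<bar>b j + \<epsilon> - 1/2\<bar> < r"
    and c_near: "\<And>j. j < m \<Longrightarrow> \<bar>c j - \<epsilon> - 1/2\<bar> < r"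
begin

lemma b_bounds: "j < m \<Longrightarrow> - \<epsilon> < b j" "j < m \<Longrightarrow> b j < 1 - \<epsilon>"
  using b_near[of j] r by linarith+

lemma c_bounds: "j < m \<Longrightarrow> \<epsilon> < c j" "j < m \<Longrightarrow> c j < 1 + \<epsilon>"
  using c_near[of j] r by linarith+

definition psi :: "complex \<Rightarrow> complex" where
  "psi w = (\<Prod>j<m. Gamma (w + of_real (b j)) * Gamma (of_real (c j) - w))"

definition centre :: "nat \<Rightarrow> complex" where "centre k = of_real (\<epsilon> + 1/2 + real k)"

text \<open>The set of points through which contours run: vertical lines between the clusters of poles, the
  part away from the real axis, and the circles around the clusters.\<close>

definition regular :: "complex \<Rightarrow> bool" where
  "regular w \<longleftrightarrow> (\<exists>k::nat. Re w = \<epsilon> + real k) \<or> (Re w \<ge> \<epsilon> \<and> \<bar>Im w\<bar> \<ge> 1) \<or> (\<exists>k. norm (w - centre k) = r)"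

lemma regular_Re: assumes "regular w" shows "Re w \<ge> \<epsilon>"
proof -
  have "Re w \<ge> \<epsilon>" if "norm (w - centre k) = r" for k
    using abs_Re_le_cmod[of "w - centre k"] that r by (auto simp: centre_def)
  with assms show ?thesis by (auto simp: regular_def)
qed

lemma sin_shift: "norm (sin (of_real pi * (z - of_nat k))) = norm (sin (of_real pi * z))" for z :: complex
proof (induction k)
  case (Suc k)
  have "sin (of_real pi * (z - of_nat (Suc k))) = - sin (of_real pi * (z - of_nat k))"
  proof -
    have "of_real pi * (z - of_nat (Suc k)) = of_real pi * (z - of_nat k) - of_real pi"
      by (simp add: algebra_simps)
    then show ?thesis by (simp only: sin_diff sin_of_real cos_of_real) simp
  qed
  then show ?case using Suc by simp
qed simp

text \<open>The nearest zero of the sine stays at a positive distance from every contour, uniformly in the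
  cluster, since a shift by an integer changes the sine only by a sign.\<close>

lemma sin_lower_bound:
  "\<exists>\<delta>>0. \<forall>w j. regular w \<longrightarrow> j < m \<longrightarrow> \<delta> \<le> norm (sin (of_real pi * (of_real (c j) - w)))"
proof -
  have "\<exists>\<delta>>0. \<forall>w. regular w \<longrightarrow> \<delta> \<le> norm (sin (of_real pi * (of_real (c j) - w)))" if j: "j < m" for j
  proof -
    define f where "f = (\<lambda>w :: complex. norm (sin (of_real pi * (of_real (c j) - w))))"
    have per: "f (w + of_nat k) = f w" for w k
      using sin_shift[of "of_real (c j) - w" k] by (simp add: f_def algebra_simps)
    define d1 where "d1 = \<bar>sin (pi * (c j - \<epsilon>))\<bar>"
    have d1: "d1 > 0"
    proof -
      have "0 < pi * (c j - \<epsilon>)" "pi * (c j - \<epsilon>) < pi" using c_bounds[OF j] by auto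
      then have "0 < sin (pi * (c j - \<epsilon>))" by (rule sin_gt_zero)
      then show ?thesis by (simp add: d1_def)
    qed
    have pos: "0 < f w" if w: "w \<in> sphere (centre 0) r" for w
    proof (rule ccontr)
      assume "\<not> 0 < f w"
      then have "sin (of_real pi * (of_real (c j) - w)) = 0" by (simp add: f_def)
      then obtain n :: int where n: "of_real pi * (of_real (c j) - w) = of_real (of_int n * pi)"
        unfolding sin_eq_0 by auto
      then have "of_real (c j) - w = of_int n" by (simp add: mult.commute)
      then have w_eq: "w = of_real (c j - of_int n)" by (simp add: algebra_simps)
      have "norm (w - centre 0) = \<bar>c j - of_int n - (\<epsilon> + 1/2)\<bar>"
        unfolding w_eq centre_def of_real_diff[symmetric] norm_of_real by simp
      then have e1: "\<bar>c j - of_int n - \<epsilon> - 1/2\<bar> = r"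
        using w by (simp add: dist_norm norm_minus_commute algebra_simps)
      then have "n \<noteq> 0" using c_near[OF j] by auto
      then have "\<bar>real_of_int n\<bar> \<ge> 1" by linarith
      then show False using e1 c_near[OF j] r by linarith
    qed
    have "compact (sphere (centre 0) r)" "sphere (centre 0) r \<noteq> {}" using r by auto
    moreover have "continuous_on (sphere (centre 0) r) f" unfolding f_def by (intro continuous_intros)
    ultimately obtain w0 where w0: "w0 \<in> sphere (centre 0) r" "\<And>w. w \<in> sphere (centre 0) r \<Longrightarrow> f w0 \<le> f w"
      using continuous_attains_inf[of "sphere (centre 0) r" f] by auto
    have "min (min d1 (1/4)) (f w0) \<le> f w" if "regular w" for w
    proof -
      consider k :: nat where "Re w = \<epsilon> + real k" | "\<bar>Im w\<bar> \<ge> 1" | k where "norm (w - centre k) = r"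
        using \<open>regular w\<close> by (auto simp: regular_def)
      then show ?thesis
      proof cases
        case 1
        have "d1 = \<bar>sin (Re (of_real pi * (of_real (c j) - (w - of_nat k))))\<bar>"
          using 1 by (simp add: d1_def)
        also have "\<dots> \<le> f (w - of_nat k)" unfolding f_def by (rule abs_sin_Re_le_norm_sin)
        also have "\<dots> = f w" using per[of "w - of_nat k" k] by simp
        finally show ?thesis by simp
      next
        case 2
        have "1 \<le> \<bar>Im (of_real pi * (of_real (c j) - w))\<bar>"
          using 2 pi_ge_two mult_mono[of 1 pi 1 "\<bar>Im w\<bar>"] by (simp add: abs_mult)
        then have "exp \<bar>Im (of_real pi * (of_real (c j) - w))\<bar> / 4 \<le> f w"
          unfolding f_def by (rule norm_sin_ge_exp_of_large_Im)
        moreover have "1 \<le> exp \<bar>Im (of_real pi * (of_real (c j) - w))\<bar>" by simp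
        ultimately have "1 / 4 \<le> f w" by linarith
        then show ?thesis by simp
      next
        case 3
        then have "w - of_nat k \<in> sphere (centre 0) r"
          by (simp add: centre_def dist_norm norm_minus_commute algebra_simps)
        then show ?thesis using w0(2) per[of "w - of_nat k" k] by force
      qed
    qed
    then show ?thesis using d1 pos[OF w0(1)] unfolding f_def
      by (intro exI[of _ "min (min d1 (1/4)) (f w0)"]) (auto simp: f_def)
  qed
  then have "\<forall>j. \<exists>\<delta>. j < m \<longrightarrow> \<delta> > 0 \<and> (\<forall>w. regular w \<longrightarrow> \<delta> \<le> norm (sin (of_real pi * (of_real (c j) - w))))"
    by blast
  then obtain \<delta> where \<delta>: "\<And>j. j < m \<Longrightarrow> \<delta> j > 0"
    "\<And>j w. j < m \<Longrightarrow> regular w \<Longrightarrow> \<delta> j \<le> norm (sin (of_real pi * (of_real (c j) - w)))"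
    by metis
  define d where "d = Min (insert 1 (\<delta> ` {..<m}))"
  have "d > 0" using \<delta>(1) by (auto simp: d_def)
  moreover have "d \<le> \<delta> j" if "j < m" for j using that by (auto simp: d_def)
  ultimately show ?thesis using \<delta>(2) by (meson order_trans)
qed

text \<open>The growth is uniform on all contours at once. This one estimate gives the convergence of the
  integral, the convergence of the sum of residues, and the vanishing of the difference on large
  rectangles.\<close>

lemma psi_bound:
  "\<exists>C\<ge>0. \<forall>w. regular w \<longrightarrow> norm (psi w) \<le> C * (1 + norm w) ^ m * exp (- (pi * real m * \<bar>Im w\<bar>))"
proof -
  obtain \<delta> where \<delta>: "\<delta> > 0" "\<And>w j. regular w \<Longrightarrow> j < m \<Longrightarrow> \<delta> \<le> norm (sin (of_real pi * (of_real (c j) - w)))"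
    using sin_lower_bound by blast
  have "\<forall>j. \<exists>C. j < m \<longrightarrow> (\<forall>w. Re w \<ge> \<epsilon> \<longrightarrow> norm (sin (of_real pi * (of_real (c j) - w))) \<ge> \<delta> \<longrightarrow>
       norm (Gamma (w + of_real (b j)) * Gamma (of_real (c j) - w)) \<le> C * (1 + norm w) * exp (- pi * \<bar>Im w\<bar>))"
    using norm_Gamma_pair_le[OF b_bounds c_bounds \<delta>(1)] by blast
  then obtain C where C: "\<And>j w. j < m \<Longrightarrow> Re w \<ge> \<epsilon> \<Longrightarrow> norm (sin (of_real pi * (of_real (c j) - w))) \<ge> \<delta> \<Longrightarrow>
       norm (Gamma (w + of_real (b j)) * Gamma (of_real (c j) - w)) \<le> C j * (1 + norm w) * exp (- pi * \<bar>Im w\<bar>)"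
    by metis
  show ?thesis
  proof (intro exI conjI allI impI)
    show "0 \<le> (\<Prod>j<m. \<bar>C j\<bar>)" by (intro prod_nonneg) auto
    fix w assume w: "regular w"
    have "norm (psi w) = (\<Prod>j<m. norm (Gamma (w + of_real (b j)) * Gamma (of_real (c j) - w)))"
      by (simp add: psi_def prod_norm)
    also have "\<dots> \<le> (\<Prod>j<m. \<bar>C j\<bar> * (1 + norm w) * exp (- pi * \<bar>Im w\<bar>))"
    proof (intro prod_mono conjI)
      fix j assume "j \<in> {..<m}"
      then have "norm (Gamma (w + of_real (b j)) * Gamma (of_real (c j) - w)) \<le> C j * (1 + norm w) * exp (- pi * \<bar>Im w\<bar>)"
        using C \<delta>(2)[OF w] regular_Re[OF w] by auto
      also have "\<dots> \<le> \<bar>C j\<bar> * (1 + norm w) * exp (- pi * \<bar>Im w\<bar>)" by (intro mult_right_mono) auto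
      finally show "norm (Gamma (w + of_real (b j)) * Gamma (of_real (c j) - w)) \<le> \<bar>C j\<bar> * (1 + norm w) * exp (- pi * \<bar>Im w\<bar>)" .
    qed auto
    also have "\<dots> = (\<Prod>j<m. \<bar>C j\<bar>) * (1 + norm w) ^ m * exp (- pi * \<bar>Im w\<bar>) ^ m"
      by (simp add: prod.distrib)
    also have "exp (- pi * \<bar>Im w\<bar>) ^ m = exp (- (pi * real m * \<bar>Im w\<bar>))"
      by (simp add: exp_of_nat_mult[symmetric] mult_ac)
    finally show "norm (psi w) \<le> (\<Prod>j<m. \<bar>C j\<bar>) * (1 + norm w) ^ m * exp (- (pi * real m * \<bar>Im w\<bar>))" .
  qed
qed

lemma psi_holomorphic:
  assumes "\<And>w j. w \<in> A \<Longrightarrow> j < m \<Longrightarrow> w + of_real (b j) \<notin> \<int>\<^sub>\<le>\<^sub>0 \<and> of_real (c j) - w \<notin> \<int>\<^sub>\<le>\<^sub>0"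
  shows "psi holomorphic_on A"
  unfolding psi_def using assms by (intro holomorphic_intros) auto

lemma regular_not_pole:
  assumes "regular w" "j < m"
  shows "w + of_real (b j) \<notin> \<int>\<^sub>\<le>\<^sub>0" "of_real (c j) - w \<notin> \<int>"
proof -
  show "w + of_real (b j) \<notin> \<int>\<^sub>\<le>\<^sub>0"
    using regular_Re[OF assms(1)] b_bounds[OF assms(2)]
    by (force elim!: nonpos_Ints_cases dest: arg_cong[where f = Re])
  show "of_real (c j) - w \<notin> \<int>"
  proof
    assume "of_real (c j) - w \<in> \<int>"
    then obtain n where "of_real (c j) - w = of_int n" by (elim Ints_cases)
    then have "sin (of_real pi * (of_real (c j) - w)) = 0"
      by (auto simp: sin_eq_0 mult.commute intro: exI[of _ n])
    then show False using sin_lower_bound assms by force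
  qed
qed

lemma psi_continuous: assumes "\<And>w. w \<in> A \<Longrightarrow> regular w" shows "continuous_on A psi"
proof (rule holomorphic_on_imp_continuous_on[OF psi_holomorphic])
  fix w j assume "w \<in> A" "j < m"
  then have "w + of_real (b j) \<notin> \<int>\<^sub>\<le>\<^sub>0" "of_real (c j) - w \<notin> \<int>"
    using regular_not_pole[OF assms] by auto
  then show "w + of_real (b j) \<notin> \<int>\<^sub>\<le>\<^sub>0 \<and> of_real (c j) - w \<notin> \<int>\<^sub>\<le>\<^sub>0"
    using nonpos_Ints_subset_Ints[where 'a = complex] by (auto dest: subsetD)
qed

lemma regular_circle: "w \<in> path_image (circlepath (centre k) r) \<Longrightarrow> regular w"
  using r by (auto simp: regular_def dist_norm norm_minus_commute)

end

section \<open>Sums of residues\<close>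

context mellin_barnes
begin

text \<open>The contribution of the \<open>k\<close>-th cluster of poles; the polynomial \<open>p\<close>
  records derivatives with respect to \<open>u\<close>, as differentiation multiplies the
  integrand by \<open>w\<close>.\<close>

definition Cr :: "complex poly \<Rightarrow> nat \<Rightarrow> complex \<Rightarrow> complex" where
  "Cr p k u = contour_integral (circlepath (centre k) r) (\<lambda>w. poly p w * psi w * exp (w * u))"

lemma continuous_on_circle:
  "continuous_on (path_image (circlepath (centre k) r)) (\<lambda>w. poly p w * psi w)"
  by (intro continuous_intros psi_continuous regular_circle)

lemma integrable_circle:
  "(\<lambda>w. poly p w * psi w * exp (w * u)) contour_integrable_on circlepath (centre k) r"
  by (intro contour_integrable_continuous_circlepath continuous_intros continuous_on_circle)

lemma Cr_deriv: "(Cr p k has_field_derivative Cr (pCons 0 p) k u) (at u)"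
proof -
  have "((\<lambda>u. contour_integral (circlepath (centre k) r) (\<lambda>w. (poly p w * psi w) * exp (w * u))) has_field_derivative
           contour_integral (circlepath (centre k) r) (\<lambda>w. w * (poly p w * psi w) * exp (w * u))) (at u)"
    by (intro has_field_derivative_contour_integral_exp continuous_on_circle) blast
  then show ?thesis by (simp add: Cr_def[abs_def] mult.assoc)
qed

lemma Cr_add: "Cr (p + q) k u = Cr p k u + Cr q k u"
proof -
  have "Cr (p + q) k u = contour_integral (circlepath (centre k) r)
     (\<lambda>w. poly p w * psi w * exp (w * u) + poly q w * psi w * exp (w * u))"
    unfolding Cr_def by (simp add: distrib_right)
  then show ?thesis unfolding Cr_def by (simp only: contour_integral_add[OF integrable_circle integrable_circle])
qed

lemma Cr_smult: "Cr (Polynomial.smult a p) k u = a * Cr p k u"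
proof -
  have "Cr (Polynomial.smult a p) k u = contour_integral (circlepath (centre k) r)
     (\<lambda>w. a * (poly p w * psi w * exp (w * u)))"
    unfolding Cr_def by (simp add: mult.assoc)
  then show ?thesis unfolding Cr_def by (simp only: contour_integral_lmul[OF integrable_circle])
qed

lemma Cr_bound:
  "\<exists>C d. C \<ge> 0 \<and> (\<forall>k u. Re u \<le> 0 \<longrightarrow>
     norm (Cr p k u) \<le> C * (2 + \<bar>\<epsilon>\<bar> + real k) ^ d * exp ((\<epsilon> + real k) * Re u + \<bar>Im u\<bar>))"
proof -
  obtain C where C: "C \<ge> 0" "\<And>w. regular w \<Longrightarrow> norm (psi w) \<le> C * (1 + norm w) ^ m * exp (- (pi * real m * \<bar>Im w\<bar>))"
    using psi_bound by blast
  obtain D d where D: "D \<ge> 0" "\<And>w. norm (poly p w) \<le> D * (1 + norm w) ^ d"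
    using poly_norm_bound[of p] by blast
  have "norm (Cr p k u) \<le> (D * C * (2 * pi * r)) * (2 + \<bar>\<epsilon>\<bar> + real k) ^ (d + m) * exp ((\<epsilon> + real k) * Re u + \<bar>Im u\<bar>)"
    if u: "Re u \<le> 0" for k u
  proof -
    define E where "E = exp ((\<epsilon> + real k) * Re u + \<bar>Im u\<bar>)"
    define N where "N = 2 + \<bar>\<epsilon>\<bar> + real k"
    have "norm (Cr p k u) \<le> ((D * N ^ d) * (C * N ^ m) * E) * (2 * pi * r)"
      unfolding Cr_def
    proof (rule has_contour_integral_bound_circlepath[OF has_contour_integral_integral[OF integrable_circle]])
      fix w assume w: "norm (w - centre k) = r"
      then have reg: "regular w" using regular_def by blast
      have "\<bar>Re (w - centre k)\<bar> \<le> r" "\<bar>Im (w - centre k)\<bar> \<le> r"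
        using abs_Re_le_cmod[of "w - centre k"] abs_Im_le_cmod[of "w - centre k"] w by auto
      then have Re_w: "Re w \<ge> \<epsilon> + real k" and Im_w: "\<bar>Im w\<bar> \<le> 1" using r by (auto simp: centre_def)
      have "norm w \<le> norm (w - centre k) + norm (centre k)"
        using norm_triangle_ineq[of "w - centre k" "centre k"] by simp
      also have "norm (centre k) = \<bar>\<epsilon> + 1/2 + real k\<bar>" unfolding centre_def by (rule norm_of_real)
      finally have nw: "1 + norm w \<le> N" using w r unfolding N_def by linarith
      have "norm (poly p w) \<le> D * (1 + norm w) ^ d" by (rule D)
      also have "\<dots> \<le> D * N ^ d" using nw D(1) by (intro mult_left_mono power_mono) auto
      finally have 1: "norm (poly p w) \<le> D * N ^ d" .
      have "norm (psi w) \<le> C * (1 + norm w) ^ m * exp (- (pi * real m * \<bar>Im w\<bar>))" by (rule C(2)[OF reg])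
      also have "\<dots> \<le> C * N ^ m * 1" using nw C(1) unfolding N_def by (intro mult_mono power_mono) auto
      finally have 2: "norm (psi w) \<le> C * N ^ m" by simp
      have "Re w * Re u \<le> (\<epsilon> + real k) * Re u" using Re_w u by (intro mult_right_mono_neg) auto
      moreover have "\<bar>Im w\<bar> * \<bar>Im u\<bar> \<le> 1 * \<bar>Im u\<bar>" using Im_w by (intro mult_right_mono) auto
      then have "- (Im w * Im u) \<le> \<bar>Im u\<bar>" by (simp add: abs_mult[symmetric])
      ultimately have 3: "norm (exp (w * u)) \<le> E" by (simp add: E_def)
      show "norm (poly p w * psi w * exp (w * u)) \<le> (D * N ^ d) * (C * N ^ m) * E"
        unfolding norm_mult using 1 2 3 D(1) C(1)
        by (intro mult_mono) (auto simp: N_def)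
    qed (use r C D in \<open>auto simp: N_def E_def\<close>)
    then show ?thesis by (simp add: N_def E_def power_add mult_ac)
  qed
  then show ?thesis using C D r by (intro exI[of _ "D * C * (2 * pi * r)"] exI[of _ "d + m"]) auto
qed

lemma Cr_bound_uniform:
  assumes "\<eta> > 0"
  shows "\<exists>M. summable M \<and> (\<forall>k u. Re u \<le> - \<eta> \<longrightarrow> norm u \<le> R \<longrightarrow> norm (Cr p k u) \<le> M k)"
proof -
  obtain C d where C: "C \<ge> 0" "\<And>k u. Re u \<le> 0 \<Longrightarrow>
     norm (Cr p k u) \<le> C * (2 + \<bar>\<epsilon>\<bar> + real k) ^ d * exp ((\<epsilon> + real k) * Re u + \<bar>Im u\<bar>)"
    using Cr_bound[of p] by blast
  define M where "M = (\<lambda>k::nat. (C * exp ((\<bar>\<epsilon>\<bar> + 1) * R)) * ((2 + \<bar>\<epsilon>\<bar> + real k) ^ d * exp (- \<eta> * real k)))"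
  have "summable M" unfolding M_def using assms by (intro summable_mult summable_power_exp) auto
  moreover have "norm (Cr p k u) \<le> M k" if u: "Re u \<le> - \<eta>" "norm u \<le> R" for k u
  proof -
    have a: "real k * Re u \<le> real k * (- \<eta>)" using u by (intro mult_left_mono) auto
    have "\<epsilon> * Re u \<le> \<bar>\<epsilon>\<bar> * \<bar>Re u\<bar>" by (metis abs_ge_self abs_mult)
    also have "\<dots> \<le> \<bar>\<epsilon>\<bar> * R" using u abs_Re_le_cmod[of u] by (intro mult_left_mono) auto
    finally have b: "\<epsilon> * Re u \<le> \<bar>\<epsilon>\<bar> * R" .
    have c: "\<bar>Im u\<bar> \<le> R" using u abs_Im_le_cmod[of u] by auto
    have "exp ((\<epsilon> + real k) * Re u + \<bar>Im u\<bar>) \<le> exp ((\<bar>\<epsilon>\<bar> + 1) * R) * exp (- \<eta> * real k)"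
      unfolding exp_add[symmetric] exp_le_cancel_iff using a b c by (simp add: algebra_simps)
    then have "C * (2 + \<bar>\<epsilon>\<bar> + real k) ^ d * exp ((\<epsilon> + real k) * Re u + \<bar>Im u\<bar>)
       \<le> C * (2 + \<bar>\<epsilon>\<bar> + real k) ^ d * (exp ((\<bar>\<epsilon>\<bar> + 1) * R) * exp (- \<eta> * real k))"
      using C(1) by (intro mult_left_mono) auto
    then show ?thesis using C(2)[of u k] u assms unfolding M_def by (simp add: mult_ac)
  qed
  ultimately show ?thesis by blast
qed

text \<open>The sum of all residues to the right of the line, with the sign of a contour closed clockwise.\<close>

definition Lam :: "complex poly \<Rightarrow> complex \<Rightarrow> complex" where
  "Lam p u = - (\<Sum>k. Cr p k u)"

lemma summable_Cr: assumes "Re u < 0" shows "summable (\<lambda>k. Cr p k u)"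
proof -
  obtain M where M: "summable M" "\<And>k v. Re v \<le> - (- Re u) \<Longrightarrow> norm v \<le> norm u \<Longrightarrow> norm (Cr p k v) \<le> M k"
    using Cr_bound_uniform[of "- Re u" "norm u" p] assms by auto
  show ?thesis by (rule summable_comparison_test'[OF M(1), of 0]) (use M(2)[of u] in auto)
qed

text \<open>Each cluster contributes at most a constant times a polynomial in \<open>k\<close> times
  \<open>exp (k Re u)\<close>, so the series and the series of derivatives converge locally
  uniformly on the left half-plane.\<close>

lemma Lam_deriv:
  assumes "Re u < 0"
  shows "(Lam p has_field_derivative Lam (pCons 0 p) u) (at u)"
proof -
  define \<eta> where "\<eta> = - Re u / 2"
  have \<eta>: "\<eta> > 0" using assms by (simp add: \<eta>_def)
  define S where "S = cball u \<eta>"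
  have S: "Re v \<le> - \<eta>" "norm v \<le> norm u + \<eta>" if "v \<in> S" for v
  proof -
    have d: "norm (v - u) \<le> \<eta>" using that by (simp add: S_def dist_norm norm_minus_commute)
    have "\<bar>Re (v - u)\<bar> \<le> \<eta>" using abs_Re_le_cmod[of "v - u"] d by linarith
    then show "Re v \<le> - \<eta>" by (simp add: \<eta>_def)
    show "norm v \<le> norm u + \<eta>" using norm_triangle_ineq[of "v - u" u] d by simp
  qed
  obtain M where M: "summable M" "\<And>k v. Re v \<le> - \<eta> \<Longrightarrow> norm v \<le> norm u + \<eta> \<Longrightarrow> norm (Cr (pCons 0 p) k v) \<le> M k"
    using Cr_bound_uniform[OF \<eta>, of "norm u + \<eta>" "pCons 0 p"] by auto
  have "((\<lambda>v. \<Sum>k. Cr p k v) has_field_derivative (\<Sum>k. Cr (pCons 0 p) k u)) (at u)"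
  proof (rule has_field_derivative_series'(2)[of S _ _ u])
    show "convex S" by (simp add: S_def)
    show "(Cr p k has_field_derivative Cr (pCons 0 p) k v) (at v within S)" for k v
      by (rule has_field_derivative_at_within[OF Cr_deriv])
    show "uniformly_convergent_on S (\<lambda>n v. \<Sum>k<n. Cr (pCons 0 p) k v)"
      by (rule Weierstrass_m_test'[OF _ M(1)]) (use M(2) S in auto)
    show "u \<in> S" "u \<in> interior S" using \<eta> by (auto simp: S_def)
    show "summable (\<lambda>k. Cr p k u)" by (rule summable_Cr[OF assms])
  qed
  then show ?thesis unfolding Lam_def[abs_def] by (rule DERIV_minus)
qed

lemma Lam_add: "Re u < 0 \<Longrightarrow> Lam (p + q) u = Lam p u + Lam q u"
  unfolding Lam_def Cr_add by (simp add: suminf_add[OF summable_Cr summable_Cr, symmetric])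

lemma Lam_smult: "Re u < 0 \<Longrightarrow> Lam (Polynomial.smult a p) u = a * Lam p u"
  unfolding Lam_def Cr_smult by (simp add: suminf_mult[OF summable_Cr])

lemma Lam_0: "Lam 0 u = 0"
  by (simp add: Lam_def Cr_def)

lemma open_left: "open {u::complex. Re u < 0}" by (rule open_halfspace_Re_lt)

lemma Lam_holomorphic: "Lam p holomorphic_on {u. Re u < 0}"
  using Lam_deriv open_left by (auto simp: holomorphic_on_open)

lemma higher_deriv_Lam:
  "Re u < 0 \<Longrightarrow> (deriv ^^ k) (Lam p) u = Lam (monom 1 k * p) u"
proof (induction k arbitrary: u)
  case 0 then show ?case by (simp add: monom_0)
next
  case (Suc k)
  have "\<forall>\<^sub>F v in nhds u. (deriv ^^ k) (Lam p) v = Lam (monom 1 k * p) v"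
    using eventually_nhds_in_open[OF open_left, of u] Suc
    by (auto elim!: eventually_mono)
  then have "deriv ((deriv ^^ k) (Lam p)) u = deriv (Lam (monom 1 k * p)) u"
    by (rule deriv_cong_ev) simp
  also have "\<dots> = Lam (pCons 0 (monom 1 k * p)) u"
    using Lam_deriv[OF Suc.prems] by (rule DERIV_imp_deriv)
  also have "pCons 0 (monom 1 k * p) = monom 1 (Suc k) * p" by (simp add: monom_Suc)
  finally show ?case by simp
qed

lemma Lam_sum: "Re u < 0 \<Longrightarrow> finite A \<Longrightarrow> Lam (\<Sum>i\<in>A. f i) u = (\<Sum>i\<in>A. Lam (f i) u)"
proof -
  assume "Re u < 0" "finite A"
  from \<open>finite A\<close> show ?thesis using \<open>Re u < 0\<close>
    by (induction A rule: finite_induct) (auto simp: Lam_0 Lam_add)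
qed

lemma poly_deriv_Lam:
  assumes "Re u < 0"
  shows "(\<Sum>k\<le>degree q. coeff q k * (deriv ^^ k) (Lam p) u) = Lam (q * p) u"
proof -
  have "q * p = (\<Sum>k\<le>degree q. Polynomial.smult (coeff q k) (monom 1 k * p))"
    by (subst (1) poly_as_sum_of_monoms[symmetric]) (simp add: sum_distrib_right smult_monom flip: mult_smult_left)
  also have "Lam \<dots> u = (\<Sum>k\<le>degree q. coeff q k * Lam (monom 1 k * p) u)"
    using assms by (simp add: Lam_sum Lam_smult)
  finally show ?thesis using assms by (simp add: higher_deriv_Lam)
qed

definition PP :: "complex poly" where "PP = (\<Prod>j<m. [:- of_real (c j), 1:])"
definition QQ :: "complex poly" where "QQ = (\<Prod>j<m. [:of_real (b j), 1:])"

text \<open>The functional equation of the gamma function turns multiplication by \<open>exp u\<close> into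
  a shift of \<open>w\<close> by one.\<close>

lemma psi_shift:
  assumes "regular w"
  shows "(-1) ^ m * poly PP (w + 1) * psi (w + 1) = poly QQ w * psi w"
proof -
  have "(-1) ^ m * poly PP (w + 1) * psi (w + 1)
      = (\<Prod>j<m. (-1) * (w + 1 - of_real (c j)) * (Gamma (w + 1 + of_real (b j)) * Gamma (of_real (c j) - (w + 1))))"
  proof -
    have "(-1) ^ m = (\<Prod>j<m. (-1 :: complex))" by simp
    then show ?thesis by (simp only: PP_def psi_def poly_prod prod.distrib[symmetric]) (simp add: mult.assoc)
  qed
  also have "\<dots> = (\<Prod>j<m. (w + of_real (b j)) * (Gamma (w + of_real (b j)) * Gamma (of_real (c j) - w)))"
  proof (rule prod.cong[OF refl])
    fix j assume j: "j \<in> {..<m}"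
    have 1: "Gamma (w + 1 + of_real (b j)) = (w + of_real (b j)) * Gamma (w + of_real (b j))"
      using Gamma_plus1[of "w + of_real (b j)"] regular_not_pole(1)[OF assms] j by (simp add: add_ac)
    have "of_real (c j) - (w + 1) \<notin> \<int>"
      using regular_not_pole(2)[OF assms, of j] j by (metis Ints_1 Ints_add diff_add_cancel diff_diff_eq lessThan_iff)
    then have "of_real (c j) - (w + 1) \<notin> \<int>\<^sub>\<le>\<^sub>0" using nonpos_Ints_subset_Ints by blast
    then have 2: "Gamma (of_real (c j) - w) = (of_real (c j) - (w + 1)) * Gamma (of_real (c j) - (w + 1))"
      using Gamma_plus1[of "of_real (c j) - (w + 1)"] by simp
    show "(-1) * (w + 1 - of_real (c j)) * (Gamma (w + 1 + of_real (b j)) * Gamma (of_real (c j) - (w + 1)))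
      = (w + of_real (b j)) * (Gamma (w + of_real (b j)) * Gamma (of_real (c j) - w))"
      unfolding 1 2 by (simp add: algebra_simps)
  qed
  also have "\<dots> = poly QQ w * psi w"
    unfolding QQ_def psi_def poly_prod prod.distrib[symmetric] by (simp add: add.commute)
  finally show ?thesis .
qed

lemma centre_Suc: "centre (Suc k) = centre k + 1" by (simp add: centre_def)

lemma Cr_shift: "(-1) ^ m * Cr PP (Suc k) u = exp u * Cr QQ k u"
proof -
  have "(-1) ^ m * Cr PP (Suc k) u = contour_integral (circlepath (centre (Suc k)) r)
      (\<lambda>w. (-1) ^ m * (poly PP w * psi w * exp (w * u)))"
    unfolding Cr_def using integrable_circle by (simp only: contour_integral_lmul)
  also have "\<dots> = contour_integral (circlepath (centre k) r)
      (\<lambda>w. (-1) ^ m * (poly PP (w + 1) * psi (w + 1) * exp ((w + 1) * u)))"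
    unfolding centre_Suc contour_integral_circlepath_shift ..
  also have "\<dots> = contour_integral (circlepath (centre k) r)
      (\<lambda>w. exp u * (poly QQ w * psi w * exp (w * u)))"
  proof (rule contour_integral_cong[OF refl])
    fix w assume "w \<in> path_image (circlepath (centre k) r)"
    then have reg: "regular w" by (rule regular_circle)
    have "(-1) ^ m * (poly PP (w + 1) * psi (w + 1) * exp ((w + 1) * u))
       = ((-1) ^ m * poly PP (w + 1) * psi (w + 1)) * exp ((w + 1) * u)" by (simp only: mult.assoc)
    also have "\<dots> = exp u * (poly QQ w * psi w * exp (w * u))"
      unfolding psi_shift[OF reg] by (simp add: algebra_simps exp_add)
    finally show "(-1) ^ m * (poly PP (w + 1) * psi (w + 1) * exp ((w + 1) * u))
       = exp u * (poly QQ w * psi w * exp (w * u))" .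
  qed
  also have "\<dots> = exp u * Cr QQ k u"
    unfolding Cr_def using integrable_circle by (simp only: contour_integral_lmul)
  finally show ?thesis .
qed

definition strip :: "nat \<Rightarrow> complex set" where
  "strip k = {w. \<epsilon> + real k < Re w \<and> Re w < \<epsilon> + real k + 1}"

lemma strip: "open (strip k)" "convex (strip k)" "path_image (circlepath (centre k) r) \<subseteq> strip k"
  "cball (centre k) r \<subseteq> strip k"
proof -
  have eq: "strip k = {w. \<epsilon> + real k < Re w} \<inter> {w. Re w < \<epsilon> + real k + 1}" by (auto simp: strip_def)
  show "open (strip k)" unfolding eq by (intro open_Int open_halfspace_Re_lt open_halfspace_Re_gt)
  show "convex (strip k)" unfolding eq by (intro convex_Int convex_halfspace_Re_lt convex_halfspace_Re_gt)
  show c: "cball (centre k) r \<subseteq> strip k"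
  proof
    fix w assume "w \<in> cball (centre k) r"
    then have "norm (w - centre k) \<le> r" by (simp add: dist_norm norm_minus_commute)
    then have "\<bar>Re (w - centre k)\<bar> \<le> r" using abs_Re_le_cmod[of "w - centre k"] by linarith
    then show "w \<in> strip k" using r by (auto simp: centre_def strip_def)
  qed
  show "path_image (circlepath (centre k) r) \<subseteq> strip k"
    using c r by auto
qed

lemma not_nonpos_Ints_Re: "Re z > 0 \<Longrightarrow> z \<notin> \<int>\<^sub>\<le>\<^sub>0"
  by (force elim!: nonpos_Ints_cases)

definition hh :: "complex \<Rightarrow> complex" where
  "hh w = (\<Prod>j<m. Gamma (w + of_real (b j)) * Gamma (of_real (c j) - w + 1))"

lemma hh_holomorphic: "hh holomorphic_on strip 0"
  unfolding hh_def using b_bounds c_bounds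
  by (intro holomorphic_intros not_nonpos_Ints_Re) (force simp: strip_def)+

lemma hh_eq: assumes "regular w" shows "(\<Prod>j<m. of_real (c j) - w) * psi w = hh w"
proof -
  have "Gamma (of_real (c j) - w + 1) = (of_real (c j) - w) * Gamma (of_real (c j) - w)" if "j < m" for j
  proof -
    have "of_real (c j) - w \<notin> \<int>\<^sub>\<le>\<^sub>0"
      using regular_not_pole(2)[OF assms that] nonpos_Ints_subset_Ints[where 'a = complex] by auto
    then show ?thesis by (rule Gamma_plus1)
  qed
  then show ?thesis unfolding psi_def hh_def prod.distrib[symmetric] by (intro prod.cong) auto
qed

text \<open>Multiplying by \<open>c j - w\<close> for all \<open>j\<close> removes the poles of the first
  cluster.\<close>

lemma Cr_PP_0: "Cr PP 0 u = 0"
proof -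
  have "((\<lambda>w. (-1) ^ m * hh w * exp (w * u)) has_contour_integral 0) (circlepath (centre 0) r)"
    by (rule Cauchy_theorem_convex_simple[of _ "strip 0"])
       (use strip[of 0] in \<open>auto intro!: holomorphic_intros hh_holomorphic\<close>)
  then have "contour_integral (circlepath (centre 0) r) (\<lambda>w. (-1) ^ m * hh w * exp (w * u)) = 0"
    by (rule contour_integral_unique)
  moreover have "poly PP w * psi w = (-1) ^ m * hh w" if "w \<in> path_image (circlepath (centre 0) r)" for w
  proof -
    have "poly PP w = (\<Prod>j<m. (-1) * (of_real (c j) - w))" by (simp add: PP_def poly_prod)
    also have "\<dots> = (-1) ^ m * (\<Prod>j<m. of_real (c j) - w)" by (subst prod.distrib) simp
    finally show ?thesis using hh_eq[OF regular_circle[OF that]] by (simp add: mult.assoc)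
  qed
  ultimately show ?thesis unfolding Cr_def by (subst contour_integral_cong[OF refl]) auto
qed

text \<open>Applying the operator with symbol \<open>PP\<close> kills the first cluster, and moves the
  \<open>(k + 1)\<close>-st one to \<open>exp u\<close> times the \<open>k\<close>-th one with
  symbol \<open>QQ\<close>.\<close>

theorem Lam_ode:
  assumes "Re u < 0"
  shows "(-1) ^ m * Lam PP u = exp u * Lam QQ u"
proof -
  have "(\<Sum>k. Cr PP k u) = (\<Sum>k. Cr PP (Suc k) u)"
    using suminf_split_head[OF summable_Cr[OF assms, of PP]] by (simp add: Cr_PP_0)
  then have "(-1) ^ m * (\<Sum>k. Cr PP k u) = (\<Sum>k. (-1) ^ m * Cr PP (Suc k) u)"
    using suminf_mult[of "\<lambda>k. Cr PP (Suc k) u" "(-1) ^ m"] summable_Cr[OF assms, of PP]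
      summable_Suc_iff[of "\<lambda>k. Cr PP k u"] by simp
  also have "\<dots> = exp u * (\<Sum>k. Cr QQ k u)"
    unfolding Cr_shift by (rule suminf_mult[OF summable_Cr[OF assms]])
  finally show ?thesis by (simp add: Lam_def)
qed

lemma exp_shift: "exp (w * (u + 2 * pi * \<i> * \<sigma> * of_nat k)) = exp (w * u) * exp (2 * pi * \<i> * \<sigma> * w) ^ k"
  by (simp add: exp_of_nat_mult[symmetric] exp_add[symmetric] algebra_simps)

lemma Cr_comb:
  "(\<Sum>k\<in>{..<n}. x k * Cr p l (u + 2 * pi * \<i> * \<sigma> * of_nat k))
   = contour_integral (circlepath (centre l) r)
       (\<lambda>w. (\<Sum>k<n. x k * exp (2 * pi * \<i> * \<sigma> * w) ^ k) * (poly p w * psi w * exp (w * u)))"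
proof -
  have "(\<Sum>k\<in>{..<n}. x k * Cr p l (u + 2 * pi * \<i> * \<sigma> * of_nat k))
      = (\<Sum>k\<in>{..<n}. contour_integral (circlepath (centre l) r)
          (\<lambda>w. x k * (poly p w * psi w * exp (w * (u + 2 * pi * \<i> * \<sigma> * of_nat k)))))"
    unfolding Cr_def by (simp only: contour_integral_lmul[OF integrable_circle])
  also have "\<dots> = contour_integral (circlepath (centre l) r)
     (\<lambda>w. \<Sum>k<n. x k * (poly p w * psi w * exp (w * (u + 2 * pi * \<i> * \<sigma> * of_nat k))))"
    by (intro contour_integral_sum[symmetric] contour_integrable_lmul integrable_circle) auto
  also have "\<dots> = contour_integral (circlepath (centre l) r)
       (\<lambda>w. (\<Sum>k<n. x k * exp (2 * pi * \<i> * \<sigma> * w) ^ k) * (poly p w * psi w * exp (w * u)))"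
    unfolding exp_shift sum_distrib_right by (simp only: mult_ac)
  finally show ?thesis .
qed

text \<open>The polynomial whose roots are the local exponentials \<open>exp (2 \<pi> \<i> \<sigma> c
  j)\<close>; the sign \<open>\<sigma>\<close> is the direction of the turn around the singular
  point.\<close>

definition XX :: "complex \<Rightarrow> complex poly" where
  "XX \<sigma> = (\<Prod>j<m. [:- exp (2 * pi * \<i> * \<sigma> * of_real (c j)), 1:])"

text \<open>Every factor \<open>exp (2 \<pi> \<i> \<sigma> w) - exp (2 \<pi> \<i> \<sigma> c j)\<close> is a
  multiple of \<open>sin (\<pi> (c j - w))\<close>, and by reflection its product with
  \<open>\<Gamma>(c j - w)\<close> is entire.\<close>

lemma XX_psi:
  assumes \<sigma>: "\<sigma> = 1 \<or> \<sigma> = -1" and w: "regular w" 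
  shows "poly (XX \<sigma>) (exp (2 * pi * \<i> * \<sigma> * w)) * psi w
     = (\<Prod>j<m. - 2 * pi * \<i> * \<sigma> * exp (pi * \<i> * \<sigma> * (w + of_real (c j))) * rGamma (1 - of_real (c j) + w) * Gamma (w + of_real (b j)))"
  unfolding XX_def psi_def poly_prod prod.distrib[symmetric]
proof (rule prod.cong[OF refl])
  fix j assume "j \<in> {..<m}"
  then have j: "j < m" by simp
  define x where "x = of_real pi * (of_real (c j) - w)"
  have s: "sin x \<noteq> 0"
    using sin_lower_bound w j unfolding x_def by force
  have G: "Gamma (of_real (c j) - w) = of_real pi / sin x * rGamma (1 - of_real (c j) + w)"
    using Gamma_reflect[of "of_real (c j) - w"] regular_Re[OF w] c_bounds[OF j]
    by (simp add: x_def algebra_simps)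
  have "exp (2 * pi * \<i> * \<sigma> * w) - exp (2 * pi * \<i> * \<sigma> * of_real (c j))
      = - 2 * \<i> * \<sigma> * exp (pi * \<i> * \<sigma> * (w + of_real (c j))) * sin x"
  proof -
    have s2: "2 * \<i> * sin x = exp (\<i> * x) - exp (- (\<i> * x))" by (simp add: sin_exp_eq)
    define e where "e = exp (pi * \<i> * \<sigma> * (w + of_real (c j)))"
    have "- 2 * \<i> * \<sigma> * e * sin x = - \<sigma> * (e * (2 * \<i> * sin x))" by simp
    also have "\<dots> = - \<sigma> * (e * exp (\<i> * x) - e * exp (- (\<i> * x)))" by (simp only: s2 right_diff_distrib)
    also have "\<dots> = exp (2 * pi * \<i> * \<sigma> * w) - exp (2 * pi * \<i> * \<sigma> * of_real (c j))"
      using \<sigma> unfolding e_def x_def exp_add[symmetric] by (auto simp: algebra_simps)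
    finally show ?thesis by (simp add: e_def)
  qed
  then show "poly [:- exp (2 * pi * \<i> * \<sigma> * of_real (c j)), 1:] (exp (2 * pi * \<i> * \<sigma> * w)) *
        (Gamma (w + of_real (b j)) * Gamma (of_real (c j) - w))
     = - 2 * pi * \<i> * \<sigma> * exp (pi * \<i> * \<sigma> * (w + of_real (c j))) * rGamma (1 - of_real (c j) + w) * Gamma (w + of_real (b j))"
  proof -
    assume "exp (2 * pi * \<i> * \<sigma> * w) - exp (2 * pi * \<i> * \<sigma> * of_real (c j))
      = - 2 * \<i> * \<sigma> * exp (pi * \<i> * \<sigma> * (w + of_real (c j))) * sin x"
    then have "poly [:- exp (2 * pi * \<i> * \<sigma> * of_real (c j)), 1:] (exp (2 * pi * \<i> * \<sigma> * w))
      = - 2 * \<i> * \<sigma> * exp (pi * \<i> * \<sigma> * (w + of_real (c j))) * sin x" by simp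
    then show ?thesis unfolding G using s by simp
  qed
qed

text \<open>Translating \<open>u\<close> by \<open>2 \<pi> \<i> \<sigma>\<close> multiplies the integrand by
  \<open>exp (2 \<pi> \<i> \<sigma> w)\<close>. The combination of translates with the
  coefficients of \<open>XX \<sigma>\<close> therefore has an integrand without poles inside the
  circles.\<close>

theorem Lam_shift_relation:
  assumes \<sigma>: "\<sigma> = 1 \<or> \<sigma> = -1" and u: "Re u < 0"
  shows "(\<Sum>k\<le>degree (XX \<sigma>). coeff (XX \<sigma>) k * Lam p (u + 2 * pi * \<i> * \<sigma> * of_nat k)) = 0"
proof -
  have Re: "Re (u + 2 * pi * \<i> * \<sigma> * of_nat k) < 0" for k using u \<sigma> by auto
  have z: "(\<Sum>k\<in>{..<Suc (degree (XX \<sigma>))}. coeff (XX \<sigma>) k * Cr p l (u + 2 * pi * \<i> * \<sigma> * of_nat k)) = 0" for l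
  proof -
    let ?g = "\<lambda>w. (\<Prod>j<m. - 2 * pi * \<i> * \<sigma> * exp (pi * \<i> * \<sigma> * (w + of_real (c j))) * rGamma (1 - of_real (c j) + w) * Gamma (w + of_real (b j)))
          * (poly p w * exp (w * u))"
    have "(?g has_contour_integral 0) (circlepath (centre l) r)"
    proof (rule Cauchy_theorem_convex_simple[of _ "strip l"])
      show "?g holomorphic_on strip l" using b_bounds
        by (intro holomorphic_intros not_nonpos_Ints_Re) (force simp: strip_def)+
    qed (use strip[of l] in auto)
    then have "contour_integral (circlepath (centre l) r) ?g = 0" by (rule contour_integral_unique)
    moreover have "(\<Sum>k<Suc (degree (XX \<sigma>)). coeff (XX \<sigma>) k * exp (2 * pi * \<i> * \<sigma> * w) ^ k) * (poly p w * psi w * exp (w * u)) = ?g w"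
      if "w \<in> path_image (circlepath (centre l) r)" for w
    proof -
      have "(\<Sum>k<Suc (degree (XX \<sigma>)). coeff (XX \<sigma>) k * exp (2 * pi * \<i> * \<sigma> * w) ^ k) * (poly p w * psi w * exp (w * u))
         = (poly (XX \<sigma>) (exp (2 * pi * \<i> * \<sigma> * w)) * psi w) * (poly p w * exp (w * u))"
        unfolding poly_altdef lessThan_Suc_atMost by (simp only: mult_ac)
      then show ?thesis unfolding XX_psi[OF \<sigma> regular_circle[OF that]] .
    qed
    ultimately show ?thesis unfolding Cr_comb by (subst contour_integral_cong[OF refl]) auto
  qed
  have "(\<Sum>k\<le>degree (XX \<sigma>). coeff (XX \<sigma>) k * Lam p (u + 2 * pi * \<i> * \<sigma> * of_nat k))
     = - (\<Sum>k\<le>degree (XX \<sigma>). \<Sum>l. coeff (XX \<sigma>) k * Cr p l (u + 2 * pi * \<i> * \<sigma> * of_nat k))"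
    unfolding Lam_def using suminf_mult[OF summable_Cr[OF Re]] by (simp add: sum_negf)
  also have "(\<Sum>k\<le>degree (XX \<sigma>). \<Sum>l. coeff (XX \<sigma>) k * Cr p l (u + 2 * pi * \<i> * \<sigma> * of_nat k))
     = (\<Sum>l. \<Sum>k\<le>degree (XX \<sigma>). coeff (XX \<sigma>) k * Cr p l (u + 2 * pi * \<i> * \<sigma> * of_nat k))"
    by (rule suminf_sum[symmetric]) (intro summable_mult summable_Cr Re)
  also have "\<dots> = 0" using z by (simp add: lessThan_Suc_atMost)
  finally show ?thesis by simp
qed

lemma Cr_residue:
  assumes j0: "j0 < m"
  defines "p \<equiv> \<Prod>j\<in>{..<m} - {j0}. [:- of_real (c j), 1:]"
  shows "Cr p 0 u = 2 * pi * \<i> * ((-1) ^ m * hh (of_real (c j0)) * exp (of_real (c j0) * u))"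
proof -
  have c0: "of_real (c j0) \<in> strip 0" using c_bounds[OF j0] by (simp add: strip_def)
  have nrm: "norm (of_real (c j0) - centre 0) < r"
    using c_near[OF j0] unfolding centre_def of_real_diff[symmetric] norm_of_real by simp
  have "((\<lambda>w. ((-1) ^ m * hh w * exp (w * u)) / (w - of_real (c j0))) has_contour_integral
       2 * of_real pi * \<i> * ((-1) ^ m * hh (of_real (c j0)) * exp (of_real (c j0) * u))) (circlepath (centre 0) r)"
    by (rule Cauchy_integral_circlepath_simple)
       (use strip(4)[of 0] nrm in \<open>auto intro!: holomorphic_intros holomorphic_on_subset[OF hh_holomorphic]\<close>)
  then have "contour_integral (circlepath (centre 0) r) (\<lambda>w. ((-1) ^ m * hh w * exp (w * u)) / (w - of_real (c j0)))
     = 2 * pi * \<i> * ((-1) ^ m * hh (of_real (c j0)) * exp (of_real (c j0) * u))"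
    by (simp add: contour_integral_unique)
  moreover have "poly p w * psi w * exp (w * u) = ((-1) ^ m * hh w * exp (w * u)) / (w - of_real (c j0))"
    if "w \<in> path_image (circlepath (centre 0) r)" for w
  proof -
    have reg: "regular w" by (rule regular_circle[OF that])
    have ne: "w - of_real (c j0) \<noteq> 0" using regular_not_pole(2)[OF reg j0] by auto
    have "poly p w * (w - of_real (c j0)) = (\<Prod>j<m. (-1) * (of_real (c j) - w))"
      using j0 by (simp add: p_def poly_prod prod.remove[of "{..<m}" j0] mult.commute)
    also have "\<dots> = (-1) ^ m * (\<Prod>j<m. of_real (c j) - w)" by (subst prod.distrib) simp
    finally have "poly p w * psi w * (w - of_real (c j0)) = (-1) ^ m * hh w"
      using hh_eq[OF reg] by (metis (no_types, lifting) mult.assoc mult.commute)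
    then have "poly p w * psi w = (-1) ^ m * hh w / (w - of_real (c j0))" using ne by (simp add: eq_divide_eq)
    then show ?thesis by simp
  qed
  ultimately show ?thesis unfolding Cr_def by (subst contour_integral_cong[OF refl]) auto
qed

lemma hh_nonzero: assumes "j0 < m" shows "hh (of_real (c j0)) \<noteq> 0"
proof -
  have "Gamma (of_real (c j0) + of_real (b j) :: complex) \<noteq> 0 \<and> Gamma (of_real (c j) - of_real (c j0) + 1 :: complex) \<noteq> 0" if "j < m" for j
    unfolding Gamma_eq_zero_iff
    using c_near[OF assms] c_near[OF that] b_near[OF that] r by (intro conjI not_nonpos_Ints_Re) auto
  then show ?thesis unfolding hh_def by auto
qed

lemma Lam_head: "Re u < 0 \<Longrightarrow> Lam p u = - Cr p 0 u - (\<Sum>k. Cr p (Suc k) u)"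
  using suminf_split_head[OF summable_Cr[of u p]] by (simp add: Lam_def)

lemma Cr_tail_bound:
  "\<exists>C\<ge>0. \<forall>u. Re u \<le> -1 \<longrightarrow> norm (\<Sum>k. Cr p (Suc k) u) \<le> C * exp ((\<epsilon> + 1) * Re u + \<bar>Im u\<bar>)"
proof -
  obtain C d where C: "C \<ge> 0" "\<And>k u. Re u \<le> 0 \<Longrightarrow>
     norm (Cr p k u) \<le> C * (2 + \<bar>\<epsilon>\<bar> + real k) ^ d * exp ((\<epsilon> + real k) * Re u + \<bar>Im u\<bar>)"
    using Cr_bound[of p] by blast
  define M where "M = (\<lambda>k::nat. C * ((3 + \<bar>\<epsilon>\<bar> + real k) ^ d * exp (- 1 * real k)))"
  have M: "summable M" unfolding M_def by (intro summable_mult summable_power_exp) auto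
  have "norm (\<Sum>k. Cr p (Suc k) u) \<le> (\<Sum>k. M k) * exp ((\<epsilon> + 1) * Re u + \<bar>Im u\<bar>)" if u: "Re u \<le> -1" for u
  proof -
    have le: "norm (Cr p (Suc k) u) \<le> M k * exp ((\<epsilon> + 1) * Re u + \<bar>Im u\<bar>)" for k
    proof -
      have "real k * Re u \<le> real k * (-1)" using u by (intro mult_left_mono) auto
      then have "exp ((\<epsilon> + real (Suc k)) * Re u + \<bar>Im u\<bar>) \<le> exp (- 1 * real k) * exp ((\<epsilon> + 1) * Re u + \<bar>Im u\<bar>)"
        unfolding exp_add[symmetric] exp_le_cancel_iff by (simp add: algebra_simps)
      then have "C * (2 + \<bar>\<epsilon>\<bar> + real (Suc k)) ^ d * exp ((\<epsilon> + real (Suc k)) * Re u + \<bar>Im u\<bar>)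
        \<le> C * (2 + \<bar>\<epsilon>\<bar> + real (Suc k)) ^ d * (exp (- 1 * real k) * exp ((\<epsilon> + 1) * Re u + \<bar>Im u\<bar>))"
        using C(1) by (intro mult_left_mono) auto
      then show ?thesis using C(2)[of u "Suc k"] u by (simp add: M_def add_ac mult_ac)
    qed
    have s: "summable (\<lambda>k. M k * exp ((\<epsilon> + 1) * Re u + \<bar>Im u\<bar>))" using M by (rule summable_mult2)
    have "norm (\<Sum>k. Cr p (Suc k) u) \<le> (\<Sum>k. M k * exp ((\<epsilon> + 1) * Re u + \<bar>Im u\<bar>))"
      by (rule norm_suminf_le[OF le s])
    also have "\<dots> = (\<Sum>k. M k) * exp ((\<epsilon> + 1) * Re u + \<bar>Im u\<bar>)" using M by (rule suminf_mult2[symmetric])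
    finally show ?thesis .
  qed
  moreover have "(\<Sum>k. M k) \<ge> 0" using M C(1) by (intro suminf_nonneg) (auto simp: M_def)
  ultimately show ?thesis by blast
qed

text \<open>Applying the operator whose symbol vanishes at all \<open>c j\<close> except one leaves a simple
  pole in the first cluster. Its residue has the size of \<open>exp (c j u)\<close>, and dominates
  the remaining clusters as \<open>Re u\<close> tends to \<open>-\<infinity>\<close>; so the
  coefficient of that residue must vanish.\<close>

theorem Lam_independent:
  assumes \<sigma>: "\<sigma> = 1 \<or> \<sigma> = -1"
    and zero: "\<And>u. Re u < 0 \<Longrightarrow> (\<Sum>k<n. x k * Lam 1 (u + 2 * pi * \<i> * \<sigma> * of_nat k)) = 0"
    and j0: "j0 < m"
  shows "(\<Sum>k<n. x k * exp (2 * pi * \<i> * \<sigma> * of_real (c j0)) ^ k) = 0"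
proof -
  have Re: "Re (u + 2 * pi * \<i> * \<sigma> * of_nat k) = Re u" for u k using \<sigma> by auto
  have all: "(\<Sum>k<n. x k * Lam p (u + 2 * pi * \<i> * \<sigma> * of_nat k)) = 0" if "Re u < 0" for u p
    using that
  proof (induction p arbitrary: u)
    case 0 then show ?case by (simp add: Lam_0)
  next
    case (pCons a p)
    have step: "(\<Sum>k<n. x k * Lam (pCons 0 p) (u + 2 * pi * \<i> * \<sigma> * of_nat k)) = 0"
    proof -
      have "((\<lambda>u. \<Sum>k<n. x k * Lam p (u + 2 * pi * \<i> * \<sigma> * of_nat k)) has_field_derivative
         (\<Sum>k<n. x k * (Lam (pCons 0 p) (u + 2 * pi * \<i> * \<sigma> * of_nat k) * 1))) (at u)"
        by (intro DERIV_sum DERIV_cmult DERIV_chain'[OF _ Lam_deriv]) (use \<sigma> pCons.prems in \<open>auto intro!: derivative_eq_intros\<close>)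
      moreover have "((\<lambda>u. \<Sum>k<n. x k * Lam p (u + 2 * pi * \<i> * \<sigma> * of_nat k)) has_field_derivative 0) (at u)"
      proof (rule DERIV_cong_ev[THEN iffD2, OF refl _ refl, of _ "\<lambda>_. 0"])
        show "\<forall>\<^sub>F v in nhds u. (\<Sum>k<n. x k * Lam p (v + 2 * pi * \<i> * \<sigma> * of_nat k)) = 0"
          using eventually_nhds_in_open[OF open_left, of u] pCons by (auto elim!: eventually_mono)
      qed auto
      ultimately show ?thesis using DERIV_unique by fastforce
    qed
    have "pCons a p = Polynomial.smult a 1 + pCons 0 p" by simp
    then have that: "Lam (pCons a p) v = a * Lam 1 v + Lam (pCons 0 p) v" if "Re v < 0" for v
      by (metis Lam_add Lam_smult that)
    have "(\<Sum>k<n. x k * Lam (pCons a p) (u + 2 * pi * \<i> * \<sigma> * of_nat k))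
      = a * (\<Sum>k<n. x k * Lam 1 (u + 2 * pi * \<i> * \<sigma> * of_nat k)) + (\<Sum>k<n. x k * Lam (pCons 0 p) (u + 2 * pi * \<i> * \<sigma> * of_nat k))"
    proof -
      have "Re (u + 2 * pi * \<i> * \<sigma> * of_nat k) < 0" for k using Re[of u k] pCons.prems by linarith
      then have L: "Lam (pCons a p) (u + 2 * pi * \<i> * \<sigma> * of_nat k)
         = a * Lam 1 (u + 2 * pi * \<i> * \<sigma> * of_nat k) + Lam (pCons 0 p) (u + 2 * pi * \<i> * \<sigma> * of_nat k)" for k
        using that by blast
      show ?thesis unfolding L distrib_left sum.distrib sum_distrib_left by (simp only: mult.left_commute)
    qed
    then show ?case using step zero[OF pCons.prems] by simp
  qed
  define p where "p = (\<Prod>j\<in>{..<m} - {j0}. [:- of_real (c j), 1 :: complex:])"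
  define Y where "Y = (\<Sum>k<n. x k * exp (2 * pi * \<i> * \<sigma> * of_real (c j0)) ^ k)"
  define H where "H = 2 * pi * \<i> * ((-1) ^ m * hh (of_real (c j0)))"
  have H: "H \<noteq> 0" using hh_nonzero[OF j0] by (simp add: H_def)
  obtain C where C: "C \<ge> 0" "\<And>u. Re u \<le> -1 \<Longrightarrow> norm (\<Sum>k. Cr p (Suc k) u) \<le> C * exp ((\<epsilon> + 1) * Re u + \<bar>Im u\<bar>)"
    using Cr_tail_bound[of p] by blast
  define D where "D = (\<Sum>k<n. norm (x k) * (C * exp (2 * pi * real k)))"
  have main: "norm (H * Y) \<le> D * exp (- (\<epsilon> + 1 - c j0) * t)" if t: "t \<ge> 1" for t
  proof -
    define u :: complex where "u = - of_real t"
    have Reu: "Re (u + 2 * pi * \<i> * \<sigma> * of_nat k) = - t" for k using Re by (simp add: u_def)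
    have Imu: "\<bar>Im (u + 2 * pi * \<i> * \<sigma> * of_nat k)\<bar> = 2 * pi * real k" for k
      using \<sigma> by (auto simp: u_def abs_mult)
    have tb: "norm (\<Sum>l. Cr p (Suc l) (u + 2 * pi * \<i> * \<sigma> * of_nat k)) \<le> C * exp ((\<epsilon> + 1) * (- t) + 2 * pi * real k)" for k
      using C(2)[of "u + 2 * pi * \<i> * \<sigma> * of_nat k"] t unfolding Reu Imu by simp
    have "0 = (\<Sum>k<n. x k * Lam p (u + 2 * pi * \<i> * \<sigma> * of_nat k))"
      using all[of u p] t by (simp add: u_def)
    also have "\<dots> = (\<Sum>k<n. x k * (- Cr p 0 (u + 2 * pi * \<i> * \<sigma> * of_nat k) - (\<Sum>l. Cr p (Suc l) (u + 2 * pi * \<i> * \<sigma> * of_nat k))))"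
      using Reu t by (simp add: Lam_head)
    also have "\<dots> = - (\<Sum>k<n. x k * Cr p 0 (u + 2 * pi * \<i> * \<sigma> * of_nat k)) - (\<Sum>k<n. x k * (\<Sum>l. Cr p (Suc l) (u + 2 * pi * \<i> * \<sigma> * of_nat k)))"
      by (simp add: right_diff_distrib sum_subtractf sum_negf)
    also have "(\<Sum>k<n. x k * Cr p 0 (u + 2 * pi * \<i> * \<sigma> * of_nat k)) = H * Y * exp (of_real (c j0) * u)"
      unfolding p_def Cr_residue[OF j0] exp_shift Y_def H_def by (simp add: sum_distrib_left sum_distrib_right mult_ac)
    finally have z: "0 = - (H * Y * exp (of_real (c j0) * u)) - (\<Sum>k<n. x k * (\<Sum>l. Cr p (Suc l) (u + 2 * pi * \<i> * \<sigma> * of_nat k)))" .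
    have neg: "a = - b" if "0 = - a - b" for a b :: complex
    proof -
      have "a + b = - (- a - b)" by simp
      then show ?thesis using that by (simp add: eq_neg_iff_add_eq_0)
    qed
    have "H * Y * exp (of_real (c j0) * u) = - (\<Sum>k<n. x k * (\<Sum>l. Cr p (Suc l) (u + 2 * pi * \<i> * \<sigma> * of_nat k)))"
      by (rule neg[OF z])
    then have "norm (H * Y * exp (of_real (c j0) * u)) \<le> (\<Sum>k<n. norm (x k * (\<Sum>l. Cr p (Suc l) (u + 2 * pi * \<i> * \<sigma> * of_nat k))))"
      by (simp add: norm_sum)
    also have "\<dots> \<le> (\<Sum>k<n. norm (x k) * (C * exp ((\<epsilon> + 1) * (- t) + 2 * pi * real k)))"
      unfolding norm_mult by (intro sum_mono mult_left_mono tb) auto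
    also have "\<dots> = D * exp (- (\<epsilon> + 1) * t)"
      by (simp add: D_def exp_add sum_distrib_right sum_distrib_left mult_ac exp_minus[symmetric] exp_diff[symmetric])
         (simp add: exp_minus exp_diff field_simps exp_add)?
    finally have "norm (H * Y) * exp (- c j0 * t) \<le> D * exp (- (\<epsilon> + 1) * t)"
      by (simp add: norm_mult u_def)
    then have "norm (H * Y) * exp (- c j0 * t) * exp (c j0 * t) \<le> D * exp (- (\<epsilon> + 1) * t) * exp (c j0 * t)"
      by (intro mult_right_mono) auto
    then show ?thesis by (simp add: mult.assoc exp_add[symmetric] algebra_simps)
  qed
  define d where "d = \<epsilon> + 1 - c j0"
  have d: "- d < 0" using c_bounds[OF j0] by (simp add: d_def)
  have "filterlim (\<lambda>t. - d * t) at_bot at_top"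
    by (rule filterlim_tendsto_neg_mult_at_bot[OF tendsto_const d filterlim_ident])
  then have "((\<lambda>t. exp (- d * t)) \<longlongrightarrow> 0) at_top"
    by (rule filterlim_compose[OF exp_at_bot])
  then have "((\<lambda>t. D * exp (- d * t)) \<longlongrightarrow> D * 0) at_top"
    by (intro tendsto_mult tendsto_const)
  then have lim: "((\<lambda>t. D * exp (- d * t)) \<longlongrightarrow> 0) at_top" by simp
  have "norm (H * Y) \<le> 0"
  proof (rule tendsto_lowerbound[OF lim])
    show "\<forall>\<^sub>F t in at_top. norm (H * Y) \<le> D * exp (- d * t)"
      by (rule eventually_mono[OF eventually_ge_at_top[of 1]]) (use main in \<open>simp add: d_def\<close>)
  qed simp
  then have "Y = 0" using H by simp
  then show ?thesis by (simp add: Y_def)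
qed

end

section \<open>The integral over a vertical line\<close>

context mellin_barnes
begin

text \<open>Vertical and horizontal sides of the rectangles that enclose the first clusters of poles.\<close>

definition V :: "nat \<Rightarrow> real \<Rightarrow> complex \<Rightarrow> complex" where
  "V k y u = contour_integral (linepath (Complex (\<epsilon> + real k) (-y)) (Complex (\<epsilon> + real k) y)) (\<lambda>w. psi w * exp (w * u))"

definition Hz :: "nat \<Rightarrow> real \<Rightarrow> complex \<Rightarrow> complex" where
  "Hz k y u = contour_integral (linepath (Complex (\<epsilon> + real k) y) (Complex (\<epsilon> + real k + 1) y)) (\<lambda>w. psi w * exp (w * u))"

lemma closed_segment_vertical:
  "w \<in> closed_segment (Complex x p) (Complex x q) \<Longrightarrow> p \<le> q \<Longrightarrow> Re w = x \<and> p \<le> Im w \<and> Im w \<le> q"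
  by (auto simp: closed_segment_same_Re closed_segment_eq_real_ivl)

lemma closed_segment_horizontal:
  "w \<in> closed_segment (Complex p y) (Complex q y) \<Longrightarrow> p \<le> q \<Longrightarrow> Im w = y \<and> p \<le> Re w \<and> Re w \<le> q"
  by (auto simp: closed_segment_same_Im closed_segment_eq_real_ivl)

lemma continuous_vertical:
  "p \<le> q \<Longrightarrow> continuous_on (closed_segment (Complex (\<epsilon> + real k) p) (Complex (\<epsilon> + real k) q)) (\<lambda>w. psi w * exp (w * u))"
  by (intro continuous_intros psi_continuous) (auto dest!: closed_segment_vertical simp: regular_def)

lemma continuous_horizontal:
  "\<bar>y\<bar> \<ge> 1 \<Longrightarrow> continuous_on (closed_segment (Complex (\<epsilon> + real k) y) (Complex (\<epsilon> + real k + 1) y)) (\<lambda>w. psi w * exp (w * u))"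
  by (intro continuous_intros psi_continuous) (auto dest!: closed_segment_horizontal simp: regular_def)

text \<open>Both the boundary of the rectangle and the \<open>k\<close>-th circle wind once around each pole
  of the \<open>k\<close>-th cluster and around no other pole, so the two integrals agree.\<close>

lemma rectangle:
  assumes y: "y \<ge> 1"
  shows "Hz k (-y) u + V (Suc k) y u - Hz k y u - V k y u = Cr 1 k u"
proof -
  define f where "f = (\<lambda>w. psi w * exp (w * u))"
  define \<eta> where "\<eta> = 1/2 - r"
  have \<eta>: "\<eta> > 0" "\<eta> < 1/2" using r by (auto simp: \<eta>_def)
  define S where "S = {w. \<epsilon> + real k - \<eta> < Re w} \<inter> {w. Re w < \<epsilon> + real k + 1 + \<eta>}"
  define pts where "pts = (\<lambda>j. of_real (c j + real k) :: complex) ` {..<m}"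
  define a1 where "a1 = Complex (\<epsilon> + real k) (-y)"
  define a3 where "a3 = Complex (\<epsilon> + real k + 1) y"
  have S: "open S" "convex S"
    unfolding S_def by (intro open_Int open_halfspace_Re_lt open_halfspace_Re_gt convex_Int convex_halfspace_Re_lt convex_halfspace_Re_gt)+
  have hol: "f holomorphic_on S - pts"
    unfolding f_def
  proof (intro holomorphic_intros psi_holomorphic conjI)
    fix w j assume w: "w \<in> S - pts" and j: "j < m"
    have "b j + \<epsilon> > \<eta>" using b_near[OF j] by (simp add: \<eta>_def)
    then show "w + of_real (b j) \<notin> \<int>\<^sub>\<le>\<^sub>0" using w by (intro not_nonpos_Ints_Re) (auto simp: S_def)
    show "of_real (c j) - w \<notin> \<int>\<^sub>\<le>\<^sub>0"
    proof
      assume "of_real (c j) - w \<in> \<int>\<^sub>\<le>\<^sub>0"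
      then obtain i :: int where i: "of_real (c j) - w = of_int i" by (elim nonpos_Ints_cases)
      then have weq: "w = of_real (c j - of_int i)" by (simp add: algebra_simps)
      then have Rew: "Re w = c j - of_int i" by simp
      have "\<epsilon> + real k - \<eta> < c j - of_int i" "c j - of_int i < \<epsilon> + real k + 1 + \<eta>"
        using w unfolding Rew[symmetric] by (auto simp: S_def)
      moreover have "c j - \<epsilon> > \<eta>" "c j - \<epsilon> < 1 - \<eta>" using c_near[OF j] by (auto simp: \<eta>_def)
      ultimately have "real_of_int (int k + i) < 1" "real_of_int (int k + i) > -1" by simp_all
      then have "i = - int k" by linarith
      then have "w = of_real (c j + real k)" unfolding weq by simp
      then show False using w j by (auto simp: pts_def)
    qed
  qed
  have fin: "finite pts" by (simp add: pts_def)
  have pts: "p \<in> box a1 a3" "norm (p - centre k) < r" if p: "p \<in> pts" for p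
  proof -
    obtain j where j: "j < m" "p = of_real (c j + real k)" using p by (auto simp: pts_def)
    show "p \<in> box a1 a3" using c_bounds[OF j(1)] y unfolding j(2) by (auto simp: in_box_complex_iff a1_def a3_def)
    show "norm (p - centre k) < r"
      using c_near[OF j(1)] unfolding j(2) centre_def of_real_diff[symmetric] norm_of_real by simp
  qed
  have "contour_integral (rectpath a1 a3) f = 2 * pi * \<i> * (\<Sum>p\<in>pts. winding_number (rectpath a1 a3) p * residue f p)"
  proof (rule Residue_theorem[of S])
    have "path_image (rectpath a1 a3) \<subseteq> cbox a1 a3" using y
      by (intro path_image_rectpath_subset_cbox) (auto simp: a1_def a3_def)
    also have "\<dots> \<subseteq> S" using \<eta> by (auto simp: S_def in_cbox_complex_iff a1_def a3_def)
    finally have sub: "path_image (rectpath a1 a3) \<subseteq> S" .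
    moreover have "path_image (rectpath a1 a3) \<inter> pts = {}"
      using path_image_rectpath_inter_box[of a1 a3] pts y by (auto simp: a1_def a3_def)
    ultimately show "path_image (rectpath a1 a3) \<subseteq> S - pts" by blast
    show "\<forall>z. z \<notin> S \<longrightarrow> winding_number (rectpath a1 a3) z = 0"
      using winding_number_zero_outside[OF _ S(2) _ _ sub] by simp
  qed (use S hol fin convex_connected in auto)
  also have "\<dots> = 2 * pi * \<i> * (\<Sum>p\<in>pts. residue f p)"
    using winding_number_rectpath pts by simp
  finally have 1: "contour_integral (rectpath a1 a3) f = 2 * pi * \<i> * (\<Sum>p\<in>pts. residue f p)" .
  have "contour_integral (circlepath (centre k) r) f = 2 * pi * \<i> * (\<Sum>p\<in>pts. winding_number (circlepath (centre k) r) p * residue f p)"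
  proof (rule Residue_theorem[of S])
    have sub: "path_image (circlepath (centre k) r) \<subseteq> S"
      using strip(3)[of k] \<eta> by (force simp: strip_def S_def)
    moreover have "path_image (circlepath (centre k) r) \<inter> pts = {}"
      using pts(2) r by (force simp: dist_norm norm_minus_commute)
    ultimately show "path_image (circlepath (centre k) r) \<subseteq> S - pts" by blast
    show "\<forall>z. z \<notin> S \<longrightarrow> winding_number (circlepath (centre k) r) z = 0"
      using winding_number_zero_outside[OF _ S(2) _ _ sub] by simp
  qed (use S hol fin convex_connected in auto)
  also have "\<dots> = 2 * pi * \<i> * (\<Sum>p\<in>pts. residue f p)"
    using winding_number_circlepath pts by simp
  finally have 2: "contour_integral (circlepath (centre k) r) f = 2 * pi * \<i> * (\<Sum>p\<in>pts. residue f p)" .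
  have y': "\<bar>y\<bar> \<ge> 1" "\<bar>-y\<bar> \<ge> 1" using y by auto
  define a2 where "a2 = Complex (\<epsilon> + real k + 1) (-y)"
  define a4 where "a4 = Complex (\<epsilon> + real k) y"
  have c1: "continuous_on (closed_segment a1 a2) f" unfolding a1_def a2_def f_def by (rule continuous_horizontal[OF y'(2)])
  have c2: "continuous_on (closed_segment a2 a3) f" unfolding a2_def a3_def f_def
    using continuous_vertical[of "-y" y "Suc k" u] y by (simp add: add_ac)
  have c3: "continuous_on (closed_segment a4 a3) f" unfolding a3_def a4_def f_def by (rule continuous_horizontal[OF y'(1)])
  have c4: "continuous_on (closed_segment a1 a4) f" unfolding a1_def a4_def f_def using y by (intro continuous_vertical) auto
  have i1: "f contour_integrable_on linepath a1 a2" using c1 by (rule contour_integrable_continuous_linepath)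
  have i2: "f contour_integrable_on linepath a2 a3" using c2 by (rule contour_integrable_continuous_linepath)
  have i3: "f contour_integrable_on linepath a3 a4"
    using c3 by (intro contour_integrable_continuous_linepath) (simp add: closed_segment_commute)
  have i4: "f contour_integrable_on linepath a4 a1"
    using c4 by (intro contour_integrable_continuous_linepath) (simp add: closed_segment_commute)
  have "rectpath a1 a3 = linepath a1 a2 +++ linepath a2 a3 +++ linepath a3 a4 +++ linepath a4 a1"
    by (simp add: rectpath_def Let_def a1_def a2_def a3_def a4_def)
  then have "contour_integral (rectpath a1 a3) f = contour_integral (linepath a1 a2) f + (contour_integral (linepath a2 a3) f
      + (contour_integral (linepath a3 a4) f + contour_integral (linepath a4 a1) f))"
    using i1 i2 i3 i4 by (simp add: valid_path_join contour_integrable_joinI)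
  moreover have "contour_integral (linepath a3 a4) f = - contour_integral (linepath a4 a3) f"
    using contour_integral_reversepath[of "linepath a4 a3" f] by simp
  moreover have "contour_integral (linepath a4 a1) f = - contour_integral (linepath a1 a4) f"
    using contour_integral_reversepath[of "linepath a1 a4" f] by simp
  ultimately have "contour_integral (rectpath a1 a3) f = Hz k (-y) u + V (Suc k) y u - Hz k y u - V k y u"
    by (simp add: Hz_def V_def a1_def a2_def a3_def a4_def f_def add_ac)
  moreover have "contour_integral (circlepath (centre k) r) f = Cr 1 k u" by (simp add: Cr_def f_def)
  ultimately show ?thesis using 1 2 by simp
qed

lemma sum_Cr:
  assumes y: "y \<ge> 1"
  shows "(\<Sum>k<K. Cr 1 k u) = V K y u - V 0 y u + (\<Sum>k<K. Hz k (-y) u - Hz k y u)"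
  by (induction K) (simp_all flip: rectangle[OF y])

lemma integrand_bound:
  "\<exists>C\<ge>0. \<forall>w u. regular w \<longrightarrow> norm (psi w * exp (w * u))
     \<le> C * (1 + norm w) ^ m * exp (- (pi * real m - \<bar>Im u\<bar>) * \<bar>Im w\<bar>) * exp (Re w * Re u)"
proof -
  obtain C where C: "C \<ge> 0" "\<And>w. regular w \<Longrightarrow> norm (psi w) \<le> C * (1 + norm w) ^ m * exp (- (pi * real m * \<bar>Im w\<bar>))"
    using psi_bound by blast
  have "norm (psi w * exp (w * u))
     \<le> C * (1 + norm w) ^ m * exp (- (pi * real m - \<bar>Im u\<bar>) * \<bar>Im w\<bar>) * exp (Re w * Re u)" if w: "regular w" for w u
  proof -
    have "- (Im w * Im u) \<le> \<bar>Im u\<bar> * \<bar>Im w\<bar>" by (metis abs_ge_minus_self abs_mult mult.commute)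
    then have "norm (exp (w * u)) \<le> exp (\<bar>Im u\<bar> * \<bar>Im w\<bar>) * exp (Re w * Re u)"
      by (simp add: exp_add[symmetric])
    then have "norm (psi w * exp (w * u)) \<le> (C * (1 + norm w) ^ m * exp (- (pi * real m * \<bar>Im w\<bar>))) * (exp (\<bar>Im u\<bar> * \<bar>Im w\<bar>) * exp (Re w * Re u))"
      unfolding norm_mult using C(2)[OF w] C(1) by (intro mult_mono) auto
    also have "\<dots> = C * (1 + norm w) ^ m * (exp (- (pi * real m * \<bar>Im w\<bar>)) * exp (\<bar>Im u\<bar> * \<bar>Im w\<bar>)) * exp (Re w * Re u)"
      by (simp only: mult_ac)
    also have "exp (- (pi * real m * \<bar>Im w\<bar>)) * exp (\<bar>Im u\<bar> * \<bar>Im w\<bar>) = exp (- (pi * real m - \<bar>Im u\<bar>) * \<bar>Im w\<bar>)"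
      by (simp add: exp_add[symmetric] algebra_simps)
    finally show ?thesis .
  qed
  with C(1) show ?thesis by blast
qed

definition wide :: "complex set" where "wide = {u. \<bar>Im u\<bar> < pi * real m}"

lemma open_wide: "open wide" unfolding wide_def by (intro open_Collect_less continuous_intros)

text \<open>The integral over the whole line \<open>Re w = \<epsilon>\<close>, as a limit of truncated
  integrals. Writing it as a series makes it a locally uniform limit of entire functions.\<close>

definition II :: "complex \<Rightarrow> complex" where
  "II u = (\<Sum>N. V 0 (real (Suc N)) u - V 0 (real N) u)"

lemma V_step:
  "V 0 (real (Suc N)) u - V 0 (real N) u
    = contour_integral (linepath (Complex \<epsilon> (- real (Suc N))) (Complex \<epsilon> (- real N))) (\<lambda>w. psi w * exp (w * u))
    + contour_integral (linepath (Complex \<epsilon> (real N)) (Complex \<epsilon> (real (Suc N)))) (\<lambda>w. psi w * exp (w * u))"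
proof -
  let ?f = "\<lambda>w. psi w * exp (w * u)"
  have mem: "Complex \<epsilon> y \<in> closed_segment (Complex \<epsilon> p) (Complex \<epsilon> q)" if "p \<le> y" "y \<le> q" for y p q
    using that by (auto simp: closed_segment_same_Re closed_segment_eq_real_ivl)
  have "contour_integral (linepath (Complex \<epsilon> (- real (Suc N))) (Complex \<epsilon> (real (Suc N)))) ?f
     = contour_integral (linepath (Complex \<epsilon> (- real (Suc N))) (Complex \<epsilon> (- real N))) ?f
     + contour_integral (linepath (Complex \<epsilon> (- real N)) (Complex \<epsilon> (real (Suc N)))) ?f"
    using continuous_vertical[of "- real (Suc N)" "real (Suc N)" 0 u]
    by (intro contour_integral_split_linepath mem) auto
  moreover have "contour_integral (linepath (Complex \<epsilon> (- real N)) (Complex \<epsilon> (real (Suc N)))) ?f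
     = contour_integral (linepath (Complex \<epsilon> (- real N)) (Complex \<epsilon> (real N))) ?f
     + contour_integral (linepath (Complex \<epsilon> (real N)) (Complex \<epsilon> (real (Suc N)))) ?f"
    using continuous_vertical[of "- real N" "real (Suc N)" 0 u]
    by (intro contour_integral_split_linepath mem) auto
  ultimately show ?thesis by (simp add: V_def)
qed

lemma V_step_bound:
  assumes "\<eta> > 0"
  shows "\<exists>M. summable M \<and> (\<forall>N u. \<bar>Im u\<bar> \<le> pi * real m - \<eta> \<longrightarrow> norm u \<le> R \<longrightarrow>
     norm (V 0 (real (Suc N)) u - V 0 (real N) u) \<le> M N)"
proof -
  obtain C where C: "C \<ge> 0" "\<And>w u. regular w \<Longrightarrow> norm (psi w * exp (w * u))
     \<le> C * (1 + norm w) ^ m * exp (- (pi * real m - \<bar>Im u\<bar>) * \<bar>Im w\<bar>) * exp (Re w * Re u)"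
    using integrand_bound by blast
  define B where "B = (\<lambda>N::nat. C * (2 + \<bar>\<epsilon>\<bar> + real N) ^ m * exp (- \<eta> * real N) * exp (\<bar>\<epsilon>\<bar> * R))"
  define M where "M = (\<lambda>N. 2 * B N)"
  have "summable (\<lambda>N. (2 * C * exp (\<bar>\<epsilon>\<bar> * R)) * ((2 + \<bar>\<epsilon>\<bar> + real N) ^ m * exp (- \<eta> * real N)))"
    using assms by (intro summable_mult summable_power_exp) auto
  then have "summable M" unfolding M_def B_def by (simp add: mult_ac)
  moreover have "norm (V 0 (real (Suc N)) u - V 0 (real N) u) \<le> M N"
    if u: "\<bar>Im u\<bar> \<le> pi * real m - \<eta>" "norm u \<le> R" for N u
  proof -
    have B0: "B N \<ge> 0" using C(1) by (simp add: B_def)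
    have le: "norm (psi w * exp (w * u)) \<le> B N" if w: "Re w = \<epsilon>" "real N \<le> \<bar>Im w\<bar>" "\<bar>Im w\<bar> \<le> real (Suc N)" for w
    proof -
      have reg: "regular w" unfolding regular_def using w by (auto intro: exI[of _ 0])
      have nw: "1 + norm w \<le> 2 + \<bar>\<epsilon>\<bar> + real N" using cmod_le[of w] w by simp
      have e1: "- (pi * real m - \<bar>Im u\<bar>) * \<bar>Im w\<bar> \<le> - \<eta> * real N"
      proof -
        have "\<eta> * real N \<le> (pi * real m - \<bar>Im u\<bar>) * \<bar>Im w\<bar>" using u w assms by (intro mult_mono) auto
        then show ?thesis by (simp only: mult_minus_left neg_le_iff_le)
      qed
      have e2: "Re w * Re u \<le> \<bar>\<epsilon>\<bar> * R"
      proof -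
        have "Re w * Re u \<le> \<bar>\<epsilon>\<bar> * \<bar>Re u\<bar>" using w by (metis abs_ge_self abs_mult)
        also have "\<dots> \<le> \<bar>\<epsilon>\<bar> * R" using u abs_Re_le_cmod[of u] by (intro mult_left_mono) auto
        finally show ?thesis .
      qed
      have "norm (psi w * exp (w * u)) \<le> C * (1 + norm w) ^ m * exp (- (pi * real m - \<bar>Im u\<bar>) * \<bar>Im w\<bar>) * exp (Re w * Re u)"
        by (rule C(2)[OF reg])
      also have "\<dots> \<le> B N" unfolding B_def using nw e1 e2 C(1)
        by (intro mult_mono power_mono) auto
      finally show ?thesis .
    qed
    have "norm (contour_integral (linepath (Complex \<epsilon> (- real (Suc N))) (Complex \<epsilon> (- real N))) (\<lambda>w. psi w * exp (w * u)))
       \<le> B N * norm (Complex \<epsilon> (- real N) - Complex \<epsilon> (- real (Suc N)))"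
      using continuous_vertical[of "- real (Suc N)" "- real N" 0 u]
      by (intro contour_integral_bound_linepath contour_integrable_continuous_linepath B0)
         (auto dest!: closed_segment_vertical intro!: le)
    also have "Complex \<epsilon> (- real N) - Complex \<epsilon> (- real (Suc N)) = \<i>" by (simp add: complex_eq_iff)
    finally have 1: "norm (contour_integral (linepath (Complex \<epsilon> (- real (Suc N))) (Complex \<epsilon> (- real N))) (\<lambda>w. psi w * exp (w * u))) \<le> B N" by simp
    have "norm (contour_integral (linepath (Complex \<epsilon> (real N)) (Complex \<epsilon> (real (Suc N)))) (\<lambda>w. psi w * exp (w * u)))
       \<le> B N * norm (Complex \<epsilon> (real (Suc N)) - Complex \<epsilon> (real N))"
      using continuous_vertical[of "real N" "real (Suc N)" 0 u]
      by (intro contour_integral_bound_linepath contour_integrable_continuous_linepath B0)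
         (auto dest!: closed_segment_vertical intro!: le)
    also have "Complex \<epsilon> (real (Suc N)) - Complex \<epsilon> (real N) = \<i>" by (simp add: complex_eq_iff)
    finally have 2: "norm (contour_integral (linepath (Complex \<epsilon> (real N)) (Complex \<epsilon> (real (Suc N)))) (\<lambda>w. psi w * exp (w * u))) \<le> B N" by simp
    show ?thesis unfolding V_step M_def using 1 2 norm_triangle_ineq order_trans add_mono by (smt (verit))
  qed
  ultimately show ?thesis by blast
qed

lemma V_0: "V k 0 u = 0" by (simp add: V_def)

lemma V_uniform_limit:
  assumes "\<eta> > 0"
  shows "uniform_limit {u. \<bar>Im u\<bar> \<le> pi * real m - \<eta> \<and> norm u \<le> R} (\<lambda>N u. V 0 (real N) u) II sequentially"
proof -
  obtain M where M: "summable M" "\<And>N u. \<bar>Im u\<bar> \<le> pi * real m - \<eta> \<Longrightarrow> norm u \<le> R \<Longrightarrow>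
     norm (V 0 (real (Suc N)) u - V 0 (real N) u) \<le> M N" using V_step_bound[OF assms, of R] by blast
  have "uniform_limit {u. \<bar>Im u\<bar> \<le> pi * real m - \<eta> \<and> norm u \<le> R}
     (\<lambda>n u. \<Sum>N<n. V 0 (real (Suc N)) u - V 0 (real N) u) (\<lambda>u. \<Sum>N. V 0 (real (Suc N)) u - V 0 (real N) u) sequentially"
    by (rule Weierstrass_m_test[OF _ M(1)]) (use M(2) in auto)
  moreover have "(\<Sum>N<n. V 0 (real (Suc N)) u - V 0 (real N) u) = V 0 (real n) u" for n u
    using sum_lessThan_telescope[of "\<lambda>N. V 0 (real N) u" n] by (simp add: V_0)
  ultimately show ?thesis by (simp add: II_def[abs_def])
qed

lemma V_tendsto: assumes "u \<in> wide" shows "(\<lambda>N. V 0 (real N) u) \<longlonglongrightarrow> II u"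
  using tendsto_uniform_limitI[OF V_uniform_limit[of "pi * real m - \<bar>Im u\<bar>" "norm u"], of u] assms
  by (auto simp: wide_def)

lemma V_holomorphic: "V 0 (real N) holomorphic_on A"
proof -
  have "\<exists>D. (V 0 (real N) has_field_derivative D) (at u)" for u
  proof -
    have "continuous_on (path_image (linepath (Complex (\<epsilon> + real 0) (- real N)) (Complex (\<epsilon> + real 0) (real N)))) psi"
      by (intro psi_continuous) (auto dest!: closed_segment_vertical simp: regular_def intro: exI[of _ 0])
    from has_field_derivative_contour_integral_exp[OF this] show ?thesis unfolding V_def[abs_def] by blast
  qed
  then show ?thesis by (auto intro: holomorphic_on_subset[of _ UNIV] simp: holomorphic_on_open)
qed

theorem II_holomorphic: "II holomorphic_on wide"
proof (rule holomorphic_uniform_sequence[OF open_wide])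
  show "V 0 (real N) holomorphic_on wide" for N by (rule V_holomorphic)
  fix u assume "u \<in> wide"
  define \<eta> where "\<eta> = (pi * real m - \<bar>Im u\<bar>) / 2"
  have \<eta>: "\<eta> > 0" using \<open>u \<in> wide\<close> by (simp add: \<eta>_def wide_def)
  have "cball u \<eta> \<subseteq> {v. \<bar>Im v\<bar> \<le> pi * real m - \<eta> \<and> norm v \<le> norm u + \<eta>}"
  proof
    fix v assume "v \<in> cball u \<eta>"
    then have d: "norm (v - u) \<le> \<eta>" by (simp add: dist_norm norm_minus_commute)
    have "\<bar>Im (v - u)\<bar> \<le> \<eta>" using abs_Im_le_cmod[of "v - u"] d by linarith
    then have "\<bar>Im v\<bar> \<le> \<bar>Im u\<bar> + \<eta>" by simp
    moreover have "norm v \<le> norm u + \<eta>" using norm_triangle_ineq[of "v - u" u] d by simp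
    ultimately show "v \<in> {v. \<bar>Im v\<bar> \<le> pi * real m - \<eta> \<and> norm v \<le> norm u + \<eta>}" by (simp add: \<eta>_def field_simps)
  qed
  moreover from this have "cball u \<eta> \<subseteq> wide" using \<eta> by (auto simp: wide_def)
  ultimately show "\<exists>d>0. cball u d \<subseteq> wide \<and> uniform_limit (cball u d) (\<lambda>N u. V 0 (real N) u) II sequentially"
    using \<eta> uniform_limit_on_subset[OF V_uniform_limit[OF \<eta>, of "norm u + \<eta>"]] by blast
qed

text \<open>The sides of a rectangle that tends to infinity contribute nothing, because on them the
  integrand is small: by \<open>exp (w u)\<close> on the far vertical side, and by the decay of
  \<open>psi\<close> on the horizontal sides.\<close>

theorem II_eq_Lam:
  assumes u: "u \<in> wide" "Re u < 0"
  shows "II u = Lam 1 u"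
proof -
  obtain C where C: "C \<ge> 0" "\<And>w u. regular w \<Longrightarrow> norm (psi w * exp (w * u))
     \<le> C * (1 + norm w) ^ m * exp (- (pi * real m - \<bar>Im u\<bar>) * \<bar>Im w\<bar>) * exp (Re w * Re u)"
    using integrand_bound by blast
  define \<eta> where "\<eta> = pi * real m - \<bar>Im u\<bar>"
  define \<kappa> where "\<kappa> = min \<eta> (- Re u)"
  define a where "a = (2 + \<bar>\<epsilon>\<bar>) / 2"
  define E where "E = exp (\<bar>\<epsilon>\<bar> * \<bar>Re u\<bar>)"
  define B where "B = (\<lambda>N::nat. C * (2 * (a + real N)) ^ m * exp (- \<kappa> * real N) * E)"
  have \<kappa>: "\<kappa> > 0" using u by (auto simp: \<kappa>_def \<eta>_def wide_def)
  have B0: "B N \<ge> 0" for N using C(1) by (simp add: B_def E_def a_def)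
  have base: "norm (psi w * exp (w * u)) \<le> B N"
    if w: "regular w" "\<bar>Re w\<bar> \<le> \<bar>\<epsilon>\<bar> + real N" "\<bar>Im w\<bar> \<le> real N"
      and e: "- \<eta> * \<bar>Im w\<bar> + Re w * Re u \<le> - \<kappa> * real N + \<bar>\<epsilon>\<bar> * \<bar>Re u\<bar>" for w N
  proof -
    have nw: "1 + norm w \<le> 2 * (a + real N)" using cmod_le[of w] w by (simp add: a_def field_simps)
    have "norm (psi w * exp (w * u)) \<le> C * (1 + norm w) ^ m * exp (- \<eta> * \<bar>Im w\<bar>) * exp (Re w * Re u)"
      unfolding \<eta>_def by (rule C(2)[OF w(1)])
    also have "\<dots> = C * (1 + norm w) ^ m * exp (- \<eta> * \<bar>Im w\<bar> + Re w * Re u)" by (simp only: exp_add mult.assoc)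
    also have "\<dots> \<le> C * (2 * (a + real N)) ^ m * exp (- \<kappa> * real N + \<bar>\<epsilon>\<bar> * \<bar>Re u\<bar>)"
      using nw e C(1) by (intro mult_mono power_mono) (auto simp: a_def)
    also have "exp (- \<kappa> * real N + \<bar>\<epsilon>\<bar> * \<bar>Re u\<bar>) = exp (- \<kappa> * real N) * E"
      unfolding E_def by (rule exp_add)
    also have "C * (2 * (a + real N)) ^ m * (exp (- \<kappa> * real N) * E) = B N"
      unfolding B_def by (simp only: mult.assoc)
    finally show ?thesis .
  qed
  have eps: "\<epsilon> * Re u \<le> \<bar>\<epsilon>\<bar> * \<bar>Re u\<bar>" by (metis abs_ge_self abs_mult)
  have VB: "norm (V N (real N) u) \<le> 2 * real N * B N" for N
  proof -
    have "norm (V N (real N) u) \<le> B N * norm (Complex (\<epsilon> + real N) (real N) - Complex (\<epsilon> + real N) (- real N))"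
      unfolding V_def
    proof (intro contour_integral_bound_linepath contour_integrable_continuous_linepath continuous_vertical B0)
      fix w assume "w \<in> closed_segment (Complex (\<epsilon> + real N) (- real N)) (Complex (\<epsilon> + real N) (real N))"
      then have w: "Re w = \<epsilon> + real N" "\<bar>Im w\<bar> \<le> real N" by (auto dest!: closed_segment_vertical)
      show "norm (psi w * exp (w * u)) \<le> B N"
      proof (rule base)
        show "regular w" using w by (auto simp: regular_def)
        have "\<eta> \<ge> 0" using u by (simp add: \<eta>_def wide_def)
        then have "- \<eta> * \<bar>Im w\<bar> \<le> 0" by (simp add: mult_nonneg_nonneg)
        moreover have "real N * Re u \<le> real N * (- \<kappa>)" by (intro mult_left_mono) (auto simp: \<kappa>_def)
        ultimately show "- \<eta> * \<bar>Im w\<bar> + Re w * Re u \<le> - \<kappa> * real N + \<bar>\<epsilon>\<bar> * \<bar>Re u\<bar>"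
          using eps unfolding w(1) by (simp add: algebra_simps)
      qed (use w in auto)
    qed auto
    also have "Complex (\<epsilon> + real N) (real N) - Complex (\<epsilon> + real N) (- real N) = of_real (2 * real N) * \<i>"
      by (simp add: complex_eq_iff)
    also have "norm (of_real (2 * real N) * \<i>) = 2 * real N" unfolding norm_mult norm_of_real by simp
    finally show ?thesis by (simp add: mult_ac)
  qed
  have HB: "norm (Hz k y u) \<le> B N" if N: "N \<ge> 1" "k < N" and y: "\<bar>y\<bar> = real N" for k y N
  proof -
    have "norm (Hz k y u) \<le> B N * norm (Complex (\<epsilon> + real k + 1) y - Complex (\<epsilon> + real k) y)"
      unfolding Hz_def
    proof (intro contour_integral_bound_linepath contour_integrable_continuous_linepath continuous_horizontal B0)
      show "\<bar>y\<bar> \<ge> 1" using N y by simp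
      fix w assume "w \<in> closed_segment (Complex (\<epsilon> + real k) y) (Complex (\<epsilon> + real k + 1) y)"
      then have w: "Im w = y" "\<epsilon> + real k \<le> Re w" "Re w \<le> \<epsilon> + real k + 1" by (auto dest!: closed_segment_horizontal)
      show "norm (psi w * exp (w * u)) \<le> B N"
      proof (rule base)
        show "regular w" using w N y by (auto simp: regular_def)
        have "\<kappa> * real N \<le> \<eta> * real N" by (intro mult_right_mono) (auto simp: \<kappa>_def)
        moreover have "Re w * Re u \<le> \<epsilon> * Re u" using w u by (intro mult_right_mono_neg) auto
        ultimately show "- \<eta> * \<bar>Im w\<bar> + Re w * Re u \<le> - \<kappa> * real N + \<bar>\<epsilon>\<bar> * \<bar>Re u\<bar>"
          using eps w y by simp
        have "real k + 1 \<le> real N" using N by linarith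
        then show "\<bar>Re w\<bar> \<le> \<bar>\<epsilon>\<bar> + real N" using w by linarith
      qed (use w y in auto)
    qed
    also have "Complex (\<epsilon> + real k + 1) y - Complex (\<epsilon> + real k) y = 1" by (simp add: complex_eq_iff)
    finally show ?thesis by simp
  qed
  have main: "norm ((\<Sum>k<N. Cr 1 k u) + V 0 (real N) u) \<le> 4 * real N * B N" if N: "N \<ge> 1" for N
  proof -
    have e: "(\<Sum>k<N. Cr 1 k u) + V 0 (real N) u = V N (real N) u + (\<Sum>k<N. Hz k (- real N) u - Hz k (real N) u)"
      using sum_Cr[where y = "real N" and K = N and u = u] N by simp
    have "norm ((\<Sum>k<N. Cr 1 k u) + V 0 (real N) u) \<le> norm (V N (real N) u) + norm (\<Sum>k<N. Hz k (- real N) u - Hz k (real N) u)"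
      unfolding e by (rule norm_triangle_ineq)
    also have "\<dots> \<le> norm (V N (real N) u) + (\<Sum>k<N. norm (Hz k (- real N) u - Hz k (real N) u))"
      by (rule add_left_mono[OF norm_sum])
    also have "\<dots> \<le> 2 * real N * B N + (\<Sum>k<N. 2 * B N)"
    proof (rule add_mono[OF VB sum_mono])
      fix k assume "k \<in> {..<N}"
      then have k: "k < N" by simp
      have "norm (Hz k (- real N) u) \<le> B N" by (rule HB[OF N k]) simp
      moreover have "norm (Hz k (real N) u) \<le> B N" by (rule HB[OF N k]) simp
      ultimately
      show "norm (Hz k (- real N) u - Hz k (real N) u) \<le> 2 * B N"
        using norm_triangle_ineq4[of "Hz k (- real N) u" "Hz k (real N) u"] by linarith
    qed
    also have "(\<Sum>k<N. 2 * B N) = 2 * real N * B N" by (simp only: sum_constant card_lessThan mult.assoc mult.left_commute)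
    also have "2 * real N * B N + 2 * real N * B N = 4 * real N * B N" by (simp only: distrib_right[symmetric]) simp
    finally show ?thesis .
  qed
  have "(\<lambda>N. (4 * C * 2 ^ m * E) * ((a + real N) ^ Suc m * exp (- \<kappa> * real N))) \<longlonglongrightarrow> 0"
    using \<kappa> by (intro tendsto_mult_right_zero summable_LIMSEQ_zero summable_power_exp) (auto simp: a_def)
  then have "(\<lambda>N. (\<Sum>k<N. Cr 1 k u) + V 0 (real N) u) \<longlonglongrightarrow> 0"
  proof (rule Lim_null_comparison[rotated])
    show "\<forall>\<^sub>F N in sequentially. norm ((\<Sum>k<N. Cr 1 k u) + V 0 (real N) u)
       \<le> (4 * C * 2 ^ m * E) * ((a + real N) ^ Suc m * exp (- \<kappa> * real N))"
      using eventually_ge_at_top[of 1]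
    proof eventually_elim
      case (elim N)
      have "4 * real N * B N \<le> 4 * (a + real N) * B N"
        using B0 by (intro mult_right_mono) (auto simp: a_def)
      also have "\<dots> = (4 * C * 2 ^ m * E) * ((a + real N) ^ Suc m * exp (- \<kappa> * real N))"
        by (simp only: B_def power_mult_distrib power_Suc mult_ac)
      finally show ?case using main[OF elim] by linarith
    qed
  qed
  moreover have "(\<lambda>N. (\<Sum>k<N. Cr 1 k u) + V 0 (real N) u) \<longlonglongrightarrow> (\<Sum>k. Cr 1 k u) + II u"
    by (intro tendsto_add summable_LIMSEQ summable_Cr V_tendsto u)
  ultimately have "(\<Sum>k. Cr 1 k u) + II u = 0" using LIMSEQ_unique by blast
  then show ?thesis by (simp add: Lam_def add_eq_0_iff)
qed

end

section \<open>A solution of the hypergeometric equation\<close>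

lemma contour_integral_linepath_uminus:
  "contour_integral (linepath (- a) (- b)) f = - contour_integral (linepath a b) (\<lambda>w. f (- w))"
proof -
  have "linepath (- a) (- b) t = - linepath a b t" for t by (simp add: linepath_def algebra_simps)
  then show ?thesis unfolding contour_integral_integral
    by (simp add: vector_derivative_linepath_at integral_neg[symmetric] algebra_simps)
qed

text \<open>The substitution of \<open>-w\<close> for \<open>w\<close> exchanges \<open>b\<close> and
  \<open>c\<close>, the left and the right half-plane of \<open>u\<close>, and the two kinds of
  poles. Everything on the right half-plane is thus a copy of what holds on the left one.\<close>

lemma (in mellin_barnes) mirror: "mellin_barnes m c b (- \<epsilon>) r"
  using r b_near c_near by unfold_locales (auto simp: algebra_simps)

lemma (in mellin_barnes) psi_mirror: "mellin_barnes.psi m c b w = psi (- w)"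
proof -
  interpret mir: mellin_barnes m c b "- \<epsilon>" r by (rule mirror)
  show ?thesis by (simp add: mir.psi_def psi_def mult.commute add.commute)
qed

lemma (in mellin_barnes) V_mirror: "mellin_barnes.V m c b (- \<epsilon>) 0 y u = V 0 y (- u)"
proof -
  interpret mir: mellin_barnes m c b "- \<epsilon>" r by (rule mirror)
  have "mir.V 0 y u = contour_integral (linepath (- Complex \<epsilon> y) (- Complex \<epsilon> (- y))) (\<lambda>w. psi (- w) * exp (w * u))"
    by (simp add: mir.V_def psi_mirror complex_eq_iff[of "- Complex \<epsilon> y"])
       (simp add: Complex_eq)?
  also have "\<dots> = - contour_integral (linepath (Complex \<epsilon> y) (Complex \<epsilon> (- y))) (\<lambda>w. psi w * exp (w * (- u)))"
    unfolding contour_integral_linepath_uminus by simp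
  also have "\<dots> = contour_integral (linepath (Complex \<epsilon> (- y)) (Complex \<epsilon> y)) (\<lambda>w. psi w * exp (w * (- u)))"
    using contour_integral_reversepath[of "linepath (Complex \<epsilon> y) (Complex \<epsilon> (- y))" "\<lambda>w. psi w * exp (w * (- u))"] by simp
  finally show ?thesis by (simp add: V_def)
qed

lemma (in mellin_barnes) II_mirror: "mellin_barnes.II m c b (- \<epsilon>) u = II (- u)"
proof -
  interpret mir: mellin_barnes m c b "- \<epsilon>" r by (rule mirror)
  show ?thesis by (simp add: mir.II_def II_def V_mirror)
qed

context mellin_barnes
begin

definition domain :: "complex set" where "domain = {u. Re u \<noteq> 0 \<or> \<bar>Im u\<bar> < pi * real m}"

text \<open>The integral converges only in a strip; the sums of residues on either side continue it to both
  half-planes.\<close>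

definition sol :: "complex \<Rightarrow> complex" where
  "sol u = (if Re u < 0 then Lam 1 u else if \<bar>Im u\<bar> < pi * real m then II u
            else mellin_barnes.Lam m c b (- \<epsilon>) r 1 (- u))"

lemma open_domain: "open domain"
proof -
  have "domain = - ({u. Re u = 0} \<inter> {u. \<bar>Im u\<bar> \<ge> pi * real m})" by (auto simp: domain_def)
  moreover have "closed ({u. Re u = 0} \<inter> {u. \<bar>Im u\<bar> \<ge> pi * real m})"
    by (intro closed_Int closed_Collect_eq closed_Collect_le continuous_intros)
  ultimately show ?thesis by (metis open_Compl)
qed

lemma connected_domain: "m > 0 \<Longrightarrow> connected domain"
proof -
  assume m: "m > 0"
  have "starlike domain" unfolding starlike_def
  proof (intro bexI ballI)
    show 0: "0 \<in> domain" using m by (simp add: domain_def)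
    fix u assume u: "u \<in> domain"
    show "closed_segment 0 u \<subseteq> domain"
    proof
      fix v assume "v \<in> closed_segment 0 u"
      then obtain t where t: "0 \<le> t" "t \<le> 1" "v = of_real t * u" by (auto simp: in_segment scaleR_conv_of_real)
      show "v \<in> domain"
      proof (cases "t = 0 \<or> Re u \<noteq> 0")
        case True then show ?thesis using 0 t by (auto simp: domain_def)
      next
        case False
        then have "\<bar>Im u\<bar> < pi * real m" using u by (auto simp: domain_def)
        moreover have "\<bar>Im v\<bar> \<le> \<bar>Im u\<bar>" using t by (simp add: abs_mult mult_left_le_one_le)
        ultimately show ?thesis by (simp add: domain_def)
      qed
    qed
  qed
  then show ?thesis by (rule starlike_imp_connected)
qed

lemma sol_left: "Re u < 0 \<Longrightarrow> sol u = Lam 1 u" by (simp add: sol_def)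
lemma sol_wide: "u \<in> wide \<Longrightarrow> sol u = II u" using II_eq_Lam[of u] by (auto simp: sol_def wide_def)
lemma sol_right: "Re u > 0 \<Longrightarrow> sol u = mellin_barnes.Lam m c b (- \<epsilon>) r 1 (- u)"
proof -
  assume u: "Re u > 0"
  interpret mir: mellin_barnes m c b "- \<epsilon>" r by (rule mirror)
  have w: "mir.wide = wide" by (simp add: mir.wide_def wide_def)
  show ?thesis
  proof (cases "u \<in> wide")
    case True
    then have "sol u = II u" by (rule sol_wide)
    also have "\<dots> = mir.II (- u)" by (simp add: II_mirror)
    also have "\<dots> = mir.Lam 1 (- u)" using True u by (intro mir.II_eq_Lam) (auto simp: mir.wide_def wide_def)
    finally show ?thesis .
  next
    case False
    then show ?thesis using u by (simp add: sol_def wide_def)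
  qed
qed

lemma sol_holomorphic: "sol holomorphic_on domain"
proof -
  interpret mir: mellin_barnes m c b "- \<epsilon>" r by (rule mirror)
  have L: "sol holomorphic_on {u. Re u < 0}"
    by (rule holomorphic_transform[OF Lam_holomorphic[of 1]]) (simp add: sol_left)
  have W: "sol holomorphic_on wide"
    by (rule holomorphic_transform[OF II_holomorphic]) (simp add: sol_wide)
  have "(mir.Lam 1 \<circ> uminus) holomorphic_on {u. Re u > 0}"
    by (rule holomorphic_on_compose_gen[OF _ mir.Lam_holomorphic[of 1]])
       (use holomorphic_on_minus[OF holomorphic_on_ident, of "{u. Re u > 0}"] in auto)
  then have R: "sol holomorphic_on {u. Re u > 0}"
    by (rule holomorphic_transform) (simp add: sol_right o_def)
  have "sol holomorphic_on {u. Re u < 0} \<union> wide \<union> {u. Re u > 0}"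
    using L W R open_wide open_left open_halfspace_Re_gt[of 0] by (intro holomorphic_on_Un open_Un)
  moreover have "domain = {u. Re u < 0} \<union> wide \<union> {u. Re u > 0}" by (auto simp: domain_def wide_def)
  ultimately show ?thesis by simp
qed

text \<open>The equation holds on the left half-plane, hence by the identity theorem on the connected
  domain.\<close>

lemma sol_ode:
  assumes m: "m > 0" and u: "u \<in> domain"
  shows "(-1) ^ m * (\<Sum>k\<le>degree PP. coeff PP k * (deriv ^^ k) sol u)
       = exp u * (\<Sum>k\<le>degree QQ. coeff QQ k * (deriv ^^ k) sol u)"
proof (rule analytic_continuation_open[where s = "{u. Re u < 0}" and s' = domain
      and f = "\<lambda>u. (-1) ^ m * (\<Sum>k\<le>degree PP. coeff PP k * (deriv ^^ k) sol u)"
      and g = "\<lambda>u. exp u * (\<Sum>k\<le>degree QQ. coeff QQ k * (deriv ^^ k) sol u)"])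
  show "open {u::complex. Re u < 0}" by (rule open_left)
  show "open domain" by (rule open_domain)
  show "{u::complex. Re u < 0} \<noteq> {}" by (auto intro: exI[of _ "-1"])
  show "connected domain" by (rule connected_domain[OF m])
  show "{u::complex. Re u < 0} \<subseteq> domain" by (auto simp: domain_def)
  show "(\<lambda>u. (-1) ^ m * (\<Sum>k\<le>degree PP. coeff PP k * (deriv ^^ k) sol u)) holomorphic_on domain"
    by (intro holomorphic_intros holomorphic_higher_deriv sol_holomorphic open_domain)
  show "(\<lambda>u. exp u * (\<Sum>k\<le>degree QQ. coeff QQ k * (deriv ^^ k) sol u)) holomorphic_on domain"
    by (intro holomorphic_intros holomorphic_higher_deriv sol_holomorphic open_domain)
  fix z :: complex assume "z \<in> {u. Re u < 0}"
  then have z: "Re z < 0" by simp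
  have "(deriv ^^ k) sol z = (deriv ^^ k) (Lam 1) z" for k
    by (rule higher_deriv_cong_ev)
       (use eventually_nhds_in_open[OF open_left, of z] z in \<open>auto elim!: eventually_mono simp: sol_left\<close>)
  then show "(-1) ^ m * (\<Sum>k\<le>degree PP. coeff PP k * (deriv ^^ k) sol z)
       = exp z * (\<Sum>k\<le>degree QQ. coeff QQ k * (deriv ^^ k) sol z)"
    using Lam_ode[OF z] poly_deriv_Lam[OF z, of _ 1] by simp
qed (rule u)

end

text \<open>The constants \<open>\<epsilon>\<close> and \<open>r\<close> are half of, and one half minus a
  quarter of, the least distance of the exponents from the bounds that they must respect.\<close>

theorem mellin_barnes_solution:
  fixes b c :: "nat \<Rightarrow> real" and m :: nat
  assumes m: "m > 0" and b: "\<And>j. j < m \<Longrightarrow> 0 \<le> b j \<and> b j < 1" and c: "\<And>j. j < m \<Longrightarrow> 0 < c j \<and> c j < 1"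
  defines "D \<equiv> {u. Re u \<noteq> 0 \<or> \<bar>Im u\<bar> < pi * real m}"
    and "P \<equiv> (\<Prod>j<m. [:- complex_of_real (c j), 1:])" and "Q \<equiv> (\<Prod>j<m. [:complex_of_real (b j), 1:])"
    and "XL \<equiv> (\<Prod>j<m. [:- exp (- 2 * pi * \<i> * of_real (c j)), 1:])"
    and "XR \<equiv> (\<Prod>j<m. [:- exp (2 * pi * \<i> * of_real (b j)), 1:])"
  shows "\<exists>f. f holomorphic_on D
    \<and> (\<forall>u\<in>D. (-1) ^ m * (\<Sum>k\<le>degree P. coeff P k * (deriv ^^ k) f u)
             = exp u * (\<Sum>k\<le>degree Q. coeff Q k * (deriv ^^ k) f u))
    \<and> (\<forall>u. Re u < 0 \<longrightarrow> (\<Sum>k\<le>degree XL. coeff XL k * f (u - 2 * pi * \<i> * of_nat k)) = 0)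
    \<and> (\<forall>u. Re u > 0 \<longrightarrow> (\<Sum>k\<le>degree XR. coeff XR k * f (u - 2 * pi * \<i> * of_nat k)) = 0)
    \<and> (\<forall>x n. (\<forall>u. Re u < 0 \<longrightarrow> (\<Sum>k<n. x k * f (u - 2 * pi * \<i> * of_nat k)) = 0) \<longrightarrow>
          (\<forall>j<m. (\<Sum>k<n. x k * exp (- 2 * pi * \<i> * of_real (c j)) ^ k) = 0))"
proof -
  define \<delta> where "\<delta> = Min (insert 1 (c ` {..<m} \<union> (\<lambda>j. 1 - b j) ` {..<m} \<union> (\<lambda>j. 1 - c j) ` {..<m}))"
  have \<delta>: "\<delta> > 0" unfolding \<delta>_def using b c by auto
  have \<delta>1: "\<delta> \<le> 1" "\<And>j. j < m \<Longrightarrow> \<delta> \<le> c j" "\<And>j. j < m \<Longrightarrow> \<delta> \<le> 1 - b j"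
    unfolding \<delta>_def by auto
  define \<epsilon> where "\<epsilon> = \<delta> / 2"
  define r where "r = 1/2 - \<delta> / 4"
  interpret mellin_barnes m b c \<epsilon> r
    using \<delta> \<delta>1 b c by unfold_locales (fastforce simp: \<epsilon>_def r_def abs_less_iff field_simps)+
  interpret mir: mellin_barnes m c b "- \<epsilon>" r by (rule mirror)
  have D: "D = domain" by (simp add: D_def domain_def)
  have PQ: "P = PP" "Q = QQ" by (simp_all add: P_def Q_def PP_def QQ_def)
  have XL: "XL = XX (-1)" by (simp add: XL_def XX_def)
  have XR: "XR = mir.XX 1" by (simp add: XR_def mir.XX_def)
  have min: "u - 2 * pi * \<i> * of_nat k = u + 2 * pi * \<i> * (-1) * of_nat k" for u k by simp
  have left: "sol (u - 2 * pi * \<i> * of_nat k) = Lam 1 (u + 2 * pi * \<i> * (-1) * of_nat k)" if "Re u < 0" for u k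
    using that by (subst sol_left) auto
  have right: "sol (u - 2 * pi * \<i> * of_nat k) = mir.Lam 1 (- u + 2 * pi * \<i> * 1 * of_nat k)" if "Re u > 0" for u k
    using that by (subst sol_right) auto
  show ?thesis
  proof (intro exI[of _ sol] conjI allI impI ballI)
    show "sol holomorphic_on D" unfolding D by (rule sol_holomorphic)
    show "(-1) ^ m * (\<Sum>k\<le>degree P. coeff P k * (deriv ^^ k) sol u)
             = exp u * (\<Sum>k\<le>degree Q. coeff Q k * (deriv ^^ k) sol u)" if "u \<in> D" for u
      using sol_ode[OF m] that unfolding D PQ by blast
    show "(\<Sum>k\<le>degree XL. coeff XL k * sol (u - 2 * pi * \<i> * of_nat k)) = 0" if "Re u < 0" for u
      using Lam_shift_relation[of "-1" u 1] that left[OF that] unfolding XL by simp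
    show "(\<Sum>k\<le>degree XR. coeff XR k * sol (u - 2 * pi * \<i> * of_nat k)) = 0" if "Re u > 0" for u
      using mir.Lam_shift_relation[of 1 "- u" 1] that right[OF that] unfolding XR by simp
    show "(\<Sum>k<n. x k * exp (- 2 * pi * \<i> * of_real (c j)) ^ k) = 0"
      if z: "\<forall>u. Re u < 0 \<longrightarrow> (\<Sum>k<n. x k * sol (u - 2 * pi * \<i> * of_nat k)) = 0" and j: "j < m" for x n j
    proof -
      have "(\<Sum>k<n. x k * Lam 1 (u + 2 * pi * \<i> * (-1) * of_nat k)) = 0" if "Re u < 0" for u
      proof -
        have "(\<Sum>k<n. x k * sol (u - 2 * pi * \<i> * of_nat k)) = 0" using z that by blast
        then show ?thesis unfolding left[OF that] .
      qed
      from Lam_independent[OF _ this j] show ?thesis by simp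
    qed
  qed
qed

section \<open>Analytic continuation of germs\<close>

definition germ_family ::
  "(real \<Rightarrow> complex) \<Rightarrow> real set \<Rightarrow> (real \<Rightarrow> complex \<Rightarrow> complex) \<Rightarrow> (real \<Rightarrow> complex set) \<Rightarrow> bool" where
  "germ_family p S F D \<longleftrightarrow>
     (\<forall>t\<in>S. open (D t) \<and> p t \<in> D t \<and> F t holomorphic_on D t) \<and>
     (\<forall>t\<in>S. \<exists>\<delta>>0. \<forall>u\<in>S. \<bar>u - t\<bar> < \<delta> \<longrightarrow> p u \<in> D t \<and> (\<forall>\<^sub>F z in nhds (p u). F u z = F t z))"

text \<open>Continuation along a part of a path, so that paths can be cut and glued.\<close>

definition cont_on ::
  "(real \<Rightarrow> complex) \<Rightarrow> real \<Rightarrow> real \<Rightarrow> (complex \<Rightarrow> complex) \<Rightarrow> (complex \<Rightarrow> complex) \<Rightarrow> bool" where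
  "cont_on p a b f g \<longleftrightarrow> (\<exists>F D. germ_family p {a..b} F D \<and>
     (\<forall>\<^sub>F z in nhds (p a). f z = F a z) \<and> (\<forall>\<^sub>F z in nhds (p b). g z = F b z))"

lemma continues_along_iff: "continues_along p f g \<longleftrightarrow> cont_on p 0 1 f g"
  unfolding continues_along_def cont_on_def germ_family_def pathstart_def pathfinish_def by simp

lemma germ_family_at:
  assumes "germ_family p S F D" "t \<in> S"
  shows "open (D t)" "p t \<in> D t" "F t holomorphic_on D t"
  using assms by (simp_all add: germ_family_def)

lemma germ_family_near:
  assumes "germ_family p S F D" "t \<in> S"
  obtains \<delta> where "\<delta> > 0" "\<And>u. u \<in> S \<Longrightarrow> \<bar>u - t\<bar> < \<delta> \<Longrightarrow> p u \<in> D t"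
    "\<And>u. u \<in> S \<Longrightarrow> \<bar>u - t\<bar> < \<delta> \<Longrightarrow> \<forall>\<^sub>F z in nhds (p u). F u z = F t z"
  using assms unfolding germ_family_def by blast

lemma germ_family_reparam:
  assumes "germ_family p T F D" "continuous_on S \<sigma>" "\<sigma> ` S \<subseteq> T" "\<And>t. t \<in> S \<Longrightarrow> q t = p (\<sigma> t)"
  shows "germ_family q S (\<lambda>t. F (\<sigma> t)) (\<lambda>t. D (\<sigma> t))"
  unfolding germ_family_def
proof (intro conjI ballI)
  fix t assume t: "t \<in> S"
  then have \<sigma>t: "\<sigma> t \<in> T" using assms(3) by auto
  then show "open (D (\<sigma> t))" "q t \<in> D (\<sigma> t)" "F (\<sigma> t) holomorphic_on D (\<sigma> t)"
    using assms(1) assms(4)[OF t] unfolding germ_family_def by auto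
  obtain \<delta> where \<delta>: "\<delta> > 0" "\<And>u. u \<in> T \<Longrightarrow> \<bar>u - \<sigma> t\<bar> < \<delta> \<Longrightarrow> p u \<in> D (\<sigma> t) \<and> (\<forall>\<^sub>F z in nhds (p u). F u z = F (\<sigma> t) z)"
    using assms(1) \<sigma>t unfolding germ_family_def by blast
  obtain e where e: "e > 0" "\<And>u. u \<in> S \<Longrightarrow> dist u t < e \<Longrightarrow> dist (\<sigma> u) (\<sigma> t) < \<delta>"
    using assms(2) t \<delta>(1) unfolding continuous_on_iff by blast
  show "\<exists>\<delta>>0. \<forall>u\<in>S. \<bar>u - t\<bar> < \<delta> \<longrightarrow> q u \<in> D (\<sigma> t) \<and> (\<forall>\<^sub>F z in nhds (q u). F (\<sigma> u) z = F (\<sigma> t) z)"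
  proof (intro exI[of _ e] conjI ballI impI e(1))
    fix u assume u: "u \<in> S" "\<bar>u - t\<bar> < e"
    then have "\<sigma> u \<in> T" "\<bar>\<sigma> u - \<sigma> t\<bar> < \<delta>" using assms(3) e(2)[of u] by (auto simp: dist_real_def)
    then show "q u \<in> D (\<sigma> t)" "\<forall>\<^sub>F z in nhds (q u). F (\<sigma> u) z = F (\<sigma> t) z"
      using \<delta>(2)[of "\<sigma> u"] assms(4)[OF u(1)] by auto
  qed
qed

lemma cont_on_local:
  assumes "open U" "G holomorphic_on U" "\<And>t. a \<le> t \<Longrightarrow> t \<le> b \<Longrightarrow> p t \<in> U"
    and "\<forall>\<^sub>F z in nhds (p a). f z = G z" "\<forall>\<^sub>F z in nhds (p b). g z = G z"
  shows "cont_on p a b f g"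
  unfolding cont_on_def germ_family_def
  using assms by (intro exI[of _ "\<lambda>_. G"] exI[of _ "\<lambda>_. U"]) (auto intro: exI[of _ 1])

lemma cont_on_cong:
  assumes "cont_on p a b f g" "\<forall>\<^sub>F z in nhds (p a). f' z = f z" "\<forall>\<^sub>F z in nhds (p b). g' z = g z"
  shows "cont_on p a b f' g'"
proof -
  obtain F D where F: "germ_family p {a..b} F D" "\<forall>\<^sub>F z in nhds (p a). f z = F a z" "\<forall>\<^sub>F z in nhds (p b). g z = F b z"
    using assms(1) unfolding cont_on_def by blast
  have "\<forall>\<^sub>F z in nhds (p a). f' z = F a z" using assms(2) F(2) by eventually_elim simp
  moreover have "\<forall>\<^sub>F z in nhds (p b). g' z = F b z" using assms(3) F(3) by eventually_elim simp
  ultimately show ?thesis using F(1) unfolding cont_on_def by blast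
qed

text \<open>Two families agree near the common point, where the function element of the first may be
  restricted to that of the second.\<close>

lemma cont_on_trans:
  assumes "a \<le> c" "c \<le> b" and p: "continuous_on {a..b} p"
    and 1: "cont_on p a c f h" and 2: "cont_on p c b h g"
  shows "cont_on p a b f g"
proof -
  obtain F1 D1 where F1: "germ_family p {a..c} F1 D1" "\<forall>\<^sub>F z in nhds (p a). f z = F1 a z" "\<forall>\<^sub>F z in nhds (p c). h z = F1 c z"
    using 1 unfolding cont_on_def by blast
  obtain F2 D2 where F2: "germ_family p {c..b} F2 D2" "\<forall>\<^sub>F z in nhds (p c). h z = F2 c z" "\<forall>\<^sub>F z in nhds (p b). g z = F2 b z"
    using 2 unfolding cont_on_def by blast
  have "\<forall>\<^sub>F z in nhds (p c). F1 c z = F2 c z" using F1(3) F2(2) by eventually_elim simp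
  then obtain W where W: "open W" "p c \<in> W" "\<And>z. z \<in> W \<Longrightarrow> F1 c z = F2 c z"
    unfolding eventually_nhds by blast
  define F where "F = (\<lambda>t. if t \<le> c then F1 t else F2 t)"
  define D where "D = (\<lambda>t. if t \<le> c then D1 t else D2 t)"
  have fam: "germ_family p {a..b} F D"
    unfolding germ_family_def
  proof (intro conjI ballI)
    fix t assume t: "t \<in> {a..b}"
    then show "open (D t)" "p t \<in> D t" "F t holomorphic_on D t"
      using F1(1) F2(1) unfolding germ_family_def F_def D_def by auto
    consider "t < c" | "t = c" | "t > c" by linarith
    then show "\<exists>\<delta>>0. \<forall>u\<in>{a..b}. \<bar>u - t\<bar> < \<delta> \<longrightarrow> p u \<in> D t \<and> (\<forall>\<^sub>F z in nhds (p u). F u z = F t z)"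
    proof cases
      case 1
      have tS: "t \<in> {a..c}" using t 1 by simp
      obtain \<delta> where \<delta>: "\<delta> > 0" "\<And>u. u \<in> {a..c} \<Longrightarrow> \<bar>u - t\<bar> < \<delta> \<Longrightarrow> p u \<in> D1 t"
         "\<And>u. u \<in> {a..c} \<Longrightarrow> \<bar>u - t\<bar> < \<delta> \<Longrightarrow> \<forall>\<^sub>F z in nhds (p u). F1 u z = F1 t z"
        using germ_family_near[OF F1(1) tS] by blast
      show ?thesis
        using \<delta> 1 by (intro exI[of _ "min \<delta> (c - t)"]) (simp add: F_def D_def abs_less_iff)
    next
      case 3
      have tS: "t \<in> {c..b}" using t 3 by simp
      obtain \<delta> where \<delta>: "\<delta> > 0" "\<And>u. u \<in> {c..b} \<Longrightarrow> \<bar>u - t\<bar> < \<delta> \<Longrightarrow> p u \<in> D2 t"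
         "\<And>u. u \<in> {c..b} \<Longrightarrow> \<bar>u - t\<bar> < \<delta> \<Longrightarrow> \<forall>\<^sub>F z in nhds (p u). F2 u z = F2 t z"
        using germ_family_near[OF F2(1) tS] by blast
      show ?thesis
        using \<delta> 3 by (intro exI[of _ "min \<delta> (t - c)"]) (simp add: F_def D_def abs_less_iff)
    next
      case 2
      have tS: "c \<in> {a..c}" using assms(1) by simp
      obtain \<delta>1 where \<delta>1: "\<delta>1 > 0" "\<And>u. u \<in> {a..c} \<Longrightarrow> \<bar>u - c\<bar> < \<delta>1 \<Longrightarrow> p u \<in> D1 c"
         "\<And>u. u \<in> {a..c} \<Longrightarrow> \<bar>u - c\<bar> < \<delta>1 \<Longrightarrow> \<forall>\<^sub>F z in nhds (p u). F1 u z = F1 c z"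
        using germ_family_near[OF F1(1) tS] by blast
      have tS2: "c \<in> {c..b}" using assms(2) by simp
      obtain \<delta>2 where \<delta>2: "\<delta>2 > 0" "\<And>u. u \<in> {c..b} \<Longrightarrow> \<bar>u - c\<bar> < \<delta>2 \<Longrightarrow> p u \<in> D2 c"
         "\<And>u. u \<in> {c..b} \<Longrightarrow> \<bar>u - c\<bar> < \<delta>2 \<Longrightarrow> \<forall>\<^sub>F z in nhds (p u). F2 u z = F2 c z"
        using germ_family_near[OF F2(1) tS2] by blast
      have oD: "open (D1 c)" "p c \<in> D1 c" using F1(1) assms(1) unfolding germ_family_def by auto
      then have "open (D1 c \<inter> W)" "p c \<in> D1 c \<inter> W" using W by auto
      then obtain r where r: "r > 0" "ball (p c) r \<subseteq> D1 c \<inter> W" using open_contains_ball by blast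
      obtain e where e: "e > 0" "\<And>u. u \<in> {a..b} \<Longrightarrow> dist u c < e \<Longrightarrow> dist (p u) (p c) < r"
        using p assms(1,2) r(1) unfolding continuous_on_iff by (metis atLeastAtMost_iff)
      show ?thesis
      proof (intro exI[of _ "min (min \<delta>1 \<delta>2) e"] conjI ballI impI)
        show "0 < min (min \<delta>1 \<delta>2) e" using \<delta>1 \<delta>2 e by simp
        fix u assume u: "u \<in> {a..b}" "\<bar>u - t\<bar> < min (min \<delta>1 \<delta>2) e"
        have "dist (p u) (p c) < r" using e(2)[OF u(1)] u(2) 2 by (simp add: dist_real_def)
        then have pu: "p u \<in> D1 c" "p u \<in> W" using r(2) by (auto simp: dist_commute)
        then show "p u \<in> D t" using 2 by (simp add: D_def)
        show "\<forall>\<^sub>F z in nhds (p u). F u z = F t z"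
        proof (cases "u \<le> c")
          case True
          then show ?thesis using \<delta>1(3)[of u] u 2 by (simp add: F_def)
        next
          case False
          then have "\<forall>\<^sub>F z in nhds (p u). F2 u z = F2 c z" using \<delta>2(3)[of u] u 2 by simp
          moreover have "\<forall>\<^sub>F z in nhds (p u). F1 c z = F2 c z"
            using eventually_nhds_in_open[OF W(1) pu(2)] by eventually_elim (rule W(3))
          ultimately have "\<forall>\<^sub>F z in nhds (p u). F2 u z = F1 c z" by eventually_elim simp
          then show ?thesis using False 2 by (simp add: F_def)
        qed
      qed
    qed
  qed
  show ?thesis
  proof (cases "c < b")
    case True
    then show ?thesis using fam F1(2) F2(3) assms(1) unfolding cont_on_def
      by (intro exI[of _ F] exI[of _ D]) (auto simp: F_def)
  next
    case False
    then have cb: "c = b" using assms(2) by simp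
    have "\<forall>\<^sub>F z in nhds (p b). F1 c z = F2 c z" using eventually_nhds_in_open[OF W(1,2)] unfolding cb[symmetric]
      by eventually_elim (rule W(3))
    then have "\<forall>\<^sub>F z in nhds (p b). g z = F b z" using F2(3) unfolding cb[symmetric] by eventually_elim (simp add: F_def)
    then show ?thesis using fam F1(2) assms(1) cb unfolding cont_on_def
      by (intro exI[of _ F] exI[of _ D]) (auto simp: F_def)
  qed
qed

lemma cont_on_reparam:
  assumes "cont_on p c d f g" "continuous_on {a..b} \<sigma>" "\<sigma> ` {a..b} \<subseteq> {c..d}" "a \<le> b"
    and "\<sigma> a = c" "\<sigma> b = d" "\<And>t. t \<in> {a..b} \<Longrightarrow> q t = p (\<sigma> t)"
  shows "cont_on q a b f g"
proof -
  obtain F D where F: "germ_family p {c..d} F D" "\<forall>\<^sub>F z in nhds (p c). f z = F c z" "\<forall>\<^sub>F z in nhds (p d). g z = F d z"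
    using assms(1) unfolding cont_on_def by blast
  show ?thesis unfolding cont_on_def
    using germ_family_reparam[OF F(1) assms(2,3,7)] F(2,3) assms(4-7)
    by (intro exI[of _ "\<lambda>t. F (\<sigma> t)"] exI[of _ "\<lambda>t. D (\<sigma> t)"]) auto
qed

lemma cont_on_reverse:
  assumes "cont_on p c d f g" "continuous_on {a..b} \<sigma>" "\<sigma> ` {a..b} \<subseteq> {c..d}" "a \<le> b"
    and "\<sigma> a = d" "\<sigma> b = c" "\<And>t. t \<in> {a..b} \<Longrightarrow> q t = p (\<sigma> t)"
  shows "cont_on q a b g f"
proof -
  obtain F D where F: "germ_family p {c..d} F D" "\<forall>\<^sub>F z in nhds (p c). f z = F c z" "\<forall>\<^sub>F z in nhds (p d). g z = F d z"
    using assms(1) unfolding cont_on_def by blast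
  show ?thesis unfolding cont_on_def
    using germ_family_reparam[OF F(1) assms(2,3,7)] F(2,3) assms(4-7)
    by (intro exI[of _ "\<lambda>t. F (\<sigma> t)"] exI[of _ "\<lambda>t. D (\<sigma> t)"]) auto
qed

lemma continues_along_join:
  assumes "continues_along p f h" "continues_along q h g" "path p" "path q" "pathfinish p = pathstart q"
  shows "continues_along (p +++ q) f g"
  unfolding continues_along_iff
proof (rule cont_on_trans[of 0 "1/2"])
  show "continuous_on {0..1} (p +++ q)" using path_join_imp[OF assms(3-5)] by (simp add: path_def)
  show "cont_on (p +++ q) 0 (1/2) f h"
    by (rule cont_on_reparam[OF assms(1)[unfolded continues_along_iff], of _ _ "\<lambda>t. 2 * t"])
       (auto simp: joinpaths_def intro!: continuous_intros)
  have second: "(p +++ q) t = q (2 * t - 1)" if "t \<in> {1/2..1}" for t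
    using that assms(5) by (cases "2 * t = 1") (simp_all add: joinpaths_def pathstart_def pathfinish_def)
  show "cont_on (p +++ q) (1/2) 1 h g"
    by (rule cont_on_reparam[OF assms(2)[unfolded continues_along_iff], of _ _ "\<lambda>t. 2 * t - 1"])
       (use second in \<open>auto intro!: continuous_intros\<close>)
qed auto

lemma continues_along_reversepath:
  assumes "continues_along p f g"
  shows "continues_along (reversepath p) g f"
  unfolding continues_along_iff
  by (rule cont_on_reverse[OF assms[unfolded continues_along_iff], of _ _ "\<lambda>t. 1 - t"])
     (auto simp: reversepath_def intro!: continuous_intros)

text \<open>Near each parameter both families are restrictions of a single function element, so agreement of
  germs passes from one parameter to all nearby ones; bisection of the interval does the rest.\<close>

lemma germ_family_unique:
  assumes ab: "a \<le> b" and p: "continuous_on {a..b} p"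
    and F: "germ_family p {a..b} F D" and G: "germ_family p {a..b} G E"
    and eq: "\<forall>\<^sub>F z in nhds (p a). F a z = G a z"
  shows "\<forall>\<^sub>F z in nhds (p b). F b z = G b z"
proof -
  define P where "P = (\<lambda>x y. a \<le> x \<longrightarrow> y \<le> b \<longrightarrow> (\<forall>\<^sub>F z in nhds (p x). F x z = G x z) \<longrightarrow> (\<forall>\<^sub>F z in nhds (p y). F y z = G y z))"
  have "P a b"
  proof (rule Bolzano[OF ab])
    fix x y z assume "P x y" "P y z" "x \<le> y" "y \<le> z"
    then show "P x z" unfolding P_def by simp
  next
    fix x assume x: "a \<le> x" "x \<le> b"
    then have xin: "x \<in> {a..b}" by simp
      have tS: "x \<in> {a..b}" using xin by simp
      obtain \<delta>1 where \<delta>1: "\<delta>1 > 0" "\<And>u. u \<in> {a..b} \<Longrightarrow> \<bar>u - x\<bar> < \<delta>1 \<Longrightarrow> p u \<in> D x"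
         "\<And>u. u \<in> {a..b} \<Longrightarrow> \<bar>u - x\<bar> < \<delta>1 \<Longrightarrow> \<forall>\<^sub>F z in nhds (p u). F u z = F x z"
        using germ_family_near[OF F tS] by blast
      have tS2: "x \<in> {a..b}" using xin by simp
      obtain \<delta>2 where \<delta>2: "\<delta>2 > 0" "\<And>u. u \<in> {a..b} \<Longrightarrow> \<bar>u - x\<bar> < \<delta>2 \<Longrightarrow> p u \<in> E x"
         "\<And>u. u \<in> {a..b} \<Longrightarrow> \<bar>u - x\<bar> < \<delta>2 \<Longrightarrow> \<forall>\<^sub>F z in nhds (p u). G u z = G x z"
        using germ_family_near[OF G tS2] by blast
    have "open (D x \<inter> E x)" "p x \<in> D x \<inter> E x" using germ_family_at[OF F xin] germ_family_at[OF G xin] by auto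
    then obtain r where r: "r > 0" "ball (p x) r \<subseteq> D x \<inter> E x" using open_contains_ball by blast
    obtain e where e: "e > 0" "\<And>u. u \<in> {a..b} \<Longrightarrow> dist u x < e \<Longrightarrow> dist (p u) (p x) < r"
      using p xin r(1) unfolding continuous_on_iff by metis
    have hol: "F x holomorphic_on ball (p x) r" "G x holomorphic_on ball (p x) r"
      using germ_family_at(3)[OF F xin] germ_family_at(3)[OF G xin] r(2) by (auto intro: holomorphic_on_subset)
    define d where "d = min (min \<delta>1 \<delta>2) e"
    have d: "d > 0" using \<delta>1 \<delta>2 e by (simp add: d_def)
    show "\<exists>d>0. \<forall>u v. u \<le> x \<and> x \<le> v \<and> v - u < d \<longrightarrow> P u v"
    proof (intro exI[of _ d] conjI allI impI d)
      fix u v assume uv: "u \<le> x \<and> x \<le> v \<and> v - u < d"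
      show "P u v" unfolding P_def
      proof (intro impI)
        assume b: "a \<le> u" "v \<le> b" and uu: "\<forall>\<^sub>F z in nhds (p u). F u z = G u z"
        have u: "u \<in> {a..b}" "\<bar>u - x\<bar> < \<delta>1" "\<bar>u - x\<bar> < \<delta>2" "dist u x < e"
          and v: "v \<in> {a..b}" "\<bar>v - x\<bar> < \<delta>1" "\<bar>v - x\<bar> < \<delta>2" "dist v x < e"
          using uv b unfolding d_def dist_real_def by auto
        have pu: "p u \<in> ball (p x) r" "p v \<in> ball (p x) r"
          using e(2)[of u] e(2)[of v] u v by (simp_all add: dist_commute)
        have Fu: "\<forall>\<^sub>F z in nhds (p u). F u z = F x z" and Gu: "\<forall>\<^sub>F z in nhds (p u). G u z = G x z"
          and Fv: "\<forall>\<^sub>F z in nhds (p v). F v z = F x z" and Gv: "\<forall>\<^sub>F z in nhds (p v). G v z = G x z"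
          using \<delta>1(3) \<delta>2(3) u v by simp_all
        have "\<forall>\<^sub>F z in nhds (p u). F x z = G x z" using uu Fu Gu by eventually_elim simp
        then obtain W where W: "open W" "p u \<in> W" "\<And>z. z \<in> W \<Longrightarrow> F x z = G x z"
          unfolding eventually_nhds by blast
        have eqb: "F x z = G x z" if "z \<in> ball (p x) r" for z
          by (rule analytic_continuation_open[of "W \<inter> ball (p x) r" "ball (p x) r"])
             (use W pu hol that in auto)
        have "\<forall>\<^sub>F z in nhds (p v). F x z = G x z"
          using eventually_nhds_in_open[OF open_ball pu(2)] by eventually_elim (rule eqb)
        then show "\<forall>\<^sub>F z in nhds (p v). F v z = G v z" using Fv Gv by eventually_elim simp
      qed
    qed
  qed
  then show ?thesis using eq by (simp add: P_def)
qed

text \<open>Continuation along a fixed path determines the final germ, so monodromy matrices are well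
  defined once the germs of a basis are independent.\<close>

lemma continues_along_unique:
  assumes "path p" "continues_along p f g" "continues_along p f g'"
  shows "\<forall>\<^sub>F z in nhds (pathfinish p). g z = g' z"
proof -
  have p: "continuous_on {0..1} p" using assms(1) by (simp add: path_def)
  obtain F D where F: "germ_family p {0..1} F D" "\<forall>\<^sub>F z in nhds (p 0). f z = F 0 z" "\<forall>\<^sub>F z in nhds (p 1). g z = F 1 z"
    using assms(2) unfolding continues_along_iff cont_on_def by blast
  obtain G E where G: "germ_family p {0..1} G E" "\<forall>\<^sub>F z in nhds (p 0). f z = G 0 z" "\<forall>\<^sub>F z in nhds (p 1). g' z = G 1 z"
    using assms(3) unfolding continues_along_iff cont_on_def by blast
  have "\<forall>\<^sub>F z in nhds (p 0). F 0 z = G 0 z" using F(2) G(2) by eventually_elim simp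
  then have "\<forall>\<^sub>F z in nhds (p 1). F 1 z = G 1 z" by (intro germ_family_unique[OF _ p F(1) G(1)]) auto
  then show ?thesis unfolding pathfinish_def using F(3) G(3) by eventually_elim simp
qed

lemma cont_on_add:
  assumes "cont_on p a b f g" "cont_on p a b f' g'"
  shows "cont_on p a b (\<lambda>z. f z + f' z) (\<lambda>z. g z + g' z)"
proof -
  obtain F D where F: "germ_family p {a..b} F D" "\<forall>\<^sub>F z in nhds (p a). f z = F a z" "\<forall>\<^sub>F z in nhds (p b). g z = F b z"
    using assms(1) unfolding cont_on_def by blast
  obtain G E where G: "germ_family p {a..b} G E" "\<forall>\<^sub>F z in nhds (p a). f' z = G a z" "\<forall>\<^sub>F z in nhds (p b). g' z = G b z"
    using assms(2) unfolding cont_on_def by blast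
  have "germ_family p {a..b} (\<lambda>t z. F t z + G t z) (\<lambda>t. D t \<inter> E t)"
    unfolding germ_family_def
  proof (intro conjI ballI)
    fix t assume t: "t \<in> {a..b}"
    then show "open (D t \<inter> E t)" "p t \<in> D t \<inter> E t"
      using germ_family_at[OF F(1) t] germ_family_at[OF G(1) t] by auto
    show "(\<lambda>z. F t z + G t z) holomorphic_on D t \<inter> E t"
      using germ_family_at(3)[OF F(1) t] germ_family_at(3)[OF G(1) t]
      by (intro holomorphic_on_add) (auto intro: holomorphic_on_subset)
      have tS: "t \<in> {a..b}" using t by simp
      obtain \<delta>1 where \<delta>1: "\<delta>1 > 0" "\<And>u. u \<in> {a..b} \<Longrightarrow> \<bar>u - t\<bar> < \<delta>1 \<Longrightarrow> p u \<in> D t"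
         "\<And>u. u \<in> {a..b} \<Longrightarrow> \<bar>u - t\<bar> < \<delta>1 \<Longrightarrow> \<forall>\<^sub>F z in nhds (p u). F u z = F t z"
        using germ_family_near[OF F(1) tS] by blast
      have tS2: "t \<in> {a..b}" using t by simp
      obtain \<delta>2 where \<delta>2: "\<delta>2 > 0" "\<And>u. u \<in> {a..b} \<Longrightarrow> \<bar>u - t\<bar> < \<delta>2 \<Longrightarrow> p u \<in> E t"
         "\<And>u. u \<in> {a..b} \<Longrightarrow> \<bar>u - t\<bar> < \<delta>2 \<Longrightarrow> \<forall>\<^sub>F z in nhds (p u). G u z = G t z"
        using germ_family_near[OF G(1) tS2] by blast
    show "\<exists>\<delta>>0. \<forall>u\<in>{a..b}. \<bar>u - t\<bar> < \<delta> \<longrightarrow> p u \<in> D t \<inter> E t \<and> (\<forall>\<^sub>F z in nhds (p u). F u z + G u z = F t z + G t z)"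
      proof (intro exI[of _ "min \<delta>1 \<delta>2"] conjI ballI impI)
      show "0 < min \<delta>1 \<delta>2" using \<delta>1(1) \<delta>2(1) by simp
      fix u assume u: "u \<in> {a..b}" "\<bar>u - t\<bar> < min \<delta>1 \<delta>2"
      then show "p u \<in> D t \<inter> E t" using \<delta>1(2) \<delta>2(2) by simp
      have "\<forall>\<^sub>F z in nhds (p u). F u z = F t z" "\<forall>\<^sub>F z in nhds (p u). G u z = G t z"
        using \<delta>1(3) \<delta>2(3) u by simp_all
      then show "\<forall>\<^sub>F z in nhds (p u). F u z + G u z = F t z + G t z" by eventually_elim simp
    qed
  qed
  moreover have "\<forall>\<^sub>F z in nhds (p a). f z + f' z = F a z + G a z" using F(2) G(2) by eventually_elim simp
  moreover have "\<forall>\<^sub>F z in nhds (p b). g z + g' z = F b z + G b z" using F(3) G(3) by eventually_elim simp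
  ultimately show ?thesis unfolding cont_on_def by blast
qed

lemma cont_on_cmult:
  assumes "cont_on p a b f g"
  shows "cont_on p a b (\<lambda>z. c * f z) (\<lambda>z. c * g z)"
proof -
  obtain F D where F: "germ_family p {a..b} F D" "\<forall>\<^sub>F z in nhds (p a). f z = F a z" "\<forall>\<^sub>F z in nhds (p b). g z = F b z"
    using assms(1) unfolding cont_on_def by blast
  have "germ_family p {a..b} (\<lambda>t z. c * F t z) D"
    unfolding germ_family_def
  proof (intro conjI ballI)
    fix t assume t: "t \<in> {a..b}"
    then show "open (D t)" "p t \<in> D t" using F(1) unfolding germ_family_def by auto
    show "(\<lambda>z. c * F t z) holomorphic_on D t"
      using F(1) t unfolding germ_family_def by (intro holomorphic_intros) auto
      have tS: "t \<in> {a..b}" using t by simp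
      obtain \<delta>1 where \<delta>1: "\<delta>1 > 0" "\<And>u. u \<in> {a..b} \<Longrightarrow> \<bar>u - t\<bar> < \<delta>1 \<Longrightarrow> p u \<in> D t"
         "\<And>u. u \<in> {a..b} \<Longrightarrow> \<bar>u - t\<bar> < \<delta>1 \<Longrightarrow> \<forall>\<^sub>F z in nhds (p u). F u z = F t z"
        using germ_family_near[OF F(1) tS] by blast
    show "\<exists>\<delta>>0. \<forall>u\<in>{a..b}. \<bar>u - t\<bar> < \<delta> \<longrightarrow> p u \<in> D t \<and> (\<forall>\<^sub>F z in nhds (p u). c * F u z = c * F t z)"
      using \<delta>1 by (intro exI[of _ \<delta>1]) (auto elim!: eventually_mono intro: \<delta>1(2))
  qed
  moreover have "\<forall>\<^sub>F z in nhds (p a). c * f z = c * F a z" using F(2) by eventually_elim simp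
  moreover have "\<forall>\<^sub>F z in nhds (p b). c * g z = c * F b z" using F(3) by eventually_elim simp
  ultimately show ?thesis unfolding cont_on_def by blast
qed

lemma cont_on_sum:
  assumes "\<And>j. j < (n::nat) \<Longrightarrow> cont_on p a b (f j) (g j)"
  shows "cont_on p a b (\<lambda>z. \<Sum>j<n. c j * f j z) (\<lambda>z. \<Sum>j<n. c j * g j z)"
  using assms
proof (induction n)
  case 0
  have "cont_on p a b (\<lambda>_. 0) (\<lambda>_. 0)" by (rule cont_on_local[of UNIV "\<lambda>_. 0"]) auto
  then show ?case by simp
next
  case (Suc n)
  have "cont_on p a b (\<lambda>z. (\<Sum>j<n. c j * f j z) + c n * f n z) (\<lambda>z. (\<Sum>j<n. c j * g j z) + c n * g n z)"
    using Suc by (intro cont_on_add cont_on_cmult) auto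
  then show ?case by simp
qed

definition germ_independent :: "nat \<Rightarrow> (nat \<Rightarrow> complex \<Rightarrow> complex) \<Rightarrow> complex \<Rightarrow> bool" where
  "germ_independent m b s \<longleftrightarrow> (\<forall>x. (\<forall>\<^sub>F z in nhds s. (\<Sum>i<m. x i * b i z) = 0) \<longrightarrow> (\<forall>i<m. x i = 0))"

lemma has_monodromy_unique:
  assumes "path p" "pathfinish p = s" "germ_independent m b s" "has_monodromy m b p M" "has_monodromy m b p N"
  shows "M = N"
proof (rule eq_matI)
  have c: "M \<in> carrier_mat m m" "N \<in> carrier_mat m m" using assms(4,5) by (auto simp: has_monodromy_def)
  fix i j assume ij: "i < dim_row N" "j < dim_col N"
  then have j: "i < m" "j < m" using c by auto
  have "\<forall>\<^sub>F z in nhds s. (\<Sum>i<m. M $$ (i, j) * b i z) = (\<Sum>i<m. N $$ (i, j) * b i z)"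
    using continues_along_unique[OF assms(1)] assms(2,4,5) j unfolding has_monodromy_def by blast
  then have "\<forall>\<^sub>F z in nhds s. (\<Sum>i<m. (M $$ (i, j) - N $$ (i, j)) * b i z) = 0"
    by eventually_elim (simp add: left_diff_distrib sum_subtractf)
  then have "\<forall>i<m. M $$ (i, j) - N $$ (i, j) = 0"
    using assms(3)[unfolded germ_independent_def, rule_format, of "\<lambda>i. M $$ (i, j) - N $$ (i, j)"] by blast
  then show "M $$ (i, j) = N $$ (i, j)" using j by simp
qed (use assms(4,5) in \<open>auto simp: has_monodromy_def\<close>)

text \<open>Row vector of functions times matrix, in the convention that column \<open>j\<close> holds the
  coordinates of the \<open>j\<close>-th new function.\<close>

definition frame_mult :: "nat \<Rightarrow> (nat \<Rightarrow> complex \<Rightarrow> complex) \<Rightarrow> complex mat \<Rightarrow> nat \<Rightarrow> complex \<Rightarrow> complex" where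
  "frame_mult m f M j z = (\<Sum>i<m. M $$ (i, j) * f i z)"

lemma frame_mult_mult:
  assumes "M \<in> carrier_mat m m" "N \<in> carrier_mat m m" "j < m"
  shows "frame_mult m (frame_mult m f M) N j z = frame_mult m f (M * N) j z"
proof -
  have "frame_mult m f (M * N) j z = (\<Sum>i<m. (\<Sum>k<m. M $$ (i, k) * N $$ (k, j)) * f i z)"
    unfolding frame_mult_def using assms
    by (intro sum.cong refl) (auto simp: scalar_prod_def lessThan_atLeast0)
  also have "\<dots> = (\<Sum>i<m. \<Sum>k<m. M $$ (i, k) * N $$ (k, j) * f i z)" by (simp add: sum_distrib_right)
  also have "\<dots> = (\<Sum>k<m. \<Sum>i<m. M $$ (i, k) * N $$ (k, j) * f i z)" by (rule sum.swap)
  also have "\<dots> = frame_mult m (frame_mult m f M) N j z"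
    unfolding frame_mult_def by (simp add: sum_distrib_left mult_ac)
  finally show ?thesis by simp
qed

lemma frame_mult_one: "j < m \<Longrightarrow> frame_mult m f (1\<^sub>m m) j z = f j z"
  unfolding frame_mult_def by (simp add: if_distrib[of "\<lambda>x. x * _"] cong: if_cong)

text \<open>The order is reversed: the functions are continued first along \<open>p\<close>, and the
  coefficients of that result are constants for the continuation along \<open>q\<close>.\<close>

lemma has_monodromy_join:
  assumes "path p" "path q" "pathfinish p = pathstart q" "has_monodromy m b p M" "has_monodromy m b q N"
  shows "has_monodromy m b (p +++ q) (N * M)"
  unfolding has_monodromy_def
proof (intro conjI allI impI)
  have c: "M \<in> carrier_mat m m" "N \<in> carrier_mat m m" using assms(4,5) by (auto simp: has_monodromy_def)
  then show "N * M \<in> carrier_mat m m" by simp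
  fix j assume j: "j < m"
  have 1: "continues_along p (b j) (\<lambda>z. \<Sum>i<m. M $$ (i, j) * b i z)" using assms(4) j by (simp add: has_monodromy_def)
  have "continues_along q (\<lambda>z. \<Sum>i<m. M $$ (i, j) * b i z) (\<lambda>z. \<Sum>i<m. M $$ (i, j) * (\<Sum>k<m. N $$ (k, i) * b k z))"
    using assms(5) unfolding continues_along_iff has_monodromy_def by (intro cont_on_sum) auto
  also have "(\<lambda>z. \<Sum>i<m. M $$ (i, j) * (\<Sum>k<m. N $$ (k, i) * b k z)) = (\<lambda>z. \<Sum>i<m. (N * M) $$ (i, j) * b i z)"
    using frame_mult_mult[OF c(2,1) j, of b] unfolding frame_mult_def by (intro ext) metis
  finally show "continues_along (p +++ q) (b j) (\<lambda>z. \<Sum>i<m. (N * M) $$ (i, j) * b i z)"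
    using 1 assms(1-3) by (intro continues_along_join)
qed

lemma has_monodromy_reverse:
  assumes "has_monodromy m b p M" "N \<in> carrier_mat m m" "M * N = 1\<^sub>m m"
  shows "has_monodromy m b (reversepath p) N"
  unfolding has_monodromy_def
proof (intro conjI allI impI assms(2))
  have c: "M \<in> carrier_mat m m" using assms by (auto simp: has_monodromy_def)
  fix k assume k: "k < m"
  have "continues_along (reversepath p) (\<lambda>z. \<Sum>j<m. N $$ (j, k) * (\<Sum>i<m. M $$ (i, j) * b i z)) (\<lambda>z. \<Sum>j<m. N $$ (j, k) * b j z)"
    unfolding continues_along_iff
    by (rule cont_on_sum) (use assms(1) continues_along_reversepath in \<open>auto simp: has_monodromy_def continues_along_iff[symmetric]\<close>)
  moreover have "(\<Sum>j<m. N $$ (j, k) * (\<Sum>i<m. M $$ (i, j) * b i z)) = b k z" for z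
    using frame_mult_mult[OF c assms(2) k, of b z] frame_mult_one[OF k, of b z] unfolding assms(3)
    by (simp add: frame_mult_def)
  ultimately show "continues_along (reversepath p) (b k) (\<lambda>z. \<Sum>i<m. N $$ (i, k) * b i z)" by simp
qed

section \<open>The exponential covering\<close>

lemma group_GL: "group (GL TYPE('a::comm_ring_1) m)"
proof -
  have "ring (ring_mat TYPE('a) m ())" by (rule ring_mat)
  then have "monoid (ring_mat TYPE('a) m ())" by (rule ring.is_monoid)
  then show ?thesis unfolding GL_def by (rule monoid.units_group)
qed

lemma GL_mult: "x \<otimes>\<^bsub>GL ty m\<^esub> y = x * y"
  by (simp add: GL_def units_of_mult ring_mat_simps)

lemma GL_one: "\<one>\<^bsub>GL ty m\<^esub> = 1\<^sub>m m"
  by (simp add: GL_def units_of_one ring_mat_simps)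

lemma GL_carrier: "carrier (GL ty m) = {x \<in> carrier_mat m m. \<exists>y\<in>carrier_mat m m. y * x = 1\<^sub>m m \<and> x * y = 1\<^sub>m m}"
  by (auto simp: GL_def units_of_def Units_def ring_mat_simps)

lemma GL_mat: "x \<in> carrier (GL ty m) \<Longrightarrow> x \<in> carrier_mat m m"
  by (simp add: GL_carrier)

text \<open>The map \<open>E\<close> uniformizes the punctured plane; the coordinate of the hypergeometric
  equation is \<open>exp u\<close>, and the points where it is \<open>1\<close> are \<open>2 \<pi>
  \<i> k\<close>.\<close>

locale exp_cover =
  fixes \<gamma> :: nat and \<kappa> :: real
  assumes \<gamma>: "\<gamma> > 0" and \<kappa>: "\<kappa> > 0"
begin

definition E :: "complex \<Rightarrow> complex" where "E u = of_real \<kappa> * exp (u / of_nat \<gamma>)"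

text \<open>The local inverse of \<open>E\<close> that takes \<open>E u\<close> to \<open>u\<close>, used on
  the half-plane around \<open>E u\<close>.\<close>

definition br :: "complex \<Rightarrow> complex \<Rightarrow> complex" where "br u z = u + of_nat \<gamma> * Ln (z / E u)"

definition Hp :: "complex \<Rightarrow> complex set" where "Hp u = {z. Re (z / E u) > 0}"

text \<open>The plane without the imaginary axis, except for the \<open>k\<close>-th open segment between
  consecutive points of \<open>2 \<pi> \<i> \<int>\<close>; the segments are numbered downwards,
  like the singular points.\<close>

definition Om :: "int \<Rightarrow> complex set" where
  "Om k = {u. Re u \<noteq> 0 \<or> (- 2 * pi * of_int k < Im u \<and> Im u < 2 * pi - 2 * pi * of_int k)}"

lemma E_nonzero [simp]: "E u \<noteq> 0" using \<kappa> by (simp add: E_def)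

lemma norm_E: "norm (E u) = \<kappa> * exp (Re u / real \<gamma>)"
  using \<kappa> by (simp add: E_def norm_mult Re_divide_of_nat)

lemma E_eq_iff: "E u = E v \<longleftrightarrow> (\<exists>n::int. u = v + 2 * of_real pi * \<i> * of_nat \<gamma> * of_int n)"
proof -
  have "E u = E v \<longleftrightarrow> exp (u / of_nat \<gamma>) = exp (v / of_nat \<gamma>)" using \<kappa> by (simp add: E_def)
  also have "\<dots> \<longleftrightarrow> (\<exists>n::int. u / of_nat \<gamma> = v / of_nat \<gamma> + (of_int (2 * n) * pi) * \<i>)" by (rule exp_eq)
  also have "\<dots> \<longleftrightarrow> (\<exists>n::int. u = v + 2 * of_real pi * \<i> * of_nat \<gamma> * of_int n)"
    using \<gamma> by (simp add: field_simps)
  finally show ?thesis .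
qed

lemma E_holomorphic: "E holomorphic_on A" unfolding E_def by (intro holomorphic_intros) (use \<gamma> in auto)

lemma E_shift: "E (u + 2 * of_real pi * \<i> * of_nat \<gamma> * of_int n) = E u"
  by (subst E_eq_iff) auto

lemma Hp: "open (Hp u)" "E u \<in> Hp u"
  by (auto simp: Hp_def intro!: open_Collect_less continuous_intros)

lemma Hp_nz: "z \<in> Hp u \<Longrightarrow> z / E u \<notin> \<real>\<^sub>\<le>\<^sub>0" "z \<in> Hp u \<Longrightarrow> z \<noteq> 0"
  by (auto simp: Hp_def complex_nonpos_Reals_iff)

lemma br_E [simp]: "br u (E u) = u" by (simp add: br_def)

lemma E_br: "z \<noteq> 0 \<Longrightarrow> E (br u z) = z"
proof -
  assume z: "z \<noteq> 0"
  have "E (br u z) = E u * exp (Ln (z / E u))"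
    using \<gamma> by (simp add: E_def br_def add_divide_distrib exp_add)
  then show ?thesis using z by simp
qed

lemma br_holomorphic: "br u holomorphic_on Hp u"
  unfolding br_def by (intro holomorphic_intros) (auto dest: Hp_nz)

lemma br_continuous: "continuous_on (Hp u) (br u)"
  by (rule holomorphic_on_imp_continuous_on[OF br_holomorphic])

lemma br_unique:
  assumes "E v = z" "z \<noteq> 0" "\<bar>Im (v - br u z)\<bar> < 2 * pi * real \<gamma>"
  shows "v = br u z"
proof -
  have "E v = E (br u z)" using assms by (simp add: E_br)
  then obtain n :: int where n: "v = br u z + 2 * of_real pi * \<i> * of_nat \<gamma> * of_int n" using E_eq_iff by blast
  then have "\<bar>2 * pi * real \<gamma> * real_of_int n\<bar> < 2 * pi * real \<gamma>" using assms(3) by simp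
  then have "2 * pi * real \<gamma> * \<bar>real_of_int n\<bar> < 2 * pi * real \<gamma> * 1" by (simp add: abs_mult)
  then have "\<bar>real_of_int n\<bar> < 1" using \<gamma> by (subst (asm) mult_less_cancel_left_pos) auto
  then have "n = 0" by linarith
  then show ?thesis using n by simp
qed

lemma br_near:
  assumes z0: "z0 \<in> Hp u" and u': "u' = br u z0 + 2 * of_real pi * \<i> * of_nat \<gamma> * of_int n"
  shows "\<forall>\<^sub>F z in nhds z0. br u' z = br u z + 2 * of_real pi * \<i> * of_nat \<gamma> * of_int n"
proof -
  have Eu': "E u' = z0" using Hp_nz(2)[OF z0] by (simp add: u' E_shift E_br)
  define f where "f = (\<lambda>z. Im (br u z + 2 * of_real pi * \<i> * of_nat \<gamma> * of_int n - br u' z))"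
  have z0': "z0 \<in> Hp u'" using Hp(2)[of u'] Eu' by simp
  have op: "open (Hp u \<inter> Hp u')" using Hp by auto
  have "continuous_on (Hp u \<inter> Hp u') f" unfolding f_def
    by (intro continuous_intros continuous_on_subset[OF br_continuous]) auto
  then have "isCont f z0" using op z0 z0' by (simp add: continuous_on_eq_continuous_at)
  moreover have "br u' z0 = u'" using br_E[of u'] Eu' by metis
  then have "f z0 = Im (u' - u')" unfolding f_def using u' by metis
  then have "f z0 = 0" by simp
  ultimately have "(f \<longlongrightarrow> 0) (nhds z0)"
    using tendsto_at_iff_tendsto_nhds[of f z0] by (simp add: isCont_def)
  then have "\<forall>\<^sub>F z in nhds z0. dist (f z) 0 < 2 * pi * real \<gamma>"
    by (rule tendstoD) (use \<gamma> in simp)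
  moreover have "\<forall>\<^sub>F z in nhds z0. z \<in> Hp u \<inter> Hp u'"
    using op z0 z0' by (intro eventually_nhds_in_open) auto
  ultimately show ?thesis
  proof eventually_elim
    case (elim z)
    then have "z \<noteq> 0" by (auto dest: Hp_nz)
    then have "br u z + 2 * of_real pi * \<i> * of_nat \<gamma> * of_int n = br u' z"
      using elim by (intro br_unique) (auto simp: E_shift E_br f_def)
    then show ?case by simp
  qed
qed

lemma open_Om: "open (Om k)"
proof -
  have "Om k = - ({u. Re u = 0} \<inter> ({u. Im u \<le> - 2 * pi * of_int k} \<union> {u. Im u \<ge> 2 * pi - 2 * pi * of_int k}))"
    by (auto simp: Om_def)
  moreover have "closed ({u. Re u = 0} \<inter> ({u. Im u \<le> - 2 * pi * of_int k} \<union> {u. Im u \<ge> 2 * pi - 2 * pi * of_int k}))"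
    by (intro closed_Int closed_Un closed_Collect_eq closed_Collect_le continuous_intros)
  ultimately show ?thesis by (metis open_Compl)
qed

lemma Om_shift: "u + 2 * of_real pi * \<i> * of_int k \<in> Om 0 \<longleftrightarrow> u \<in> Om k"
  by (auto simp: Om_def algebra_simps)

lemma starlike_Om: "starlike (Om k)"
  unfolding starlike_def
proof (intro bexI ballI)
  define c where "c = Complex 0 (pi - 2 * pi * of_int k)"
  show c: "c \<in> Om k" using pi_gt_zero by (simp add: Om_def c_def)
  fix u assume u: "u \<in> Om k"
  show "closed_segment c u \<subseteq> Om k"
  proof
    fix v assume "v \<in> closed_segment c u"
    then obtain t where t: "0 \<le> t" "t \<le> 1" "v = (1 - t) *\<^sub>R c + t *\<^sub>R u" by (auto simp: in_segment)
    show "v \<in> Om k"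
    proof (cases "t = 0 \<or> Re u \<noteq> 0")
      case True then show ?thesis using c t by (auto simp: Om_def c_def)
    next
      case False
      then have "t > 0" "Re u = 0" using t by auto
      then have "u \<in> {w. - 2 * pi * of_int k < Im w} \<inter> {w. Im w < 2 * pi - 2 * pi * of_int k}"
        using u by (auto simp: Om_def)
      moreover have "c \<in> {w. - 2 * pi * of_int k < Im w} \<inter> {w. Im w < 2 * pi - 2 * pi * of_int k}"
        using pi_gt_zero by (simp add: c_def)
      moreover have "convex ({w. - 2 * pi * of_int k < Im w} \<inter> {w. Im w < 2 * pi - 2 * pi * of_int k})"
        by (intro convex_Int convex_halfspace_Im_lt convex_halfspace_Im_gt)
      ultimately have "v \<in> {w. - 2 * pi * of_int k < Im w} \<inter> {w. Im w < 2 * pi - 2 * pi * of_int k}"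
        using convexD_alt[of _ c u t] t by blast
      then show ?thesis by (auto simp: Om_def)
    qed
  qed
qed

lemma path_connected_Om: "path_connected (Om k)"
  using starlike_Om starlike_imp_path_connected by blast

text \<open>Along the image of a path a function of \<open>u\<close> is continued by composing it with the
  local inverses of the covering at the points of the path.\<close>

lemma continues_along_lift:
  assumes G: "G holomorphic_on A" and A: "open A" and q: "path q" "path_image q \<subseteq> A"
  shows "continues_along (E \<circ> q) (\<lambda>z. G (br (pathstart q) z)) (\<lambda>z. G (br (pathfinish q) z))"
proof -
  have cq: "continuous_on {0..1} q" using q(1) by (simp add: path_def)
  have cE: "continuous_on {0..1} (E \<circ> q)"
    by (intro continuous_on_compose cq holomorphic_on_imp_continuous_on E_holomorphic)
  define P where "P = (\<lambda>a b. 0 \<le> a \<longrightarrow> b \<le> 1 \<longrightarrow> cont_on (E \<circ> q) a b (\<lambda>z. G (br (q a) z)) (\<lambda>z. G (br (q b) z)))"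
  have "P 0 1"
  proof (rule Bolzano)
    fix a b c assume "P a b" "P b c" "a \<le> b" "b \<le> c"
    then show "P a c" unfolding P_def
      by (auto intro!: cont_on_trans[of a b c] continuous_on_subset[OF cE])
  next
    fix x :: real assume x: "0 \<le> x" "x \<le> 1"
    then have qx: "q x \<in> A" using q(2) by (auto simp: path_image_def)
    define N where "N = br (q x) -` A \<inter> Hp (q x)"
    have N: "open N" unfolding N_def
      using continuous_open_preimage[OF br_continuous Hp(1) A, of "q x"] by (simp add: Int_commute)
    have xN: "E (q x) \<in> N" using qx Hp(2) by (simp add: N_def)
    have hol: "(\<lambda>z. G (br (q x) z)) holomorphic_on N"
      using holomorphic_on_compose_gen[OF holomorphic_on_subset[OF br_holomorphic] G, of N "q x"]
      by (auto simp: N_def o_def)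
    obtain r1 where r1: "r1 > 0" "ball (E (q x)) r1 \<subseteq> N" using N xN open_contains_ball by blast
    obtain d1 where d1: "d1 > 0" "\<And>t. t \<in> {0..1} \<Longrightarrow> dist t x < d1 \<Longrightarrow> dist (E (q t)) (E (q x)) < r1"
      using cE x r1(1) unfolding continuous_on_iff by (metis atLeastAtMost_iff comp_apply)
    have c2: "continuous_on {0..1} (\<lambda>t. q t)" using cq by simp
    obtain d2 where d2: "d2 > 0" "\<And>t. t \<in> {0..1} \<Longrightarrow> dist t x < d2 \<Longrightarrow> dist (q t) (q x) < pi * real \<gamma>"
      using c2 x \<gamma> unfolding continuous_on_iff by (metis atLeastAtMost_iff mult_pos_pos of_nat_0_less_iff pi_gt_zero)
    have loc: "E (q t) \<in> N \<and> (\<forall>\<^sub>F z in nhds (E (q t)). br (q t) z = br (q x) z)"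
      if t: "t \<in> {0..1}" "dist t x < min d1 d2" for t
    proof -
      have tN: "E (q t) \<in> N" using d1(2)[OF t(1)] t(2) r1(2) by (auto simp: dist_commute)
      then have tH: "E (q t) \<in> Hp (q x)" by (simp add: N_def)
      have "q t = br (q x) (E (q t))"
      proof (rule br_unique)
        have "E (q t) / E (q x) \<notin> \<real>\<^sub>\<le>\<^sub>0" "Re (E (q t) / E (q x)) > 0" using tH Hp_nz by (auto simp: Hp_def)
        then have "\<bar>Im (Ln (E (q t) / E (q x)))\<bar> < pi / 2" by (subst Re_Ln_pos_lt) auto
        moreover have "Im (br (q x) (E (q t))) = Im (q x) + real \<gamma> * Im (Ln (E (q t) / E (q x)))"
          by (simp add: br_def)
        moreover have "\<bar>Im (q t - q x)\<bar> < pi * real \<gamma>"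
          using d2(2)[OF t(1)] t(2) abs_Im_le_cmod[of "q t - q x"] by (simp add: dist_norm)
        moreover have "\<bar>real \<gamma> * Im (Ln (E (q t) / E (q x)))\<bar> \<le> real \<gamma> * (pi / 2)"
          using calculation(1) unfolding abs_mult by (intro mult_mono) auto
        ultimately show "\<bar>Im (q t - br (q x) (E (q t)))\<bar> < 2 * pi * real \<gamma>" using \<gamma> pi_gt_zero
          by (simp add: field_simps)
      qed auto
      then have "\<forall>\<^sub>F z in nhds (E (q t)). br (q t) z = br (q x) z"
        using br_near[OF tH, of "q t" 0] by simp
      then show ?thesis using tN by blast
    qed
    show "\<exists>d>0. \<forall>a b. a \<le> x \<and> x \<le> b \<and> b - a < d \<longrightarrow> P a b"
    proof (intro exI[of _ "min d1 d2"] conjI allI impI)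
      show "0 < min d1 d2" using d1 d2 by simp
      fix a b assume ab: "a \<le> x \<and> x \<le> b \<and> b - a < min d1 d2"
      show "P a b" unfolding P_def
      proof (intro impI)
        assume 01: "0 \<le> a" "b \<le> 1"
        show "cont_on (E \<circ> q) a b (\<lambda>z. G (br (q a) z)) (\<lambda>z. G (br (q b) z))"
        proof (rule cont_on_local[OF N hol])
          fix t assume t: "a \<le> t" "t \<le> b"
          have "dist t x < min d1 d2" unfolding dist_real_def using ab t by linarith
          then show "(E \<circ> q) t \<in> N" using loc[of t] t 01 by simp
        next
          have "\<forall>\<^sub>F z in nhds (E (q a)). br (q a) z = br (q x) z" using loc[of a] ab 01 x by (simp add: dist_real_def)
          then show "\<forall>\<^sub>F z in nhds ((E \<circ> q) a). G (br (q a) z) = G (br (q x) z)"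
            unfolding comp_def by eventually_elim simp
          have "\<forall>\<^sub>F z in nhds (E (q b)). br (q b) z = br (q x) z" using loc[of b] ab 01 x by (simp add: dist_real_def)
          then show "\<forall>\<^sub>F z in nhds ((E \<circ> q) b). G (br (q b) z) = G (br (q x) z)"
            unfolding comp_def by eventually_elim simp
        qed
      qed
    qed
  qed simp
  then show ?thesis unfolding continues_along_iff P_def pathstart_def pathfinish_def by simp
qed

end

section \<open>Frames over a slit plane\<close>

lemma frame_mult_cong:
  "(\<And>i. i < m \<Longrightarrow> f i z = f' i z') \<Longrightarrow> frame_mult m f M j z = frame_mult m f' M j z'"
  unfolding frame_mult_def by (intro sum.cong) auto

text \<open>The frame lives on the plane slit along the imaginary axis outside one segment. A turn in the
  right half-plane acts by \<open>hI\<close> and a turn in the left half-plane by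
  \<open>hZi\<close>. These two matrices determine the continuation everywhere.\<close>

locale monodromy_frame = exp_cover \<gamma> \<kappa> for \<gamma> \<kappa> +
  fixes m :: nat and g :: "nat \<Rightarrow> complex \<Rightarrow> complex" and hI hZi :: "complex mat"
  assumes hI: "hI \<in> carrier (GL TYPE(complex) m)" and hZi: "hZi \<in> carrier (GL TYPE(complex) m)"
    and g_hol: "\<And>j. j < m \<Longrightarrow> g j holomorphic_on Om 0"
    and right: "\<And>j u. j < m \<Longrightarrow> Re u > 0 \<Longrightarrow> g j (u - 2 * of_real pi * \<i>) = frame_mult m g hI j u"
    and left: "\<And>j u. j < m \<Longrightarrow> Re u < 0 \<Longrightarrow> g j (u - 2 * of_real pi * \<i>) = frame_mult m g hZi j u"
    and indep: "\<And>u. u \<in> Om 0 \<Longrightarrow> germ_independent m g u"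
begin

abbreviation GG :: "complex mat monoid" where "GG \<equiv> GL TYPE(complex) m"

lemma grp: "group GG" by (rule group_GL)

sublocale GG: group GG by (rule grp)

lemma pow_closed [simp]: "hI [^]\<^bsub>GG\<^esub> (k::int) \<in> carrier GG" "hZi [^]\<^bsub>GG\<^esub> (k::int) \<in> carrier GG"
  using hI hZi by auto

lemma fm_mult:
  assumes "A \<in> carrier GG" "B \<in> carrier GG" "j < m"
  shows "frame_mult m (frame_mult m f A) B j z = frame_mult m f (A \<otimes>\<^bsub>GG\<^esub> B) j z"
  unfolding GL_mult using frame_mult_mult[OF GL_mat[OF assms(1)] GL_mat[OF assms(2)] assms(3)] .

lemma fm_one: "j < m \<Longrightarrow> frame_mult m f \<one>\<^bsub>GG\<^esub> j z = f j z"
  unfolding GL_one by (rule frame_mult_one)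

lemma shift_aux:
  assumes A: "A \<in> carrier GG"
    and T: "\<And>u (k::int). u \<in> T \<Longrightarrow> u + 2 * of_real pi * \<i> * of_int k \<in> T"
    and step: "\<And>j u. j < m \<Longrightarrow> u \<in> T \<Longrightarrow> g j (u - 2 * of_real pi * \<i>) = frame_mult m g A j u"
    and u: "u \<in> T" and j: "j < m"
  shows "g j (u + 2 * of_real pi * \<i> * of_int k) = frame_mult m g (A [^]\<^bsub>GG\<^esub> (- k)) j u"
proof -
  have nat: "g j (u - 2 * of_real pi * \<i> * of_nat n) = frame_mult m g (A [^]\<^bsub>GG\<^esub> n) j u"
    if "u \<in> T" "j < m" for n :: nat and u j
    using that
  proof (induction n arbitrary: j)
    case 0 then show ?case by (simp add: fm_one)
  next
    case (Suc n)
    define w where "w = u - 2 * of_real pi * \<i> * of_nat n"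
    have w: "w \<in> T" using T[OF Suc.prems(1), of "- int n"] by (simp add: w_def)
    have "g j (u - 2 * of_real pi * \<i> * of_nat (Suc n)) = g j (w - 2 * of_real pi * \<i>)"
      by (simp add: w_def algebra_simps)
    also have "\<dots> = frame_mult m g A j w" by (rule step[OF Suc.prems(2) w])
    also have "\<dots> = frame_mult m (frame_mult m g (A [^]\<^bsub>GG\<^esub> n)) A j u"
      by (rule frame_mult_cong) (use Suc in \<open>simp add: w_def\<close>)
    also have "\<dots> = frame_mult m g (A [^]\<^bsub>GG\<^esub> Suc n) j u"
      using fm_mult[OF GG.nat_pow_closed[OF A] A Suc.prems(2)] by simp
    finally show ?case .
  qed
  show ?thesis
  proof (cases "k \<le> 0")
    case True
    then have n': "k = - int (nat (- k))" by simp
    then obtain n where n: "k = - int n" by blast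
    then show ?thesis using nat[OF u j, of n] by (simp add: int_pow_int)
  next
    case False
    then have "k = int (nat k)" by simp
    then obtain n where n: "k = int n" by blast
    define w where "w = u + 2 * of_real pi * \<i> * of_nat n"
    have w: "w \<in> T" using T[OF u, of "int n"] by (simp add: w_def)
    have inv: "A [^]\<^bsub>GG\<^esub> (- k) = inv\<^bsub>GG\<^esub> (A [^]\<^bsub>GG\<^esub> n)" using A by (simp add: n GG.int_pow_neg int_pow_int)
    have "g j w = frame_mult m (frame_mult m g (A [^]\<^bsub>GG\<^esub> n)) (inv\<^bsub>GG\<^esub> (A [^]\<^bsub>GG\<^esub> n)) j w"
      using fm_mult[of "A [^]\<^bsub>GG\<^esub> n" "inv\<^bsub>GG\<^esub> (A [^]\<^bsub>GG\<^esub> n)" j g w] A j by (simp add: fm_one)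
    also have "\<dots> = frame_mult m g (inv\<^bsub>GG\<^esub> (A [^]\<^bsub>GG\<^esub> n)) j u"
    proof (rule frame_mult_cong)
      fix i assume "i < m"
      then show "frame_mult m g (A [^]\<^bsub>GG\<^esub> n) i w = g i u" using nat[OF w, of i n] by (simp add: w_def)
    qed
    finally show ?thesis unfolding inv by (simp add: w_def n)
  qed
qed

lemma shift_right:
  "Re u > 0 \<Longrightarrow> j < m \<Longrightarrow> g j (u + 2 * of_real pi * \<i> * of_int k) = frame_mult m g (hI [^]\<^bsub>GG\<^esub> (- k)) j u"
  by (rule shift_aux[OF hI, of "{u. Re u > 0}"]) (auto simp: right)

lemma shift_left:
  "Re u < 0 \<Longrightarrow> j < m \<Longrightarrow> g j (u + 2 * of_real pi * \<i> * of_int k) = frame_mult m g (hZi [^]\<^bsub>GG\<^esub> (- k)) j u"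
  by (rule shift_aux[OF hZi, of "{u. Re u < 0}"]) (auto simp: left)

text \<open>The frame translated into the \<open>k\<close>-th segment, and normalized so that on the right
  half-plane it is \<open>g\<close> again.\<close>

definition gk :: "int \<Rightarrow> nat \<Rightarrow> complex \<Rightarrow> complex" where
  "gk k = frame_mult m (\<lambda>i v. g i (v + 2 * of_real pi * \<i> * of_int k)) (hI [^]\<^bsub>GG\<^esub> k)"

text \<open>On the left half-plane the \<open>k\<close>-th frame differs from \<open>g\<close> by this
  matrix; the quotient of two consecutive ones is the monodromy around the singular point between
  the segments.\<close>

definition aa :: "int \<Rightarrow> complex mat" where
  "aa k = hZi [^]\<^bsub>GG\<^esub> (- k) \<otimes>\<^bsub>GG\<^esub> hI [^]\<^bsub>GG\<^esub> k"

definition h1 :: "complex mat" where "h1 = inv\<^bsub>GG\<^esub> (inv\<^bsub>GG\<^esub> hZi \<otimes>\<^bsub>GG\<^esub> hI)"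

definition Mk :: "int \<Rightarrow> complex mat" where
  "Mk k = hI [^]\<^bsub>GG\<^esub> (- k) \<otimes>\<^bsub>GG\<^esub> h1 \<otimes>\<^bsub>GG\<^esub> hI [^]\<^bsub>GG\<^esub> k"

lemma closed [simp]: "h1 \<in> carrier GG" "aa k \<in> carrier GG" "Mk k \<in> carrier GG"
  using hI hZi by (simp_all add: h1_def aa_def Mk_def)

lemma gk_right: assumes "Re u > 0" "j < m" shows "gk k j u = g j u"
proof -
  have "gk k j u = frame_mult m (frame_mult m g (hI [^]\<^bsub>GG\<^esub> (- k))) (hI [^]\<^bsub>GG\<^esub> k) j u"
    unfolding gk_def by (rule frame_mult_cong) (rule shift_right[OF assms(1)])
  also have "\<dots> = frame_mult m g (hI [^]\<^bsub>GG\<^esub> (- k) \<otimes>\<^bsub>GG\<^esub> hI [^]\<^bsub>GG\<^esub> k) j u"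
    by (rule fm_mult) (use assms in auto)
  also have "hI [^]\<^bsub>GG\<^esub> (- k) \<otimes>\<^bsub>GG\<^esub> hI [^]\<^bsub>GG\<^esub> k = \<one>\<^bsub>GG\<^esub>"
    using hI by (simp add: GG.int_pow_mult[symmetric])
  finally show ?thesis using assms by (simp add: fm_one)
qed

lemma gk_left: assumes "Re u < 0" "j < m" shows "gk k j u = frame_mult m g (aa k) j u"
proof -
  have "gk k j u = frame_mult m (frame_mult m g (hZi [^]\<^bsub>GG\<^esub> (- k))) (hI [^]\<^bsub>GG\<^esub> k) j u"
    unfolding gk_def by (rule frame_mult_cong) (rule shift_left[OF assms(1)])
  also have "\<dots> = frame_mult m g (aa k) j u"
    unfolding aa_def by (rule fm_mult) (use assms in auto)
  finally show ?thesis .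
qed

lemma gk_shift:
  assumes "j < m"
  shows "gk k j (w + 2 * of_real pi * \<i> * of_int N) = frame_mult m (gk (k + N)) (hI [^]\<^bsub>GG\<^esub> (- N)) j w"
proof -
  let ?f = "\<lambda>i v. g i (v + 2 * of_real pi * \<i> * of_int (k + N))"
  have "frame_mult m (gk (k + N)) (hI [^]\<^bsub>GG\<^esub> (- N)) j w = frame_mult m ?f (hI [^]\<^bsub>GG\<^esub> (k + N) \<otimes>\<^bsub>GG\<^esub> hI [^]\<^bsub>GG\<^esub> (- N)) j w"
    unfolding gk_def by (rule fm_mult) (use assms in auto)
  also have "hI [^]\<^bsub>GG\<^esub> (k + N) \<otimes>\<^bsub>GG\<^esub> hI [^]\<^bsub>GG\<^esub> (- N) = hI [^]\<^bsub>GG\<^esub> k"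
    using hI by (simp add: GG.int_pow_mult[symmetric])
  also have "frame_mult m ?f (hI [^]\<^bsub>GG\<^esub> k) j w = gk k j (w + 2 * of_real pi * \<i> * of_int N)"
    unfolding gk_def by (rule frame_mult_cong) (simp add: algebra_simps)
  finally show ?thesis by simp
qed

lemma aa_0: "aa 0 = \<one>\<^bsub>GG\<^esub>" by (simp add: aa_def)

lemma aa_step: "aa (k + 1) \<otimes>\<^bsub>GG\<^esub> Mk k = aa k"
proof -
  let ?X = "hI [^]\<^bsub>GG\<^esub> k" and ?Z = "hZi [^]\<^bsub>GG\<^esub> (- k)"
  have 1: "hI [^]\<^bsub>GG\<^esub> (k + 1) = hI \<otimes>\<^bsub>GG\<^esub> ?X"
    using hI GG.int_pow_mult[of hI 1 k] by (simp add: add.commute)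
  have "- (k + 1) = - k + (-1)" by simp
  then have 2: "hZi [^]\<^bsub>GG\<^esub> (- (k + 1)) = ?Z \<otimes>\<^bsub>GG\<^esub> inv\<^bsub>GG\<^esub> hZi"
    using hZi GG.int_pow_mult[of hZi "- k" "-1"] GG.int_pow_neg[of hZi 1] by simp
  have 3: "hI [^]\<^bsub>GG\<^esub> (- k) = inv\<^bsub>GG\<^esub> ?X" using hI by (simp add: GG.int_pow_neg)
  have h1': "h1 = inv\<^bsub>GG\<^esub> hI \<otimes>\<^bsub>GG\<^esub> hZi" using hI hZi by (simp add: h1_def GG.inv_mult_group)
  have "aa (k + 1) \<otimes>\<^bsub>GG\<^esub> Mk k = (?Z \<otimes>\<^bsub>GG\<^esub> inv\<^bsub>GG\<^esub> hZi \<otimes>\<^bsub>GG\<^esub> (hI \<otimes>\<^bsub>GG\<^esub> ?X)) \<otimes>\<^bsub>GG\<^esub> (inv\<^bsub>GG\<^esub> ?X \<otimes>\<^bsub>GG\<^esub> (inv\<^bsub>GG\<^esub> hI \<otimes>\<^bsub>GG\<^esub> hZi) \<otimes>\<^bsub>GG\<^esub> ?X)"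
    unfolding aa_def Mk_def 1 2 3 h1' ..
  also have "\<dots> = ?Z \<otimes>\<^bsub>GG\<^esub> (inv\<^bsub>GG\<^esub> hZi \<otimes>\<^bsub>GG\<^esub> (hI \<otimes>\<^bsub>GG\<^esub> (?X \<otimes>\<^bsub>GG\<^esub> (inv\<^bsub>GG\<^esub> ?X \<otimes>\<^bsub>GG\<^esub> (inv\<^bsub>GG\<^esub> hI \<otimes>\<^bsub>GG\<^esub> (hZi \<otimes>\<^bsub>GG\<^esub> ?X))))))"
    using hI hZi by (simp add: GG.m_assoc)
  also have "\<dots> = ?Z \<otimes>\<^bsub>GG\<^esub> ?X"
    using hI hZi by (simp add: GG.m_assoc[symmetric])
       (simp add: GG.m_assoc GG.inv_solve_left)?
  finally show ?thesis by (simp add: aa_def)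
qed

text \<open>Frames of adjacent segments agree on the right and differ on the left by the matrix of a turn
  around the point between the segments.\<close>

lemma gk_left_step: assumes "Re u < 0" "j < m" shows "gk k j u = frame_mult m (gk (k + 1)) (Mk k) j u"
proof -
  have "frame_mult m (gk (k + 1)) (Mk k) j u = frame_mult m (frame_mult m g (aa (k + 1))) (Mk k) j u"
    by (rule frame_mult_cong) (rule gk_left[OF assms(1)])
  also have "\<dots> = frame_mult m g (aa k) j u" using fm_mult[of "aa (k+1)" "Mk k" j] assms aa_step by simp
  finally show ?thesis using gk_left[OF assms] by simp
qed

definition HH :: "complex mat set" where
  "HH = generate GG (insert (hI [^]\<^bsub>GG\<^esub> \<gamma>) ((\<lambda>i::nat. Mk (int i)) ` {..<\<gamma>}))"

lemma HH_subgroup: "subgroup HH GG"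
  unfolding HH_def using hI by (intro GG.generate_is_subgroup) auto

lemma HH_carrier: "h \<in> HH \<Longrightarrow> h \<in> carrier GG" by (rule subgroup.mem_carrier[OF HH_subgroup])

lemma HH_ops: "x \<in> HH \<Longrightarrow> y \<in> HH \<Longrightarrow> x \<otimes>\<^bsub>GG\<^esub> y \<in> HH" "x \<in> HH \<Longrightarrow> inv\<^bsub>GG\<^esub> x \<in> HH" "\<one>\<^bsub>GG\<^esub> \<in> HH"
  by (rule subgroup.m_closed[OF HH_subgroup], assumption+)
     (rule subgroup.m_inv_closed[OF HH_subgroup], assumption, rule subgroup.one_closed[OF HH_subgroup])

lemma HH_gamma_pow: "hI [^]\<^bsub>GG\<^esub> (int \<gamma> * q) \<in> HH"
proof -
  have "hI [^]\<^bsub>GG\<^esub> \<gamma> \<in> HH" unfolding HH_def by (rule generate.incl) simp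
  then have "(hI [^]\<^bsub>GG\<^esub> \<gamma>) [^]\<^bsub>GG\<^esub> q \<in> HH" by (rule GG.subgroup_int_pow_closed[OF HH_subgroup])
  then show ?thesis using hI GG.int_pow_pow[of hI "int \<gamma>" q] by (simp add: int_pow_int)
qed

text \<open>Conjugation by \<open>hI [^] \<gamma>\<close> shifts \<open>k\<close> by
  \<open>\<gamma>\<close>, so every \<open>Mk k\<close> is reached from one with \<open>0 \<le> k
  < \<gamma>\<close>.\<close>

lemma Mk_HH: "Mk k \<in> HH"
proof -
  define i where "i = nat (k mod int \<gamma>)"
  define q where "q = k div int \<gamma>"
  have i: "i < \<gamma>" using \<gamma> by (simp add: i_def nat_less_iff)
  have k: "k = int i + int \<gamma> * q" using \<gamma> by (simp add: i_def q_def)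
  let ?Q = "hI [^]\<^bsub>GG\<^esub> (int \<gamma> * q)" and ?I = "hI [^]\<^bsub>GG\<^esub> int i"
  have 1: "hI [^]\<^bsub>GG\<^esub> k = ?I \<otimes>\<^bsub>GG\<^esub> ?Q" unfolding k using hI by (simp add: GG.int_pow_mult)
  have 2: "hI [^]\<^bsub>GG\<^esub> (- k) = inv\<^bsub>GG\<^esub> ?Q \<otimes>\<^bsub>GG\<^esub> inv\<^bsub>GG\<^esub> ?I"
    unfolding GG.int_pow_neg[OF hI] 1 by (simp add: GG.inv_mult_group)
  have 3: "hI [^]\<^bsub>GG\<^esub> (- int i) = inv\<^bsub>GG\<^esub> ?I" by (rule GG.int_pow_neg[OF hI])
  have "Mk k = inv\<^bsub>GG\<^esub> ?Q \<otimes>\<^bsub>GG\<^esub> Mk (int i) \<otimes>\<^bsub>GG\<^esub> ?Q"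
    unfolding Mk_def 1 2 3 by (simp add: GG.m_assoc)
  moreover have "Mk (int i) \<in> HH" unfolding HH_def using i by (intro generate.incl) auto
  ultimately show ?thesis using HH_gamma_pow[of q] HH_ops by simp
qed

lemma aa_HH: "aa k \<in> HH"
proof (induction k rule: int_induct[of _ 0])
  case base then show ?case by (simp add: aa_0 HH_ops)
next
  case (step1 k)
  have "aa (k + 1) = aa k \<otimes>\<^bsub>GG\<^esub> inv\<^bsub>GG\<^esub> Mk k"
    by (rule GG.inv_solve_right[THEN iffD2]) (use aa_step[of k] in simp_all)
  then show ?case using step1 Mk_HH HH_ops by simp
next
  case (step2 k)
  have "aa (k - 1) = aa k \<otimes>\<^bsub>GG\<^esub> Mk (k - 1)" using aa_step[of "k - 1"] by simp
  then show ?case using step2 Mk_HH HH_ops by simp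
qed

lemma gk_holomorphic: "j < m \<Longrightarrow> gk k j holomorphic_on Om k"
proof -
  have "(\<lambda>v. g i (v + 2 * of_real pi * \<i> * of_int k)) holomorphic_on Om k" if "i < m" for i
  proof -
    have "(g i \<circ> (\<lambda>v. v + 2 * of_real pi * \<i> * of_int k)) holomorphic_on Om k"
      by (rule holomorphic_on_compose_gen[OF _ g_hol[OF that]]) (auto simp: Om_shift intro!: holomorphic_intros)
    then show ?thesis by (simp add: o_def)
  qed
  then show ?thesis unfolding gk_def frame_mult_def by (intro holomorphic_intros) auto
qed

lemma fm_indep:
  assumes "germ_independent m f s" "A \<in> carrier GG"
  shows "germ_independent m (frame_mult m f A) s"
  unfolding germ_independent_def
proof (intro allI impI)
  fix x i assume x: "\<forall>\<^sub>F z in nhds s. (\<Sum>i<m. x i * frame_mult m f A i z) = 0" and i: "i < m"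
  have "(\<Sum>i<m. x i * frame_mult m f A i z) = (\<Sum>l<m. (\<Sum>i<m. A $$ (l, i) * x i) * f l z)" for z
    unfolding frame_mult_def sum_distrib_left sum_distrib_right by (subst sum.swap) (simp add: mult_ac)
  then have "\<forall>l<m. (\<Sum>i<m. A $$ (l, i) * x i) = 0"
    using assms(1)[unfolded germ_independent_def, rule_format, of "\<lambda>l. \<Sum>i<m. A $$ (l, i) * x i"] x by simp
  then have A0: "A *\<^sub>v Matrix.vec m x = 0\<^sub>v m"
    using GL_mat[OF assms(2)] by (intro eq_vecI) (auto simp: scalar_prod_def lessThan_atLeast0)
  obtain B where B: "B \<in> carrier_mat m m" "B * A = 1\<^sub>m m" using assms(2) by (auto simp: GL_carrier)
  have "Matrix.vec m x = (B * A) *\<^sub>v Matrix.vec m x" by (simp add: B)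
  also have "\<dots> = B *\<^sub>v (A *\<^sub>v Matrix.vec m x)" using B GL_mat[OF assms(2)] by (intro assoc_mult_mat_vec) auto
  also have "\<dots> = 0\<^sub>v m" unfolding A0 using B by (intro eq_vecI) auto
  finally have "Matrix.vec m x $ i = 0\<^sub>v m $ i" by simp
  then show "x i = 0" using i by simp
qed

lemma gk_indep: "u \<in> Om k \<Longrightarrow> germ_independent m (gk k) u"
  unfolding gk_def
proof (rule fm_indep)
  assume u: "u \<in> Om k"
  define c where "c = 2 * of_real pi * \<i> * of_int k"
  have ind: "germ_independent m g (u + c)" using u unfolding c_def by (intro indep) (simp add: Om_shift)
  show "germ_independent m (\<lambda>i v. g i (v + 2 * of_real pi * \<i> * of_int k)) u"
    unfolding germ_independent_def c_def[symmetric]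
  proof (intro allI impI)
    fix x i assume x: "\<forall>\<^sub>F z in nhds u. (\<Sum>i<m. x i * g i (z + c)) = 0" and i: "i < m"
    have "filterlim (\<lambda>z. z - c) (nhds u) (nhds (u + c))"
      by (auto intro!: tendsto_eq_intros filterlim_ident)
    then have "\<forall>\<^sub>F z in nhds (u + c). (\<Sum>i<m. x i * g i (z - c + c)) = 0"
      using x unfolding filterlim_iff by blast
    then show "x i = 0" using ind i unfolding germ_independent_def by simp
  qed
qed simp

lemma br_E_near: "\<forall>\<^sub>F w in nhds u. br u (E w) = w"
proof -
  have "\<forall>\<^sub>F w in nhds u. w \<in> {w. \<bar>Im (w - u)\<bar> < pi * real \<gamma>}"
    using \<gamma> by (intro eventually_nhds_in_open open_Collect_less continuous_intros) auto
  then show ?thesis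
  proof eventually_elim
    case (elim w)
    have "E w / E u = exp ((w - u) / of_nat \<gamma>)" using \<kappa> by (simp add: E_def exp_diff diff_divide_distrib)
    moreover have "- (pi * real \<gamma>) < Im w - Im u" "Im w - Im u < pi * real \<gamma>" using elim by auto
    then have "- pi < (Im w - Im u) / real \<gamma>" "(Im w - Im u) / real \<gamma> < pi"
      using \<gamma> by (simp_all add: less_divide_eq divide_less_eq)
    then have "Ln (exp ((w - u) / of_nat \<gamma>)) = (w - u) / of_nat \<gamma>"
      by (intro Ln_exp) (simp_all add: Im_divide_of_nat)
    ultimately show ?case using \<gamma> by (simp add: br_def)
  qed
qed

lemma br_indep:
  assumes "germ_independent m f u"
  shows "germ_independent m (\<lambda>j z. f j (br u z)) (E u)"
  unfolding germ_independent_def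
proof (intro allI impI)
  fix x i assume x: "\<forall>\<^sub>F z in nhds (E u). (\<Sum>i<m. x i * f i (br u z)) = 0" and i: "i < m"
  have "isCont E u" unfolding E_def by (intro continuous_intros) (use \<gamma> in auto)
  then have "filterlim E (nhds (E u)) (nhds u)" using tendsto_at_iff_tendsto_nhds[of E u] by (simp add: isCont_def)
  then have "\<forall>\<^sub>F w in nhds u. (\<Sum>i<m. x i * f i (br u (E w))) = 0" using x unfolding filterlim_iff by blast
  then have "\<forall>\<^sub>F w in nhds u. (\<Sum>i<m. x i * f i w) = 0" using br_E_near[of u] by eventually_elim simp
  then show "x i = 0" using assms i unfolding germ_independent_def by simp
qed

end

section \<open>Continuation of frames\<close>

lemma continues_along_cong:
  assumes "continues_along p f g" "\<forall>\<^sub>F z in nhds (pathstart p). f' z = f z" "\<forall>\<^sub>F z in nhds (pathfinish p). g' z = g z"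
  shows "continues_along p f' g'"
  using assms unfolding continues_along_iff pathstart_def pathfinish_def by (rule cont_on_cong)

context exp_cover
begin

definition XX :: "complex set" where "XX = {s. s \<noteq> 0 \<and> (\<forall>n::int. s \<noteq> E (2 * of_real pi * \<i> * of_int n))}"

lemma E_in_XX: assumes "u \<in> Om k" shows "E u \<in> XX"
proof -
  have "E u \<noteq> E (2 * of_real pi * \<i> * of_int n)" for n :: int
  proof
    assume "E u = E (2 * of_real pi * \<i> * of_int n)"
    then obtain l :: int where "u = 2 * of_real pi * \<i> * of_int n + 2 * of_real pi * \<i> * of_nat \<gamma> * of_int l"
      using E_eq_iff by blast
    then have "u = 2 * of_real pi * \<i> * of_int (n + int \<gamma> * l)" by (simp add: algebra_simps)
    then have Re: "Re u = 0" and Im: "Im u = 2 * pi * real_of_int (n + int \<gamma> * l)" by simp_all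
    define N where "N = n + int \<gamma> * l"
    have "2 * pi * real_of_int (- k) < 2 * pi * real_of_int N" "2 * pi * real_of_int N < 2 * pi * real_of_int (1 - k)"
      using assms Re Im unfolding Om_def N_def by (auto simp: algebra_simps)
    then have "real_of_int (- k) < real_of_int N" "real_of_int N < real_of_int (1 - k)"
      by (simp_all only: mult_less_cancel_left_pos[of "2 * pi"] pi_gt_zero mult_pos_pos zero_less_numeral)
    then have "- k < N" "N < 1 - k" by (simp_all only: of_int_less_iff)
    then show False by linarith
  qed
  then show ?thesis by (auto simp: XX_def)
qed

lemma XX_lift: assumes "s \<in> XX" obtains u k where "E u = s" "u \<in> Om k"
proof -
  have s: "s \<noteq> 0" "\<And>n::int. s \<noteq> E (2 * of_real pi * \<i> * of_int n)" using assms by (auto simp: XX_def)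
  define u where "u = br 0 s"
  have Eu: "E u = s" using s by (simp add: u_def E_br)
  define k where "k = - \<lfloor>Im u / (2 * pi)\<rfloor>"
  have "u \<in> Om k"
  proof (cases "Re u = 0")
    case False then show ?thesis by (simp add: Om_def)
  next
    case True
    have "Im u \<noteq> 2 * pi * real_of_int n" for n
    proof
      assume "Im u = 2 * pi * real_of_int n"
      then have "u = 2 * of_real pi * \<i> * of_int n" using True by (simp add: complex_eq_iff)
      then show False using s(2)[of n] Eu by simp
    qed
    then have ne: "Im u / (2 * pi) \<noteq> real_of_int n" for n by (simp add: field_simps)
    have "real_of_int (- k) \<le> Im u / (2 * pi)" "Im u / (2 * pi) < real_of_int (- k) + 1"
      unfolding k_def using floor_correct[of "Im u / (2 * pi)"] by simp_all
    then have "real_of_int (- k) < Im u / (2 * pi)" "Im u / (2 * pi) < real_of_int (- k) + 1"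
      using ne[of "- k"] by linarith+
    then have "real_of_int (- k) * (2 * pi) < Im u" "Im u < (real_of_int (- k) + 1) * (2 * pi)"
      using pi_gt_zero by (simp_all only: pos_less_divide_eq pos_divide_less_eq mult_pos_pos zero_less_numeral)
    then show ?thesis by (simp add: Om_def algebra_simps)
  qed
  then show ?thesis using that Eu by blast
qed

end

context monodromy_frame
begin

text \<open>Frames that are, near \<open>s\<close>, one of the frames \<open>gk k\<close> up to a matrix of
  the group. Continuation along any path preserves this class, which bounds the monodromy group
  from above.\<close>

definition Adm :: "complex \<Rightarrow> (nat \<Rightarrow> complex \<Rightarrow> complex) \<Rightarrow> bool" where
  "Adm s \<phi> \<longleftrightarrow> (\<exists>u k h. E u = s \<and> u \<in> Om k \<and> h \<in> HH \<and>
     (\<forall>j<m. \<forall>\<^sub>F z in nhds s. \<phi> j z = frame_mult m (gk k) h j (br u z)))"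

text \<open>Passing between two segments needs a product of the matrices of the half-plane steps, and
  passing to another sheet of the covering a power of \<open>hI [^] \<gamma>\<close>; both lie in
  the group.\<close>

lemma gk_transition:
  assumes v: "v \<in> Om k" and v': "v + 2 * of_real pi * \<i> * of_nat \<gamma> * of_int n \<in> Om k'"
  shows "\<exists>h\<in>HH. \<forall>\<^sub>F w in nhds v. \<forall>j<m.
     gk k' j (w + 2 * of_real pi * \<i> * of_nat \<gamma> * of_int n) = frame_mult m (gk k) h j w"
proof -
  define N where "N = int \<gamma> * n"
  have sh: "w + 2 * of_real pi * \<i> * of_nat \<gamma> * of_int n = w + 2 * of_real pi * \<i> * of_int N" for w :: complex
    by (simp add: N_def)
  have hN: "hI [^]\<^bsub>GG\<^esub> (- N) \<in> HH" using HH_gamma_pow[of "- n"] by (simp add: N_def)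
  consider "Re v > 0" | "Re v < 0" | "Re v = 0" by linarith
  then show ?thesis
  proof cases
    case 1
    have "\<forall>\<^sub>F w in nhds v. w \<in> {w. Re w > 0}" using 1 by (intro eventually_nhds_in_open open_halfspace_Re_gt) auto
    then have "\<forall>\<^sub>F w in nhds v. \<forall>j<m. gk k' j (w + 2 * of_real pi * \<i> * of_nat \<gamma> * of_int n) = frame_mult m (gk k) (hI [^]\<^bsub>GG\<^esub> (- N)) j w"
    proof eventually_elim
      case (elim w)
      show ?case
      proof (intro allI impI)
        fix j assume j: "j < m"
        have "gk k' j (w + 2 * of_real pi * \<i> * of_int N) = frame_mult m (gk (k' + N)) (hI [^]\<^bsub>GG\<^esub> (- N)) j w"
          by (rule gk_shift[OF j])
        also have "\<dots> = frame_mult m (gk k) (hI [^]\<^bsub>GG\<^esub> (- N)) j w"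
          by (rule frame_mult_cong) (use elim gk_right in auto)
        finally show "gk k' j (w + 2 * of_real pi * \<i> * of_nat \<gamma> * of_int n) = frame_mult m (gk k) (hI [^]\<^bsub>GG\<^esub> (- N)) j w"
          unfolding sh .
      qed
    qed
    then show ?thesis using hN by blast
  next
    case 2
    define h where "h = inv\<^bsub>GG\<^esub> (aa k) \<otimes>\<^bsub>GG\<^esub> (aa (k' + N) \<otimes>\<^bsub>GG\<^esub> hI [^]\<^bsub>GG\<^esub> (- N))"
    have h: "h \<in> HH" unfolding h_def using hN aa_HH HH_ops by simp
    have "\<forall>\<^sub>F w in nhds v. w \<in> {w. Re w < 0}" using 2 by (intro eventually_nhds_in_open open_halfspace_Re_lt) auto
    then have "\<forall>\<^sub>F w in nhds v. \<forall>j<m. gk k' j (w + 2 * of_real pi * \<i> * of_nat \<gamma> * of_int n) = frame_mult m (gk k) h j w"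
    proof eventually_elim
      case (elim w)
      then have w: "Re w < 0" by simp
      show ?case
      proof (intro allI impI)
        fix j assume j: "j < m"
        have "gk k' j (w + 2 * of_real pi * \<i> * of_int N) = frame_mult m (gk (k' + N)) (hI [^]\<^bsub>GG\<^esub> (- N)) j w"
          by (rule gk_shift[OF j])
        also have "\<dots> = frame_mult m (frame_mult m g (aa (k' + N))) (hI [^]\<^bsub>GG\<^esub> (- N)) j w"
          by (rule frame_mult_cong) (rule gk_left[OF w])
        also have "\<dots> = frame_mult m g (aa (k' + N) \<otimes>\<^bsub>GG\<^esub> hI [^]\<^bsub>GG\<^esub> (- N)) j w"
          using j by (intro fm_mult) auto
        also have "aa (k' + N) \<otimes>\<^bsub>GG\<^esub> hI [^]\<^bsub>GG\<^esub> (- N) = aa k \<otimes>\<^bsub>GG\<^esub> h"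
          unfolding h_def by (simp add: GG.m_assoc[symmetric])
        also have "frame_mult m g (aa k \<otimes>\<^bsub>GG\<^esub> h) j w = frame_mult m (frame_mult m g (aa k)) h j w"
          using j HH_carrier[OF h] by (intro fm_mult[symmetric]) auto
        also have "\<dots> = frame_mult m (gk k) h j w"
          by (rule frame_mult_cong) (rule gk_left[OF w, symmetric])
        finally show "gk k' j (w + 2 * of_real pi * \<i> * of_nat \<gamma> * of_int n) = frame_mult m (gk k) h j w"
          unfolding sh .
      qed
    qed
    then show ?thesis using h by blast
  next
    case 3
    have "- 2 * pi * of_int k < Im v" "Im v < 2 * pi - 2 * pi * of_int k"
      using v 3 by (auto simp: Om_def)
    moreover have "- 2 * pi * of_int k' < Im v + 2 * pi * of_int N" "Im v + 2 * pi * of_int N < 2 * pi - 2 * pi * of_int k'"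
      using v' 3 unfolding sh by (auto simp: Om_def)
    ultimately have "2 * pi * real_of_int (k - k' - N) < 2 * pi * 1" "2 * pi * real_of_int (- (k - k' - N)) < 2 * pi * 1"
      by (simp_all add: algebra_simps)
    then have "real_of_int (k - k' - N) < 1" "real_of_int (- (k - k' - N)) < 1"
      by (simp_all only: mult_less_cancel_left_pos[of "2 * pi"] pi_gt_zero mult_pos_pos zero_less_numeral)
    then have k: "k = k' + N" by linarith
    have "\<forall>w. \<forall>j<m. gk k' j (w + 2 * of_real pi * \<i> * of_nat \<gamma> * of_int n) = frame_mult m (gk k) (hI [^]\<^bsub>GG\<^esub> (- N)) j w"
      unfolding sh k using gk_shift by blast
    then show ?thesis using hN by (intro bexI[of _ "hI [^]\<^bsub>GG\<^esub> (- N)"] always_eventually) auto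
  qed
qed

definition Nb :: "complex \<Rightarrow> int \<Rightarrow> complex set" where "Nb u k = Hp u \<inter> br u -` Om k"

lemma Nb_open: "open (Nb u k)"
  unfolding Nb_def using continuous_open_preimage[OF br_continuous Hp(1) open_Om] .

lemma Nb_self: "u \<in> Om k \<Longrightarrow> E u \<in> Nb u k" by (simp add: Nb_def Hp(2))

lemma gk_br_holomorphic: "j < m \<Longrightarrow> (\<lambda>z. gk k j (br u z)) holomorphic_on Nb u k"
proof -
  assume j: "j < m"
  have "(gk k j \<circ> br u) holomorphic_on Nb u k"
    by (rule holomorphic_on_compose_gen[OF holomorphic_on_subset[OF br_holomorphic] gk_holomorphic[OF j]])
       (auto simp: Nb_def)
  then show ?thesis by (simp add: o_def)
qed

lemma fm_br_holomorphic: "(\<lambda>z. frame_mult m (gk k) h j (br u z)) holomorphic_on Nb u k"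
  unfolding frame_mult_def by (intro holomorphic_intros gk_br_holomorphic) auto

lemma br_tendsto: "z0 \<in> Hp u \<Longrightarrow> filterlim (br u) (nhds (br u z0)) (nhds z0)"
proof -
  assume "z0 \<in> Hp u"
  then have "isCont (br u) z0" using br_continuous Hp(1) by (simp add: continuous_on_eq_continuous_at)
  then show ?thesis using tendsto_at_iff_tendsto_nhds[of "br u" z0] by (simp add: isCont_def)
qed

lemma Adm_local:
  assumes y: "y \<in> Nb u k"
  shows "Adm y \<phi> \<longleftrightarrow> (\<exists>h\<in>HH. \<forall>j<m. \<forall>\<^sub>F z in nhds y. \<phi> j z = frame_mult m (gk k) h j (br u z))"
proof
  have yH: "y \<in> Hp u" "br u y \<in> Om k" "y \<noteq> 0" using y Hp_nz by (auto simp: Nb_def)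
  {
    assume "\<exists>h\<in>HH. \<forall>j<m. \<forall>\<^sub>F z in nhds y. \<phi> j z = frame_mult m (gk k) h j (br u z)"
    then obtain h where h: "h \<in> HH" "\<And>j. j < m \<Longrightarrow> \<forall>\<^sub>F z in nhds y. \<phi> j z = frame_mult m (gk k) h j (br u z)" by blast
    have near: "\<forall>\<^sub>F z in nhds y. br (br u y) z = br u z" using br_near[OF yH(1), of "br u y" 0] by simp
    have "\<forall>\<^sub>F z in nhds y. \<phi> j z = frame_mult m (gk k) h j (br (br u y) z)" if "j < m" for j
      using near h(2)[OF that] by eventually_elim simp
    then show "Adm y \<phi>" unfolding Adm_def using yH h(1)
      by (intro exI[of _ "br u y"] exI[of _ k] exI[of _ h]) (auto simp: E_br)
  }
  assume "Adm y \<phi>"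
  then obtain u' k' h' where A: "E u' = y" "u' \<in> Om k'" "h' \<in> HH"
    "\<And>j. j < m \<Longrightarrow> \<forall>\<^sub>F z in nhds y. \<phi> j z = frame_mult m (gk k') h' j (br u' z)" unfolding Adm_def by blast
  have "E u' = E (br u y)" using A(1) yH by (simp add: E_br)
  then obtain n :: int where n: "u' = br u y + 2 * of_real pi * \<i> * of_nat \<gamma> * of_int n" using E_eq_iff by blast
  have near: "\<forall>\<^sub>F z in nhds y. br u' z = br u z + 2 * of_real pi * \<i> * of_nat \<gamma> * of_int n"
    by (rule br_near[OF yH(1) n])
  obtain h where h: "h \<in> HH" "\<forall>\<^sub>F w in nhds (br u y). \<forall>j<m.
     gk k' j (w + 2 * of_real pi * \<i> * of_nat \<gamma> * of_int n) = frame_mult m (gk k) h j w"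
    using gk_transition[OF yH(2), of n k'] A(2) n by blast
  have tr: "\<forall>\<^sub>F z in nhds y. \<forall>j<m.
     gk k' j (br u z + 2 * of_real pi * \<i> * of_nat \<gamma> * of_int n) = frame_mult m (gk k) h j (br u z)"
    using h(2) br_tendsto[OF yH(1)] unfolding filterlim_iff by blast
  have "\<forall>\<^sub>F z in nhds y. \<phi> j z = frame_mult m (gk k) (h \<otimes>\<^bsub>GG\<^esub> h') j (br u z)" if j: "j < m" for j
    using near tr A(4)[OF j]
  proof eventually_elim
    case (elim z)
    have "\<phi> j z = frame_mult m (frame_mult m (gk k) h) h' j (br u z)"
      unfolding elim(3) by (rule frame_mult_cong) (use elim(1,2) in simp)
    then show ?case using fm_mult[OF HH_carrier[OF h(1)] HH_carrier[OF A(3)] j] by simp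
  qed
  then show "\<exists>h\<in>HH. \<forall>j<m. \<forall>\<^sub>F z in nhds y. \<phi> j z = frame_mult m (gk k) h j (br u z)"
    using HH_ops(1)[OF h(1) A(3)] by blast
qed

text \<open>The class is locally constant, so a bisection of the parameter interval suffices.\<close>

lemma Adm_continue:
  assumes p: "path p" "path_image p \<subseteq> XX" and \<phi>: "Adm (pathstart p) \<phi>"
  shows "\<exists>\<phi>'. Adm (pathfinish p) \<phi>' \<and> (\<forall>j<m. continues_along p (\<phi> j) (\<phi>' j))"
proof -
  have cp: "continuous_on {0..1} p" using p(1) by (simp add: path_def)
  define P where "P = (\<lambda>a b. 0 \<le> a \<longrightarrow> b \<le> 1 \<longrightarrow> (\<forall>\<phi>. Adm (p a) \<phi> \<longrightarrow> (\<exists>\<phi>'. Adm (p b) \<phi>' \<and> (\<forall>j<m. cont_on p a b (\<phi> j) (\<phi>' j)))))"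
  have "P 0 1"
  proof (rule Bolzano)
    fix a b c :: real assume P: "P a b" "P b c" and le: "a \<le> b" "b \<le> c"
    show "P a c" unfolding P_def
    proof (intro impI allI)
      fix \<phi> assume "0 \<le> a" "c \<le> 1" "Adm (p a) \<phi>"
      then obtain \<phi>1 where 1: "Adm (p b) \<phi>1" "\<And>j. j < m \<Longrightarrow> cont_on p a b (\<phi> j) (\<phi>1 j)"
        using P(1) le unfolding P_def by (meson order_trans)
      then obtain \<phi>2 where 2: "Adm (p c) \<phi>2" "\<And>j. j < m \<Longrightarrow> cont_on p b c (\<phi>1 j) (\<phi>2 j)"
        using P(2) le \<open>0 \<le> a\<close> \<open>c \<le> 1\<close> unfolding P_def by (meson order_trans)
      have "cont_on p a c (\<phi> j) (\<phi>2 j)" if "j < m" for j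
        by (rule cont_on_trans[OF le _ 1(2)[OF that] 2(2)[OF that]])
           (use \<open>0 \<le> a\<close> \<open>c \<le> 1\<close> in \<open>auto intro: continuous_on_subset[OF cp]\<close>)
      then show "\<exists>\<phi>'. Adm (p c) \<phi>' \<and> (\<forall>j<m. cont_on p a c (\<phi> j) (\<phi>' j))" using 2(1) by blast
    qed
  next
    fix x :: real assume x: "0 \<le> x" "x \<le> 1"
    then have "p x \<in> XX" using p(2) by (auto simp: path_image_def)
    then obtain u k where uk: "E u = p x" "u \<in> Om k" by (rule XX_lift)
    then have xN: "p x \<in> Nb u k" using Nb_self[OF uk(2)] by simp
    obtain r1 where r1: "r1 > 0" "ball (p x) r1 \<subseteq> Nb u k" using Nb_open xN open_contains_ball by blast
    obtain d where d: "d > 0" "\<And>t. t \<in> {0..1} \<Longrightarrow> dist t x < d \<Longrightarrow> dist (p t) (p x) < r1"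
      using cp x r1(1) unfolding continuous_on_iff by (metis atLeastAtMost_iff)
    have loc: "p t \<in> Nb u k" if "t \<in> {0..1}" "dist t x < d" for t
      using d(2)[OF that] r1(2) by (auto simp: dist_commute)
    show "\<exists>d>0. \<forall>a b. a \<le> x \<and> x \<le> b \<and> b - a < d \<longrightarrow> P a b"
    proof (intro exI[of _ d] conjI allI impI d)
      fix a b assume ab: "a \<le> x \<and> x \<le> b \<and> b - a < d"
      show "P a b" unfolding P_def
      proof (intro impI allI)
        fix \<phi> assume 01: "0 \<le> a" "b \<le> 1" and \<phi>: "Adm (p a) \<phi>"
        have inN: "p t \<in> Nb u k" if t: "a \<le> t" "t \<le> b" for t
        proof -
          have "dist t x < d" unfolding dist_real_def using ab t by linarith
          then show ?thesis using loc[of t] t 01 by simp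
        qed
        have aN: "p a \<in> Nb u k" and bN: "p b \<in> Nb u k" using inN ab by auto
        obtain h where h: "h \<in> HH" "\<And>j. j < m \<Longrightarrow> \<forall>\<^sub>F z in nhds (p a). \<phi> j z = frame_mult m (gk k) h j (br u z)"
          using \<phi> Adm_local[OF aN] by blast
        define \<phi>' where "\<phi>' = (\<lambda>j z. frame_mult m (gk k) h j (br u z))"
        have "Adm (p b) \<phi>'" unfolding Adm_local[OF bN] \<phi>'_def using h(1) by (intro bexI[of _ h]) auto
        moreover have "cont_on p a b (\<phi> j) (\<phi>' j)" if "j < m" for j
          by (rule cont_on_local[where U = "Nb u k" and G = "\<lambda>z. frame_mult m (gk k) h j (br u z)"])
             (use Nb_open fm_br_holomorphic inN h(2)[OF that] in \<open>auto simp: \<phi>'_def\<close>)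
        ultimately show "\<exists>\<phi>'. Adm (p b) \<phi>' \<and> (\<forall>j<m. cont_on p a b (\<phi> j) (\<phi>' j))" by blast
      qed
    qed
  qed simp
  then show ?thesis using \<phi> unfolding P_def pathstart_def pathfinish_def continues_along_iff by simp
qed

end

text \<open>A basis of germs at \<open>s0\<close> that is the pull-back of the frame of one segment.\<close>

locale based_frame = monodromy_frame +
  fixes s0 u0 :: complex and k0 :: int and b :: "nat \<Rightarrow> complex \<Rightarrow> complex"
  assumes Eu0: "E u0 = s0" and u0: "u0 \<in> Om k0"
    and b: "\<And>j. j < m \<Longrightarrow> \<forall>\<^sub>F z in nhds s0. b j z = gk k0 j (br u0 z)"
begin

lemma b_adm: "Adm s0 b"
  unfolding Adm_def using Eu0 u0 b HH_ops(3)
  by (intro exI[of _ u0] exI[of _ k0] exI[of _ "\<one>\<^bsub>GG\<^esub>"]) (auto simp: fm_one)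

lemma b_indep: "germ_independent m b s0"
  unfolding germ_independent_def
proof (intro allI impI)
  fix x i assume x: "\<forall>\<^sub>F z in nhds s0. (\<Sum>i<m. x i * b i z) = 0" and i: "i < m"
  have "\<forall>\<^sub>F z in nhds s0. \<forall>j\<in>{..<m}. b j z = gk k0 j (br u0 z)"
    using b by (intro eventually_ball_finite) auto
  then have "\<forall>\<^sub>F z in nhds (E u0). (\<Sum>i<m. x i * gk k0 i (br u0 z)) = 0"
    using x unfolding Eu0 by eventually_elim simp
  then show "x i = 0" using br_indep[OF gk_indep[OF u0]] i unfolding germ_independent_def by blast
qed

lemma monodromy_in_HH:
  assumes "loop_in XX s0 p"
  shows "\<exists>h\<in>HH. has_monodromy m b p h"
proof -
  have p: "path p" "path_image p \<subseteq> XX" "pathstart p = s0" "pathfinish p = s0" using assms by (auto simp: loop_in_def)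
  obtain \<phi> where \<phi>: "Adm s0 \<phi>" "\<And>j. j < m \<Longrightarrow> continues_along p (b j) (\<phi> j)"
    using Adm_continue[OF p(1,2)] b_adm p(3,4) by auto
  have sN: "s0 \<in> Nb u0 k0" using Nb_self[OF u0] Eu0 by simp
  obtain h where h: "h \<in> HH" "\<And>j. j < m \<Longrightarrow> \<forall>\<^sub>F z in nhds s0. \<phi> j z = frame_mult m (gk k0) h j (br u0 z)"
    using \<phi>(1) Adm_local[OF sN] by blast
  have bb: "\<forall>\<^sub>F z in nhds s0. \<forall>j\<in>{..<m}. b j z = gk k0 j (br u0 z)"
    using b by (intro eventually_ball_finite) auto
  have "has_monodromy m b p h" unfolding has_monodromy_def
  proof (intro conjI allI impI)
    show "h \<in> carrier_mat m m" by (rule GL_mat[OF HH_carrier[OF h(1)]])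
    fix j assume j: "j < m"
    show "continues_along p (b j) (\<lambda>z. \<Sum>i<m. h $$ (i, j) * b i z)"
    proof (rule continues_along_cong[OF \<phi>(2)[OF j]])
      show "\<forall>\<^sub>F z in nhds (pathfinish p). (\<Sum>i<m. h $$ (i, j) * b i z) = \<phi> j z"
        unfolding p(4) using bb h(2)[OF j] by eventually_elim (simp add: frame_mult_def)
    qed simp
  qed
  then show ?thesis using h(1) by blast
qed

lemma monodromy_unique: "loop_in XX s0 p \<Longrightarrow> has_monodromy m b p M \<Longrightarrow> has_monodromy m b p N \<Longrightarrow> M = N"
  using has_monodromy_unique[OF _ _ b_indep] by (auto simp: loop_in_def)

lemma monodromy_group_sub: "monodromy_group XX s0 m b \<subseteq> HH"
proof
  fix M assume "M \<in> monodromy_group XX s0 m b"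
  then obtain p where p: "loop_in XX s0 p" "has_monodromy m b p M" by (auto simp: monodromy_group_def)
  obtain h where "h \<in> HH" "has_monodromy m b p h" using monodromy_in_HH[OF p(1)] by blast
  then show "M \<in> HH" using monodromy_unique[OF p(1,2)] by blast
qed

lemma s0_XX: "s0 \<in> XX" using E_in_XX[OF u0] Eu0 by simp

lemma monodromy_group_super:
  assumes "hI [^]\<^bsub>GG\<^esub> \<gamma> \<in> monodromy_group XX s0 m b" "\<And>i. i < \<gamma> \<Longrightarrow> Mk (int i) \<in> monodromy_group XX s0 m b"
  shows "HH \<subseteq> monodromy_group XX s0 m b"
proof
  fix M assume "M \<in> HH"
  then show "M \<in> monodromy_group XX s0 m b" unfolding HH_def
  proof (induction rule: generate.induct)
    case one
    have "has_monodromy m b (linepath s0 s0) (1\<^sub>m m)" unfolding has_monodromy_def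
    proof (intro conjI allI impI)
      fix j assume j: "j < m"
      have sN: "s0 \<in> Nb u0 k0" using Nb_self[OF u0] Eu0 by simp
      have "(\<Sum>i<m. 1\<^sub>m m $$ (i, j) * b i z) = b j z" for z
        using frame_mult_one[OF j, of b z] by (simp add: frame_mult_def)
      then show "continues_along (linepath s0 s0) (b j) (\<lambda>z. \<Sum>i<m. 1\<^sub>m m $$ (i, j) * b i z)"
        unfolding continues_along_iff using b[OF j] sN
        by (intro cont_on_local[OF Nb_open gk_br_holomorphic[OF j]]) (auto simp: linepath_def)
    qed simp
    moreover have "loop_in XX s0 (linepath s0 s0)" using s0_XX by (simp add: loop_in_def)
    ultimately show ?case unfolding monodromy_group_def GL_one by blast
  next
    case (incl h) then show ?case using assms by auto
  next
    case (inv h)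
    then have hm: "h \<in> monodromy_group XX s0 m b" and hc: "h \<in> carrier GG" using assms hI by auto
    then obtain p where p: "loop_in XX s0 p" "has_monodromy m b p h" by (auto simp: monodromy_group_def)
    have "h * inv\<^bsub>GG\<^esub> h = 1\<^sub>m m" using GG.r_inv[OF hc] by (simp add: GL_mult GL_one)
    then have "has_monodromy m b (reversepath p) (inv\<^bsub>GG\<^esub> h)"
      using p(2) GL_mat[OF GG.inv_closed[OF hc]] by (intro has_monodromy_reverse)
    moreover have "loop_in XX s0 (reversepath p)" using p(1) by (auto simp: loop_in_def)
    ultimately show ?case unfolding monodromy_group_def by blast
  next
    case (eng h1 h2)
    then obtain p q where p: "loop_in XX s0 p" "has_monodromy m b p h1" and q: "loop_in XX s0 q" "has_monodromy m b q h2"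
      by (auto simp: monodromy_group_def)
    have "has_monodromy m b (q +++ p) (h1 * h2)"
      using p q by (intro has_monodromy_join) (auto simp: loop_in_def)
    moreover have "loop_in XX s0 (q +++ p)" using p(1) q(1) by (auto simp: loop_in_def path_image_join)
    ultimately show ?case unfolding monodromy_group_def GL_mult by blast
  qed
qed

end

section \<open>Simple loops\<close>

lemma sin_2pi_nonneg: "0 \<le> y \<and> y \<le> 1/2 \<or> 1 \<le> y \<and> y \<le> 3/2 \<Longrightarrow> sin (2 * pi * y) \<ge> 0"
proof (elim disjE)
  assume "0 \<le> y \<and> y \<le> 1/2"
  then show ?thesis by (intro sin_ge_zero) (auto simp: field_simps)
next
  assume y: "1 \<le> y \<and> y \<le> 3/2"
  have "sin (2 * pi * y) = sin (2 * pi * (y - 1) + 2 * pi)" by (simp add: algebra_simps)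
  also have "\<dots> = sin (2 * pi * (y - 1))" by (rule sin_periodic)
  also have "\<dots> \<ge> 0" using y by (intro sin_ge_zero) (auto simp: field_simps)
  finally show ?thesis .
qed

lemma sin_2pi_nonpos: "1/2 \<le> y \<and> y \<le> 1 \<or> 3/2 \<le> y \<and> y \<le> 2 \<Longrightarrow> sin (2 * pi * y) \<le> 0"
proof -
  assume y: "1/2 \<le> y \<and> y \<le> 1 \<or> 3/2 \<le> y \<and> y \<le> 2"
  have "sin (2 * pi * y) = sin (2 * pi * (y - 1/2) + pi)" by (simp add: algebra_simps)
  also have "\<dots> = - sin (2 * pi * (y - 1/2))" by (rule sin_periodic_pi)
  finally show ?thesis using sin_2pi_nonneg[of "y - 1/2"] y by auto
qed

context exp_cover
begin

definition omega :: "nat \<Rightarrow> complex" where "omega i = E (- 2 * of_real pi * \<i> * of_nat i)"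

text \<open>The lift of a small disc around a singular point is cut by the horizontal line through the
  centre: the upper part lies over the segment above, the lower part over the segment below.\<close>

lemma upper_half:
  assumes z: "z \<in> Hp v" "z \<noteq> E v" and v: "v = - 2 * of_real pi * \<i> * of_nat i"
    and near: "\<bar>Im (br v z - v)\<bar> < 2 * pi"
  shows "Im (z / E v) \<ge> 0 \<Longrightarrow> br v z \<in> Om (int i)" "Im (z / E v) \<le> 0 \<Longrightarrow> br v z \<in> Om (int i + 1)"
proof -
  define w where "w = z / E v"
  have w: "Re w > 0" "w \<noteq> 0" "w \<noteq> 1" using z by (auto simp: Hp_def w_def)
  have Im: "Im (br v z) = Im v + real \<gamma> * Im (Ln w)" "Re (br v z) = Re v + real \<gamma> * Re (Ln w)"
    by (simp_all add: br_def w_def)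
  have Imv: "Im v = - 2 * pi * real i" by (simp add: v)
  have real_case: "Re (br v z) \<noteq> 0" if "Im w = 0"
  proof
    assume "Re (br v z) = 0"
    then have "ln (norm w) = 0" using Im(2) w \<gamma> by (simp add: v)
    then have "norm w = 1" using w by simp
    moreover have "w = of_real (Re w)" using that by (simp add: complex_eq_iff)
    then have "norm w = Re w" using w by (metis abs_of_pos norm_of_real)
    ultimately have "w = 1" using that by (simp add: complex_eq_iff)
    then show False using w by simp
  qed
  have bd: "\<bar>real \<gamma> * Im (Ln w)\<bar> < 2 * pi" using near by (simp add: Im(1))
  { assume "Im (z / E v) \<ge> 0"
    then consider "Im w = 0" | "Im w > 0" unfolding w_def[symmetric] by linarith
    then show "br v z \<in> Om (int i)"
    proof cases
      case 1 then show ?thesis using real_case by (simp add: Om_def)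
    next
      case 2
      then have "Im (Ln w) > 0" using Im_Ln_pos_lt[of w] w by simp
      then have "real \<gamma> * Im (Ln w) > 0" using \<gamma> by simp
      then show ?thesis using bd by (simp add: Om_def Im(1) Imv)
    qed }
  { assume "Im (z / E v) \<le> 0"
    then consider "Im w = 0" | "Im w < 0" unfolding w_def[symmetric] by linarith
    then show "br v z \<in> Om (int i + 1)"
    proof cases
      case 1 then show ?thesis using real_case by (simp add: Om_def)
    next
      case 2
      then have "\<not> 0 \<le> Im (Ln w)" using Im_Ln_pos_le[of w] w Im_Ln_le_pi[of w] by auto
      then have "real \<gamma> * Im (Ln w) < 0" using \<gamma> by (simp add: mult_pos_neg)
      then show ?thesis using bd by (simp add: Om_def Im(1) Imv algebra_simps)
    qed }
qed

end

context based_frame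
begin

text \<open>The path leaves the base point over its own segment, enters the right half-plane, and returns to
  \<open>v\<close> over the other segment. No matrix arises, since all frames coincide on the
  right half-plane.\<close>

lemma path_to:
  assumes "v \<in> Om k"
  obtains d where "path d" "path_image d \<subseteq> XX" "pathstart d = s0" "pathfinish d = E v"
    "\<And>j. j < m \<Longrightarrow> continues_along d (b j) (\<lambda>z. gk k j (br v z))"
proof -
  have one: "1 \<in> Om l" for l by (simp add: Om_def)
  obtain q1 where q1: "path q1" "path_image q1 \<subseteq> Om k0" "pathstart q1 = u0" "pathfinish q1 = 1"
    using path_connected_Om u0 one unfolding path_connected_def by meson
  obtain q2 where q2: "path q2" "path_image q2 \<subseteq> Om k" "pathstart q2 = 1" "pathfinish q2 = v"
    using path_connected_Om assms one unfolding path_connected_def by meson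
  define d where "d = (E \<circ> q1) +++ (E \<circ> q2)"
  have cE: "continuous_on A E" for A by (rule holomorphic_on_imp_continuous_on[OF E_holomorphic])
  have p1: "path (E \<circ> q1)" "path (E \<circ> q2)" using q1 q2 cE by (auto intro: path_continuous_image)
  have st: "pathstart (E \<circ> q1) = s0" "pathfinish (E \<circ> q1) = E 1" "pathstart (E \<circ> q2) = E 1" "pathfinish (E \<circ> q2) = E v"
    using q1 q2 Eu0 by (simp_all add: pathstart_def pathfinish_def)
  have im: "path_image (E \<circ> q1) \<subseteq> XX" "path_image (E \<circ> q2) \<subseteq> XX"
    using q1(2) q2(2) E_in_XX by (auto simp: path_image_def)
  have "continues_along d (b j) (\<lambda>z. gk k j (br v z))" if j: "j < m" for j
    unfolding d_def
  proof (rule continues_along_join)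
    have "continues_along (E \<circ> q1) (\<lambda>z. gk k0 j (br u0 z)) (\<lambda>z. gk k0 j (br 1 z))"
      using continues_along_lift[OF gk_holomorphic[OF j] open_Om q1(1,2)] q1(3,4) by simp
    then show "continues_along (E \<circ> q1) (b j) (\<lambda>z. gk k j (br 1 z))"
    proof (rule continues_along_cong)
      show "\<forall>\<^sub>F z in nhds (pathstart (E \<circ> q1)). b j z = gk k0 j (br u0 z)" unfolding st by (rule b[OF j])
      have "\<forall>\<^sub>F w in nhds 1. w \<in> {w. Re w > 0}" by (intro eventually_nhds_in_open open_halfspace_Re_gt) auto
      then have "\<forall>\<^sub>F w in nhds (br 1 (E 1)). gk k j w = gk k0 j w" unfolding br_E
        by eventually_elim (use gk_right j in auto)
      then show "\<forall>\<^sub>F z in nhds (pathfinish (E \<circ> q1)). gk k j (br 1 z) = gk k0 j (br 1 z)"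
        unfolding st using br_tendsto[OF Hp(2)[of 1]] unfolding filterlim_iff by blast
    qed
    show "continues_along (E \<circ> q2) (\<lambda>z. gk k j (br 1 z)) (\<lambda>z. gk k j (br v z))"
      using continues_along_lift[OF gk_holomorphic[OF j] open_Om q2(1,2)] q2(3,4) by simp
  qed (use p1 st in auto)
  then show ?thesis
    using that[of d] p1 st im unfolding d_def by (simp add: path_image_join)
qed

lemma loop_monodromy:
  assumes M: "M \<in> carrier GG"
    and d: "path d" "pathstart d = s0" "pathfinish d = E v"
      "\<And>j. j < m \<Longrightarrow> continues_along d (b j) (\<lambda>z. gk k j (br v z))"
    and c: "path c" "pathstart c = E v" "pathfinish c = E v"
      "\<And>j. j < m \<Longrightarrow> continues_along c (\<lambda>z. gk k j (br v z)) (\<lambda>z. frame_mult m (gk k) M j (br v z))"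
  shows "has_monodromy m b (d +++ c +++ reversepath d) M"
  unfolding has_monodromy_def
proof (intro conjI allI impI)
  show "M \<in> carrier_mat m m" by (rule GL_mat[OF M])
  fix j assume j: "j < m"
  have "continues_along (reversepath d) (\<lambda>z. \<Sum>i<m. M $$ (i, j) * gk k i (br v z)) (\<lambda>z. \<Sum>i<m. M $$ (i, j) * b i z)"
    unfolding continues_along_iff
    by (rule cont_on_sum) (use d(4) continues_along_reversepath in \<open>auto simp: continues_along_iff[symmetric]\<close>)
  then have r: "continues_along (reversepath d) (\<lambda>z. frame_mult m (gk k) M j (br v z)) (\<lambda>z. \<Sum>i<m. M $$ (i, j) * b i z)"
    by (simp add: frame_mult_def)
  show "continues_along (d +++ c +++ reversepath d) (b j) (\<lambda>z. \<Sum>i<m. M $$ (i, j) * b i z)"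
    using d c(1-3) by (intro continues_along_join[OF d(4)[OF j] continues_along_join[OF c(4)[OF j] r]]) auto
qed

text \<open>The small circle is cut where it crosses the ray from the origin through the singular point. One
  part lifts to one segment and the other part to the next one. At the outer crossing, which lies
  in the right half-plane, the two frames agree, and at the inner one they differ by
  \<open>Mk\<close>.\<close>

lemma loop_omega:
  assumes i: "i < \<gamma>"
  shows "\<exists>p. loop_around XX s0 (omega i) p \<and> has_monodromy m b p (Mk (int i))"
proof -
  define v where "v = - 2 * of_real pi * \<i> * of_nat i"
  define \<omega> where "\<omega> = E v"
  have om: "omega i = \<omega>" by (simp add: omega_def \<omega>_def v_def)
  define W where "W = Hp v \<inter> br v -` {w. \<bar>Im (w - v)\<bar> < 2 * pi}"
  have W: "open W" unfolding W_def
    by (rule continuous_open_preimage[OF br_continuous Hp(1)]) (intro open_Collect_less continuous_intros)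
  have "\<omega> \<in> W" by (simp add: W_def \<omega>_def Hp(2))
  then obtain \<epsilon> where \<epsilon>: "\<epsilon> > 0" "cball \<omega> \<epsilon> \<subseteq> W" using W open_contains_cball by blast
  have inW: "z \<in> Hp v" "\<bar>Im (br v z - v)\<bar> < 2 * pi" if "z \<in> cball \<omega> \<epsilon>" for z
    using that \<epsilon>(2) by (auto simp: W_def)
  have up: "z \<in> Nb v (int i)" if "z \<in> cball \<omega> \<epsilon>" "z \<noteq> \<omega>" "Im (z / \<omega>) \<ge> 0" for z
    using upper_half(1)[OF inW(1)[OF that(1)] _ v_def inW(2)[OF that(1)]] that inW(1)[OF that(1)]
    by (auto simp: Nb_def \<omega>_def)
  have low: "z \<in> Nb v (int i + 1)" if "z \<in> cball \<omega> \<epsilon>" "z \<noteq> \<omega>" "Im (z / \<omega>) \<le> 0" for z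
    using upper_half(2)[OF inW(1)[OF that(1)] _ v_def inW(2)[OF that(1)]] that inW(1)[OF that(1)]
    by (auto simp: Nb_def \<omega>_def)
  have sub: "cball \<omega> \<epsilon> - {\<omega>} \<subseteq> XX"
  proof
    fix z assume z: "z \<in> cball \<omega> \<epsilon> - {\<omega>}"
    then have "z \<in> Nb v (int i) \<or> z \<in> Nb v (int i + 1)" using up[of z] low[of z] by fastforce
    then obtain k where k: "z \<in> Nb v k" by blast
    then have "br v z \<in> Om k" "z \<noteq> 0" using Hp_nz by (auto simp: Nb_def)
    then show "z \<in> XX" using E_in_XX[of "br v z" k] by (simp add: E_br)
  qed
  define c where "c = circlepath \<omega> \<epsilon>"
  define x where "x = real i / real \<gamma>"
  have x: "0 \<le> x" "x < 1" using i by (auto simp: x_def)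
  have \<omega>eq: "\<omega> = of_real \<kappa> * cis (- (2 * pi * x))"
    by (simp add: \<omega>_def E_def v_def cis_conv_exp x_def mult_ac)
  have cdiv: "c t / \<omega> = 1 + of_real (\<epsilon> / \<kappa>) * cis (2 * pi * (t + x))" for t
  proof -
    have "c t = \<omega> + of_real \<epsilon> * cis (2 * pi * t)" by (simp add: c_def circlepath cis_conv_exp mult_ac)
    then have "c t / \<omega> = \<omega> / \<omega> + of_real \<epsilon> * cis (2 * pi * t) / \<omega>" by (simp only: add_divide_distrib)
    also have "\<omega> / \<omega> = 1" by (simp add: \<omega>_def)
    also have "of_real \<epsilon> * cis (2 * pi * t) / \<omega> = of_real (\<epsilon> / \<kappa>) * (cis (2 * pi * t) / cis (- (2 * pi * x)))"
      unfolding \<omega>eq by simp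
    also have "cis (2 * pi * t) / cis (- (2 * pi * x)) = cis (2 * pi * (t + x))"
      by (simp add: cis_divide algebra_simps)
    finally show ?thesis .
  qed
  have Imc: "Im (c t / \<omega>) = \<epsilon> / \<kappa> * sin (2 * pi * (t + x))" for t unfolding cdiv by simp
  have e\<kappa>: "\<epsilon> / \<kappa> > 0" using \<epsilon> \<kappa> by simp
  have cin: "c t \<in> cball \<omega> \<epsilon>" "c t \<noteq> \<omega>" for t
    using \<epsilon>(1) by (auto simp: c_def circlepath dist_norm norm_mult)
  have cup: "c t \<in> Nb v (int i)" if "0 \<le> t + x \<and> t + x \<le> 1/2 \<or> 1 \<le> t + x \<and> t + x \<le> 3/2" for t
  proof (rule up[OF cin])
    show "Im (c t / \<omega>) \<ge> 0" unfolding Imc by (rule mult_nonneg_nonneg) (use sin_2pi_nonneg[OF that] e\<kappa> in auto)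
  qed
  have clow: "c t \<in> Nb v (int i + 1)" if "1/2 \<le> t + x \<and> t + x \<le> 1 \<or> 3/2 \<le> t + x \<and> t + x \<le> 2" for t
  proof (rule low[OF cin])
    show "Im (c t / \<omega>) \<le> 0" unfolding Imc by (rule mult_nonneg_nonpos) (use sin_2pi_nonpos[OF that] e\<kappa> in auto)
  qed
  have Re_br: "Re (br v z) = real \<gamma> * ln (norm (z / \<omega>))" if "z \<in> cball \<omega> \<epsilon>" for z
    using Hp_nz(2)[OF inW(1)[OF that]] by (simp add: br_def v_def \<omega>_def)
  have leftpt: "\<forall>\<^sub>F z in nhds (c t). \<forall>j<m. gk (int i) j (br v z) = frame_mult m (gk (int i + 1)) (Mk (int i)) j (br v z)"
    if t: "t + x = 1/2 \<or> t + x = 3/2" for t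
  proof -
    have "cis (2 * pi * (t + x)) = -1"
    proof -
      from t show ?thesis
      proof
        assume h: "t + x = 1/2"
        show ?thesis unfolding h by simp
      next
        assume h: "t + x = 3/2"
        have "2 * pi * (3 / 2) = pi + 2 * pi" by simp
        then show ?thesis unfolding h by (simp only: cis_mult[symmetric] cis_pi cis_2pi) simp
      qed
    qed
    then have r: "c t / \<omega> = of_real (1 - \<epsilon> / \<kappa>)" unfolding cdiv by simp
    have "Re (c t / \<omega>) > 0" using inW(1)[OF cin(1)[of t]] by (simp add: Hp_def \<omega>_def)
    then have "1 - \<epsilon> / \<kappa> > 0" unfolding r by simp
    then have "norm (c t / \<omega>) = 1 - \<epsilon> / \<kappa>" unfolding r by (simp only: norm_of_real abs_of_pos)
    then have "ln (norm (c t / \<omega>)) < 0" using \<open>1 - \<epsilon> / \<kappa> > 0\<close> e\<kappa> by simp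
    then have "Re (br v (c t)) < 0" unfolding Re_br[OF cin(1)] using \<gamma> by (simp add: mult_pos_neg)
    then have "\<forall>\<^sub>F w in nhds (br v (c t)). w \<in> {w. Re w < 0}"
      by (intro eventually_nhds_in_open open_halfspace_Re_lt) auto
    then have "\<forall>\<^sub>F w in nhds (br v (c t)). \<forall>j<m. gk (int i) j w = frame_mult m (gk (int i + 1)) (Mk (int i)) j w"
      by eventually_elim (use gk_left_step in auto)
    then show ?thesis using br_tendsto[OF inW(1)[OF cin(1)[of t]]] unfolding filterlim_iff by blast
  qed
  have rightpt: "\<forall>\<^sub>F z in nhds (c t). \<forall>j<m. gk (int i) j (br v z) = gk (int i + 1) j (br v z)"
    if t: "t + x = 1" for t
  proof -
    have r: "c t / \<omega> = of_real (1 + \<epsilon> / \<kappa>)" unfolding cdiv t by simp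
    have "norm (c t / \<omega>) = 1 + \<epsilon> / \<kappa>" unfolding r norm_of_real using e\<kappa> by simp
    then have "ln (norm (c t / \<omega>)) > 0" using e\<kappa> by simp
    then have "Re (br v (c t)) > 0" unfolding Re_br[OF cin(1)] using \<gamma> by simp
    then have "\<forall>\<^sub>F w in nhds (br v (c t)). w \<in> {w. Re w > 0}"
      by (intro eventually_nhds_in_open open_halfspace_Re_gt) auto
    then have "\<forall>\<^sub>F w in nhds (br v (c t)). \<forall>j<m. gk (int i) j w = gk (int i + 1) j w"
      by eventually_elim (use gk_right in auto)
    then show ?thesis using br_tendsto[OF inW(1)[OF cin(1)[of t]]] unfolding filterlim_iff by blast
  qed
  have cc: "continuous_on A c" for A unfolding c_def circlepath by (intro continuous_intros)
  define M where "M = Mk (int i)"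
  define F where "F = (\<lambda>k j z. gk k j (br v z))"
  define FM where "FM = (\<lambda>k j z. frame_mult m (gk k) M j (br v z))"
  have holF: "j < m \<Longrightarrow> F k j holomorphic_on Nb v k" for k j unfolding F_def by (rule gk_br_holomorphic)
  have holFM: "FM k j holomorphic_on Nb v k" for k j unfolding FM_def by (rule fm_br_holomorphic)
  have FM_right: "\<forall>\<^sub>F z in nhds (c t). FM (int i) j z = FM (int i + 1) j z" if "t + x = 1" for t j
    using rightpt[OF that] by eventually_elim (auto simp: FM_def intro!: frame_mult_cong)
  have F_left: "\<forall>\<^sub>F z in nhds (c t). F (int i) j z = FM (int i + 1) j z" if "t + x = 1/2 \<or> t + x = 3/2" "j < m" for t j
    using leftpt[OF that(1)] by eventually_elim (use that(2) in \<open>auto simp: F_def FM_def M_def\<close>)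
  have F_right: "\<forall>\<^sub>F z in nhds (c t). F (int i) j z = F (int i + 1) j z" if "t + x = 1" "j < m" for t j
    using rightpt[OF that(1)] by eventually_elim (use that(2) in \<open>auto simp: F_def\<close>)
  have ex: "\<exists>k. c 0 \<in> Nb v k \<and> (\<forall>j<m. cont_on c 0 1 (F k j) (FM k j))"
  proof (cases "x \<le> 1/2")
    case True
    have "cont_on c 0 1 (F (int i) j) (FM (int i) j)" if j: "j < m" for j
    proof (rule cont_on_trans[of 0 "1/2 - x"])
      show "cont_on c 0 (1/2 - x) (F (int i) j) (FM (int i + 1) j)"
        by (rule cont_on_local[where U = "Nb v (int i)" and G = "F (int i) j"])
           (use Nb_open holF[OF j] cup F_left[of "1/2 - x" j] j x True in \<open>auto elim: eventually_mono\<close>)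
      show "cont_on c (1/2 - x) 1 (FM (int i + 1) j) (FM (int i) j)"
      proof (rule cont_on_trans[of _ "1 - x"])
        show "cont_on c (1/2 - x) (1 - x) (FM (int i + 1) j) (FM (int i) j)"
          by (rule cont_on_local[where U = "Nb v (int i + 1)" and G = "FM (int i + 1) j"])
             (use Nb_open holFM clow FM_right[of "1 - x" j] x True in auto)
        show "cont_on c (1 - x) 1 (FM (int i) j) (FM (int i) j)"
          by (rule cont_on_local[where U = "Nb v (int i)" and G = "FM (int i) j"])
             (use Nb_open holFM cup x True in auto)
      qed (use x cc in auto)
    qed (use x cc True in auto)
    then show ?thesis using cup[of 0] x True by auto
  next
    case False
    have "cont_on c 0 1 (F (int i + 1) j) (FM (int i + 1) j)" if j: "j < m" for j
    proof (rule cont_on_trans[of 0 "1 - x"])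
      show "cont_on c 0 (1 - x) (F (int i + 1) j) (F (int i) j)"
        by (rule cont_on_local[where U = "Nb v (int i + 1)" and G = "F (int i + 1) j"])
           (use Nb_open holF[OF j] clow F_right[of "1 - x" j] j x False in \<open>auto elim: eventually_mono\<close>)
      show "cont_on c (1 - x) 1 (F (int i) j) (FM (int i + 1) j)"
      proof (rule cont_on_trans[of _ "3/2 - x"])
        show "cont_on c (1 - x) (3/2 - x) (F (int i) j) (FM (int i + 1) j)"
          by (rule cont_on_local[where U = "Nb v (int i)" and G = "F (int i) j"])
             (use Nb_open holF[OF j] cup F_left[of "3/2 - x" j] j x False in \<open>auto elim: eventually_mono\<close>)
        show "cont_on c (3/2 - x) 1 (FM (int i + 1) j) (FM (int i + 1) j)"
          by (rule cont_on_local[where U = "Nb v (int i + 1)" and G = "FM (int i + 1) j"])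
             (use Nb_open holFM clow x False in auto)
      qed (use x cc False in auto)
    qed (use x cc in auto)
    then show ?thesis using clow[of 0] x False by auto
  qed
  then obtain k where k: "c 0 \<in> Nb v k" "\<And>j. j < m \<Longrightarrow> cont_on c 0 1 (F k j) (FM k j)" by blast
  define u where "u = br v (c 0)"
  have c0: "c 0 \<in> Hp v" "u \<in> Om k" "c 0 \<noteq> 0" using k(1) Hp_nz by (auto simp: Nb_def u_def)
  have Eu: "E u = c 0" using c0 by (simp add: u_def E_br)
  have c01: "c 0 = \<omega> + of_real \<epsilon>" "c 1 = c 0" by (simp_all add: c_def circlepath)
  have near: "\<forall>\<^sub>F z in nhds (E u). br u z = br v z"
    using br_near[OF c0(1), of u 0] by (simp add: u_def[symmetric] Eu)
  obtain d where d: "path d" "path_image d \<subseteq> XX" "pathstart d = s0" "pathfinish d = E u"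
    "\<And>j. j < m \<Longrightarrow> continues_along d (b j) (\<lambda>z. gk k j (br u z))" using path_to[OF c0(2)] by blast
  have "has_monodromy m b (d +++ c +++ reversepath d) M"
  proof (rule loop_monodromy[OF _ d(1,3,4,5)])
    show "M \<in> carrier GG" by (simp add: M_def)
    show "path c" "pathstart c = E u" "pathfinish c = E u"
      unfolding Eu using c01 by (simp_all add: c_def pathstart_def pathfinish_def)
    fix j assume j: "j < m"
    have "continues_along c (F k j) (FM k j)" unfolding continues_along_iff by (rule k(2)[OF j])
    then show "continues_along c (\<lambda>z. gk k j (br u z)) (\<lambda>z. frame_mult m (gk k) M j (br u z))"
    proof (rule continues_along_cong)
      show "\<forall>\<^sub>F z in nhds (pathstart c). gk k j (br u z) = F k j z"
        using near unfolding Eu pathstart_def by eventually_elim (simp add: F_def)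
      show "\<forall>\<^sub>F z in nhds (pathfinish c). frame_mult m (gk k) M j (br u z) = FM k j z"
        using near unfolding Eu pathfinish_def c01(2) by eventually_elim (simp add: FM_def)
    qed
  qed
  moreover have "loop_around XX s0 (omega i) (d +++ c +++ reversepath d)"
    unfolding loop_around_def om using \<epsilon>(1) sub d Eu c01 c_def by (intro exI[of _ d] exI[of _ \<epsilon>]) auto
  ultimately show ?thesis unfolding M_def by blast
qed

text \<open>The circle lifts to a vertical path of length \<open>2 \<pi> \<gamma>\<close> in the right
  half-plane, where each turn contributes one factor \<open>hI\<close>.\<close>

lemma loop_infinity:
  "\<exists>p. loop_around_infinity XX s0 p \<and> has_monodromy m b p (hI [^]\<^bsub>GG\<^esub> \<gamma>)"
proof -
  define \<rho> where "\<rho> = \<kappa> * exp (1 / real \<gamma>)"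
  define c where "c = reversepath (circlepath 0 \<rho>)"
  have \<rho>: "\<rho> > 0" "\<rho> > \<kappa>" using \<kappa> \<gamma> by (auto simp: \<rho>_def)
  have E1: "E 1 = of_real \<rho>" by (simp add: E_def \<rho>_def exp_of_real[symmetric] of_real_divide)
  have one: "1 \<in> Om k" for k by (simp add: Om_def)
  have sub: "- ball (0::complex) \<rho> \<subseteq> XX"
  proof
    fix s :: complex assume s: "s \<in> - ball 0 \<rho>"
    then have "norm s \<ge> \<rho>" by simp
    then have "norm s > \<kappa>" "s \<noteq> 0" using \<rho> by auto
    moreover have "norm (E (2 * of_real pi * \<i> * of_int n)) = \<kappa>" for n by (simp add: norm_E)
    ultimately show "s \<in> XX" by (auto simp: XX_def)
  qed
  define w where "w = 1 - 2 * of_real pi * \<i> * of_nat \<gamma>"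
  define q where "q = linepath 1 w"
  have cq: "c = E \<circ> q"
  proof
    fix t
    have "q t = 1 - of_real t * (2 * of_real pi * \<i> * of_nat \<gamma>)"
      by (simp add: q_def w_def linepath_def algebra_simps scaleR_conv_of_real)
    then have "E (q t) = of_real \<kappa> * (exp (1 / of_nat \<gamma>) * exp (- (2 * of_real pi * \<i> * of_real t)))"
      using \<gamma> by (simp add: E_def exp_add[symmetric] diff_divide_distrib mult_ac)
    also have "of_real \<kappa> * (exp (1 / of_nat \<gamma>) * exp (- (2 * of_real pi * \<i> * of_real t))) = of_real \<rho> * exp (- (2 * of_real pi * \<i> * of_real t))"
      by (simp add: \<rho>_def exp_of_real[symmetric] of_real_divide)
    also have "exp (- (2 * of_real pi * \<i> * of_real t)) = exp (2 * of_real pi * \<i> * of_real (1 - t))"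
    proof -
      have "2 * of_real pi * \<i> * of_real (1 - t) = 2 * of_real pi * \<i> + - (2 * of_real pi * \<i> * of_real t)"
        by (simp add: algebra_simps)
      then have "exp (2 * of_real pi * \<i> * of_real (1 - t)) = exp (2 * of_real pi * \<i>) * exp (- (2 * of_real pi * \<i> * of_real t))"
        by (simp only: exp_add)
      then show ?thesis by simp
    qed
    finally show "c t = (E \<circ> q) t" by (simp add: c_def reversepath_def circlepath mult_ac)
  qed
  obtain d where d: "path d" "path_image d \<subseteq> XX" "pathstart d = s0" "pathfinish d = E 1"
    "\<And>j. j < m \<Longrightarrow> continues_along d (b j) (\<lambda>z. gk 0 j (br 1 z))" using path_to[OF one] by blast
  have gk0: "gk 0 j u = g j u" if "Re u > 0" "j < m" for j u using gk_right that by simp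
  have Ew: "E w = E 1" using E_shift[of 1 "-1"] by (simp add: w_def)
  have "has_monodromy m b (d +++ c +++ reversepath d) (hI [^]\<^bsub>GG\<^esub> \<gamma>)"
  proof (rule loop_monodromy[OF _ d(1,3,4,5)])
    show "hI [^]\<^bsub>GG\<^esub> \<gamma> \<in> carrier GG" using hI by simp
    show "path c" "pathstart c = E 1" "pathfinish c = E 1"
      unfolding E1 by (simp_all add: c_def)
    fix j assume j: "j < m"
    have "closed_segment 1 w \<subseteq> {u. Re u > 0}"
      by (intro closed_segment_subset convex_halfspace_Re_gt) (auto simp: w_def)
    then have qim: "path_image q \<subseteq> Om 0" by (auto simp: q_def Om_def)
    have "continues_along c (\<lambda>z. gk 0 j (br 1 z)) (\<lambda>z. gk 0 j (br w z))"
      using continues_along_lift[OF gk_holomorphic[OF j] open_Om _ qim] unfolding cq by (simp add: q_def)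
    then show "continues_along c (\<lambda>z. gk 0 j (br 1 z)) (\<lambda>z. frame_mult m (gk 0) (hI [^]\<^bsub>GG\<^esub> \<gamma>) j (br 1 z))"
    proof (rule continues_along_cong)
      have fin: "pathfinish c = E 1" unfolding E1 by (simp add: c_def)
      have "\<forall>\<^sub>F u in nhds (br 1 (E 1)). u \<in> {u. Re u > 0}"
        by (intro eventually_nhds_in_open open_halfspace_Re_gt) auto
      then have ev: "\<forall>\<^sub>F z in nhds (E 1). br 1 z \<in> {u. Re u > 0}"
        using br_tendsto[OF Hp(2)[of 1]] unfolding filterlim_iff by blast
      show "\<forall>\<^sub>F z in nhds (pathfinish c). frame_mult m (gk 0) (hI [^]\<^bsub>GG\<^esub> \<gamma>) j (br 1 z) = gk 0 j (br w z)"
        unfolding fin using ev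
      proof eventually_elim
        case (elim z)
        define u where "u = br 1 z"
        have u: "Re u > 0" using elim by (simp add: u_def)
        have bw: "br w z = u + 2 * of_real pi * \<i> * of_int (- int \<gamma>)" unfolding u_def br_def Ew by (simp add: w_def)
        have "gk 0 j (br w z) = g j (br w z)" by (rule gk0[OF _ j]) (use u in \<open>simp add: bw\<close>)
        also have "\<dots> = frame_mult m g (hI [^]\<^bsub>GG\<^esub> (- (- int \<gamma>))) j u" unfolding bw by (rule shift_right[OF u j])
        also have "\<dots> = frame_mult m (gk 0) (hI [^]\<^bsub>GG\<^esub> \<gamma>) j u"
          by (simp add: int_pow_int) (rule frame_mult_cong, rule gk0[OF u, symmetric])
        finally show ?case by (simp add: u_def)
      qed
    qed simp
  qed
  moreover have "loop_around_infinity XX s0 (d +++ c +++ reversepath d)"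
    unfolding loop_around_infinity_def using \<rho>(1) sub d E1 c_def by (intro exI[of _ d] exI[of _ \<rho>]) auto
  ultimately show ?thesis by blast
qed

lemma loop_around_loop_in:
  "loop_around XX s0 z p \<Longrightarrow> loop_in XX s0 p" "loop_around_infinity XX s0 p \<Longrightarrow> loop_in XX s0 p"
proof -
  assume "loop_around XX s0 z p"
  then obtain d \<epsilon> where d: "\<epsilon> > 0" "cball z \<epsilon> - {z} \<subseteq> XX" "path d" "path_image d \<subseteq> XX" "pathstart d = s0"
     "pathfinish d = z + of_real \<epsilon>" "p = d +++ circlepath z \<epsilon> +++ reversepath d" by (auto simp: loop_around_def)
  have "path_image (circlepath z \<epsilon>) \<subseteq> XX" using d(1,2) by auto
  then show "loop_in XX s0 p" using d unfolding loop_in_def by (auto simp: path_image_join)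
next
  assume "loop_around_infinity XX s0 p"
  then obtain d \<rho> where d: "\<rho> > 0" "- ball 0 \<rho> \<subseteq> XX" "path d" "path_image d \<subseteq> XX" "pathstart d = s0"
     "pathfinish d = of_real \<rho>" "p = d +++ reversepath (circlepath 0 \<rho>) +++ reversepath d" by (auto simp: loop_around_infinity_def)
  have "path_image (circlepath 0 \<rho>) \<subseteq> XX" using d(1,2) by auto
  then show "loop_in XX s0 p" using d unfolding loop_in_def by (auto simp: path_image_join)
qed

text \<open>Continuation stays in the class of admissible frames, and the generators are realized by
  explicit loops.\<close>

theorem monodromy_group_eq: "monodromy_group XX s0 m b = HH"
proof
  show "HH \<subseteq> monodromy_group XX s0 m b"
  proof (rule monodromy_group_super)
    show "hI [^]\<^bsub>GG\<^esub> \<gamma> \<in> monodromy_group XX s0 m b"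
      using loop_infinity loop_around_loop_in(2) unfolding monodromy_group_def by blast
    show "Mk (int i) \<in> monodromy_group XX s0 m b" if "i < \<gamma>" for i
      using loop_omega[OF that] loop_around_loop_in(1) unfolding monodromy_group_def by blast
  qed
qed (rule monodromy_group_sub)

end

section \<open>Operators with polynomial symbol\<close>

text \<open>Both the Euler operator and the ordinary derivative are of this form.\<close>

definition vf :: "(complex \<Rightarrow> complex) \<Rightarrow> (complex \<Rightarrow> complex) \<Rightarrow> complex \<Rightarrow> complex" where
  "vf h f s = h s * deriv f s"

lemma poly_op_le: "Polynomial.degree p \<le> n \<Longrightarrow> poly_op p T f s = (\<Sum>k\<le>n. Polynomial.coeff p k * (T ^^ k) f s)"
  unfolding poly_op_def by (rule sum.mono_neutral_left) (auto simp: Polynomial.coeff_eq_0)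

lemma poly_op_0: "poly_op 0 T f s = 0" by (simp add: poly_op_def)

lemma poly_op_pCons: "poly_op (pCons a p) T f s = a * f s + poly_op p T (T f) s"
proof -
  have "poly_op (pCons a p) T f s = (\<Sum>k\<le>Suc (Polynomial.degree p). Polynomial.coeff (pCons a p) k * (T ^^ k) f s)"
    by (rule poly_op_le) (simp add: degree_pCons_le)
  also have "\<dots> = a * f s + (\<Sum>k\<le>Polynomial.degree p. Polynomial.coeff p k * (T ^^ k) (T f) s)"
    by (subst sum.atMost_Suc_shift) (simp add: funpow_swap1)
  finally show ?thesis by (simp add: poly_op_def)
qed

lemma poly_op_add: "poly_op (p + q) T f s = poly_op p T f s + poly_op q T f s"
proof -
  define n where "n = max (Polynomial.degree p) (Polynomial.degree q)"
  have "Polynomial.degree (p + q) \<le> n" "Polynomial.degree p \<le> n" "Polynomial.degree q \<le> n"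
    by (auto simp: n_def degree_add_le_max)
  then show ?thesis by (simp add: poly_op_le sum.distrib algebra_simps)
qed

lemma poly_op_smult: "poly_op (Polynomial.smult a p) T f s = a * poly_op p T f s"
  by (subst poly_op_le[of _ "Polynomial.degree p"]) (simp_all add: degree_smult_le poly_op_def sum_distrib_left mult_ac)

lemma vf_cong:
  assumes "open U" "\<And>s. s \<in> U \<Longrightarrow> f s = g s" "s \<in> U"
  shows "vf h f s = vf h g s"
proof -
  have "\<forall>\<^sub>F z in nhds s. f z = g z"
    by (rule eventually_mono[OF eventually_nhds_in_open[OF assms(1,3)]]) (rule assms(2))
  then have "deriv f s = deriv g s" by (rule deriv_cong_ev) simp
  then show ?thesis by (simp add: vf_def)
qed

lemma vf_pow_cong:
  "open U \<Longrightarrow> (\<And>s. s \<in> U \<Longrightarrow> f s = g s) \<Longrightarrow> s \<in> U \<Longrightarrow> (vf h ^^ k) f s = (vf h ^^ k) g s"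
proof (induction k arbitrary: s)
  case (Suc k)
  then show ?case using vf_cong[of U "(vf h ^^ k) f" "(vf h ^^ k) g" s h] by simp
qed simp

lemma poly_op_cong:
  assumes "open U" "\<And>s. s \<in> U \<Longrightarrow> f s = g s" "s \<in> U"
  shows "poly_op p (vf h) f s = poly_op p (vf h) g s"
  unfolding poly_op_def by (simp add: vf_pow_cong[OF assms])

locale vector_field =
  fixes U :: "complex set" and h :: "complex \<Rightarrow> complex"
  assumes U: "open U" and h: "h holomorphic_on U"
begin

abbreviation "T \<equiv> vf h"

lemma T_hol: "f holomorphic_on U \<Longrightarrow> T f holomorphic_on U"
  unfolding vf_def[abs_def] by (rule holomorphic_on_mult[OF h holomorphic_deriv[OF _ U]])

lemma Tk_hol: "f holomorphic_on U \<Longrightarrow> (T ^^ k) f holomorphic_on U"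
  by (induction k) (auto intro: T_hol)

lemma poly_op_hol: "f holomorphic_on U \<Longrightarrow> poly_op p T f holomorphic_on U"
  unfolding poly_op_def[abs_def] by (intro holomorphic_intros Tk_hol) auto

lemma fd: "f holomorphic_on U \<Longrightarrow> s \<in> U \<Longrightarrow> f field_differentiable at s"
  by (rule holomorphic_on_imp_differentiable_at[OF _ U])

lemma T_add: "f holomorphic_on U \<Longrightarrow> g holomorphic_on U \<Longrightarrow> s \<in> U \<Longrightarrow> T (\<lambda>s. f s + g s) s = T f s + T g s"
  unfolding vf_def by (subst deriv_add) (auto intro: fd simp: algebra_simps)

lemma T_cmult: "f holomorphic_on U \<Longrightarrow> s \<in> U \<Longrightarrow> T (\<lambda>s. c * f s) s = c * T f s"
  unfolding vf_def by (subst deriv_cmult) (auto intro: fd simp: algebra_simps)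

lemma T_mult: "f holomorphic_on U \<Longrightarrow> g holomorphic_on U \<Longrightarrow> s \<in> U \<Longrightarrow> T (\<lambda>s. f s * g s) s = f s * T g s + T f s * g s"
  unfolding vf_def by (subst deriv_mult) (auto intro: fd simp: algebra_simps)

lemma T_sum: "(\<And>k. k \<in> A \<Longrightarrow> f k holomorphic_on U) \<Longrightarrow> s \<in> U \<Longrightarrow> finite A \<Longrightarrow> T (\<lambda>s. \<Sum>k\<in>A. f k s) s = (\<Sum>k\<in>A. T (f k) s)"
proof -
  assume f: "\<And>k. k \<in> A \<Longrightarrow> f k holomorphic_on U" and s: "s \<in> U" and "finite A"
  from \<open>finite A\<close> f show ?thesis
  proof (induction A rule: finite_induct)
    case empty then show ?case by (simp add: vf_def)
  next
    case (insert x F)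
    have "T (\<lambda>s. f x s + (\<Sum>k\<in>F. f k s)) s = T (f x) s + T (\<lambda>s. \<Sum>k\<in>F. f k s) s"
    proof (rule T_add)
      show "f x holomorphic_on U" using insert.prems by simp
      show "(\<lambda>s. \<Sum>k\<in>F. f k s) holomorphic_on U"
        by (rule holomorphic_on_sum) (use insert.prems in simp)
    qed (rule s)
    moreover have "T (\<lambda>s. \<Sum>k\<in>F. f k s) s = (\<Sum>k\<in>F. T (f k) s)"
      using insert by simp
    ultimately show ?case using insert.hyps by simp
  qed
qed

lemma poly_op_fun_add:
  "f holomorphic_on U \<Longrightarrow> g holomorphic_on U \<Longrightarrow> s \<in> U \<Longrightarrow> poly_op p T (\<lambda>s. f s + g s) s = poly_op p T f s + poly_op p T g s"
proof (induction p arbitrary: f g s)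
  case (pCons a p)
  have "poly_op p T (T (\<lambda>s. f s + g s)) s = poly_op p T (\<lambda>s. T f s + T g s) s"
    using pCons.prems by (intro poly_op_cong[OF U] T_add) auto
  then show ?case using pCons T_hol by (simp add: poly_op_pCons algebra_simps)
qed (simp add: poly_op_0)

lemma poly_op_fun_cmult:
  "f holomorphic_on U \<Longrightarrow> s \<in> U \<Longrightarrow> poly_op p T (\<lambda>s. c * f s) s = c * poly_op p T f s"
proof (induction p arbitrary: f s)
  case (pCons a p)
  have "poly_op p T (T (\<lambda>s. c * f s)) s = poly_op p T (\<lambda>s. c * T f s) s"
    using pCons.prems by (intro poly_op_cong[OF U] T_cmult) auto
  then show ?case using pCons T_hol by (simp add: poly_op_pCons algebra_simps)
qed (simp add: poly_op_0)

lemma T_poly_op: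
  assumes "f holomorphic_on U" "s \<in> U" shows "T (poly_op p T f) s = poly_op p T (T f) s"
proof -
  have "T (\<lambda>s. \<Sum>k\<le>Polynomial.degree p. Polynomial.coeff p k * (T ^^ k) f s) s
     = (\<Sum>k\<le>Polynomial.degree p. T (\<lambda>s. Polynomial.coeff p k * (T ^^ k) f s) s)"
    using assms by (intro T_sum holomorphic_on_mult holomorphic_on_const Tk_hol) auto
  also have "\<dots> = (\<Sum>k\<le>Polynomial.degree p. Polynomial.coeff p k * T ((T ^^ k) f) s)"
    using assms by (intro sum.cong refl T_cmult Tk_hol)
  also have "\<dots> = poly_op p T (T f) s" by (simp add: poly_op_def funpow_swap1)
  finally show ?thesis by (simp add: poly_op_def[abs_def])
qed

lemma poly_op_mult:
  "f holomorphic_on U \<Longrightarrow> s \<in> U \<Longrightarrow> poly_op (p * q) T f s = poly_op p T (poly_op q T f) s"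
proof (induction p arbitrary: f s)
  case (pCons a p)
  have "poly_op (pCons a p * q) T f s = a * poly_op q T f s + poly_op (p * q) T (T f) s"
    by (simp add: poly_op_add poly_op_smult poly_op_pCons)
  also have "poly_op (p * q) T (T f) s = poly_op p T (poly_op q T (T f)) s"
    using pCons T_hol by blast
  also have "\<dots> = poly_op p T (T (poly_op q T f)) s"
    using pCons.prems by (intro poly_op_cong[OF U] T_poly_op[symmetric]) auto
  finally show ?case by (simp add: poly_op_pCons)
qed (simp add: poly_op_0)

text \<open>Conjugation by an eigenfunction of the derivation shifts the symbol by the eigenvalue.\<close>

lemma poly_op_eigen:
  assumes e: "e holomorphic_on U" "\<And>s. s \<in> U \<Longrightarrow> T e s = \<mu> * e s"
  shows "f holomorphic_on U \<Longrightarrow> s \<in> U \<Longrightarrow>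
     poly_op p T (\<lambda>s. e s * f s) s = e s * poly_op (pcompose p [:\<mu>, 1:]) T f s"
proof (induction p arbitrary: f s)
  case (pCons a p)
  let ?r = "pcompose p [:\<mu>, 1:]"
  have hol: "(\<lambda>s. \<mu> * f s + T f s) holomorphic_on U" "(\<lambda>s. \<mu> * f s) holomorphic_on U"
    using pCons.prems by (auto intro!: holomorphic_intros T_hol)
  have "poly_op p T (T (\<lambda>s. e s * f s)) s = poly_op p T (\<lambda>s. e s * (\<mu> * f s + T f s)) s"
    using pCons.prems e by (intro poly_op_cong[OF U]) (auto simp: T_mult algebra_simps)
  also have "\<dots> = e s * poly_op ?r T (\<lambda>s. \<mu> * f s + T f s) s" using hol pCons by blast
  also have "\<dots> = e s * (\<mu> * poly_op ?r T f s + poly_op ?r T (T f) s)"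
    using pCons.prems hol by (simp add: poly_op_fun_add poly_op_fun_cmult T_hol)
  finally show ?case
    by (simp add: poly_op_pCons pcompose_pCons poly_op_add poly_op_smult poly_op_0 algebra_simps)
qed (simp add: poly_op_0)

lemma poly_op_scale:
  "f holomorphic_on U \<Longrightarrow> s \<in> U \<Longrightarrow>
     poly_op p (vf (\<lambda>s. c * h s)) f s = poly_op (pcompose p [:0, c:]) T f s"
proof (induction p arbitrary: f s)
  case (pCons a p)
  have eq: "vf (\<lambda>s. c * h s) f = (\<lambda>s. c * T f s)" by (simp add: vf_def fun_eq_iff)
  have hol: "(\<lambda>s. c * T f s) holomorphic_on U" using pCons.prems by (intro holomorphic_intros T_hol)
  have "poly_op p (vf (\<lambda>s. c * h s)) (\<lambda>s. c * T f s) s = poly_op (pcompose p [:0, c:]) T (\<lambda>s. c * T f s) s"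
    using hol pCons by blast
  also have "\<dots> = c * poly_op (pcompose p [:0, c:]) T (T f) s"
    using pCons.prems by (intro poly_op_fun_cmult T_hol)
  finally show ?case
    by (simp add: poly_op_pCons pcompose_pCons poly_op_add poly_op_smult poly_op_0 eq)
qed (simp add: poly_op_0)

lemma poly_op_zero_fun: "s \<in> U \<Longrightarrow> poly_op p T (\<lambda>_. 0) s = 0"
  using poly_op_fun_cmult[of "\<lambda>_. 0" s p 0] by simp

text \<open>In the coordinate \<open>l\<close> the vector field is the ordinary derivative.\<close>

lemma poly_op_pullback:
  assumes l: "l holomorphic_on U" "l ` U \<subseteq> A" "\<And>s. s \<in> U \<Longrightarrow> h s * deriv l s = 1" and A: "open A"
  shows "G holomorphic_on A \<Longrightarrow> s \<in> U \<Longrightarrow> poly_op p T (\<lambda>s. G (l s)) s = poly_op p deriv G (l s)"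
proof (induction p arbitrary: G s)
  case (pCons a p)
  have "poly_op p T (T (\<lambda>s. G (l s))) s = poly_op p T (\<lambda>s. deriv G (l s)) s"
  proof (rule poly_op_cong[OF U _ pCons.prems(2)])
    fix s assume s: "s \<in> U"
    have "l field_differentiable at s" using fd[OF l(1) s] .
    moreover have "G field_differentiable at (l s)"
      using pCons.prems(1) A l(2) s by (auto simp: holomorphic_on_def at_within_open[OF _ A] image_subset_iff)
    ultimately have "deriv (G \<circ> l) s = deriv G (l s) * deriv l s" by (rule deriv_chain)
    then show "T (\<lambda>s. G (l s)) s = deriv G (l s)" using l(3)[OF s] by (simp add: vf_def o_def algebra_simps)
  qed
  also have "\<dots> = poly_op p deriv (deriv G) (l s)"
    using pCons holomorphic_deriv[OF pCons.prems(1) A] by blast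
  finally show ?case by (simp add: poly_op_pCons)
qed (simp add: poly_op_0)

text \<open>By induction every derivative is a combination, with holomorphic coefficients, of the first
  \<open>m\<close> iterates of the vector field. If these vanish at one point, so does the whole
  Taylor series there.\<close>

lemma ode_unique:
  assumes f: "f holomorphic_on U" and con: "connected U" and s0: "s0 \<in> U" and h0: "\<And>s. s \<in> U \<Longrightarrow> h s \<noteq> 0"
    and m: "m > 0" and r: "\<And>k. k < m \<Longrightarrow> r k holomorphic_on U"
    and ode: "\<And>s. s \<in> U \<Longrightarrow> (T ^^ m) f s = (\<Sum>k<m. r k s * (T ^^ k) f s)"
    and zero: "\<And>k. k < m \<Longrightarrow> (T ^^ k) f s0 = 0" and s: "s \<in> U"
  shows "f s = 0"
proof -
  have "\<exists>c. (\<forall>k<m. c k holomorphic_on U) \<and> (\<forall>s\<in>U. (deriv ^^ n) f s = (\<Sum>k<m. c k s * (T ^^ k) f s))" for n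
  proof (induction n)
    case 0
    have "(\<Sum>k<m. (if k = 0 then 1 else 0) * (T ^^ k) f s) = f s" for s
      using m by (subst sum.remove[of _ 0]) (auto intro: sum.neutral)
    then show ?case by (intro exI[of _ "\<lambda>k s. if k = 0 then 1 else 0"]) auto
  next
    case (Suc n)
    then obtain c where c: "\<And>k. k < m \<Longrightarrow> c k holomorphic_on U"
      "\<And>s. s \<in> U \<Longrightarrow> (deriv ^^ n) f s = (\<Sum>k<m. c k s * (T ^^ k) f s)" by blast
    define d where "d = (\<lambda>k s. deriv (c k) s + (if k = 0 then 0 else c (k - 1) s / h s) + c (m - 1) s / h s * r k s)"
    have "d k holomorphic_on U" if "k < m" for k
      unfolding d_def using that m c(1) h h0 r U by (cases "k = 0") (auto intro!: holomorphic_intros)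
    moreover have "(deriv ^^ Suc n) f s = (\<Sum>k<m. d k s * (T ^^ k) f s)" if s: "s \<in> U" for s
    proof -
      have "h s * (deriv ^^ Suc n) f s = T ((deriv ^^ n) f) s" by (simp add: vf_def)
      also have "\<dots> = T (\<lambda>s. \<Sum>k<m. c k s * (T ^^ k) f s) s" by (rule vf_cong[OF U c(2) s])
      also have "\<dots> = (\<Sum>k<m. T (\<lambda>s. c k s * (T ^^ k) f s) s)"
        using c(1) f s by (intro T_sum holomorphic_on_mult Tk_hol) auto
      also have "\<dots> = (\<Sum>k<m. h s * deriv (c k) s * (T ^^ k) f s + c k s * (T ^^ Suc k) f s)"
      proof (rule sum.cong[OF refl])
        fix k assume "k \<in> {..<m}"
        then have "T (\<lambda>s. c k s * (T ^^ k) f s) s = c k s * T ((T ^^ k) f) s + T (c k) s * (T ^^ k) f s"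
          using c(1) by (intro T_mult Tk_hol f s) auto
        moreover have "T (c k) s = h s * deriv (c k) s" by (simp add: vf_def)
        ultimately show "T (\<lambda>s. c k s * (T ^^ k) f s) s = h s * deriv (c k) s * (T ^^ k) f s + c k s * (T ^^ Suc k) f s"
          by simp
      qed
      also have "\<dots> = (\<Sum>k<m. h s * deriv (c k) s * (T ^^ k) f s) + (\<Sum>k<m. c k s * (T ^^ Suc k) f s)"
        by (rule sum.distrib)
      also have "(\<Sum>k<m. c k s * (T ^^ Suc k) f s) = (\<Sum>k<m. (if k = 0 then 0 else c (k - 1) s) * (T ^^ k) f s) + c (m - 1) s * (T ^^ m) f s"
      proof -
        obtain m' where m': "m = Suc m'" using m gr0_implies_Suc by blast
        have "(\<Sum>k<m. (if k = 0 then 0 else c (k - 1) s) * (T ^^ k) f s) = (\<Sum>k<m'. c k s * (T ^^ Suc k) f s)"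
          unfolding m' sum.lessThan_Suc_shift by simp
        then show ?thesis unfolding m' by simp
      qed
      also have "c (m - 1) s * (T ^^ m) f s = (\<Sum>k<m. c (m - 1) s * r k s * (T ^^ k) f s)"
        unfolding ode[OF s] by (simp add: sum_distrib_left mult.assoc)
      also have "(\<Sum>k<m. h s * deriv (c k) s * (T ^^ k) f s) + ((\<Sum>k<m. (if k = 0 then 0 else c (k - 1) s) * (T ^^ k) f s)
          + (\<Sum>k<m. c (m - 1) s * r k s * (T ^^ k) f s)) = (\<Sum>k<m. h s * (d k s * (T ^^ k) f s))"
        unfolding sum.distrib[symmetric]
      proof (rule sum.cong[OF refl])
        fix k
        show "h s * deriv (c k) s * (T ^^ k) f s + ((if k = 0 then 0 else c (k - 1) s) * (T ^^ k) f s
          + c (m - 1) s * r k s * (T ^^ k) f s) = h s * (d k s * (T ^^ k) f s)"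
          unfolding d_def using h0[OF s] by (cases "k = 0") (simp_all add: field_simps)
      qed
      finally have "h s * (deriv ^^ Suc n) f s = (\<Sum>k<m. h s * (d k s * (T ^^ k) f s))" .
      then show ?thesis using h0[OF s] by (simp add: sum_distrib_left[symmetric])
    qed
    ultimately show ?case by blast
  qed
  then have "(deriv ^^ n) f s0 = 0" for n using zero s0 by (metis (no_types, lifting) lessThan_iff mult_zero_right sum.neutral)
  then show ?thesis using holomorphic_fun_eq_0_on_connected[OF f U con _ s0 s] by blast
qed

end

lemma poly_op_deriv_shift: "poly_op p deriv (\<lambda>u. f (u + c)) u = poly_op p deriv f (u + c)"
proof (induction p arbitrary: f u)
  case (pCons a p)
  have "deriv (\<lambda>u. f (u + c)) = (\<lambda>u. deriv f (u + c))"
    unfolding deriv_def by (simp add: DERIV_shift fun_eq_iff)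
  then show ?case using pCons by (simp add: poly_op_pCons)
qed (simp add: poly_op_0)

lemma cfun_sum: "(\<Sum>i\<in>A. (\<lambda>z. c i * f i z)) = (\<lambda>z. \<Sum>i\<in>A. c i * (f i z :: complex))" for f :: "'i \<Rightarrow> complex \<Rightarrow> complex"
  by (induction A rule: infinite_finite_induct) (auto simp: fun_eq_iff)

text \<open>The linear functionals \<open>J\<close> inject \<open>V\<close> into an
  \<open>m\<close>-dimensional space, so \<open>m\<close> independent vectors already span.\<close>

lemma span_of_independent:
  fixes v :: "nat \<Rightarrow> complex \<Rightarrow> complex" and J :: "(complex \<Rightarrow> complex) \<Rightarrow> nat \<Rightarrow> complex"
  assumes V: "cfun.subspace V" and vV: "\<And>j. j < m \<Longrightarrow> v j \<in> V"
    and ind: "\<And>x. (\<forall>z. (\<Sum>i<m. x i * v i z) = 0) \<Longrightarrow> \<forall>i<m. x i = 0"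
    and Jadd: "\<And>f g k. f \<in> V \<Longrightarrow> g \<in> V \<Longrightarrow> J (\<lambda>z. f z + g z) k = J f k + J g k"
    and Jscale: "\<And>f c k. f \<in> V \<Longrightarrow> J (\<lambda>z. c * f z) k = c * J f k"
    and Jinj: "\<And>f. f \<in> V \<Longrightarrow> (\<And>k. k < m \<Longrightarrow> J f k = 0) \<Longrightarrow> f = (\<lambda>_. 0)"
  shows "is_basis V m v"
proof -
  have inj: "inj_on v {..<m}"
  proof (rule inj_onI, rule ccontr)
    fix i j assume ij: "i \<in> {..<m}" "j \<in> {..<m}" "v i = v j" "i \<noteq> j"
    define x where "x = (\<lambda>k. if k = i then 1 else if k = j then -1 else 0 :: complex)"
    have "(\<Sum>k<m. x k * v k z) = 0" for z
    proof -
      have "(\<Sum>k<m. x k * v k z) = (\<Sum>k\<in>{i, j}. x k * v k z)"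
        using ij by (intro sum.mono_neutral_right) (auto simp: x_def)
      then show ?thesis using ij by (simp add: x_def)
    qed
    then have "x i = 0" using ind[of x] ij by auto
    then show False by (simp add: x_def)
  qed
  have indep: "cfun.independent (v ` {..<m})"
  proof (subst cfun.dependent_finite)
    show "\<not> (\<exists>u. (\<exists>w\<in>v ` {..<m}. u w \<noteq> 0) \<and> (\<Sum>w\<in>v ` {..<m}. (\<lambda>z. u w * w z)) = 0)"
    proof
      assume "\<exists>u. (\<exists>w\<in>v ` {..<m}. u w \<noteq> 0) \<and> (\<Sum>w\<in>v ` {..<m}. (\<lambda>z. u w * w z)) = 0"
      then obtain u i where u: "i < m" "u (v i) \<noteq> 0" "(\<Sum>w\<in>v ` {..<m}. (\<lambda>z. u w * w z)) = 0" by auto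
      have "(\<Sum>w\<in>v ` {..<m}. (\<lambda>z. u w * w z)) = (\<Sum>k<m. (\<lambda>z. u (v k) * v k z))"
        by (subst sum.reindex[OF inj]) simp
      then have "(\<Sum>k<m. u (v k) * v k z) = 0" for z using u(3) unfolding cfun_sum by (simp add: fun_eq_iff)
      then have "u (v i) = 0" using ind[of "\<lambda>k. u (v k)"] u(1) by blast
      with u(2) show False by simp
    qed
  qed simp
  have "f \<in> cfun.span (v ` {..<m})" if f: "f \<in> V" for f
  proof (rule ccontr)
    assume nf: "f \<notin> cfun.span (v ` {..<m})"
    define w where "w = (\<lambda>k. if k < m then v k else f)"
    have wV: "w k \<in> V" for k using vV f by (simp add: w_def)
    \<comment> \<open>\<open>m + 1\<close> vectors have linearly dependent images under \<open>J\<close>, which takes values in an \<open>m\<close>-dimensional space.\<close>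
    define A where "A = Matrix.mat (Suc m) (Suc m) (\<lambda>(k, l). if k < m then J (w l) k else 0)"
    have A: "A \<in> carrier_mat (Suc m) (Suc m)" by (simp add: A_def)
    have "Determinant.det A = 0"
    proof -
      have "A\<^sup>T *\<^sub>v unit_vec (Suc m) m = 0\<^sub>v (Suc m)"
        by (intro eq_vecI) (auto simp: A_def)
      moreover have "unit_vec (Suc m) m \<noteq> (0\<^sub>v (Suc m) :: complex vec)" by simp
      ultimately have "Determinant.det (A\<^sup>T) = 0"
        using det_0_iff_vec_prod_zero[of "A\<^sup>T" "Suc m"] A by (metis transpose_carrier_mat unit_vec_carrier)
      then show ?thesis using det_transpose[OF A] by simp
    qed
    then obtain y where y: "y \<in> carrier_vec (Suc m)" "y \<noteq> 0\<^sub>v (Suc m)" "A *\<^sub>v y = 0\<^sub>v (Suc m)"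
      using det_0_iff_vec_prod_zero[OF A] by auto
    define F where "F = (\<lambda>n z. \<Sum>l<n. y $ l * w l z)"
    have FV: "F n \<in> V \<and> (\<forall>k. J (F n) k = (\<Sum>l<n. y $ l * J (w l) k))" for n
    proof (induction n)
      case 0
      have z: "(\<lambda>z. 0 * w 0 z) \<in> V" using cfun.subspace_scale[OF V wV] .
      have "J (\<lambda>z. 0 * w 0 z) k = 0" for k using Jscale[OF wV[of 0], of 0 k] by simp
      then show ?case using z by (simp add: F_def)
    next
      case (Suc n)
      have 1: "(\<lambda>z. y $ n * w n z) \<in> V" using cfun.subspace_scale[OF V wV] .
      have eq: "F (Suc n) = (\<lambda>z. F n z + y $ n * w n z)" by (simp add: F_def)
      have "F (Suc n) \<in> V" using cfun.subspace_add[OF V _ 1, of "F n"] Suc by (simp add: eq plus_fun_def)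
      moreover have "J (F (Suc n)) k = (\<Sum>l<Suc n. y $ l * J (w l) k)" for k
        unfolding eq using Jadd[OF _ 1, of "F n"] Jscale[OF wV] Suc by simp
      ultimately show ?case by blast
    qed
    have "J (F (Suc m)) k = 0" if k: "k < m" for k
    proof -
      have "0 = (A *\<^sub>v y) $ k" using y(3) k by simp
      also have "\<dots> = (\<Sum>l<Suc m. y $ l * J (w l) k)"
        using k y(1) by (simp add: A_def scalar_prod_def lessThan_atLeast0 mult.commute del: sum.op_ivl_Suc)
      finally show ?thesis using FV by simp
    qed
    then have "F (Suc m) = (\<lambda>_. 0)" using Jinj FV by blast
    then have rel: "(\<Sum>l<m. y $ l * v l z) + y $ m * f z = 0" for z
      by (auto simp: F_def w_def fun_eq_iff)
    have ym: "y $ m \<noteq> 0"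
    proof
      assume 0: "y $ m = 0"
      then have "(\<Sum>l<m. y $ l * v l z) = 0" for z using rel[of z] by simp
      then have "\<forall>l<m. y $ l = 0" using ind[of "\<lambda>l. y $ l"] by blast
      then have "y = 0\<^sub>v (Suc m)" using y(1) 0 by (intro eq_vecI) (auto simp: less_Suc_eq)
      with y(2) show False by simp
    qed
    have "f z = (\<Sum>l<m. (- y $ l / y $ m) * v l z)" for z
    proof -
      have "y $ m * f z = - (\<Sum>l<m. y $ l * v l z)" using rel[of z] by (simp add: eq_neg_iff_add_eq_0 add.commute)
      then have "f z = - (\<Sum>l<m. y $ l * v l z) / y $ m" using ym by (simp add: field_simps)
      then show ?thesis by (simp add: sum_divide_distrib sum_negf)
    qed
    then have "f = (\<Sum>l<m. (\<lambda>z. (- y $ l / y $ m) * v l z))" unfolding cfun_sum by (simp add: fun_eq_iff)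
    also have "\<dots> \<in> cfun.span (v ` {..<m})"
      by (intro cfun.span_sum cfun.span_scale cfun.span_base) auto
    finally show False using nf by simp
  qed
  moreover have "cfun.span (v ` {..<m}) \<subseteq> V"
    using vV by (intro cfun.span_minimal V) auto
  ultimately have "cfun.span (v ` {..<m}) = V" by blast
  then show ?thesis using inj indep unfolding is_basis_def by blast
qed

section \<open>Exponents and cyclotomic polynomials\<close>

text \<open>The combinatorial content of the simplex: positive integers with sum \<open>\<gamma>\<close>.\<close>

locale volumes_data =
  fixes n \<gamma> :: nat and B :: "nat \<Rightarrow> nat"
  assumes n: "n \<ge> 1" and \<gamma>: "\<gamma> > 0" and B: "\<And>q. q \<in> {1..n+1} \<Longrightarrow> B q > 0"
    and sum_B: "(\<Sum>q=1..n+1. B q) = \<gamma>"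
begin

abbreviation "Aset \<equiv> C_plus \<gamma> - C_zero n \<gamma> B"
abbreviation "Bset \<equiv> C_minus n B - C_zero n \<gamma> B"

lemma C_plus_set: "C_plus \<gamma> = mset_set ((\<lambda>j. real j / real \<gamma>) ` {0..<\<gamma>})"
  unfolding C_plus_def using \<gamma> by (intro image_mset_mset_set) (auto simp: inj_on_def)

lemma size_C_plus: "size (C_plus \<gamma>) = \<gamma>" by (simp add: C_plus_def)

lemma size_C_minus: "size (C_minus n B) = \<gamma>"
proof -
  have "size (\<Sum>q\<in>S. image_mset (\<lambda>j. real j / real (B q)) (mset_set {0..<B q})) = (\<Sum>q\<in>S. B q)" if "finite S" for S
    using that by (induction S rule: finite_induct) auto
  then show ?thesis unfolding C_minus_def sum_B[symmetric] by simp
qed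

lemma mem_C_plus: "x \<in># C_plus \<gamma> \<longleftrightarrow> (\<exists>j<\<gamma>. x = real j / real \<gamma>)"
  by (auto simp: C_plus_def)

lemma mem_C_minus: "x \<in># C_minus n B \<longleftrightarrow> (\<exists>q\<in>{1..n+1}. \<exists>j<B q. x = real j / real (B q))"
proof -
  have "x \<in># (\<Sum>q\<in>S. image_mset (\<lambda>j. real j / real (B q)) (mset_set {0..<B q}))
     \<longleftrightarrow> (\<exists>q\<in>S. \<exists>j<B q. x = real j / real (B q))" if "finite S" for S
    using that by (induction S rule: finite_induct) auto
  from this[of "{1..n+1}"] show ?thesis unfolding C_minus_def by blast
qed

lemma C_zero_sub: "C_zero n \<gamma> B \<subseteq># C_plus \<gamma>" "C_zero n \<gamma> B \<subseteq># C_minus n B"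
  by (auto simp: C_zero_def)

lemma count_C_plus: "count (C_plus \<gamma>) x \<le> 1"
  unfolding C_plus_set by (simp add: count_mset_set')

lemma mem_C_zero: "x \<in># C_zero n \<gamma> B \<longleftrightarrow> x \<in># C_plus \<gamma> \<and> x \<in># C_minus n B"
  by (simp add: C_zero_def)

lemma zero_mem: "0 \<in># C_plus \<gamma>" "0 \<in># C_minus n B" "0 \<in># C_zero n \<gamma> B"
proof -
  show 1: "0 \<in># C_plus \<gamma>" unfolding mem_C_plus using \<gamma> by (intro exI[of _ 0]) auto
  show 2: "0 \<in># C_minus n B" unfolding mem_C_minus using B[of 1] by (intro bexI[of _ 1] exI[of _ 0]) auto
  show "0 \<in># C_zero n \<gamma> B" using 1 2 by (simp add: mem_C_zero)
qed

lemma mem_Aset: "x \<in># Aset \<longleftrightarrow> x \<in># C_plus \<gamma> \<and> x \<notin># C_minus n B"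
proof -
  have "(0 < a - b) = (0 < a \<and> b = 0)" if "a \<le> 1" for a b :: nat using that by arith
  from this[OF count_C_plus, of x "count (C_minus n B) x"]
  have "count Aset x > 0 \<longleftrightarrow> count (C_plus \<gamma>) x > 0 \<and> count (C_minus n B) x = 0"
    by (simp add: C_zero_def)
  then show ?thesis unfolding count_greater_zero_iff count_eq_zero_iff .
qed

lemma Aset_range: "a \<in># Aset \<Longrightarrow> 0 < a \<and> a < 1"
proof -
  assume a: "a \<in># Aset"
  then obtain j where j: "j < \<gamma>" "a = real j / real \<gamma>" by (auto simp: mem_Aset mem_C_plus)
  moreover have "a \<noteq> 0" using a zero_mem(2) by (auto simp: mem_Aset)
  ultimately have "j > 0" by (auto intro: gr0I)
  then show ?thesis using j by simp
qed

lemma Bset_range: "b \<in># Bset \<Longrightarrow> 0 \<le> b \<and> b < 1"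
proof -
  assume "b \<in># Bset"
  then have "b \<in># C_minus n B" by (rule in_diffD)
  then show ?thesis unfolding mem_C_minus by (auto simp: field_simps)
qed

lemma size_Aset: "size Aset = gamma_bar n \<gamma> B" by (simp add: gamma_bar_def)

text \<open>Both multisets have \<open>\<gamma>\<close> elements, so removing the same intersection leaves
  multisets of equal size; this makes the reduced operator balanced.\<close>

lemma size_Bset: "size Bset = gamma_bar n \<gamma> B"
  unfolding gamma_bar_def using C_zero_sub by (simp add: size_Diff_submset size_C_plus size_C_minus)

text \<open>The exponent \<open>0\<close> occurs \<open>n + 1\<close> times in \<open>C_minus\<close> but
  only once in \<open>C_plus\<close>.\<close>

lemma gamma_bar_pos: "gamma_bar n \<gamma> B > 0"
proof -
  have "count (\<Sum>q\<in>S. image_mset (\<lambda>j. real j / real (B q)) (mset_set {0..<B q})) 0 \<ge> card S"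
    if "finite S" "S \<subseteq> {1..n+1}" for S
    using that
  proof (induction S rule: finite_induct)
    case (insert q S)
    then have "B q > 0" using B by auto
    then have "0 \<in># image_mset (\<lambda>j. real j / real (B q)) (mset_set {0..<B q})" by (auto intro!: image_eqI[of _ _ 0])
    then have "count (image_mset (\<lambda>j. real j / real (B q)) (mset_set {0..<B q})) 0 \<ge> 1"
      by (simp add: Suc_leI count_greater_zero_iff del: set_image_mset)
    moreover have "card S \<le> count (\<Sum>q\<in>S. image_mset (\<lambda>j. real j / real (B q)) (mset_set {0..<B q})) 0"
      using insert by blast
    ultimately show ?case unfolding sum.insert[OF insert.hyps] count_union card_insert_disjoint[OF insert.hyps] by linarith
  qed simp
  from this[of "{1..n+1}"] have "count (C_minus n B) 0 \<ge> n + 1" unfolding C_minus_def by simp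
  moreover have "count (C_zero n \<gamma> B) 0 \<le> 1" using count_C_plus[of 0] by (simp add: C_zero_def)
  ultimately have "count Bset 0 > 0" using n by simp
  then have "0 \<in># Bset" by (simp only: count_greater_zero_iff)
  then have "Bset \<noteq> {#}" by auto
  then show ?thesis using size_Bset by (metis nonempty_has_size)
qed

lemma count_Aset: "count Aset x \<le> 1" using count_C_plus[of x] by simp

end

definition integral_poly :: "complex poly \<Rightarrow> bool" where
  "integral_poly p \<longleftrightarrow> (\<exists>q :: int poly. p = map_poly of_int q)"

lemma integral_poly_coeff: "integral_poly p \<longleftrightarrow> (\<forall>i. Polynomial.coeff p i \<in> \<int>)"
proof
  assume "integral_poly p" then show "\<forall>i. Polynomial.coeff p i \<in> \<int>" by (auto simp: integral_poly_def coeff_map_poly)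
next
  assume a: "\<forall>i. Polynomial.coeff p i \<in> \<int>"
  define q where "q = map_poly (\<lambda>x. \<lfloor>Re x\<rfloor>) p"
  have "p = map_poly of_int q"
  proof (rule poly_eqI)
    fix i
    obtain z where "Polynomial.coeff p i = of_int z" using a by (meson Ints_cases)
    then show "Polynomial.coeff p i = Polynomial.coeff (map_poly of_int q) i" by (simp add: q_def coeff_map_poly)
  qed
  then show "integral_poly p" unfolding integral_poly_def by blast
qed

lemma integral_poly_mult: "integral_poly p \<Longrightarrow> integral_poly q \<Longrightarrow> integral_poly (p * q)"
  unfolding integral_poly_coeff coeff_mult by (auto intro!: Ints_sum Ints_mult)

lemma integral_poly_prod: "(\<And>i. i \<in> A \<Longrightarrow> integral_poly (f i)) \<Longrightarrow> integral_poly (\<Prod>i\<in>A. f i)"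
proof (induction A rule: infinite_finite_induct)
  case empty show ?case by (auto simp: integral_poly_coeff coeff_1)
next
  case infinite then show ?case by (auto simp: integral_poly_coeff coeff_1)
qed (auto intro: integral_poly_mult)

text \<open>Division with remainder by a monic integral polynomial stays integral, and the remainder
  vanishes by comparing degrees.\<close>

lemma integral_poly_divide:
  assumes p: "integral_poly p" and q: "integral_poly q" and lead: "Polynomial.lead_coeff q = 1" and eq: "p = r * q"
  shows "integral_poly r"
proof -
  obtain P where P: "p = map_poly of_int P" using p by (auto simp: integral_poly_def)
  obtain Q :: "int poly" where Q: "q = map_poly of_int Q" using q by (auto simp: integral_poly_def)
  have deg: "Polynomial.degree (map_poly of_int F :: complex poly) = Polynomial.degree F" for F :: "int poly"
    by (rule degree_map_poly) auto
  have "of_int (Polynomial.lead_coeff Q) = (1 :: complex)" using lead unfolding Q deg by (simp add: coeff_map_poly)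
  then have lQ: "Polynomial.lead_coeff Q = 1" by simp
  then have Q0: "Q \<noteq> 0" by auto
  obtain S T where ST: "pseudo_divmod P Q = (S, T)" by (metis surj_pair)
  from pseudo_divmod[OF Q0 ST] have PST: "P = Q * S + T" "T = 0 \<or> Polynomial.degree T < Polynomial.degree Q"
    by (simp_all add: lQ)
  let ?h = "map_poly of_int :: int poly \<Rightarrow> complex poly"
  have h: "?h (Q * S + T) = ?h Q * ?h S + ?h T"
    by (rule poly_eqI) (simp add: coeff_map_poly coeff_mult)
  have "(r - ?h S) * ?h Q = ?h T" using eq h unfolding P Q PST(1)[symmetric] by (simp add: algebra_simps)
  moreover have "r - ?h S = 0"
  proof (rule ccontr)
    assume ne: "r - ?h S \<noteq> 0"
    have "?h Q \<noteq> 0" using lead Q by auto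
    with ne have d: "Polynomial.degree ((r - ?h S) * ?h Q) \<ge> Polynomial.degree Q" "(r - ?h S) * ?h Q \<noteq> 0"
      by (auto simp: degree_mult_eq deg)
    then have "T \<noteq> 0" using calculation by auto
    then show False using PST(2) d(1) unfolding calculation deg by simp
  qed
  ultimately have "r = ?h S" by simp
  then show ?thesis unfolding integral_poly_def by blast
qed

definition rt :: "real \<Rightarrow> complex poly" where "rt x = [:- cis (2 * pi * x), 1:]"

lemma lead_rt: "Polynomial.lead_coeff (rt x) = 1" by (simp add: rt_def)

lemma monic_prod_rt: "Polynomial.lead_coeff (\<Prod>x\<in>A. rt (f x)) = 1"
  by (induction A rule: infinite_finite_induct) (auto simp: lead_coeff_mult lead_rt)

lemma monic_prod_mset_rt: "Polynomial.lead_coeff (\<Prod>x\<in>#A. rt x) = 1"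
  by (induction A) (auto simp: lead_coeff_mult lead_rt)

lemma degree_prod_mset_rt: "Polynomial.degree (\<Prod>x\<in>#A. rt x) = size A"
proof (induction A)
  case (add x A)
  have "Polynomial.lead_coeff (\<Prod>x\<in>#A. rt x) \<noteq> 0" using monic_prod_mset_rt[of A] by simp
  then have "(\<Prod>x\<in>#A. rt x) \<noteq> 0" by (metis leading_coeff_0_iff)
  moreover have "rt x \<noteq> 0" "Polynomial.degree (rt x) = 1" by (simp_all add: rt_def)
  ultimately show ?case using add by (simp add: degree_mult_eq)
qed simp

lemma prod_unity_roots:
  assumes N: "N > 0"
  shows "(\<Prod>j<N. rt (real j / real N)) = Polynomial.monom 1 N - 1"
proof -
  let ?p = "\<Prod>j<N. rt (real j / real N)" and ?q = "Polynomial.monom 1 N - 1 :: complex poly"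
  define f where "f = (\<lambda>k. cis (2 * pi * (real k / real N)))"
  have bij: "bij_betw f {..<N} {z. z ^ N = 1}"
    using Complex.bij_betw_roots_unity[OF N] by (simp add: f_def)
  have rootp: "poly ?p (f j) = 0" if "j < N" for j
    using that by (auto simp: poly_prod rt_def f_def)
  have rootq: "poly ?q (f j) = 0" if "j < N" for j
    using bij that by (auto simp: poly_monom bij_betw_def)
  have degp: "Polynomial.degree ?p = N"
    using degree_prod_mset_rt[of "image_mset (\<lambda>j. real j / real N) (mset_set {..<N})"]
    by (simp add: prod_unfold_prod_mset image_mset.compositionality o_def)
  have cp: "Polynomial.coeff ?p N = 1" using monic_prod_rt[of "\<lambda>j. real j / real N" "{..<N}"] degp by simp
  have cq: "Polynomial.coeff ?q N = 1" using N by simp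
  have "?p - ?q = 0"
  proof (rule ccontr)
    assume ne: "?p - ?q \<noteq> 0"
    have le: "Polynomial.degree (?p - ?q) \<le> N"
      using degp by (intro degree_diff_le) (auto simp: degree_monom_eq intro!: degree_diff_le)
    moreover have "Polynomial.coeff (?p - ?q) N = 0" using cp cq by simp
    ultimately have lt: "Polynomial.degree (?p - ?q) < N" using ne
      by (metis leading_coeff_0_iff le_neq_implies_less)
    have "f ` {..<N} \<subseteq> {x. poly (?p - ?q) x = 0}" using rootp rootq by auto
    moreover have "card (f ` {..<N}) = N" using card_image[of f "{..<N}"] bij unfolding bij_betw_def by (metis card_lessThan)
    ultimately have "N \<le> card {x. poly (?p - ?q) x = 0}"
      using card_mono[OF poly_roots_finite[OF ne]] by metis
    also have "\<dots> \<le> Polynomial.degree (?p - ?q)" by (rule card_poly_roots_bound[OF ne])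
    finally show False using lt by simp
  qed
  then show ?thesis by simp
qed

text \<open>Fractions in \<open>[0, 1)\<close> with exact denominator \<open>d\<close>; they index the
  primitive \<open>d\<close>-th roots of unity.\<close>

definition frac_den :: "nat \<Rightarrow> real set" where
  "frac_den d = (\<lambda>k. real k / real d) ` {k. k < d \<and> coprime k d}"

definition cyclo :: "nat \<Rightarrow> complex poly" where "cyclo d = (\<Prod>x\<in>frac_den d. rt x)"

lemma finite_frac_den: "finite (frac_den d)" by (simp add: frac_den_def)

lemma frac_den_iff:
  assumes "N > 0" "x \<in> frac_den d" "d > 0"
  shows "(\<exists>j<N. x = real j / real N) \<longleftrightarrow> d dvd N"
proof -
  obtain k where k: "k < d" "coprime k d" "x = real k / real d" using assms(2) by (auto simp: frac_den_def)
  show ?thesis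
  proof
    assume "\<exists>j<N. x = real j / real N"
    then obtain j where j: "x = real j / real N" by blast
    then have "real k * real N = real j * real d" using k(3) assms by (simp add: field_simps)
    then have "k * N = j * d" by (metis of_nat_eq_iff of_nat_mult)
    then have "d dvd k * N" by simp
    then show "d dvd N" using k(2) by (simp add: coprime_commute coprime_dvd_mult_right_iff)
  next
    assume "d dvd N"
    then obtain l where l: "N = d * l" by (elim dvdE)
    then have "l > 0" using assms by (auto intro: Nat.gr0I)
    then have "x = real (k * l) / real N" "k * l < N" using k l by auto
    then show "\<exists>j<N. x = real j / real N" by blast
  qed
qed

lemma frac_den_exists:
  assumes "j < N"
  shows "\<exists>d. d dvd N \<and> d > 0 \<and> real j / real N \<in> frac_den d"
proof -
  define g where "g = gcd j N"
  have g: "g > 0" using assms by (auto simp: g_def)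
  obtain j' N' where jn: "j = g * j'" "N = g * N'" "coprime j' N'"
    using gcd_coprime_exists[of j N] g unfolding g_def by (metis gr_implies_not0 mult.commute)
  have "real j / real N = real j' / real N'" using g by (simp add: jn(1,2))
  moreover have "j' < N'" "N' > 0" using assms g by (auto simp: jn(1,2))
  ultimately show ?thesis using jn by (intro exI[of _ N']) (auto simp: frac_den_def)
qed

lemma frac_den_disjoint:
  assumes "x \<in> frac_den d" "x \<in> frac_den e" "d > 0" "e > 0" shows "d = e"
proof -
  have *: "x \<in> frac_den d \<Longrightarrow> x \<in> frac_den e \<Longrightarrow> d > 0 \<Longrightarrow> e > 0 \<Longrightarrow> d dvd e" for d e
    using frac_den_iff[of e x d] by (auto simp: frac_den_def)
  show ?thesis using *[of d e] *[of e d] assms by (auto intro: dvd_antisym)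
qed

lemma fractions_decomp:
  assumes "N > 0"
  shows "(\<lambda>j. real j / real N) ` {..<N} = (\<Union>d\<in>{d. d dvd N}. frac_den d)"
proof (intro equalityI subsetI)
  fix x assume "x \<in> (\<lambda>j. real j / real N) ` {..<N}"
  then show "x \<in> (\<Union>d\<in>{d. d dvd N}. frac_den d)" using frac_den_exists by fastforce
next
  fix x assume "x \<in> (\<Union>d\<in>{d. d dvd N}. frac_den d)"
  then obtain d where d: "d dvd N" "x \<in> frac_den d" by blast
  then have "d > 0" using assms by (auto intro: Nat.gr0I)
  then obtain j where "j < N" "x = real j / real N" using frac_den_iff[OF assms d(2)] d(1) by blast
  then show "x \<in> (\<lambda>j. real j / real N) ` {..<N}" by auto
qed

lemma prod_frac_union:
  assumes "finite S" "0 \<notin> S"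
  shows "(\<Prod>x\<in>(\<Union>d\<in>S. frac_den d). rt x) = (\<Prod>d\<in>S. cyclo d)"
  unfolding cyclo_def
proof (rule prod.UNION_disjoint)
  show "\<forall>i\<in>S. \<forall>j\<in>S. i \<noteq> j \<longrightarrow> frac_den i \<inter> frac_den j = {}"
    using frac_den_disjoint assms(2) by (metis disjoint_iff gr0I)
qed (use assms finite_frac_den in auto)

lemma prod_cyclo:
  assumes "N > 0"
  shows "(\<Prod>d\<in>{d. d dvd N}. cyclo d) = Polynomial.monom 1 N - 1"
proof -
  have "inj_on (\<lambda>j. real j / real N) {..<N}" using assms by (auto simp: inj_on_def)
  then have "(\<Prod>j<N. rt (real j / real N)) = (\<Prod>x\<in>(\<lambda>j. real j / real N) ` {..<N}. rt x)"
    by (simp add: prod.reindex)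
  also have "\<dots> = (\<Prod>d\<in>{d. d dvd N}. cyclo d)"
    unfolding fractions_decomp[OF assms] using assms by (intro prod_frac_union) auto
  finally show ?thesis using prod_unity_roots[OF assms] by simp
qed

lemma monic_cyclo: "Polynomial.lead_coeff (cyclo d) = 1"
  unfolding cyclo_def by (rule monic_prod_rt)

lemma integral_unity: "integral_poly (Polynomial.monom 1 N - 1)"
  by (auto simp: integral_poly_coeff coeff_1)

lemma proper_divisor:
  fixes d e :: nat
  assumes "e \<in> {e. e dvd d} - {d}" "d > 0" shows "e < d \<and> e > 0"
proof -
  have "e dvd d" "e \<noteq> d" using assms by auto
  then have "e \<le> d" "e > 0" using assms(2) dvd_imp_le[of e d] dvd_pos_nat[of d e] by blast+
  then show ?thesis using \<open>e \<noteq> d\<close> by simp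
qed

text \<open>The product over all divisors is \<open>X\<^sup>d - 1\<close>, and the proper divisors are
  integral and monic by induction.\<close>

lemma integral_cyclo: "d > 0 \<Longrightarrow> integral_poly (cyclo d)"
proof (induction d rule: less_induct)
  case (less d)
  have fin: "finite {e. e dvd d}" using less.prems by simp
  have split: "(\<Prod>e\<in>{e. e dvd d}. cyclo e) = cyclo d * (\<Prod>e\<in>{e. e dvd d} - {d}. cyclo e)"
    using fin by (rule prod.remove) simp
  show ?case
  proof (rule integral_poly_divide[OF integral_unity])
    show "integral_poly (\<Prod>e\<in>{e. e dvd d} - {d}. cyclo e)"
      using less.IH proper_divisor[OF _ less.prems] by (intro integral_poly_prod) metis
    show "Polynomial.monom 1 d - 1 = cyclo d * (\<Prod>e\<in>{e. e dvd d} - {d}. cyclo e)"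
      using split prod_cyclo[OF less.prems] by simp
    show "Polynomial.lead_coeff (\<Prod>e\<in>{e. e dvd d} - {d}. cyclo e) = 1"
      by (simp add: lead_coeff_prod monic_cyclo)
  qed
qed

text \<open>The value of \<open>X\<^sup>d - 1\<close> at \<open>0\<close> is that of the factor for \<open>d
  = 1\<close>, so all other factors have value \<open>1\<close>.\<close>

lemma cyclo_at_0: "d \<ge> 2 \<Longrightarrow> poly (cyclo d) 0 = 1"
proof (induction d rule: less_induct)
  case (less d)
  have fin: "finite {e. e dvd d}" using less.prems by simp
  have c1: "poly (cyclo 1) 0 = -1" by (simp add: cyclo_def frac_den_def rt_def)
  have "-1 = poly (\<Prod>e\<in>{e. e dvd d}. cyclo e) 0"
    using prod_cyclo[of d] less.prems by (simp add: poly_monom)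
  also have "\<dots> = poly (cyclo d) 0 * (\<Prod>e\<in>{e. e dvd d} - {d}. poly (cyclo e) 0)"
    unfolding poly_prod using fin by (rule prod.remove) simp
  also have "(\<Prod>e\<in>{e. e dvd d} - {d}. poly (cyclo e) 0) = (\<Prod>e\<in>{1}. poly (cyclo e) 0)"
  proof (rule prod.mono_neutral_right)
    show "\<forall>e\<in>{e. e dvd d} - {d} - {1}. poly (cyclo e) 0 = 1"
    proof
      fix e assume e: "e \<in> {e. e dvd d} - {d} - {1}"
      then have "e < d" "e > 0" using proper_divisor[of e d] less.prems by auto
      then show "poly (cyclo e) 0 = 1" using less.IH[of e] e by auto
    qed
  qed (use fin less.prems in auto)
  also have "(\<Prod>e\<in>{1}. poly (cyclo e) 0) = -1" using c1 by (simp only: prod.insert finite.emptyI empty_iff not_False_eq_True prod.empty mult_1_right)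
  finally show ?case by simp
qed

context volumes_data
begin

lemma poly_plus_rt: "poly_plus n \<gamma> B = (\<Prod>a\<in>#Aset. rt a)" by (simp add: poly_plus_def rt_def)
lemma poly_minus_rt: "poly_minus n \<gamma> B = (\<Prod>a\<in>#Bset. rt a)" by (simp add: poly_minus_def rt_def)

lemma degree_poly_plus: "Polynomial.degree (poly_plus n \<gamma> B) = gamma_bar n \<gamma> B"
  unfolding poly_plus_rt degree_prod_mset_rt by (rule size_Aset)
lemma degree_poly_minus: "Polynomial.degree (poly_minus n \<gamma> B) = gamma_bar n \<gamma> B"
  unfolding poly_minus_rt degree_prod_mset_rt by (rule size_Bset)
lemma monic_poly_plus: "Polynomial.coeff (poly_plus n \<gamma> B) (gamma_bar n \<gamma> B) = 1"
  using monic_prod_mset_rt[of Aset] degree_poly_plus by (simp add: poly_plus_rt)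
lemma monic_poly_minus: "Polynomial.coeff (poly_minus n \<gamma> B) (gamma_bar n \<gamma> B) = 1"
  using monic_prod_mset_rt[of Bset] degree_poly_minus by (simp add: poly_minus_rt)

text \<open>The orders of the roots of unity that survive the cancellation.\<close>

definition Dset :: "nat set" where "Dset = {d. d dvd \<gamma> \<and> (\<forall>q\<in>{1..n+1}. \<not> d dvd B q)}"

lemma Aset_mset_set: "Aset = mset_set (set_mset Aset)"
proof (rule multiset_eqI)
  fix x
  show "count Aset x = count (mset_set (set_mset Aset)) x"
  proof (cases "x \<in># Aset")
    case True
    then have "count Aset x > 0" by (simp only: count_greater_zero_iff)
    then have "count Aset x = 1" using count_Aset[of x] by linarith
    then show ?thesis using True by (simp only: count_mset_set' finite_set_mset if_True simp_thms)
  next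
    case False
    then have "count Aset x = 0" by (simp only: not_in_iff)
    then show ?thesis using False by (simp only: count_mset_set' finite_set_mset if_False simp_thms)
  qed
qed

text \<open>Whether an exponent cancels depends only on its exact denominator, so the reduced polynomial is
  a product of complete cyclotomic factors.\<close>

lemma poly_plus_cyclo: "poly_plus n \<gamma> B = (\<Prod>d\<in>Dset. cyclo d)"
proof -
  have set: "set_mset Aset = (\<Union>d\<in>Dset. frac_den d)"
  proof (intro equalityI subsetI)
    fix x assume "x \<in> set_mset Aset"
    then have x: "x \<in># C_plus \<gamma>" "x \<notin># C_minus n B" by (simp_all add: mem_Aset)
    then obtain j where j: "j < \<gamma>" "x = real j / real \<gamma>" by (auto simp: mem_C_plus)
    then obtain d where d: "d dvd \<gamma>" "d > 0" "x \<in> frac_den d" using frac_den_exists by blast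
    have "\<not> d dvd B q" if q: "q \<in> {1..n+1}" for q
      using x(2) frac_den_iff[OF B[OF q] d(3,2)] q unfolding mem_C_minus by blast
    then show "x \<in> (\<Union>d\<in>Dset. frac_den d)" using d by (auto simp: Dset_def)
  next
    fix x assume "x \<in> (\<Union>d\<in>Dset. frac_den d)"
    then obtain d where d: "d dvd \<gamma>" "\<And>q. q \<in> {1..n+1} \<Longrightarrow> \<not> d dvd B q" "x \<in> frac_den d" by (auto simp: Dset_def)
    have d0: "d > 0" using d(1) \<gamma> by (rule dvd_pos_nat[rotated])
    have "x \<in># C_plus \<gamma>" using frac_den_iff[OF \<gamma> d(3) d0] d(1) unfolding mem_C_plus by blast
    moreover have "x \<notin># C_minus n B" using frac_den_iff[OF B d(3) d0] d(2) unfolding mem_C_minus by blast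
    ultimately show "x \<in> set_mset Aset" by (simp add: mem_Aset)
  qed
  have "poly_plus n \<gamma> B = (\<Prod>a\<in>set_mset Aset. rt a)"
    unfolding poly_plus_rt by (subst Aset_mset_set) (simp add: prod_unfold_prod_mset)
  also have "\<dots> = (\<Prod>d\<in>Dset. cyclo d)" unfolding set using \<gamma> by (intro prod_frac_union) (auto simp: Dset_def)
  finally show ?thesis .
qed

lemma Dset_ge_2: "d \<in> Dset \<Longrightarrow> d \<ge> 2"
proof -
  assume d: "d \<in> Dset"
  then have "d \<noteq> 0" "d \<noteq> 1" using \<gamma> by (auto simp: Dset_def)
  then show ?thesis by simp
qed

lemma integral_poly_plus: "integral_poly (poly_plus n \<gamma> B)"
  unfolding poly_plus_cyclo using Dset_ge_2 by (intro integral_poly_prod integral_cyclo) force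

lemma poly_plus_at_0: "Polynomial.coeff (poly_plus n \<gamma> B) 0 = 1"
  unfolding poly_plus_cyclo poly_0_coeff_0[symmetric] poly_prod using cyclo_at_0 Dset_ge_2 by simp

lemma prod_mset_rt_C_plus: "(\<Prod>x\<in>#C_plus \<gamma>. rt x) = Polynomial.monom 1 \<gamma> - 1"
  using prod_unity_roots[OF \<gamma>]
  by (simp add: C_plus_def prod_unfold_prod_mset image_mset.compositionality o_def lessThan_atLeast0)

lemma prod_mset_rt_C_minus: "(\<Prod>x\<in>#C_minus n B. rt x) = (\<Prod>q=1..n+1. Polynomial.monom 1 (B q) - 1)"
proof -
  have "(\<Prod>x\<in>#(\<Sum>q\<in>S. image_mset (\<lambda>j. real j / real (B q)) (mset_set {0..<B q})). rt x)
      = (\<Prod>q\<in>S. Polynomial.monom 1 (B q) - 1)" if "finite S" "S \<subseteq> {1..n+1}" for S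
    using that
  proof (induction S rule: finite_induct)
    case (insert q S)
    have "(\<Prod>x\<in>#image_mset (\<lambda>j. real j / real (B q)) (mset_set {0..<B q}). rt x) = Polynomial.monom 1 (B q) - 1"
      using prod_unity_roots[OF B[of q]] insert
      by (simp add: prod_unfold_prod_mset image_mset.compositionality o_def lessThan_atLeast0)
    then show ?case using insert by simp
  qed simp
  then show ?thesis unfolding C_minus_def by blast
qed

abbreviation "Dpoly \<equiv> (\<Prod>x\<in>#C_zero n \<gamma> B. rt x)"

lemma plus_split: "Dpoly * poly_plus n \<gamma> B = Polynomial.monom 1 \<gamma> - 1"
proof -
  have "C_plus \<gamma> = C_zero n \<gamma> B + Aset" using C_zero_sub by simp
  then have "(\<Prod>x\<in>#C_plus \<gamma>. rt x) = Dpoly * (\<Prod>x\<in>#Aset. rt x)" by (metis image_mset_union prod_mset.union)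
  then show ?thesis using prod_mset_rt_C_plus by (simp add: poly_plus_rt)
qed

lemma minus_split: "poly_minus n \<gamma> B * Dpoly = (\<Prod>q=1..n+1. Polynomial.monom 1 (B q) - 1)"
proof -
  have "C_minus n B = Bset + C_zero n \<gamma> B" using C_zero_sub by simp
  then have "(\<Prod>x\<in>#C_minus n B. rt x) = (\<Prod>x\<in>#Bset. rt x) * Dpoly" by (metis image_mset_union prod_mset.union)
  then show ?thesis using prod_mset_rt_C_minus by (simp add: poly_minus_rt)
qed

text \<open>The cancelled polynomial \<open>Dpoly\<close> is integral as a quotient of
  \<open>X\<^sup>\<gamma> - 1\<close>, and \<open>poly_minus\<close> is a quotient by it in turn.\<close>

lemma integral_poly_minus: "integral_poly (poly_minus n \<gamma> B)"
proof -
  have "integral_poly Dpoly"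
    by (rule integral_poly_divide[OF integral_unity integral_poly_plus _ plus_split[symmetric]])
       (simp add: poly_plus_rt monic_prod_mset_rt)
  then show ?thesis
    by (intro integral_poly_divide[OF integral_poly_prod[OF integral_unity] _ _ minus_split[symmetric]])
       (auto simp: monic_prod_mset_rt)
qed

lemma poly_minus_at_0: "Polynomial.coeff (poly_minus n \<gamma> B) 0 = (-1) ^ n"
proof -
  have "poly Dpoly 0 * poly (poly_plus n \<gamma> B) 0 = -1"
    using arg_cong[OF plus_split, of "\<lambda>p. poly p 0"] \<gamma> by (simp add: poly_monom)
  then have D0: "poly Dpoly 0 = -1" using poly_plus_at_0 by (simp add: poly_0_coeff_0)
  have "poly (poly_minus n \<gamma> B) 0 * poly Dpoly 0 = (\<Prod>q=1..n+1. poly (Polynomial.monom 1 (B q) - 1) 0)"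
    using arg_cong[OF minus_split, of "\<lambda>p. poly p 0"] by (simp only: poly_mult poly_prod)
  also have "\<dots> = (\<Prod>q=1..n+1. -1)" using B by (intro prod.cong refl) (auto simp: poly_monom)
  also have "\<dots> = (-1) ^ (n + 1)" by simp
  finally have "poly (poly_minus n \<gamma> B) 0 = (-1) ^ n" unfolding D0 by simp
  then show ?thesis by (simp add: poly_0_coeff_0)
qed

end

section \<open>Companion matrices\<close>

definition companion :: "nat \<Rightarrow> 'a::comm_ring_1 poly \<Rightarrow> 'a mat" where
  "companion m p = Matrix.mat m m (\<lambda>(i, j).
     if j = m - 1 then - Polynomial.coeff p i else if i = j + 1 then 1 else 0)"

text \<open>An explicit inverse, valid over every commutative ring if the constant coefficient is its own
  inverse; over the integers this is what puts the companion matrix into the general linear group.\<close>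

definition companion_inv :: "nat \<Rightarrow> 'a::comm_ring_1 poly \<Rightarrow> 'a mat" where
  "companion_inv m p = Matrix.mat m m (\<lambda>(i, j).
     if j = 0 then - Polynomial.coeff p 0 * (if i = m - 1 then 1 else Polynomial.coeff p (i + 1))
     else if j = i + 1 then 1 else 0)"

lemma companion_carrier [simp]: "companion m p \<in> carrier_mat m m" "companion_inv m p \<in> carrier_mat m m"
  "dim_row (companion m p) = m" "dim_col (companion m p) = m"
  "dim_row (companion_inv m p) = m" "dim_col (companion_inv m p) = m"
  by (simp_all add: companion_def companion_inv_def)

lemma mat_mult_index:
  assumes "A \<in> carrier_mat m m" "C \<in> carrier_mat m m" "i < m" "j < m"
  shows "(A * C) $$ (i, j) = (\<Sum>k<m. A $$ (i, k) * C $$ (k, j))"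
  using assms by (simp add: scalar_prod_def lessThan_atLeast0)

lemma companion_mult_inv:
  fixes p :: "'a::comm_ring_1 poly"
  assumes p0: "Polynomial.coeff p 0 * Polynomial.coeff p 0 = 1"
  shows "companion m p * companion_inv m p = 1\<^sub>m m"
proof (rule eq_matI)
  fix i j assume ij: "i < dim_row (1\<^sub>m m :: 'a mat)" "j < dim_col (1\<^sub>m m :: 'a mat)"
  then have i: "i < m" and j: "j < m" by simp_all
  let ?C = "companion m p" and ?D = "companion_inv m p" and ?p = "Polynomial.coeff p"
  have *: "(?C * ?D) $$ (i, j) = (\<Sum>k<m. ?C $$ (i, k) * ?D $$ (k, j))" by (rule mat_mult_index[OF _ _ i j]) simp_all
  show "(?C * ?D) $$ (i, j) = 1\<^sub>m m $$ (i, j)"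
  proof (cases "j = 0")
    case True
    have "?C $$ (i, k) * ?D $$ (k, j) = (if k = m - 1 then ?p i * ?p 0 else 0) + (if k = i - 1 then (if i = 0 then 0 else - ?p 0 * ?p i) else 0)"
      if "k < m" for k using that i True by (auto simp: companion_def companion_inv_def)
    then have "(?C * ?D) $$ (i, j) = (\<Sum>k<m. (if k = m - 1 then ?p i * ?p 0 else 0) + (if k = i - 1 then (if i = 0 then 0 else - ?p 0 * ?p i) else 0))"
      unfolding * by (intro sum.cong) auto
    then show ?thesis using i True p0 by (auto simp: sum.distrib)
  next
    case False
    have "?C $$ (i, k) * ?D $$ (k, j) = (if k = j - 1 then (if i = j then 1 else 0) else 0)"
      if "k < m" for k using that i j False by (auto simp: companion_def companion_inv_def)
    then have "(?C * ?D) $$ (i, j) = (\<Sum>k<m. if k = j - 1 then (if i = j then 1 else 0) else 0)"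
      unfolding * by (intro sum.cong) auto
    then show ?thesis using i j by auto
  qed
qed simp_all

lemma companion_inv_mult:
  fixes p :: "'a::comm_ring_1 poly"
  assumes p0: "Polynomial.coeff p 0 * Polynomial.coeff p 0 = 1"
  shows "companion_inv m p * companion m p = 1\<^sub>m m"
proof (rule eq_matI)
  fix i j assume ij: "i < dim_row (1\<^sub>m m :: 'a mat)" "j < dim_col (1\<^sub>m m :: 'a mat)"
  then have i: "i < m" and j: "j < m" by simp_all
  let ?C = "companion m p" and ?D = "companion_inv m p" and ?p = "Polynomial.coeff p"
  have *: "(?D * ?C) $$ (i, j) = (\<Sum>k<m. ?D $$ (i, k) * ?C $$ (k, j))" by (rule mat_mult_index[OF _ _ i j]) simp_all
  show "(?D * ?C) $$ (i, j) = 1\<^sub>m m $$ (i, j)"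
  proof (cases "j = m - 1")
    case True
    have "?D $$ (i, k) * ?C $$ (k, j) = (if k = 0 then ?p 0 * (if i = m - 1 then 1 else ?p (i + 1)) * ?p 0 else 0) + (if k = i + 1 then - ?p (i + 1) else 0)"
      if "k < m" for k using that i True by (auto simp: companion_def companion_inv_def)
    then have "(?D * ?C) $$ (i, j) = (\<Sum>k<m. (if k = 0 then ?p 0 * (if i = m - 1 then 1 else ?p (i + 1)) * ?p 0 else 0) + (if k = i + 1 then - ?p (i + 1) else 0))"
      unfolding * by (intro sum.cong) auto
    also have "\<dots> = ?p 0 * (if i = m - 1 then 1 else ?p (i + 1)) * ?p 0 + (if i + 1 < m then - ?p (i + 1) else 0)"
      using i by (simp add: sum.distrib)
    also have "?p 0 * (if i = m - 1 then 1 else ?p (i + 1)) * ?p 0 = (if i = m - 1 then 1 else ?p (i + 1)) * (?p 0 * ?p 0)"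
      by (simp only: mult_ac)
    finally show ?thesis using i True unfolding p0 by auto
  next
    case False
    have "?D $$ (i, k) * ?C $$ (k, j) = (if k = j + 1 then (if i = j then 1 else 0) else 0)"
      if "k < m" for k using that i j False by (auto simp: companion_def companion_inv_def)
    then have "(?D * ?C) $$ (i, j) = (\<Sum>k<m. if k = j + 1 then (if i = j then 1 else 0) else 0)"
      unfolding * by (intro sum.cong) auto
    then show ?thesis using i j False by auto
  qed
qed simp_all

lemma companion_GL:
  fixes p :: "'a::comm_ring_1 poly"
  assumes p0: "Polynomial.coeff p 0 * Polynomial.coeff p 0 = 1"
  shows "companion m p \<in> carrier (GL TYPE('a) m)"
    "inv\<^bsub>GL TYPE('a) m\<^esub> (companion m p) = companion_inv m p"
proof -
  interpret group "GL TYPE('a) m" by (rule group_GL)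
  have CD: "companion m p \<in> carrier (GL TYPE('a) m)" "companion_inv m p \<in> carrier (GL TYPE('a) m)"
    unfolding GL_carrier mem_Collect_eq using companion_mult_inv[OF p0] companion_inv_mult[OF p0] companion_carrier by metis+
  then show "companion m p \<in> carrier (GL TYPE('a) m)" by simp
  show "inv\<^bsub>GL TYPE('a) m\<^esub> (companion m p) = companion_inv m p"
    using inv_equality[of "companion_inv m p" "companion m p"] CD companion_inv_mult[OF p0]
    by (simp add: GL_mult GL_one)
qed

lemma map_mat_companion:
  "map_mat of_int (companion m p) = companion m (map_poly of_int p :: 'a::comm_ring_1 poly)"
  by (rule eq_matI) (auto simp: companion_def coeff_map_poly)

text \<open>Such a matrix fixes a hyperplane pointwise and acts as \<open>-1\<close> on the quotient.\<close>

lemma reflection_involution: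
  fixes R :: "'a::comm_ring_1 mat"
  assumes R: "R \<in> carrier_mat m m" and id: "\<And>i j. i < m \<Longrightarrow> j < m - 1 \<Longrightarrow> R $$ (i, j) = (if i = j then 1 else 0)"
    and last: "R $$ (m - 1, m - 1) = -1"
  shows "R * R = 1\<^sub>m m"
proof (rule eq_matI)
  fix i j assume ij: "i < dim_row (1\<^sub>m m :: 'a mat)" "j < dim_col (1\<^sub>m m :: 'a mat)"
  then have i: "i < m" and j: "j < m" by simp_all
  have *: "(R * R) $$ (i, j) = (\<Sum>k<m. R $$ (i, k) * R $$ (k, j))" by (rule mat_mult_index[OF R R i j])
  show "(R * R) $$ (i, j) = 1\<^sub>m m $$ (i, j)"
  proof (cases "j = m - 1")
    case True
    have "R $$ (i, k) * R $$ (k, j) = (if k = i then (if i = m - 1 then 0 else R $$ (i, m - 1)) else 0) + (if k = m - 1 then - R $$ (i, m - 1) else 0)"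
      if "k < m" for k
    proof (cases "k = m - 1")
      case True then show ?thesis using last \<open>j = m - 1\<close> by simp
    next
      case False then show ?thesis using id[of i k] that i \<open>j = m - 1\<close> by auto
    qed
    then have "(R * R) $$ (i, j) = (\<Sum>k<m. (if k = i then (if i = m - 1 then 0 else R $$ (i, m - 1)) else 0) + (if k = m - 1 then - R $$ (i, m - 1) else 0))"
      unfolding * by (intro sum.cong) auto
    then show ?thesis using i True last by (auto simp: sum.distrib)
  next
    case False
    then have "R $$ (i, k) * R $$ (k, j) = (if k = j then R $$ (i, j) else 0)" if "k < m" for k
      using id[of k j] that i j by auto
    then have "(R * R) $$ (i, j) = (\<Sum>k<m. if k = j then R $$ (i, j) else 0)"
      unfolding * by (intro sum.cong) auto
    then show ?thesis using i j False id[of i j] by auto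
  qed
qed (use R in simp_all)

text \<open>Two companion matrices differ only in their last column, so their quotient is the identity up to
  that column, and its last entry is the product of the constant coefficients.\<close>

lemma companion_quotient_involution:
  fixes p q :: "'a::comm_ring_1 poly"
  assumes m: "m > 0" and p0: "Polynomial.coeff p 0 = -1" and q0: "Polynomial.coeff q 0 = 1"
  defines "R \<equiv> companion_inv m p * companion m q"
  shows "R * R = 1\<^sub>m m"
proof (rule reflection_involution)
  show R: "R \<in> carrier_mat m m" unfolding R_def by (rule mult_carrier_mat[of _ m m]) simp_all
  have pp: "Polynomial.coeff p 0 * Polynomial.coeff p 0 = 1" by (simp add: p0)
  show "R $$ (i, j) = (if i = j then 1 else 0)" if ij: "i < m" "j < m - 1" for i j
  proof -
    have j: "j < m" using ij by simp
    have "R $$ (i, j) = (\<Sum>k<m. companion_inv m p $$ (i, k) * companion m q $$ (k, j))"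
      unfolding R_def by (rule mat_mult_index[OF _ _ ij(1) j]) simp_all
    also have "\<dots> = (\<Sum>k<m. companion_inv m p $$ (i, k) * companion m p $$ (k, j))"
      using ij by (intro sum.cong) (auto simp: companion_def)
    also have "\<dots> = (companion_inv m p * companion m p) $$ (i, j)"
      by (rule mat_mult_index[OF _ _ ij(1) j, symmetric]) simp_all
    finally show ?thesis using ij unfolding companion_inv_mult[OF pp] by simp
  qed
  have m1: "m - 1 < m" using m by simp
  have "R $$ (m - 1, m - 1) = (\<Sum>k<m. companion_inv m p $$ (m - 1, k) * companion m q $$ (k, m - 1))"
    unfolding R_def by (rule mat_mult_index[OF _ _ m1 m1]) simp_all
  also have "\<dots> = (\<Sum>k<m. if k = 0 then -1 else 0)"
    using m by (intro sum.cong) (auto simp: companion_def companion_inv_def p0 q0)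
  finally show "R $$ (m - 1, m - 1) = -1" using m by simp
qed

lemma of_int_GL_hom:
  "group_hom (GL TYPE(int) m) (GL TYPE('a::comm_ring_1) m) (map_mat of_int)"
proof -
  have car: "map_mat of_int x \<in> carrier (GL TYPE('a) m)" if x: "x \<in> carrier (GL TYPE(int) m)" for x
  proof -
    obtain y where y: "x \<in> carrier_mat m m" "y \<in> carrier_mat m m" "y * x = 1\<^sub>m m" "x * y = 1\<^sub>m m"
      using x by (auto simp: GL_carrier)
    have "map_mat of_int y * map_mat of_int x = (1\<^sub>m m :: 'a mat)" "map_mat of_int x * map_mat of_int y = (1\<^sub>m m :: 'a mat)"
      unfolding of_int_hom.mat_hom_mult[OF y(2,1), symmetric] of_int_hom.mat_hom_mult[OF y(1,2), symmetric] y
      by (simp_all only: of_int_hom.mat_hom_one)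
    moreover have "map_mat of_int x \<in> carrier_mat m m" "(map_mat of_int y :: 'a mat) \<in> carrier_mat m m" using y by simp_all
    ultimately show ?thesis unfolding GL_carrier by blast
  qed
  have "map_mat of_int (x \<otimes>\<^bsub>GL TYPE(int) m\<^esub> y) = (map_mat of_int x \<otimes>\<^bsub>GL TYPE('a) m\<^esub> map_mat of_int y :: 'a mat)"
    if "x \<in> carrier (GL TYPE(int) m)" "y \<in> carrier (GL TYPE(int) m)" for x y
    unfolding GL_mult by (rule of_int_hom.mat_hom_mult[OF GL_mat[OF that(1)] GL_mat[OF that(2)]])
  then show ?thesis using car
    by (intro group_hom.intro group_GL group_hom_axioms.intro homI) auto
qed

text \<open>A group homomorphism maps generated subgroups to generated subgroups.\<close>

lemma generate_integral:
  fixes S :: "complex mat set"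
  assumes "S \<subseteq> map_mat of_int ` carrier (GL TYPE(int) m)"
  shows "\<exists>K. subgroup K (GL TYPE(int) m) \<and> generate (GL TYPE(complex) m) S = map_mat of_int ` K"
proof -
  interpret group_hom "GL TYPE(int) m" "GL TYPE(complex) m" "map_mat of_int" by (rule of_int_GL_hom)
  define I where "I = {x \<in> carrier (GL TYPE(int) m). map_mat of_int x \<in> S}"
  have I: "I \<subseteq> carrier (GL TYPE(int) m)" by (auto simp: I_def)
  have "map_mat of_int ` I = S" using assms by (auto simp: I_def)
  then have "generate (GL TYPE(complex) m) S = map_mat of_int ` generate (GL TYPE(int) m) I"
    using generate_img[OF I] by simp
  moreover have "subgroup (generate (GL TYPE(int) m) I) (GL TYPE(int) m)"
    by (rule G.generate_is_subgroup[OF I])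
  ultimately show ?thesis by blast
qed

text \<open>Two integral matrices whose entries differ by less than one are equal, and only finitely many
  entries matter.\<close>

lemma discrete_integral_mats:
  assumes "H \<subseteq> map_mat of_int ` A" and A: "A \<subseteq> carrier_mat m m"
  shows "discrete_mats m H"
  unfolding discrete_mats_def
proof (rule discreteI)
  define F where "F = (\<lambda>(M :: complex mat) (i, j). if i < m \<and> j < m then M $$ (i, j) else 0)"
  fix x assume "x \<in> (\<lambda>M (i, j). if i < m \<and> j < m then M $$ (i, j) else 0) ` H"
  then have x: "x \<in> F ` H" by (simp add: F_def)
  then obtain M where M: "M \<in> H" "x = F M" by blast
  define J where "J = {..<m} \<times> {..<m}"
  define T where "T = (\<Inter>p\<in>J. (\<lambda>f. f p) -` ball (x p) 1)"
  have T: "open T" unfolding T_def J_def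
    by (intro open_INT ballI open_vimage[OF open_ball]) simp_all
  have "N = x" if N: "N \<in> T" "N \<in> F ` H" for N
  proof
    fix p :: "nat \<times> nat"
    obtain N' where N': "N' \<in> H" "N = F N'" using N by blast
    show "N p = x p"
    proof (cases "p \<in> J")
      case True
      then obtain i j where p: "p = (i, j)" "i < m" "j < m" by (auto simp: J_def)
      obtain Y Z where YZ: "Y \<in> A" "M = map_mat of_int Y" "Z \<in> A" "N' = map_mat of_int Z" using M N' assms(1) by blast
      have "Y \<in> carrier_mat m m" "Z \<in> carrier_mat m m" using YZ A by auto
      then have eq: "x p = of_int (Y $$ (i, j))" "N p = of_int (Z $$ (i, j))"
        using YZ p M(2) N'(2) by (simp_all add: F_def)
      have "dist (x p) (N p) < 1" using N(1) True by (auto simp: T_def)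
      then have "\<bar>Y $$ (i, j) - Z $$ (i, j)\<bar> < 1"
        unfolding eq dist_norm of_int_diff[symmetric] norm_of_int by linarith
      then show ?thesis unfolding eq by simp
    next
      case False then show ?thesis using M N' by (cases p) (auto simp: F_def J_def)
    qed
  qed
  moreover have "x \<in> T" by (simp add: T_def)
  ultimately have "T \<inter> F ` H = {x}" using x by blast
  then show "x isolated_in (\<lambda>M (i, j). if i < m \<and> j < m then M $$ (i, j) else 0) ` H"
    unfolding isolated_in_def using T x by (auto simp: F_def)
qed

context volumes_data
begin

abbreviation "GC \<equiv> GL TYPE(complex) (gamma_bar n \<gamma> B)"
abbreviation "GZ \<equiv> GL TYPE(int) (gamma_bar n \<gamma> B)"

lemma h_infinity_companion: "h_infinity n \<gamma> B = companion (gamma_bar n \<gamma> B) (poly_minus n \<gamma> B)"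
  unfolding h_infinity_def companion_def Let_def by (rule cong_mat) (auto simp: poly_minus_at_0)

lemma h_zero_inverse_companion: "h_zero_inverse n \<gamma> B = companion (gamma_bar n \<gamma> B) (poly_plus n \<gamma> B)"
  unfolding h_zero_inverse_def companion_def Let_def by (rule cong_mat) (auto simp: poly_plus_at_0)

lemma companion_integral:
  assumes p: "integral_poly p" and p0: "Polynomial.coeff p 0 * Polynomial.coeff p 0 = 1"
  shows "companion k p \<in> map_mat of_int ` carrier (GL TYPE(int) k)"
proof -
  obtain P where P: "p = map_poly of_int P" using p by (auto simp: integral_poly_def)
  have "of_int (Polynomial.coeff P 0 * Polynomial.coeff P 0) = (1 :: complex)"
    using p0 unfolding P by (simp add: coeff_map_poly)
  then have "Polynomial.coeff P 0 * Polynomial.coeff P 0 = 1" by (simp only: of_int_eq_1_iff)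
  then have "companion k P \<in> carrier (GL TYPE(int) k)" by (rule companion_GL)
  then show ?thesis unfolding P map_mat_companion[symmetric] by (rule imageI)
qed

lemma coeff_0_squared:
  "Polynomial.coeff (poly_minus n \<gamma> B) 0 * Polynomial.coeff (poly_minus n \<gamma> B) 0 = 1"
  "Polynomial.coeff (poly_plus n \<gamma> B) 0 * Polynomial.coeff (poly_plus n \<gamma> B) 0 = 1"
  by (simp_all add: poly_minus_at_0 poly_plus_at_0 power_mult_distrib[symmetric])

lemma h_integral:
  "h_infinity n \<gamma> B \<in> map_mat of_int ` carrier GZ" "h_zero_inverse n \<gamma> B \<in> map_mat of_int ` carrier GZ"
  unfolding h_infinity_companion h_zero_inverse_companion
  by (intro companion_integral integral_poly_minus integral_poly_plus coeff_0_squared)+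

lemma h_carrier: "h_infinity n \<gamma> B \<in> carrier GC" "h_zero_inverse n \<gamma> B \<in> carrier GC"
  unfolding h_infinity_companion h_zero_inverse_companion
  by (intro companion_GL coeff_0_squared)+

lemma generators_integral:
  "insert (M_infinity n \<gamma> B) (M_omega n \<gamma> B ` {..<\<gamma>}) \<subseteq> map_mat of_int ` carrier GZ"
proof -
  interpret group GC by (rule group_GL)
  interpret hom: group_hom GZ GC "map_mat of_int" by (rule of_int_GL_hom)
  have P: "subgroup (map_mat of_int ` carrier GZ) GC" by (rule hom.img_is_subgroup)
  have pow: "x [^]\<^bsub>GC\<^esub> (k::nat) \<in> map_mat of_int ` carrier GZ" if "x \<in> map_mat of_int ` carrier GZ" for x k
    using subgroup_int_pow_closed[OF P that, of "int k"] by (simp add: int_pow_int)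
  have h1: "h_one n \<gamma> B \<in> map_mat of_int ` carrier GZ"
    unfolding h_one_def h_zero_def Let_def
    by (intro subgroup.m_inv_closed[OF P] subgroup.m_closed[OF P] h_integral)
  have "M_omega n \<gamma> B i \<in> map_mat of_int ` carrier GZ" for i
    unfolding M_omega_def Let_def
    using h1 subgroup.m_closed[OF P subgroup.m_closed[OF P subgroup.m_inv_closed[OF P pow[OF h_integral(1), of i]] h1] pow[OF h_integral(1), of i]]
    by (cases "i = 0") (simp_all only: if_True if_False simp_thms)
  then show ?thesis using pow[OF h_integral(1)] unfolding M_infinity_def by blast
qed

lemma H_bar_integral: "\<exists>K. subgroup K GZ \<and> H_bar n \<gamma> B = map_mat of_int ` K"
  unfolding H_bar_def by (rule generate_integral[OF generators_integral])

lemma H_bar_discrete: "discrete_mats (gamma_bar n \<gamma> B) (H_bar n \<gamma> B)"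
proof -
  obtain K where K: "subgroup K GZ" "H_bar n \<gamma> B = map_mat of_int ` K" using H_bar_integral by blast
  have "K \<subseteq> carrier_mat (gamma_bar n \<gamma> B) (gamma_bar n \<gamma> B)"
    using subgroup.subset[OF K(1)] GL_mat by (rule subset_trans[OF _ subsetI])
  then show ?thesis by (intro discrete_integral_mats[of _ K]) (simp_all add: K)
qed

lemma h_one_eq: "h_one n \<gamma> B = inv\<^bsub>GC\<^esub> (inv\<^bsub>GC\<^esub> (h_zero_inverse n \<gamma> B) \<otimes>\<^bsub>GC\<^esub> h_infinity n \<gamma> B)"
  by (simp add: h_one_def h_zero_def Let_def)

lemma h_one_involution:
  assumes "odd n" shows "h_one n \<gamma> B \<otimes>\<^bsub>GC\<^esub> h_one n \<gamma> B = \<one>\<^bsub>GC\<^esub>"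
proof -
  interpret group GC by (rule group_GL)
  have "h_one n \<gamma> B = inv\<^bsub>GC\<^esub> (h_infinity n \<gamma> B) \<otimes>\<^bsub>GC\<^esub> h_zero_inverse n \<gamma> B"
    unfolding h_one_eq using h_carrier by (simp add: inv_mult_group)
  also have "\<dots> = companion_inv (gamma_bar n \<gamma> B) (poly_minus n \<gamma> B) * companion (gamma_bar n \<gamma> B) (poly_plus n \<gamma> B)"
    unfolding h_infinity_companion h_zero_inverse_companion companion_GL(2)[OF coeff_0_squared(1)] GL_mult ..
  finally show ?thesis unfolding GL_mult GL_one
    using companion_quotient_involution[OF gamma_bar_pos, of "poly_minus n \<gamma> B" "poly_plus n \<gamma> B"] assms
    by (simp add: poly_minus_at_0 poly_plus_at_0)
qed

lemma M_omega_eq: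
  "M_omega n \<gamma> B i = h_infinity n \<gamma> B [^]\<^bsub>GC\<^esub> (- int i) \<otimes>\<^bsub>GC\<^esub> h_one n \<gamma> B \<otimes>\<^bsub>GC\<^esub> h_infinity n \<gamma> B [^]\<^bsub>GC\<^esub> int i"
proof -
  interpret group GC by (rule group_GL)
  have "h_one n \<gamma> B \<in> carrier GC" unfolding h_one_eq using h_carrier by simp
  then show ?thesis using h_carrier(1)
    by (cases "i = 0") (simp_all add: M_omega_def Let_def int_pow_neg_int int_pow_int)
qed

end

section \<open>Factorization of the operator\<close>

lemma poly_prod_mset_eval: "poly (\<Prod>a\<in>#M. f a) x = (\<Prod>a\<in>#M. poly (f a) x)"
  by (induction M) auto

lemma euler_scaled: "(\<lambda>f s. euler_op f s / of_nat \<gamma>) = vf (\<lambda>s. s / of_nat \<gamma>)"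
  by (auto simp: fun_eq_iff euler_op_def vf_def)

context volumes_data
begin

text \<open>The symbols of the two products in the reduced operator, for arbitrary multisets of exponents.\<close>

definition Pf :: "real multiset \<Rightarrow> complex poly" where "Pf M = (\<Prod>a\<in>#M. [:of_real a, 1:])"
definition Pf1 :: "real multiset \<Rightarrow> complex poly" where "Pf1 M = (\<Prod>a\<in>#M. [:of_real a + 1, 1:])"

text \<open>The symbol of the left factor that was cancelled. The factor \<open>[:1, 1:]\<close> replaces
  the exponent \<open>0\<close>, which the multiplication by \<open>s ^ \<gamma>\<close> moves to
  \<open>1\<close>.\<close>

definition Eop :: "complex poly" where "Eop = Pf (C_zero n \<gamma> B - {#0#}) * [:1, 1:]"

definition BB :: complex where "BB = (\<Prod>q=1..n+1. of_nat (B q) ^ B q)"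

lemma C_plus_pos: "C_plus \<gamma> = add_mset 0 (image_mset (\<lambda>j. real j / real \<gamma>) (mset_set {1..<\<gamma>}))"
proof -
  have "{0..<\<gamma>} = insert 0 {1..<\<gamma>}" using \<gamma> by auto
  then show ?thesis unfolding C_plus_def by simp
qed

lemma C_minus_pos:
  "C_minus n B = add_mset 0 ((\<Sum>q=1..n. image_mset (\<lambda>j. real j / real (B q)) (mset_set {0..<B q})) +
     image_mset (\<lambda>j. real j / real (B (n + 1))) (mset_set {1..<B (n + 1)}))"
proof -
  have "{0..<B (n + 1)} = insert 0 {1..<B (n + 1)}" using B[of "n + 1"] by auto
  then show ?thesis unfolding C_minus_def by simp
qed

lemma C_split:
  "C_plus \<gamma> - {#0#} = Aset + (C_zero n \<gamma> B - {#0#})"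
  "C_minus n B - {#0#} = Bset + (C_zero n \<gamma> B - {#0#})"
proof -
  have "C_zero n \<gamma> B = add_mset 0 (C_zero n \<gamma> B - {#0#})" using zero_mem by simp
  moreover have "C_plus \<gamma> = Aset + C_zero n \<gamma> B" "C_minus n B = Bset + C_zero n \<gamma> B" using C_zero_sub by simp_all
  ultimately show "C_plus \<gamma> - {#0#} = Aset + (C_zero n \<gamma> B - {#0#})"
    "C_minus n B - {#0#} = Bset + (C_zero n \<gamma> B - {#0#})"
    by (metis add_mset_remove_trivial diff_empty union_mset_add_mset_right)+
qed

lemma poly_Pf: "poly (Pf M) x = (\<Prod>a\<in>#M. of_real a + x)" "poly (Pf1 M) x = (\<Prod>a\<in>#M. of_real a + 1 + x)"
  by (simp_all add: Pf_def Pf1_def poly_prod_mset_eval)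

lemma Pf_union: "Pf (M + N) = Pf M * Pf N" "Pf1 (M + N) = Pf1 M * Pf1 N"
  by (simp_all add: Pf_def Pf1_def)

text \<open>Reversing the order of the factors maps the exponent \<open>j / \<gamma>\<close> to \<open>1 - j
  / \<gamma>\<close>, which permutes the nonzero ones and turns \<open>0\<close> into
  \<open>1\<close>.\<close>

lemma plus_symbol:
  "pcompose (pcompose (pochhammer (- [:0, 1:]) \<gamma>) [:0, of_nat \<gamma>:]) [:1, 1:]
     = Polynomial.smult ((- of_nat \<gamma>) ^ \<gamma>) (Eop * Pf Aset)" (is "?L = ?R")
proof -
  have "poly ?L x = poly ?R x" for x
  proof -
    have \<gamma>0: "(of_nat \<gamma> :: complex) \<noteq> 0" using \<gamma> by simp
    have "poly ?L x = (\<Prod>j\<in>{0..<\<gamma>}. - (of_nat \<gamma> * (1 + x)) + of_nat j)"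
      by (simp add: poly_pcompose pochhammer_prod poly_prod of_nat_poly algebra_simps)
    also have "\<dots> = (\<Prod>j\<in>{0..<\<gamma>}. - of_nat \<gamma> * (1 + x - of_nat j / of_nat \<gamma>))"
      using \<gamma>0 by (intro prod.cong) (auto simp: field_simps)
    also have "\<dots> = (- of_nat \<gamma>) ^ \<gamma> * (\<Prod>j\<in>{0..<\<gamma>}. 1 + x - of_nat j / of_nat \<gamma>)"
      by (simp only: prod.distrib prod_constant card_atLeastLessThan diff_zero)
    also have "{0..<\<gamma>} = insert 0 {1..<\<gamma>}" using \<gamma> by auto
    also have "(\<Prod>j\<in>insert 0 {1..<\<gamma>}. 1 + x - of_nat j / of_nat \<gamma>)
       = (1 + x) * (\<Prod>j\<in>{1..<\<gamma>}. 1 + x - of_nat j / of_nat \<gamma>)" by simp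
    also have "(\<Prod>j\<in>{1..<\<gamma>}. 1 + x - of_nat j / of_nat \<gamma>) = (\<Prod>j\<in>{1..<\<gamma>}. of_real (real j / real \<gamma>) + x)"
      by (rule prod.reindex_bij_witness[of _ "\<lambda>j. \<gamma> - j" "\<lambda>j. \<gamma> - j"]) (use \<gamma>0 in \<open>auto simp: of_nat_diff field_simps\<close>)
    also have "\<dots> = poly (Pf (C_plus \<gamma> - {#0#})) x"
      unfolding poly_Pf C_plus_pos by (simp add: prod_unfold_prod_mset image_mset.compositionality o_def)
    also have "\<dots> = poly (Pf Aset) x * poly (Pf (C_zero n \<gamma> B - {#0#})) x"
      unfolding C_split(1) Pf_union by simp
    finally show ?thesis by (simp add: Eop_def algebra_simps)
  qed
  then show ?thesis unfolding poly_eq_poly_eq_iff[symmetric] by (rule ext)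
qed

lemma block_symbol:
  assumes q: "q \<in> {1..n+1}"
  shows "poly (pochhammer (L_form n \<gamma> B q (- [:0, 1:])) (B q)) (of_nat \<gamma> * (1 + x))
    = of_nat (B q) ^ B q * (\<Prod>j\<in>{0..<B q}. 1 + x + of_nat (j + (if q = n + 1 then 1 else 0)) / of_nat (B q))"
proof -
  have B0: "(of_nat (B q) :: complex) \<noteq> 0" using B[OF q] by simp
  have \<gamma>0: "(of_nat \<gamma> :: complex) \<noteq> 0" using \<gamma> by simp
  have "poly (pochhammer (L_form n \<gamma> B q (- [:0, 1:])) (B q)) (of_nat \<gamma> * (1 + x))
     = (\<Prod>j\<in>{0..<B q}. of_nat (B q) * (1 + x) + (if q = n + 1 then 1 else 0) + of_nat j)"
    unfolding pochhammer_prod poly_prod L_form_def using \<gamma>0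
    by (intro prod.cong refl) (simp add: of_nat_poly field_simps)
  also have "\<dots> = (\<Prod>j\<in>{0..<B q}. of_nat (B q) * (1 + x + of_nat (j + (if q = n + 1 then 1 else 0)) / of_nat (B q)))"
    using B0 by (intro prod.cong refl) (simp add: field_simps)
  finally show ?thesis by (simp only: prod.distrib prod_constant card_atLeastLessThan diff_zero)
qed

lemma poly_Pf1_minus:
  "(\<Prod>q=1..n+1. \<Prod>j\<in>{0..<B q}. 1 + x + of_nat (j + (if q = n + 1 then 1 else 0)) / of_nat (B q))
     = poly (Pf1 (C_minus n B - {#0#})) x * (2 + x)"
proof -
  let ?f = "\<lambda>q j. 1 + x + of_nat j / of_nat (B q)"
  have blk: "(\<Prod>a\<in>#image_mset (\<lambda>j. real j / real (B q)) (mset_set J). of_real a + 1 + x) = (\<Prod>j\<in>J. ?f q j)" for q J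
    by (simp add: prod_unfold_prod_mset image_mset.compositionality o_def algebra_simps)
  have sum: "(\<Prod>a\<in>#(\<Sum>q\<in>S. image_mset (\<lambda>j. real j / real (B q)) (mset_set {0..<B q})). of_real a + 1 + x)
      = (\<Prod>q\<in>S. \<Prod>j\<in>{0..<B q}. ?f q j)" if "finite S" for S
    using that
  proof (induction S rule: finite_induct)
    case (insert q S)
    then show ?case unfolding sum.insert[OF insert.hyps] prod.insert[OF insert.hyps] image_mset_union prod_mset.union blk by simp
  qed simp
  obtain b where b: "B (n + 1) = Suc b" using B[of "n + 1"] gr0_implies_Suc[of "B (n + 1)"] by auto
  have B0: "(of_nat (B (n + 1)) :: complex) \<noteq> 0" unfolding b by (simp del: of_nat_Suc)
  have last: "(\<Prod>j\<in>{0..<B (n + 1)}. ?f (n + 1) (j + 1)) = (\<Prod>j\<in>{1..<B (n + 1)}. ?f (n + 1) j) * (2 + x)"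
  proof -
    have "(\<Prod>j\<in>{0..<Suc b}. ?f (n + 1) (j + 1)) = (\<Prod>j\<in>{0..<b}. ?f (n + 1) (j + 1)) * ?f (n + 1) (b + 1)"
      by (rule prod.atLeast0_lessThan_Suc)
    also have "(\<Prod>j\<in>{0..<b}. ?f (n + 1) (j + 1)) = (\<Prod>j\<in>{1..<Suc b}. ?f (n + 1) j)"
      by (rule prod.reindex_bij_witness[of _ "\<lambda>j. j - 1" "\<lambda>j. j + 1"]) auto
    also have "?f (n + 1) (b + 1) = 2 + x" using B0 unfolding b by simp
    finally show ?thesis unfolding b .
  qed
  have "(\<Prod>q=1..n+1. \<Prod>j\<in>{0..<B q}. ?f q (j + (if q = n + 1 then 1 else 0)))
      = (\<Prod>q=1..n. \<Prod>j\<in>{0..<B q}. ?f q (j + (if q = n + 1 then 1 else 0))) * (\<Prod>j\<in>{0..<B (n+1)}. ?f (n+1) (j + 1))"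
    by (simp add: add.commute[of _ 1])
  moreover have "(\<Prod>q=1..n. \<Prod>j\<in>{0..<B q}. ?f q (j + (if q = n + 1 then 1 else 0))) = (\<Prod>q=1..n. \<Prod>j\<in>{0..<B q}. ?f q j)"
    by (intro prod.cong) auto
  moreover have "C_minus n B - {#0#} = (\<Sum>q=1..n. image_mset (\<lambda>j. real j / real (B q)) (mset_set {0..<B q})) +
        image_mset (\<lambda>j. real j / real (B (n + 1))) (mset_set {1..<B (n + 1)})"
    unfolding C_minus_pos by (rule add_mset_remove_trivial)
  ultimately show ?thesis
    unfolding poly_Pf last by (simp only: image_mset_union prod_mset.union blk sum[OF finite_atLeastAtMost] mult.assoc)
qed

text \<open>In the last block the additional \<open>1\<close> of \<open>L_form\<close> shifts the exponents
  by one step, which replaces one exponent \<open>0\<close> by \<open>1\<close>. This matches the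
  factor \<open>[:1, 1:]\<close> of \<open>Eop\<close> after a shift.\<close>

lemma minus_symbol:
  "pcompose (pcompose (\<Prod>q=1..n+1. pochhammer (L_form n \<gamma> B q (- [:0, 1:])) (B q)) [:0, of_nat \<gamma>:]) [:1, 1:]
     = Polynomial.smult BB (pcompose Eop [:1, 1:] * Pf1 Bset)" (is "?L = ?R")
proof -
  have "poly ?L x = poly ?R x" for x
  proof -
    have "poly ?L x = (\<Prod>q=1..n+1. poly (pochhammer (L_form n \<gamma> B q (- [:0, 1:])) (B q)) (of_nat \<gamma> * (1 + x)))"
      unfolding poly_pcompose poly_prod by (intro prod.cong refl arg_cong2[of _ _ _ _ poly]) (simp add: algebra_simps)
    also have "\<dots> = (\<Prod>q=1..n+1. of_nat (B q) ^ B q * (\<Prod>j\<in>{0..<B q}. 1 + x + of_nat (j + (if q = n + 1 then 1 else 0)) / of_nat (B q)))"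
      by (rule prod.cong[OF refl block_symbol])
    also have "\<dots> = BB * (poly (Pf1 (C_minus n B - {#0#})) x * (2 + x))"
      unfolding prod.distrib BB_def poly_Pf1_minus ..
    also have "poly (Pf1 (C_minus n B - {#0#})) x = poly (Pf1 Bset) x * poly (Pf1 (C_zero n \<gamma> B - {#0#})) x"
      unfolding C_split(2) Pf_union by simp
    also have "poly (Pf1 (C_zero n \<gamma> B - {#0#})) x = poly (pcompose (Pf (C_zero n \<gamma> B - {#0#})) [:1, 1:]) x"
      unfolding poly_pcompose poly_Pf by (simp add: algebra_simps)
    finally have "poly ?L x = BB * (poly (Pf1 Bset) x * poly (pcompose (Pf (C_zero n \<gamma> B - {#0#})) [:1, 1:]) x * (2 + x))" .
    moreover have "poly (pcompose Eop [:1, 1:]) x = poly (pcompose (Pf (C_zero n \<gamma> B - {#0#})) [:1, 1:]) x * (2 + x)"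
      unfolding Eop_def poly_pcompose poly_mult by simp
    ultimately show ?thesis unfolding poly_smult poly_mult by (simp only: mult_ac)
  qed
  then show ?thesis unfolding poly_eq_poly_eq_iff[symmetric] by (rule ext)
qed

lemma kummer_eq: "kummer n \<gamma> B s = BB * (s / of_nat \<gamma>) ^ \<gamma>" by (simp add: kummer_def BB_def)

lemma kummer_holomorphic: "kummer n \<gamma> B holomorphic_on U"
  unfolding kummer_eq[abs_def] using \<gamma> by (intro holomorphic_intros) auto

lemma deriv_power_gamma: "deriv (\<lambda>s. s ^ \<gamma>) s = of_nat \<gamma> * s ^ (\<gamma> - 1)"
  by (rule DERIV_imp_deriv) (auto intro!: derivative_eq_intros)

lemma vf_power: "vf (\<lambda>s. s / of_nat \<gamma>) (\<lambda>s. s ^ \<gamma>) s = 1 * s ^ \<gamma>"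
proof -
  have "(of_nat \<gamma> :: complex) \<noteq> 0" using \<gamma> by simp
  then have "s / of_nat \<gamma> * (of_nat \<gamma> * s ^ (\<gamma> - 1)) = s ^ (\<gamma> - 1) * s" by (simp add: field_simps)
  then show ?thesis unfolding vf_def deriv_power_gamma power_minus_mult[OF \<gamma>] by simp
qed

lemma vf_kummer: "vf (\<lambda>s. s / of_nat \<gamma>) (kummer n \<gamma> B) s = 1 * kummer n \<gamma> B s"
proof -
  have k: "kummer n \<gamma> B = (\<lambda>s. (BB / of_nat \<gamma> ^ \<gamma>) * s ^ \<gamma>)"
    by (simp add: kummer_eq fun_eq_iff power_divide)
  have "deriv (kummer n \<gamma> B) s = (BB / of_nat \<gamma> ^ \<gamma>) * deriv (\<lambda>s. s ^ \<gamma>) s"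
    unfolding k by (rule deriv_cmult) (intro field_differentiable_power field_differentiable_ident)
  then show ?thesis using vf_power[of s] unfolding vf_def k by (simp add: mult_ac)
qed

text \<open>The Kummer function is an eigenfunction of the scaled Euler operator with eigenvalue
  \<open>1\<close>. Moving it to the left of \<open>Eop\<close> shifts the symbol exactly as
  needed, so that on functions \<open>s ^ \<gamma> * v s\<close> the operator \<open>R_op\<close>
  is, up to a nonzero function, \<open>Eop\<close> applied to the reduced operator.\<close>

lemma reduced_kernel_subset:
  assumes U: "open U" and v: "v \<in> ker_on U (Rbar_op n \<gamma> B (kummer n \<gamma> B) (\<lambda>f s. euler_op f s / of_nat \<gamma>))"
  shows "(\<lambda>s. s ^ \<gamma> * v s) \<in> ker_on U (R_op n \<gamma> B)"
proof -
  interpret vector_field U "\<lambda>s. s / of_nat \<gamma>"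
    by unfold_locales (use U \<gamma> in \<open>auto intro!: holomorphic_intros\<close>)
  have hol: "v holomorphic_on U" and out: "\<And>s. s \<notin> U \<Longrightarrow> v s = 0"
    and ker: "\<And>s. s \<in> U \<Longrightarrow> poly_op (Pf Aset) T v s - kummer n \<gamma> B s * poly_op (Pf1 Bset) T v s = 0"
    using v unfolding ker_on_def Rbar_op_def euler_scaled Pf_def Pf1_def by auto
  have hol1: "(\<lambda>s. s ^ \<gamma> * v s) holomorphic_on U" by (intro holomorphic_intros hol)
  have eu: "euler_op = vf (\<lambda>s. of_nat \<gamma> * (s / of_nat \<gamma>))" using \<gamma> by (simp add: fun_eq_iff vf_def euler_op_def)
  have tr: "poly_op p euler_op (\<lambda>s. s ^ \<gamma> * v s) s = s ^ \<gamma> * poly_op (pcompose (pcompose p [:0, of_nat \<gamma>:]) [:1, 1:]) T v s"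
    if "s \<in> U" for p s
    unfolding eu poly_op_scale[OF hol1 that]
    by (rule poly_op_eigen[OF _ vf_power hol that]) (intro holomorphic_intros)
  have "R_op n \<gamma> B (\<lambda>s. s ^ \<gamma> * v s) s = 0" if s: "s \<in> U" for s
  proof -
    have 1: "poly_op (pochhammer (- [:0, 1:]) \<gamma>) euler_op (\<lambda>s. s ^ \<gamma> * v s) s
       = s ^ \<gamma> * ((- of_nat \<gamma>) ^ \<gamma> * poly_op Eop T (poly_op (Pf Aset) T v) s)"
      unfolding tr[OF s] plus_symbol poly_op_smult poly_op_mult[OF hol s] ..
    have "poly_op (\<Prod>q=1..n+1. pochhammer (L_form n \<gamma> B q (- [:0, 1:])) (B q)) euler_op (\<lambda>s. s ^ \<gamma> * v s) s
       = s ^ \<gamma> * (BB * poly_op (pcompose Eop [:1, 1:]) T (poly_op (Pf1 Bset) T v) s)"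
      unfolding tr[OF s] minus_symbol poly_op_smult poly_op_mult[OF hol s] ..
    then have 2: "s ^ \<gamma> * (-1) ^ \<gamma> * poly_op (\<Prod>q=1..n+1. pochhammer (L_form n \<gamma> B q (- [:0, 1:])) (B q)) euler_op (\<lambda>s. s ^ \<gamma> * v s) s
       = s ^ \<gamma> * ((- of_nat \<gamma>) ^ \<gamma> * (kummer n \<gamma> B s * poly_op (pcompose Eop [:1, 1:]) T (poly_op (Pf1 Bset) T v) s))"
      using \<gamma> by (simp add: kummer_eq power_divide power_minus[of "of_nat \<gamma>"])
    have "kummer n \<gamma> B s * poly_op (pcompose Eop [:1, 1:]) T (poly_op (Pf1 Bset) T v) s
       = poly_op Eop T (\<lambda>s. kummer n \<gamma> B s * poly_op (Pf1 Bset) T v s) s"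
      by (rule poly_op_eigen[OF kummer_holomorphic vf_kummer poly_op_hol[OF hol] s, symmetric])
    also have "\<dots> = poly_op Eop T (poly_op (Pf Aset) T v) s"
      using ker by (intro poly_op_cong[OF U _ s]) simp
    finally show ?thesis unfolding R_op_def 1 2 by simp
  qed
  then show ?thesis unfolding ker_on_def using hol1 out by simp
qed

end

section \<open>The Kummer covering and a scalar solution\<close>

lemma prod_nth: "(\<Prod>j<length xs. f (xs ! j)) = (\<Prod>x\<in>#mset xs. f x)"
proof -
  have "(\<Prod>j<length xs. f (xs ! j)) = prod_list (map f xs)"
    by (simp add: prod.list_conv_set_nth lessThan_atLeast0)
  then show ?thesis by (simp flip: prod_mset_prod_list)
qed

context volumes_data
begin

text \<open>The positive singular point; with this normalization of \<open>E\<close> the Kummer function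
  becomes \<open>exp u\<close>.\<close>

definition kap :: real where "kap = real \<gamma> / root \<gamma> (\<Prod>q=1..n+1. real (B q) ^ B q)"

lemma BB_pos: "(\<Prod>q=1..n+1. real (B q) ^ B q) > 0"
  using B by (intro prod_pos) auto

sublocale cov: exp_cover \<gamma> kap
  using \<gamma> BB_pos by unfold_locales (auto simp: kap_def)

lemma BB_kap: "BB * (of_real kap / of_nat \<gamma>) ^ \<gamma> = 1"
proof -
  define P where "P = (\<Prod>q=1..n+1. real (B q) ^ B q)"
  have P: "P > 0" unfolding P_def by (rule BB_pos)
  have r: "root \<gamma> P ^ \<gamma> = P" "root \<gamma> P > 0" using \<gamma> P by (simp_all add: real_root_pow_pos2)
  have k: "kap = real \<gamma> / root \<gamma> P" by (simp only: kap_def P_def)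
  have "P * (kap / real \<gamma>) ^ \<gamma> = 1"
    using \<gamma> r P by (simp add: k power_divide)
  then have "complex_of_real (P * (kap / real \<gamma>) ^ \<gamma>) = 1" by simp
  moreover have "complex_of_real P = BB" unfolding P_def BB_def by (simp only: of_real_prod of_real_power of_real_of_nat_eq)
  ultimately show ?thesis by simp
qed

lemma kummer_E: "kummer n \<gamma> B (cov.E u) = exp u"
proof -
  have "kummer n \<gamma> B (cov.E u) = BB * (of_real kap / of_nat \<gamma>) ^ \<gamma> * exp (u / of_nat \<gamma>) ^ \<gamma>"
    by (simp add: kummer_eq cov.E_def power_mult_distrib power_divide)
  also have "exp (u / of_nat \<gamma>) ^ \<gamma> = exp u" using \<gamma> by (simp flip: exp_of_nat_mult)
  finally show ?thesis by (simp add: BB_kap)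
qed

lemma omega_pt_eq: "omega_pt n \<gamma> B i = cov.omega i"
  unfolding omega_pt_def kap_def[symmetric] cov.omega_def cov.E_def by (simp add: cis_conv_exp mult_ac)

lemma sing_pts_kummer: "sing_pts n \<gamma> B = {s. kummer n \<gamma> B s = 1}"
  by (simp add: sing_pts_def kummer_def)

lemma kummer_0: "kummer n \<gamma> B 0 = 0" using \<gamma> by (simp add: kummer_eq)

lemma sing_pts_E: "sing_pts n \<gamma> B = (\<lambda>k::int. cov.E (2 * of_real pi * \<i> * of_int k)) ` UNIV"
proof (intro equalityI subsetI)
  fix s assume "s \<in> sing_pts n \<gamma> B"
  then have s: "kummer n \<gamma> B s = 1" by (simp add: sing_pts_kummer)
  then have s0: "s \<noteq> 0" using kummer_0 by auto
  define u where "u = cov.br 0 s"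
  have u: "cov.E u = s" unfolding u_def by (rule cov.E_br[OF s0])
  then have "exp u = 1" using kummer_E[of u] s by simp
  then obtain k :: int where "Re u = 0" "Im u = of_int (2 * k) * pi" unfolding exp_eq_1 by blast
  then have "u = 2 * of_real pi * \<i> * of_int k" by (simp add: complex_eq_iff)
  then show "s \<in> (\<lambda>k::int. cov.E (2 * of_real pi * \<i> * of_int k)) ` UNIV" using u by blast
next
  fix s assume "s \<in> (\<lambda>k::int. cov.E (2 * of_real pi * \<i> * of_int k)) ` UNIV"
  then obtain k :: int where s: "s = cov.E (2 * of_real pi * \<i> * of_int k)" by blast
  have "exp (2 * of_real pi * \<i> * of_int k) = 1" unfolding exp_eq_1 by simp
  then show "s \<in> sing_pts n \<gamma> B" unfolding s sing_pts_kummer mem_Collect_eq kummer_E .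
qed

lemma X_eq: "- insert 0 (sing_pts n \<gamma> B) = cov.XX"
  unfolding sing_pts_E cov.XX_def by auto

lemma bij_omega: "bij_betw (omega_pt n \<gamma> B) {..<\<gamma>} (sing_pts n \<gamma> B)"
proof (rule bij_betwI')
  fix i j assume ij: "i \<in> {..<\<gamma>}" "j \<in> {..<\<gamma>}"
  show "(omega_pt n \<gamma> B i = omega_pt n \<gamma> B j) = (i = j)"
  proof
    assume "omega_pt n \<gamma> B i = omega_pt n \<gamma> B j"
    then obtain k :: int where "- 2 * of_real pi * \<i> * of_nat i = - 2 * of_real pi * \<i> * of_nat j + 2 * of_real pi * \<i> * of_nat \<gamma> * of_int k"
      unfolding omega_pt_eq cov.omega_def cov.E_eq_iff by blast
    then have "2 * of_real pi * \<i> * (of_int (int j - int i) - of_int (int \<gamma> * k)) = 0" by (simp add: algebra_simps)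
    then have "(of_int (int j - int i) :: complex) = of_int (int \<gamma> * k)" by simp
    then have eq: "int j - int i = int \<gamma> * k" by (simp only: of_int_eq_iff)
    then have "\<bar>int \<gamma> * k\<bar> < int \<gamma> * 1" using ij by auto
    then have "\<bar>k\<bar> < 1" using \<gamma>
      by (simp only: abs_mult abs_of_nat mult_less_cancel_left_pos of_nat_0_less_iff)
    then show "i = j" using eq by simp
  qed simp
next
  fix i :: nat
  show "omega_pt n \<gamma> B i \<in> sing_pts n \<gamma> B"
    unfolding omega_pt_eq cov.omega_def sing_pts_E by (rule image_eqI[of _ _ "- int i"]) (simp_all only: of_int_minus of_int_of_nat_eq mult_minus_right mult_minus_left UNIV_I)
next
  fix s assume "s \<in> sing_pts n \<gamma> B"
  then obtain k :: int where k: "s = cov.E (2 * of_real pi * \<i> * of_int k)" unfolding sing_pts_E by (elim rangeE)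
  define i where "i = nat ((- k) mod int \<gamma>)"
  define d where "d = (- k) div int \<gamma>"
  have i: "int i = (- k) mod int \<gamma>" "i < \<gamma>" using \<gamma> by (simp_all add: i_def nat_less_iff)
  have "int \<gamma> * d + int i = - k" unfolding i(1) d_def by (rule mult_div_mod_eq)
  then have kd: "k = - int i - int \<gamma> * d" by simp
  have "s = cov.E (- 2 * of_real pi * \<i> * of_nat i + 2 * of_real pi * \<i> * of_nat \<gamma> * of_int (- d))"
    unfolding k kd by (simp add: algebra_simps)
  then have "s = omega_pt n \<gamma> B i" unfolding cov.E_shift omega_pt_eq cov.omega_def .
  then show "\<exists>i\<in>{..<\<gamma>}. s = omega_pt n \<gamma> B i" using i(2) by blast
qed

text \<open>The exponents at \<open>t = 0\<close> enter as \<open>c = 1 - a\<close>. Then the two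
  polynomials of the translation relations are exactly \<open>poly_plus\<close> and
  \<open>poly_minus\<close>.\<close>

lemma scalar_solution:
  defines "D \<equiv> {u. Re u \<noteq> 0 \<or> \<bar>Im u\<bar> < pi * real (gamma_bar n \<gamma> B)}"
  obtains f where "f holomorphic_on D"
    and "\<And>u. u \<in> D \<Longrightarrow> (-1) ^ gamma_bar n \<gamma> B * poly_op (\<Prod>a\<in>#Aset. [:of_real a - 1, 1:]) deriv f u
         = exp u * poly_op (\<Prod>b\<in>#Bset. [:of_real b, 1:]) deriv f u"
    and "\<And>u. Re u < 0 \<Longrightarrow> (\<Sum>k\<le>gamma_bar n \<gamma> B. Polynomial.coeff (poly_plus n \<gamma> B) k * f (u - 2 * of_real pi * \<i> * of_nat k)) = 0"
    and "\<And>u. Re u > 0 \<Longrightarrow> (\<Sum>k\<le>gamma_bar n \<gamma> B. Polynomial.coeff (poly_minus n \<gamma> B) k * f (u - 2 * of_real pi * \<i> * of_nat k)) = 0"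
    and "\<And>x N a. (\<forall>u. Re u < 0 \<longrightarrow> (\<Sum>k<N. x k * f (u - 2 * of_real pi * \<i> * of_nat k)) = 0) \<Longrightarrow>
          a \<in># Aset \<Longrightarrow> (\<Sum>k<N. x k * cis (2 * pi * a) ^ k) = 0"
proof -
  define m where "m = gamma_bar n \<gamma> B"
  obtain as where as: "mset as = Aset" using ex_mset by blast
  obtain bs where bs: "mset bs = Bset" using ex_mset by blast
  have len: "length as = m" "length bs = m"
    using arg_cong[OF as, of size] arg_cong[OF bs, of size] size_Aset size_Bset by (simp_all add: m_def)
  have mem: "as ! j \<in># Aset" "bs ! j \<in># Bset" if "j < m" for j
    using that len as bs by (metis nth_mem set_mset_mset)+
  define c where "c = (\<lambda>j. 1 - as ! j)"
  define b where "b = (\<lambda>j. bs ! j)"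
  have m: "m > 0" unfolding m_def by (rule gamma_bar_pos)
  have b: "0 \<le> b j \<and> b j < 1" if "j < m" for j using Bset_range[OF mem(2)[OF that]] by (simp add: b_def)
  have c: "0 < c j \<and> c j < 1" if "j < m" for j using Aset_range[OF mem(1)[OF that]] by (simp add: c_def)
  have P: "(\<Prod>j<m. [:- complex_of_real (c j), 1:]) = (\<Prod>a\<in>#Aset. [:of_real a - 1, 1:])"
    using prod_nth[of "\<lambda>a. [:complex_of_real a - 1, 1:]" as] by (simp add: len as c_def)
  have Q: "(\<Prod>j<m. [:complex_of_real (b j), 1:]) = (\<Prod>b\<in>#Bset. [:of_real b, 1:])"
    using prod_nth[of "\<lambda>a. [:complex_of_real a, 1:]" bs] by (simp add: len bs b_def)
  have ca: "exp (- 2 * complex_of_real pi * \<i> * of_real (c j)) = cis (2 * pi * (as ! j))" for j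
  proof -
    have "exp (- 2 * complex_of_real pi * \<i> * of_real (c j)) = exp (\<i> * of_real (2 * pi * (as ! j))) * exp (- (2 * of_real pi * \<i>))"
      unfolding c_def exp_add[symmetric] by (simp add: algebra_simps)
    then show ?thesis by (simp add: cis_conv_exp exp_minus)
  qed
  have XL: "(\<Prod>j<m. [:- exp (- 2 * complex_of_real pi * \<i> * of_real (c j)), 1:]) = poly_plus n \<gamma> B"
    using prod_nth[of "\<lambda>a. [:- cis (2 * pi * a), 1:]" as] unfolding ca by (simp add: len as poly_plus_def)
  have XR: "(\<Prod>j<m. [:- exp (2 * complex_of_real pi * \<i> * of_real (b j)), 1:]) = poly_minus n \<gamma> B"
    using prod_nth[of "\<lambda>a. [:- cis (2 * pi * a), 1:]" bs] by (simp add: len bs poly_minus_def b_def cis_conv_exp mult_ac)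
  have cj: "\<exists>j<m. cis (2 * pi * a) = exp (- 2 * complex_of_real pi * \<i> * of_real (c j))" if "a \<in># Aset" for a
  proof -
    have "a \<in> set as" using that as by (metis set_mset_mset)
    then obtain j where "j < m" "as ! j = a" using len by (metis in_set_conv_nth)
    then show ?thesis using ca[of j] by metis
  qed
  from mellin_barnes_solution[of m b c, OF m b c, unfolded of_real_mult of_real_numeral P Q, folded poly_op_def]
  obtain f where f: "f holomorphic_on D"
    "\<And>u. u \<in> D \<Longrightarrow> (-1) ^ m * poly_op (\<Prod>a\<in>#Aset. [:of_real a - 1, 1:]) deriv f u
         = exp u * poly_op (\<Prod>b\<in>#Bset. [:of_real b, 1:]) deriv f u"
    "\<And>u. Re u < 0 \<Longrightarrow> (\<Sum>k\<le>Polynomial.degree (\<Prod>j<m. [:- exp (- 2 * complex_of_real pi * \<i> * of_real (c j)), 1:]).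
        Polynomial.coeff (\<Prod>j<m. [:- exp (- 2 * complex_of_real pi * \<i> * of_real (c j)), 1:]) k * f (u - 2 * complex_of_real pi * \<i> * of_nat k)) = 0"
    "\<And>u. Re u > 0 \<Longrightarrow> (\<Sum>k\<le>Polynomial.degree (\<Prod>j<m. [:- exp (2 * complex_of_real pi * \<i> * of_real (b j)), 1:]).
        Polynomial.coeff (\<Prod>j<m. [:- exp (2 * complex_of_real pi * \<i> * of_real (b j)), 1:]) k * f (u - 2 * complex_of_real pi * \<i> * of_nat k)) = 0"
    "\<And>x N j. (\<forall>u. Re u < 0 \<longrightarrow> (\<Sum>k<N. x k * f (u - 2 * complex_of_real pi * \<i> * of_nat k)) = 0) \<Longrightarrow> j < m \<Longrightarrow>
          (\<Sum>k<N. x k * exp (- 2 * complex_of_real pi * \<i> * of_real (c j)) ^ k) = 0"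
    unfolding D_def m_def[symmetric] by auto
  show thesis
  proof (rule that[of f, folded m_def])
    show "(\<Sum>k\<le>m. Polynomial.coeff (poly_plus n \<gamma> B) k * f (u - 2 * of_real pi * \<i> * of_nat k)) = 0" if "Re u < 0" for u
      using f(3)[OF that] unfolding XL degree_poly_plus m_def[symmetric] .
    show "(\<Sum>k\<le>m. Polynomial.coeff (poly_minus n \<gamma> B) k * f (u - 2 * of_real pi * \<i> * of_nat k)) = 0" if "Re u > 0" for u
      using f(4)[OF that] unfolding XR degree_poly_minus m_def[symmetric] .
    show "(\<Sum>k<N. x k * cis (2 * pi * a) ^ k) = 0"
      if "\<forall>u. Re u < 0 \<longrightarrow> (\<Sum>k<N. x k * f (u - 2 * of_real pi * \<i> * of_nat k)) = 0" "a \<in># Aset" for x N a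
      using f(5)[OF that(1)] cj[OF that(2)] by metis
  qed (use f in auto)
qed

text \<open>A polynomial of degree less than \<open>gamma_bar\<close> has at most that many roots, and the
  numbers \<open>cis (2 * pi * a)\<close> are pairwise distinct because the exponents at
  \<open>0\<close> have multiplicity one.\<close>

lemma vanishing_combination:
  assumes "\<And>a. a \<in># Aset \<Longrightarrow> (\<Sum>k<gamma_bar n \<gamma> B. x k * cis (2 * pi * a) ^ k) = 0" and i: "i < gamma_bar n \<gamma> B"
  shows "x i = 0"
proof -
  define m where "m = gamma_bar n \<gamma> B"
  define p where "p = (\<Sum>k<m. Polynomial.monom (x k) k)"
  have cp: "Polynomial.coeff p k = (if k < m then x k else 0)" for k by (simp add: p_def Polynomial.coeff_sum)
  have "p = 0"
  proof (rule ccontr)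
    assume p0: "p \<noteq> 0"
    define R where "R = (\<lambda>a. cis (2 * pi * a)) ` set_mset Aset"
    have "inj_on (\<lambda>a. cis (2 * pi * a)) (set_mset Aset)"
    proof (rule inj_onI)
      fix a b assume ab: "a \<in> set_mset Aset" "b \<in> set_mset Aset" "cis (2 * pi * a) = cis (2 * pi * b)"
      obtain j k where jk: "j < \<gamma>" "a = real j / real \<gamma>" "k < \<gamma>" "b = real k / real \<gamma>"
        using ab(1,2) by (auto simp: mem_Aset mem_C_plus)
      have "inj_on (\<lambda>k. cis (2 * pi * real k / real \<gamma>)) {..<\<gamma>}"
        using Complex.bij_betw_roots_unity[OF \<gamma>] by (simp add: bij_betw_def)
      then have "j = k" using ab(3) jk by (auto dest!: inj_onD[of _ _ j k])
      then show "a = b" using jk by simp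
    qed
    then have "card R = card (set_mset Aset)" unfolding R_def by (rule card_image)
    also have "\<dots> = size Aset"
      by (subst (2) Aset_mset_set) simp
    finally have "card R = m" unfolding size_Aset m_def .
    moreover have "R \<subseteq> {z. poly p z = 0}"
      using assms(1) by (auto simp: R_def p_def poly_sum poly_monom m_def)
    ultimately have "m \<le> card {z. poly p z = 0}" using card_mono[OF poly_roots_finite[OF p0]] by metis
    also have "\<dots> \<le> Polynomial.degree p" by (rule card_poly_roots_bound[OF p0])
    also have "Polynomial.degree p < m" using i
      by (intro degree_lessI) (auto simp: cp p0 m_def)
    finally show False by simp
  qed
  then show ?thesis using cp[of i] i by (simp add: m_def)
qed

end

section \<open>The hypergeometric frame\<close>

lemma deriv_vf: "deriv = vf (\<lambda>_. 1)" by (simp add: vf_def fun_eq_iff)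

lemma (in vector_field) poly_op_fun_sum:
  "finite A \<Longrightarrow> (\<And>i. i \<in> A \<Longrightarrow> f i holomorphic_on U) \<Longrightarrow> s \<in> U \<Longrightarrow>
     poly_op p T (\<lambda>s. \<Sum>i\<in>A. c i * f i s) s = (\<Sum>i\<in>A. c i * poly_op p T (f i) s)"
proof (induction A rule: finite_induct)
  case empty then show ?case by (simp add: poly_op_zero_fun)
next
  case (insert x F)
  have "poly_op p T (\<lambda>s. c x * f x s + (\<Sum>i\<in>F. c i * f i s)) s
     = poly_op p T (\<lambda>s. c x * f x s) s + poly_op p T (\<lambda>s. \<Sum>i\<in>F. c i * f i s) s"
    using insert.prems by (intro poly_op_fun_add holomorphic_intros) auto
  then show ?case using insert by (simp add: poly_op_fun_cmult)
qed

text \<open>A periodic factor without zeros commutes with all the relations. This transports the monodromy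
  from the functions \<open>w\<close> to the functions \<open>v\<close>.\<close>

lemma frame_rescale:
  assumes "monodromy_frame \<gamma> \<kappa> m g hI hZi" and \<phi>: "\<phi> holomorphic_on UNIV" "\<And>u. \<phi> u \<noteq> 0"
    "\<And>u. \<phi> (u - 2 * of_real pi * \<i>) = \<phi> u"
  shows "monodromy_frame \<gamma> \<kappa> m (\<lambda>j u. \<phi> u * g j u) hI hZi"
proof -
  interpret monodromy_frame \<gamma> \<kappa> m g hI hZi by fact
  have fm: "frame_mult m (\<lambda>j u. \<phi> u * g j u) M j u = \<phi> u * frame_mult m g M j u" for M j u
    by (simp add: frame_mult_def sum_distrib_left mult_ac)
  show ?thesis
  proof unfold_locales
    show "germ_independent m (\<lambda>j u. \<phi> u * g j u) u" if "u \<in> Om 0" for u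
      unfolding germ_independent_def
    proof (intro allI impI)
      fix x i assume x: "\<forall>\<^sub>F z in nhds u. (\<Sum>i<m. x i * (\<phi> z * g i z)) = 0" and i: "i < m"
      have "(\<Sum>i<m. x i * (\<phi> z * g i z)) = \<phi> z * (\<Sum>i<m. x i * g i z)" for z
        by (simp add: sum_distrib_left mult_ac)
      then have "\<forall>\<^sub>F z in nhds u. (\<Sum>i<m. x i * g i z) = 0" using x \<phi>(2) by simp
      then show "x i = 0" using indep[OF that] i unfolding germ_independent_def by blast
    qed
  qed (use hI hZi g_hol right left \<phi> in \<open>auto simp: fm intro!: holomorphic_on_mult holomorphic_on_subset[OF \<phi>(1)]\<close>)
qed

context volumes_data
begin

abbreviation "P1 \<equiv> \<Prod>a\<in>#Aset. [:complex_of_real a - 1, 1:]"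
abbreviation "Q1 \<equiv> \<Prod>b\<in>#Bset. [:complex_of_real b, 1:]"

lemma last_entry:
  assumes m: "m > 0" and p: "Polynomial.coeff p m = 1" and rel: "(\<Sum>k\<le>m. Polynomial.coeff p k * f k) = 0"
  shows "f m = (\<Sum>i<m. companion m p $$ (i, m - 1) * f i)"
proof -
  have "(\<Sum>k<m. Polynomial.coeff p k * f k) + f m = 0"
    using rel p by (simp flip: lessThan_Suc_atMost)
  then have "f m = (\<Sum>i<m. - Polynomial.coeff p i * f i)" by (simp add: sum_negf eq_neg_iff_add_eq_0 add.commute)
  also have "\<dots> = (\<Sum>i<m. companion m p $$ (i, m - 1) * f i)"
    using m by (intro sum.cong) (auto simp: companion_def)
  finally show ?thesis .
qed

text \<open>Translating once more moves each function of the frame to the next one; for the last one the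
  translation relation expresses the result by the frame, with the coefficients in the last column
  of a companion matrix.\<close>

lemma shift_frame:
  fixes f :: "complex \<Rightarrow> complex"
  assumes m: "m > 0" and j: "j < m" and p: "Polynomial.coeff p m = 1"
    and g: "\<And>j u. g j u = f (u + c - 2 * of_real pi * \<i> * of_nat j)"
    and rel: "(\<Sum>k\<le>m. Polynomial.coeff p k * f (u + c - 2 * of_real pi * \<i> * of_nat k)) = 0"
  shows "g j (u - 2 * of_real pi * \<i>) = frame_mult m g (companion m p) j u"
proof -
  have sh: "g j (u - 2 * of_real pi * \<i>) = f (u + c - 2 * of_real pi * \<i> * of_nat (Suc j))"
    unfolding g by (rule arg_cong[of _ _ f]) (simp add: algebra_simps)
  show ?thesis
  proof (cases "j = m - 1")
    case True
    then have Sj: "Suc j = m" using m by simp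
    show ?thesis using last_entry[OF m p rel]
      unfolding sh unfolding frame_mult_def g Sj by (simp only: True[symmetric])
  next
    case False
    have "frame_mult m g (companion m p) j u = (\<Sum>i<m. if i = Suc j then g i u else 0)"
      unfolding frame_mult_def using False j by (intro sum.cong) (auto simp: companion_def)
    also have "\<dots> = g (Suc j) u" using False j by simp
    finally show ?thesis unfolding sh by (simp add: g)
  qed
qed

text \<open>The frame consists of translates of the scalar solution by \<open>-2 \<pi> \<i> j\<close>. The
  additional translation \<open>c\<close> places the band \<open>0 < Im u < 2 \<pi>\<close> inside
  the strip of convergence for all \<open>j < m\<close>, and absorbs the sign \<open>(-1) ^
  m\<close> of the equation.\<close>

lemma hypergeometric_frame:
  obtains g where "monodromy_frame \<gamma> kap (gamma_bar n \<gamma> B) g (h_infinity n \<gamma> B) (h_zero_inverse n \<gamma> B)"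
    "\<And>j u. j < gamma_bar n \<gamma> B \<Longrightarrow> u \<in> cov.Om 0 \<Longrightarrow> poly_op P1 deriv (g j) u = exp u * poly_op Q1 deriv (g j) u"
proof -
  define m where "m = gamma_bar n \<gamma> B"
  have m: "m > 0" unfolding m_def by (rule gamma_bar_pos)
  define D where "D = {u. Re u \<noteq> 0 \<or> \<bar>Im u\<bar> < pi * real m}"
  have D: "open D"
  proof -
    have "D = {u. Re u < 0} \<union> {u. Re u > 0} \<union> {u. \<bar>Im u\<bar> < pi * real m}" by (auto simp: D_def)
    then show ?thesis
      by (simp only:) (intro open_Un open_Collect_less continuous_intros)
  qed
  obtain f where f: "f holomorphic_on D"
    and ode: "\<And>u. u \<in> D \<Longrightarrow> (-1) ^ m * poly_op P1 deriv f u = exp u * poly_op Q1 deriv f u"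
    and fl: "\<And>u. Re u < 0 \<Longrightarrow> (\<Sum>k\<le>m. Polynomial.coeff (poly_plus n \<gamma> B) k * f (u - 2 * of_real pi * \<i> * of_nat k)) = 0"
    and fr: "\<And>u. Re u > 0 \<Longrightarrow> (\<Sum>k\<le>m. Polynomial.coeff (poly_minus n \<gamma> B) k * f (u - 2 * of_real pi * \<i> * of_nat k)) = 0"
    and ind: "\<And>x N a. (\<forall>u. Re u < 0 \<longrightarrow> (\<Sum>k<N. x k * f (u - 2 * of_real pi * \<i> * of_nat k)) = 0) \<Longrightarrow>
          a \<in># Aset \<Longrightarrow> (\<Sum>k<N. x k * cis (2 * pi * a) ^ k) = 0"
    by (rule scalar_solution[folded m_def, folded D_def]) (rule that; (assumption | blast))
  define c where "c = of_real pi * \<i> * of_nat m - 2 * of_real pi * \<i>"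
  define g where "g = (\<lambda>j u. f (u + c - 2 * of_real pi * \<i> * of_nat j))"
  have g: "g j u = f (u + c - 2 * of_real pi * \<i> * of_nat j)" for j u by (simp add: g_def)
  have Rec: "Re c = 0" by (simp add: c_def)
  have sub: "u + (c - 2 * of_real pi * \<i> * of_nat j) \<in> D" if "j < m" "u \<in> cov.Om 0" for j u
  proof (cases "Re u = 0")
    case True
    then have "0 < Im u" "Im u < 2 * pi" using that by (auto simp: cov.Om_def)
    moreover have "pi * real j \<le> pi * (real m - 1)"
      using that(1) by (intro mult_left_mono) auto
    then have "pi * real j \<le> pi * real m - pi" by (simp only: right_diff_distrib mult_1_right)
    moreover have "0 \<le> pi * real j" by simp
    moreover have "Im (u + (c - 2 * of_real pi * \<i> * of_nat j)) = Im u + pi * real m - 2 * pi - 2 * (pi * real j)"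
      by (simp add: c_def)
    ultimately have "\<bar>Im (u + (c - 2 * of_real pi * \<i> * of_nat j))\<bar> < pi * real m"
      unfolding abs_less_iff by linarith
    then show ?thesis by (simp add: D_def)
  qed (simp add: D_def Rec)
  have hol: "g j holomorphic_on cov.Om 0" if "j < m" for j
  proof -
    have "(f \<circ> (\<lambda>u. u + (c - 2 * of_real pi * \<i> * of_nat j))) holomorphic_on cov.Om 0"
      using sub[OF that] by (intro holomorphic_on_compose_gen[OF _ f] holomorphic_intros) auto
    then show ?thesis by (simp add: g_def o_def add_diff_eq)
  qed
  have god: "poly_op P1 deriv (g j) u = exp u * poly_op Q1 deriv (g j) u" if "j < m" "u \<in> cov.Om 0" for j u
  proof -
    let ?v = "u + (c - 2 * of_real pi * \<i> * of_nat j)"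
    have gj: "g j = (\<lambda>u. f (u + (c - 2 * of_real pi * \<i> * of_nat j)))" by (simp add: g_def add_diff_eq)
    have period: "exp (2 * of_real pi * \<i> * of_int k) = (1 :: complex)" for k :: int
      unfolding exp_eq_1 by simp
    have "exp ?v = exp u * exp (of_real pi * \<i>) ^ m * exp (2 * of_real pi * \<i> * of_int (- 1 - int j))"
      unfolding exp_of_nat_mult[symmetric] exp_add[symmetric] c_def by (simp add: algebra_simps)
    moreover have "exp (2 * of_real pi * \<i> * of_int (- 1 - int j)) = 1"
      by (rule period)
    moreover have "exp (of_real pi * \<i>) = -1" by (simp add: exp_pi_i)
    ultimately have e: "exp ?v = (-1) ^ m * exp u" by simp
    have "(-1) ^ m * poly_op P1 deriv f ?v = (-1) ^ m * exp u * poly_op Q1 deriv f ?v"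
      using ode[OF sub[OF that]] unfolding e .
    then have "(-1) ^ m * (poly_op P1 deriv f ?v - exp u * poly_op Q1 deriv f ?v) = 0" by (simp add: algebra_simps)
    then show ?thesis unfolding gj poly_op_deriv_shift by simp
  qed
  have "monodromy_frame \<gamma> kap m g (h_infinity n \<gamma> B) (h_zero_inverse n \<gamma> B)"
  proof (unfold_locales)
    show "h_infinity n \<gamma> B \<in> carrier (GL TYPE(complex) m)" "h_zero_inverse n \<gamma> B \<in> carrier (GL TYPE(complex) m)"
      unfolding m_def by (rule h_carrier)+
    show "g j holomorphic_on cov.Om 0" if "j < m" for j by (rule hol[OF that])
    show "g j (u - 2 * of_real pi * \<i>) = frame_mult m g (h_infinity n \<gamma> B) j u" if "j < m" "Re u > 0" for j u
      unfolding h_infinity_companion m_def[symmetric]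
      by (rule shift_frame[OF m that(1) _ g fr]) (use that Rec monic_poly_minus in \<open>simp_all add: m_def\<close>)
    show "g j (u - 2 * of_real pi * \<i>) = frame_mult m g (h_zero_inverse n \<gamma> B) j u" if "j < m" "Re u < 0" for j u
      unfolding h_zero_inverse_companion m_def[symmetric]
      by (rule shift_frame[OF m that(1) _ g fl]) (use that Rec monic_poly_plus in \<open>simp_all add: m_def\<close>)
    show "germ_independent m g u" if u: "u \<in> cov.Om 0" for u
      unfolding germ_independent_def
    proof (intro allI impI)
      fix x i assume x: "\<forall>\<^sub>F z in nhds u. (\<Sum>i<m. x i * g i z) = 0" and i: "i < m"
      define F where "F = (\<lambda>z. \<Sum>i<m. x i * g i z)"
      have F: "F holomorphic_on cov.Om 0" unfolding F_def by (intro holomorphic_intros hol) auto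
      obtain W where W: "open W" "u \<in> W" "\<And>z. z \<in> W \<Longrightarrow> F z = 0"
        using x unfolding eventually_nhds F_def by blast
      have con: "connected (cov.Om 0)" using cov.path_connected_Om by (rule path_connected_imp_connected)
      have F0: "F z = 0" if "z \<in> cov.Om 0" for z
      proof (rule analytic_continuation_open[of "W \<inter> cov.Om 0" "cov.Om 0" F "\<lambda>_. 0"])
        show "open (W \<inter> cov.Om 0)" using W(1) cov.open_Om by blast
        show "W \<inter> cov.Om 0 \<noteq> {}" using W(2) u by blast
      qed (use cov.open_Om con F W(3) that in auto)
      have "(\<Sum>k<m. x k * f (z - 2 * of_real pi * \<i> * of_nat k)) = 0" if "Re z < 0" for z
      proof -
        have "z - c \<in> cov.Om 0" using that by (simp add: cov.Om_def Rec)
        from F0[OF this] show ?thesis by (simp add: F_def g_def)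
      qed
      then have "(\<Sum>k<m. x k * cis (2 * pi * a) ^ k) = 0" if "a \<in># Aset" for a using ind that by blast
      then show "x i = 0" using vanishing_combination i unfolding m_def by blast
    qed
  qed
  then show ?thesis using that god unfolding m_def by blast
qed

end

context exp_cover
begin

lemma E_polar: "E u = rcis (\<kappa> * exp (Re u / real \<gamma>)) (Im u / real \<gamma>)"
  by (simp add: E_def rcis_def exp_eq_polar[of "u / of_nat \<gamma>"] Re_divide_of_nat Im_divide_of_nat mult_ac)

lemma cmod_rcis_diff: "(cmod (rcis a \<alpha> - rcis b \<beta>))\<^sup>2 = a\<^sup>2 + b\<^sup>2 - 2 * a * b * cos (\<alpha> - \<beta>)"
proof -
  have expand: "(a * c1 - b * c2)\<^sup>2 + (a * s1 - b * s2)\<^sup>2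
      = a\<^sup>2 * (s1\<^sup>2 + c1\<^sup>2) + b\<^sup>2 * (s2\<^sup>2 + c2\<^sup>2) - 2 * a * b * (c1 * c2 + s1 * s2)" for c1 c2 s1 s2 :: real
    by (simp add: power2_eq_square algebra_simps)
  have "(cmod (rcis a \<alpha> - rcis b \<beta>))\<^sup>2 = (a * cos \<alpha> - b * cos \<beta>)\<^sup>2 + (a * sin \<alpha> - b * sin \<beta>)\<^sup>2"
    by (simp add: cmod_power2)
  also have "\<dots> = a\<^sup>2 * ((sin \<alpha>)\<^sup>2 + (cos \<alpha>)\<^sup>2) + b\<^sup>2 * ((sin \<beta>)\<^sup>2 + (cos \<beta>)\<^sup>2) - 2 * a * b * cos (\<alpha> - \<beta>)"
    unfolding cos_diff by (rule expand)
  finally show ?thesis by simp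
qed

text \<open>On a circle around the origin the distance from \<open>s0\<close> grows with the angle. If the
  disc met the circle of radius \<open>\<kappa>\<close> on both sides of a singular point, the
  latter would be at most as far from \<open>s0\<close> as one of these points, and thus in the
  disc.\<close>

lemma disc_lift:
  assumes r: "r > 0" and sub: "ball s0 r \<subseteq> XX"
  obtains u0 k0 where "E u0 = s0" "u0 \<in> Om k0" "ball s0 r \<subseteq> Hp u0" "br u0 ` ball s0 r \<subseteq> Om k0"
proof -
  have s0: "s0 \<in> XX" using sub r by auto
  then have s00: "s0 \<noteq> 0" by (simp add: XX_def)
  define u0 where "u0 = br 0 s0"
  have Eu0: "E u0 = s0" unfolding u0_def by (rule E_br[OF s00])
  have "0 \<notin> XX" by (simp add: XX_def)
  then have "0 \<notin> ball s0 r" using sub by blast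
  then have rs: "r \<le> norm s0" by simp
  have Hp: "z \<in> Hp u0" if z: "z \<in> ball s0 r" for z
  proof -
    have "norm (1 - z / s0) = norm (s0 - z) / norm s0" using s00 by (simp add: norm_divide[symmetric] diff_divide_distrib)
    also have "\<dots> < 1" using z rs s00 by (simp add: dist_norm)
    finally have "Re (1 - z / s0) < 1" using complex_Re_le_cmod[of "1 - z / s0"] by linarith
    then show ?thesis unfolding Hp_def Eu0 by simp
  qed
  have far: "\<bar>Im (br u0 z) - Im u0\<bar> < \<bar>2 * pi * real_of_int N - Im u0\<bar>"
    if z: "z \<in> ball s0 r" and Re0: "Re (br u0 z) = 0" for z and N :: int
  proof (rule ccontr)
    assume neg: "\<not> \<bar>Im (br u0 z) - Im u0\<bar> < \<bar>2 * pi * real_of_int N - Im u0\<bar>"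
    define \<theta> where "\<theta> = (Im (br u0 z) - Im u0) / real \<gamma>"
    define \<eta> where "\<eta> = (2 * pi * real_of_int N - Im u0) / real \<gamma>"
    define R where "R = \<kappa> * exp (Re u0 / real \<gamma>)"
    have R: "R > 0" using \<kappa> by (simp add: R_def)
    have zE: "z = E (br u0 z)" using Hp_nz(2)[OF Hp[OF z]] by (simp add: E_br)
    have "\<theta> = Im (Ln (z / E u0))" using \<gamma> by (simp add: \<theta>_def br_def)
    then have th: "\<bar>\<theta>\<bar> < pi / 2"
      using Re_Ln_pos_lt[of "z / E u0"] Hp[OF z] Hp_nz[OF Hp[OF z]] by (auto simp: Hp_def)
    have "\<bar>\<eta>\<bar> \<le> \<bar>\<theta>\<bar>" using neg \<gamma> by (simp add: \<eta>_def \<theta>_def abs_divide divide_right_mono)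
    then have "cos \<bar>\<eta>\<bar> \<ge> cos \<bar>\<theta>\<bar>" using th by (intro cos_monotone_0_pi_le) auto
    then have cos: "cos \<eta> \<ge> cos \<theta>" by simp
    define P where "P = E (2 * of_real pi * \<i> * of_int N)"
    have "(cmod (P - s0))\<^sup>2 = \<kappa>\<^sup>2 + R\<^sup>2 - 2 * \<kappa> * R * cos \<eta>"
      unfolding P_def Eu0[symmetric] E_polar cmod_rcis_diff by (simp add: R_def \<eta>_def diff_divide_distrib)
    also have "\<dots> \<le> \<kappa>\<^sup>2 + R\<^sup>2 - 2 * \<kappa> * R * cos \<theta>"
      using cos \<kappa> R by (intro diff_left_mono mult_left_mono) auto
    also have "\<dots> = (cmod (E (br u0 z) - E u0))\<^sup>2"
      unfolding E_polar cmod_rcis_diff by (simp add: R_def \<theta>_def diff_divide_distrib Re0)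
    finally have "(cmod (P - s0))\<^sup>2 \<le> (cmod (z - s0))\<^sup>2" unfolding Eu0 zE[symmetric] .
    then have "cmod (P - s0) \<le> cmod (z - s0)" by (rule power2_le_imp_le) simp
    then have "P \<in> ball s0 r" using z by (simp add: dist_norm norm_minus_commute)
    then have "P \<in> XX" using sub by blast
    then show False by (auto simp: XX_def P_def)
  qed
  define k0 where "k0 = - \<lfloor>Im u0 / (2 * pi)\<rfloor>"
  have fl: "real_of_int (- k0) \<le> Im u0 / (2 * pi)" "Im u0 / (2 * pi) < real_of_int (1 - k0)"
    unfolding k0_def using floor_correct[of "Im u0 / (2 * pi)"] by (simp_all add: add.commute)
  have lo: "2 * pi * real_of_int (- k0) \<le> Im u0" using fl(1) by (simp add: field_simps)
  have hi: "Im u0 < 2 * pi * real_of_int (1 - k0)" using fl(2) by (simp add: field_simps)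
  have Om: "br u0 z \<in> Om k0" if z: "z \<in> ball s0 r" for z
  proof (cases "Re (br u0 z) = 0")
    case True
    have "Im (br u0 z) > 2 * pi * real_of_int (- k0)" "Im (br u0 z) < 2 * pi * real_of_int (1 - k0)"
      using far[OF z True, of "- k0"] far[OF z True, of "1 - k0"] lo hi by linarith+
    then show ?thesis by (simp add: Om_def algebra_simps)
  qed (simp add: Om_def)
  have "ball s0 r \<subseteq> Hp u0" "br u0 ` ball s0 r \<subseteq> Om k0" using Hp Om by blast+
  moreover have "u0 \<in> Om k0" using Om[of s0] r Eu0 br_E[of u0] by simp
  ultimately show ?thesis using that Eu0 by blast
qed

end

section \<open>Local solution spaces and the monodromy\<close>

lemma poly_op_monom: "poly_op (Polynomial.monom 1 k) T f s = (T ^^ k) f s"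
proof -
  have "poly_op (Polynomial.monom 1 k) T f s = (\<Sum>i\<le>k. Polynomial.coeff (Polynomial.monom 1 k) i * (T ^^ i) f s)"
    by (rule poly_op_le) (rule degree_monom_le)
  also have "\<dots> = (\<Sum>i\<le>k. if i = k then (T ^^ i) f s else 0)" by (intro sum.cong) auto
  finally show ?thesis by simp
qed

lemma monic_linear_product:
  "Polynomial.degree (\<Prod>a\<in>#M. [:f a, 1:]) = size M \<and> Polynomial.coeff (\<Prod>a\<in>#M. [:f a, 1 :: complex:]) (size M) = 1"
proof (induction M)
  case (add a M)
  define p where "p = (\<Prod>a\<in>#M. [:f a, 1 :: complex:])"
  have p: "Polynomial.degree p = size M" "Polynomial.lead_coeff p = 1" using add by (simp_all add: p_def)
  then have "p \<noteq> 0" by auto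
  then have "Polynomial.degree ([:f a, 1:] * p) = Suc (size M)" using p by (simp add: degree_mult_eq del: mult_pCons_left)
  moreover have "Polynomial.lead_coeff ([:f a, 1:] * p) = 1" unfolding lead_coeff_mult p(2) by simp
  ultimately show ?case by (simp add: p_def del: mult_pCons_left)
qed simp

context volumes_data
begin

abbreviation "TT \<equiv> vf (\<lambda>s. s / of_nat \<gamma>)"

text \<open>The local solution space of the reduced equation.\<close>

definition VV :: "complex set \<Rightarrow> (complex \<Rightarrow> complex) set" where
  "VV U = ker_on U (Rbar_op n \<gamma> B (kummer n \<gamma> B) (\<lambda>f s. euler_op f s / of_nat \<gamma>))"

lemma VV_iff:
  "f \<in> VV U \<longleftrightarrow> f holomorphic_on U \<and>
     (\<forall>s\<in>U. poly_op (Pf Aset) TT f s - kummer n \<gamma> B s * poly_op (Pf1 Bset) TT f s = 0) \<and> (\<forall>s. s \<notin> U \<longrightarrow> f s = 0)"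
  unfolding VV_def ker_on_def Rbar_op_def euler_scaled Pf_def Pf1_def by simp

lemma vector_field_scaled: "open U \<Longrightarrow> vector_field U (\<lambda>s. s / of_nat \<gamma>)"
  by unfold_locales (use \<gamma> in \<open>auto intro!: holomorphic_intros\<close>)

lemma VV_subspace: assumes U: "open U" shows "cfun.subspace (VV U)"
proof -
  interpret vector_field U "\<lambda>s. s / of_nat \<gamma>" by (rule vector_field_scaled[OF U])
  show ?thesis
  proof (rule cfun.subspaceI)
    show "0 \<in> VV U" unfolding VV_iff zero_fun_def by (simp add: poly_op_zero_fun)
    show "f + g \<in> VV U" if "f \<in> VV U" "g \<in> VV U" for f g
    proof -
      have "poly_op (Pf Aset) TT (\<lambda>z. f z + g z) s - kummer n \<gamma> B s * poly_op (Pf1 Bset) TT (\<lambda>z. f z + g z) s = 0" if s: "s \<in> U" for s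
      proof -
        have "poly_op (Pf Aset) TT f s - kummer n \<gamma> B s * poly_op (Pf1 Bset) TT f s = 0"
          "poly_op (Pf Aset) TT g s - kummer n \<gamma> B s * poly_op (Pf1 Bset) TT g s = 0"
          using \<open>f \<in> VV U\<close> \<open>g \<in> VV U\<close> s unfolding VV_iff by blast+
        moreover have "f holomorphic_on U" "g holomorphic_on U" using \<open>f \<in> VV U\<close> \<open>g \<in> VV U\<close> unfolding VV_iff by blast+
        ultimately show ?thesis using s by (simp add: poly_op_fun_add algebra_simps)
      qed
      then show ?thesis using that unfolding VV_iff plus_fun_def by (auto intro: holomorphic_on_add)
    qed
    show "(\<lambda>z. c * f z) \<in> VV U" if "f \<in> VV U" for c f
    proof -
      have "poly_op (Pf Aset) TT (\<lambda>z. c * f z) s - kummer n \<gamma> B s * poly_op (Pf1 Bset) TT (\<lambda>z. c * f z) s = 0" if s: "s \<in> U" for s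
      proof -
        have "c * (poly_op (Pf Aset) TT f s - kummer n \<gamma> B s * poly_op (Pf1 Bset) TT f s) = 0" "f holomorphic_on U"
          using \<open>f \<in> VV U\<close> s unfolding VV_iff by simp_all
        then show ?thesis using s by (simp add: poly_op_fun_cmult algebra_simps)
      qed
      then show ?thesis using that unfolding VV_iff by (auto intro: holomorphic_on_mult)
    qed
  qed
qed

lemma shifted_symbols:
  "pcompose (Pf Aset) [:-1, 1:] = P1" "pcompose (Pf1 Bset) [:-1, 1:] = Q1"
  unfolding poly_eq_poly_eq_iff[symmetric] fun_eq_iff poly_pcompose poly_Pf poly_prod_mset_eval
  by (simp_all add: algebra_simps)

lemma deriv_br: assumes "s \<in> cov.Hp u" shows "s / of_nat \<gamma> * deriv (cov.br u) s = 1"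
proof -
  have nz: "s / cov.E u \<notin> \<real>\<^sub>\<le>\<^sub>0" "s \<noteq> 0" using cov.Hp_nz[OF assms] by auto
  have "(cov.br u has_field_derivative of_nat \<gamma> * (inverse (s / cov.E u) * (1 / cov.E u))) (at s)"
    unfolding cov.br_def using nz by (auto intro!: derivative_eq_intros)
  then have "deriv (cov.br u) s = of_nat \<gamma> * (inverse (s / cov.E u) * (1 / cov.E u))" by (rule DERIV_imp_deriv)
  then show ?thesis using nz \<gamma> by (simp add: field_simps)
qed

text \<open>In the coordinate \<open>u\<close> the Kummer function is \<open>exp u\<close>, and the factor
  \<open>inverse (s ^ \<gamma>)\<close> shifts the exponents by one.\<close>

lemma VV_pullback:
  assumes dom: "open U" "U \<subseteq> cov.Hp u" and A: "open A" "cov.br u ` U \<subseteq> A" and G: "G holomorphic_on A"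
    and ode: "\<And>w. w \<in> A \<Longrightarrow> poly_op P1 deriv G w = exp w * poly_op Q1 deriv G w"
  shows "(\<lambda>s. if s \<in> U then inverse (s ^ \<gamma>) * G (cov.br u s) else 0) \<in> VV U"
proof -
  interpret vector_field U "\<lambda>s. s / of_nat \<gamma>" by (rule vector_field_scaled[OF dom(1)])
  let ?v = "\<lambda>s. if s \<in> U then inverse (s ^ \<gamma>) * G (cov.br u s) else 0"
  have nz: "s \<noteq> 0" if "s \<in> U" for s using that dom(2) cov.Hp_nz by blast
  have br: "cov.br u holomorphic_on U" by (rule holomorphic_on_subset[OF cov.br_holomorphic dom(2)])
  have e: "(\<lambda>s. inverse (s ^ \<gamma>)) holomorphic_on U" using nz by (intro holomorphic_intros) auto
  have pw: "(\<lambda>s. s ^ \<gamma>) holomorphic_on U" by (intro holomorphic_intros)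
  have Te: "T (\<lambda>s. inverse (s ^ \<gamma>)) s = -1 * inverse (s ^ \<gamma>)" if s: "s \<in> U" for s
  proof -
    have "T (\<lambda>s. inverse (s ^ \<gamma>) * s ^ \<gamma>) s = T (\<lambda>s. 1) s"
      by (rule vf_cong[OF dom(1) _ s]) (use nz in simp)
    also have "\<dots> = 0" by (simp add: vf_def)
    finally have "inverse (s ^ \<gamma>) * (1 * s ^ \<gamma>) + T (\<lambda>s. inverse (s ^ \<gamma>)) s * s ^ \<gamma> = 0"
      unfolding T_mult[OF e pw s] vf_power .
    then have "(T (\<lambda>s. inverse (s ^ \<gamma>)) s - (-1 * inverse (s ^ \<gamma>))) * s ^ \<gamma> = 0" by (simp add: algebra_simps)
    then show ?thesis using nz[OF s] by (simp add: eq_neg_iff_add_eq_0)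
  qed
  have Gbr: "(\<lambda>s. G (cov.br u s)) holomorphic_on U"
    using holomorphic_on_compose_gen[OF br G A(2)] by (simp add: o_def)
  have op: "poly_op p T ?v s = inverse (s ^ \<gamma>) * poly_op (pcompose p [:-1, 1:]) deriv G (cov.br u s)" if s: "s \<in> U" for p s
  proof -
    have "poly_op p T ?v s = poly_op p T (\<lambda>s. inverse (s ^ \<gamma>) * G (cov.br u s)) s"
      by (rule poly_op_cong[OF dom(1) _ s]) simp
    also have "\<dots> = inverse (s ^ \<gamma>) * poly_op (pcompose p [:-1, 1:]) T (\<lambda>s. G (cov.br u s)) s"
      by (rule poly_op_eigen[OF e Te Gbr s])
    also have "poly_op (pcompose p [:-1, 1:]) T (\<lambda>s. G (cov.br u s)) s = poly_op (pcompose p [:-1, 1:]) deriv G (cov.br u s)"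
      by (rule poly_op_pullback[OF br A(2) _ A(1) G s]) (use dom(2) deriv_br in blast)
    finally show ?thesis .
  qed
  have k: "kummer n \<gamma> B s = exp (cov.br u s)" if "s \<in> U" for s
    using kummer_E[of "cov.br u s"] nz[OF that] by (simp add: cov.E_br)
  show ?thesis unfolding VV_iff
  proof (intro conjI ballI allI impI)
    have "(\<lambda>s. inverse (s ^ \<gamma>) * G (cov.br u s)) holomorphic_on U" using e Gbr by (rule holomorphic_on_mult)
    then show "?v holomorphic_on U" by (rule holomorphic_transform) simp
    show "poly_op (Pf Aset) T ?v s - kummer n \<gamma> B s * poly_op (Pf1 Bset) T ?v s = 0" if s: "s \<in> U" for s
    proof -
      have "cov.br u s \<in> A" using A(2) s by blast
      from ode[OF this] show ?thesis unfolding op[OF s] shifted_symbols k[OF s] by simp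
    qed
  qed simp
qed

text \<open>The coefficient of the leading derivative is \<open>1 - kummer s\<close>, which vanishes only at
  the singular points.\<close>

lemma VV_unique:
  assumes dom: "open U" "connected U" "U \<subseteq> cov.XX" and s0: "s0 \<in> U" and f: "f \<in> VV U"
    and zero: "\<And>k. k < gamma_bar n \<gamma> B \<Longrightarrow> (TT ^^ k) f s0 = 0"
  shows "f = (\<lambda>_. 0)"
proof -
  interpret vector_field U "\<lambda>s. s / of_nat \<gamma>" by (rule vector_field_scaled[OF dom(1)])
  define m where "m = gamma_bar n \<gamma> B"
  let ?p = "Polynomial.coeff (Pf Aset)" and ?q = "Polynomial.coeff (Pf1 Bset)" and ?K = "kummer n \<gamma> B"
  have deg: "Polynomial.degree (Pf Aset) = m" "?p m = 1" "Polynomial.degree (Pf1 Bset) = m" "?q m = 1"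
    using monic_linear_product[of of_real Aset] monic_linear_product[of "\<lambda>a. of_real a + 1" Bset]
    by (simp_all only: Pf_def Pf1_def size_Aset size_Bset m_def)
  have K1: "1 - ?K s \<noteq> 0" if "s \<in> U" for s
    using that dom(3) unfolding X_eq[symmetric] sing_pts_kummer by auto
  have f': "f holomorphic_on U" "\<And>s. s \<notin> U \<Longrightarrow> f s = 0"
    "\<And>s. s \<in> U \<Longrightarrow> poly_op (Pf Aset) T f s - ?K s * poly_op (Pf1 Bset) T f s = 0"
    using f unfolding VV_iff by blast+
  define r where "r = (\<lambda>k s. - (?p k - ?K s * ?q k) / (1 - ?K s))"
  have ode: "(T ^^ m) f s = (\<Sum>k<m. r k s * (T ^^ k) f s)" if s: "s \<in> U" for s
  proof -
    have "0 = (\<Sum>k\<le>m. ?p k * (T ^^ k) f s) - ?K s * (\<Sum>k\<le>m. ?q k * (T ^^ k) f s)"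
      using f'(3)[OF s] by (simp add: poly_op_def deg)
    also have "\<dots> = (\<Sum>k\<le>m. (?p k - ?K s * ?q k) * (T ^^ k) f s)"
      by (simp add: sum_distrib_left sum_subtractf algebra_simps)
    also have "\<dots> = (\<Sum>k<m. (?p k - ?K s * ?q k) * (T ^^ k) f s) + (1 - ?K s) * (T ^^ m) f s"
      by (simp add: deg flip: lessThan_Suc_atMost)
    finally have "(1 - ?K s) * (T ^^ m) f s = - (\<Sum>k<m. (?p k - ?K s * ?q k) * (T ^^ k) f s)"
      by (simp add: eq_neg_iff_add_eq_0 add.commute)
    then have "(T ^^ m) f s = - (\<Sum>k<m. (?p k - ?K s * ?q k) * (T ^^ k) f s) / (1 - ?K s)"
      using K1[OF s] by (simp add: field_simps)
    also have "\<dots> = (\<Sum>k<m. r k s * (T ^^ k) f s)"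
      by (simp only: r_def sum_divide_distrib sum_negf[symmetric] minus_divide_left mult_minus_left times_divide_eq_left)
    finally show ?thesis .
  qed
  have r: "r k holomorphic_on U" for k
    unfolding r_def by (intro holomorphic_intros kummer_holomorphic K1)
  have h0: "s / of_nat \<gamma> \<noteq> 0" if "s \<in> U" for s using that dom(3) \<gamma> by (auto simp: cov.XX_def)
  have "f s = 0" if "s \<in> U" for s
    using ode_unique[OF f'(1) dom(2) s0 h0 _ r ode _ that] zero gamma_bar_pos unfolding m_def by blast
  then show ?thesis using f'(2) by (metis (no_types) ext)
qed

lemma VV_bases:
  assumes dom: "open U" "connected U" "U \<subseteq> cov.XX" and s0: "s0 \<in> U"
    and v: "\<And>j. j < gamma_bar n \<gamma> B \<Longrightarrow> v j \<in> VV U" and ind: "germ_independent (gamma_bar n \<gamma> B) v s0"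
  defines "W \<equiv> (\<lambda>f s. s ^ \<gamma> * f s) ` VV U"
  shows "is_basis (VV U) (gamma_bar n \<gamma> B) v" "is_basis W (gamma_bar n \<gamma> B) (\<lambda>j s. s ^ \<gamma> * v j s)"
    "cfun.subspace W"
proof -
  interpret vector_field U "\<lambda>s. s / of_nat \<gamma>" by (rule vector_field_scaled[OF dom(1)])
  define m where "m = gamma_bar n \<gamma> B"
  define J where "J = (\<lambda>f k. (T ^^ k) f s0)"
  have J: "J f k = poly_op (Polynomial.monom 1 k) T f s0" for f k unfolding J_def poly_op_monom ..
  have Jadd: "J (\<lambda>z. f z + g z) k = J f k + J g k" if "f \<in> VV U" "g \<in> VV U" for f g k
    using that s0 unfolding J VV_iff by (intro poly_op_fun_add) auto
  have Jscale: "J (\<lambda>z. c * f z) k = c * J f k" if "f \<in> VV U" for f c k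
    using that s0 unfolding J VV_iff by (intro poly_op_fun_cmult) auto
  have Jinj: "f = (\<lambda>_. 0)" if "f \<in> VV U" "\<And>k. k < m \<Longrightarrow> J f k = 0" for f
    using VV_unique[OF dom s0 that(1)] that(2) unfolding J_def m_def by blast
  have ind': "\<forall>i<m. x i = 0" if "\<forall>z. (\<Sum>i<m. x i * v i z) = 0" for x
    using ind that unfolding germ_independent_def m_def by simp
  have vV: "v j \<in> VV U" if "j < m" for j using v that by (simp add: m_def)
  show "is_basis (VV U) (gamma_bar n \<gamma> B) v" unfolding m_def[symmetric]
    by (rule span_of_independent[OF VV_subspace[OF dom(1)] vV ind' Jadd Jscale Jinj])
  have U0: "0 \<notin> U" using dom(3) by (auto simp: cov.XX_def)
  define D where "D = (\<lambda>(f :: complex \<Rightarrow> complex) s. f s / s ^ \<gamma>)"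
  have DV: "D f \<in> VV U" "f = (\<lambda>s. s ^ \<gamma> * D f s)" if fW: "f \<in> W" for f
  proof -
    obtain g where g: "g \<in> VV U" "f = (\<lambda>s. s ^ \<gamma> * g s)"
      using fW unfolding W_def image_iff by (elim bexE) (rule that)
    have "g 0 = 0" using g(1) U0 unfolding VV_iff by blast
    then have "D f = g" by (auto simp: D_def g(2) fun_eq_iff)
    then show "D f \<in> VV U" "f = (\<lambda>s. s ^ \<gamma> * D f s)" using g by simp_all
  qed
  have WI: "(\<lambda>s. s ^ \<gamma> * g s) \<in> W" if "g \<in> VV U" for g using that unfolding W_def by blast
  have Dadd: "D (\<lambda>z. f z + g z) = (\<lambda>z. D f z + D g z)" and Dscale: "D (\<lambda>z. c * f z) = (\<lambda>z. c * D f z)" for f g c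
    by (simp_all add: D_def add_divide_distrib)
  show W: "cfun.subspace W"
  proof (rule cfun.subspaceI)
    have "(\<lambda>s. s ^ \<gamma> * (0 :: complex \<Rightarrow> complex) s) \<in> W" by (rule WI[OF cfun.subspace_0[OF VV_subspace[OF dom(1)]]])
    then show "0 \<in> W" by (simp add: zero_fun_def)
    show "f + g \<in> W" if fg: "f \<in> W" "g \<in> W" for f g
    proof -
      have "(\<lambda>s. s ^ \<gamma> * (D f + D g) s) \<in> W"
        by (rule WI[OF cfun.subspace_add[OF VV_subspace[OF dom(1)] DV(1)[OF fg(1)] DV(1)[OF fg(2)]]])
      moreover have "(\<lambda>s. s ^ \<gamma> * (D f + D g) s) = f + g"
      proof (rule ext)
        fix s
        show "s ^ \<gamma> * (D f + D g) s = (f + g) s"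
          using fun_cong[OF DV(2)[OF fg(1)], of s] fun_cong[OF DV(2)[OF fg(2)], of s] by (simp add: distrib_left)
      qed
      ultimately show ?thesis by simp
    qed
    show "(\<lambda>z. c * f z) \<in> W" if f: "f \<in> W" for c f
    proof -
      have "(\<lambda>s. s ^ \<gamma> * (c * D f s)) \<in> W"
        by (rule WI[OF cfun.subspace_scale[OF VV_subspace[OF dom(1)] DV(1)[OF f]]])
      moreover have "(\<lambda>s. s ^ \<gamma> * (c * D f s)) = (\<lambda>z. c * f z)"
      proof (rule ext)
        fix s
        show "s ^ \<gamma> * (c * D f s) = c * f s" using fun_cong[OF DV(2)[OF f], of s] by simp
      qed
      ultimately show ?thesis by simp
    qed
  qed
  show "is_basis W (gamma_bar n \<gamma> B) (\<lambda>j s. s ^ \<gamma> * v j s)" unfolding m_def[symmetric]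
  proof (rule span_of_independent[OF W, where J = "\<lambda>f. J (D f)"])
    show "(\<lambda>s. s ^ \<gamma> * v j s) \<in> W" if "j < m" for j by (rule WI[OF vV[OF that]])
    show "\<forall>i<m. x i = 0" if x: "\<forall>z. (\<Sum>i<m. x i * (z ^ \<gamma> * v i z)) = 0" for x
    proof (rule ind', rule allI)
      fix z
      have "z ^ \<gamma> * (\<Sum>i<m. x i * v i z) = 0" using x by (simp add: sum_distrib_left mult.left_commute)
      moreover have "(\<Sum>i<m. x i * v i z) = 0" if "z = 0"
        using vV U0 that unfolding VV_iff by (intro sum.neutral) auto
      ultimately show "(\<Sum>i<m. x i * v i z) = 0" by auto
    qed
    show "J (D (\<lambda>z. f z + g z)) k = J (D f) k + J (D g) k" if "f \<in> W" "g \<in> W" for f g k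
      unfolding Dadd by (rule Jadd[OF DV(1)[OF that(1)] DV(1)[OF that(2)]])
    show "J (D (\<lambda>z. c * f z)) k = c * J (D f) k" if "f \<in> W" for f c k
      unfolding Dscale by (rule Jscale[OF DV(1)[OF that]])
    show "f = (\<lambda>_. 0)" if "f \<in> W" "\<And>k. k < m \<Longrightarrow> J (D f) k = 0" for f
      using DV(2)[OF that(1)] Jinj[OF DV(1)[OF that(1)] that(2)] by simp
  qed
qed

lemma based_monodromy:
  assumes "based_frame \<gamma> kap (gamma_bar n \<gamma> B) g (h_infinity n \<gamma> B) (h_zero_inverse n \<gamma> B) s0 u0 k0 b"
  shows "(\<forall>p. loop_in cov.XX s0 p \<longrightarrow> (\<exists>M. has_monodromy (gamma_bar n \<gamma> B) b p M)) \<and>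
     monodromy_group cov.XX s0 (gamma_bar n \<gamma> B) b = H_bar n \<gamma> B \<and>
     (\<forall>i<\<gamma>. \<exists>p. loop_around cov.XX s0 (omega_pt n \<gamma> B i) p \<and> has_monodromy (gamma_bar n \<gamma> B) b p (M_omega n \<gamma> B i)) \<and>
     (\<exists>p. loop_around_infinity cov.XX s0 p \<and> has_monodromy (gamma_bar n \<gamma> B) b p (M_infinity n \<gamma> B))"
proof -
  interpret F: based_frame \<gamma> kap "gamma_bar n \<gamma> B" g "h_infinity n \<gamma> B" "h_zero_inverse n \<gamma> B" s0 u0 k0 b by fact
  have h1: "F.h1 = h_one n \<gamma> B" unfolding F.h1_def h_one_eq ..
  have Mk: "F.Mk (int i) = M_omega n \<gamma> B i" for i unfolding F.Mk_def M_omega_eq h1 ..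
  have HH: "F.HH = H_bar n \<gamma> B" unfolding F.HH_def H_bar_def M_infinity_def Mk ..
  show ?thesis
    using F.monodromy_in_HH F.monodromy_group_eq F.loop_omega F.loop_infinity
    unfolding HH Mk omega_pt_eq M_infinity_def by blast
qed

text \<open>The two bases are pull-backs of the frame and of its multiple by the periodic function
  \<open>\<phi>\<close>, which is \<open>inverse (s ^ \<gamma>)\<close> in the coordinate
  \<open>u\<close>.\<close>

lemma local_monodromy:
  assumes r: "r > 0" and sub: "ball s0 r \<subseteq> cov.XX"
  defines "V \<equiv> VV (ball s0 r)"
  shows "\<exists>v w. is_basis V (gamma_bar n \<gamma> B) v \<and> is_basis ((\<lambda>f s. s ^ \<gamma> * f s) ` V) (gamma_bar n \<gamma> B) w \<and>
     w = (\<lambda>j s. s ^ \<gamma> * v j s) \<and> cfun.subspace ((\<lambda>f s. s ^ \<gamma> * f s) ` V) \<and>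
     (\<forall>b\<in>{v, w}. \<exists>g u0 k0. based_frame \<gamma> kap (gamma_bar n \<gamma> B) g (h_infinity n \<gamma> B) (h_zero_inverse n \<gamma> B) s0 u0 k0 b)"
proof -
  define m where "m = gamma_bar n \<gamma> B"
  define U where "U = ball s0 r"
  have U: "open U" "connected U" "U \<subseteq> cov.XX" "s0 \<in> U" using sub r by (simp_all add: U_def)
  obtain g where g: "monodromy_frame \<gamma> kap m g (h_infinity n \<gamma> B) (h_zero_inverse n \<gamma> B)"
    and god: "\<And>j u. j < m \<Longrightarrow> u \<in> cov.Om 0 \<Longrightarrow> poly_op P1 deriv (g j) u = exp u * poly_op Q1 deriv (g j) u"
    unfolding m_def by (rule hypergeometric_frame) blast
  obtain u0 k0 where u0: "cov.E u0 = s0" "u0 \<in> cov.Om k0" "U \<subseteq> cov.Hp u0" "cov.br u0 ` U \<subseteq> cov.Om k0"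
    unfolding U_def by (rule cov.disc_lift[OF r sub]) blast
  define \<phi> where "\<phi> = (\<lambda>u :: complex. inverse (of_real kap ^ \<gamma> * exp u))"
  have \<phi>0: "\<phi> u \<noteq> 0" for u using cov.\<kappa> by (simp add: \<phi>_def)
  have \<phi>hol: "\<phi> holomorphic_on UNIV" unfolding \<phi>_def using cov.\<kappa> by (intro holomorphic_intros) auto
  have period: "exp (2 * of_real pi * \<i> * of_int k) = (1 :: complex)" for k :: int
    unfolding exp_eq_1 by simp
  have \<phi>p: "\<phi> (u + 2 * of_real pi * \<i> * of_int k) = \<phi> u" for u k
    unfolding \<phi>_def exp_add period by simp
  have \<phi>p': "\<phi> (u - 2 * of_real pi * \<i>) = \<phi> u" for u using \<phi>p[of u "-1"] by simp
  interpret FW: monodromy_frame \<gamma> kap m g "h_infinity n \<gamma> B" "h_zero_inverse n \<gamma> B" by (rule g)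
  interpret FV: monodromy_frame \<gamma> kap m "\<lambda>j u. \<phi> u * g j u" "h_infinity n \<gamma> B" "h_zero_inverse n \<gamma> B"
    by (rule frame_rescale[OF g \<phi>hol \<phi>0 \<phi>p'])
  have FVW: "FV.gk k0 j u = \<phi> u * FW.gk k0 j u" for j u
    unfolding FV.gk_def FW.gk_def frame_mult_def \<phi>p by (simp add: sum_distrib_left mult_ac)
  define c where "c = 2 * of_real pi * \<i> * of_int k0"
  have ode: "poly_op P1 deriv (FW.gk k0 j) u = exp u * poly_op Q1 deriv (FW.gk k0 j) u"
    if j: "j < m" and u: "u \<in> cov.Om k0" for j u
  proof -
    interpret O: vector_field "cov.Om k0" "\<lambda>_. 1" by unfold_locales (auto simp: cov.open_Om)
    define M where "M = h_infinity n \<gamma> B [^]\<^bsub>GL TYPE(complex) m\<^esub> k0"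
    have G: "FW.gk k0 j = (\<lambda>u. \<Sum>i<m. M $$ (i, j) * g i (u + c))"
      by (simp add: fun_eq_iff FW.gk_def frame_mult_def M_def c_def)
    have hol: "(\<lambda>u. g i (u + c)) holomorphic_on cov.Om k0" if "i < m" for i
    proof -
      have "(g i \<circ> (\<lambda>u. u + c)) holomorphic_on cov.Om k0"
        by (rule holomorphic_on_compose_gen[OF _ FW.g_hol[OF that]])
          (auto simp: c_def cov.Om_shift intro!: holomorphic_intros)
      then show ?thesis by (simp add: o_def)
    qed
    have lin: "poly_op p deriv (FW.gk k0 j) u = (\<Sum>i<m. M $$ (i, j) * poly_op p deriv (g i) (u + c))" for p
    proof -
      have "poly_op p deriv (FW.gk k0 j) u = (\<Sum>i<m. M $$ (i, j) * poly_op p deriv (\<lambda>u. g i (u + c)) u)"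
        unfolding G deriv_vf by (rule O.poly_op_fun_sum) (use hol u in auto)
      then show ?thesis unfolding poly_op_deriv_shift .
    qed
    have "u + c \<in> cov.Om 0" using u by (simp add: c_def cov.Om_shift)
    moreover have "exp (u + c) = exp u" unfolding c_def exp_add period by simp
    ultimately have "poly_op P1 deriv (g i) (u + c) = exp u * poly_op Q1 deriv (g i) (u + c)" if "i < m" for i
      using god[OF that, of "u + c"] by simp
    then show ?thesis unfolding lin by (simp add: sum_distrib_left mult.left_commute)
  qed
  define v where "v = (\<lambda>j s. if s \<in> U then inverse (s ^ \<gamma>) * FW.gk k0 j (cov.br u0 s) else 0)"
  have vV: "v j \<in> VV U" if "j < m" for j
    unfolding v_def by (rule VV_pullback[OF U(1) u0(3) cov.open_Om u0(4) FW.gk_holomorphic[OF that] ode[OF that]])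
  have nz: "s \<noteq> 0" if "s \<in> U" for s using that U(3) by (auto simp: cov.XX_def)
  have v1: "v j s = FV.gk k0 j (cov.br u0 s)" if s: "s \<in> U" for j s
  proof -
    have "s ^ \<gamma> = cov.E (cov.br u0 s) ^ \<gamma>" using nz[OF s] by (simp add: cov.E_br)
    also have "\<dots> = of_real kap ^ \<gamma> * exp (cov.br u0 s / of_nat \<gamma>) ^ \<gamma>"
      by (simp add: cov.E_def power_mult_distrib)
    also have "exp (cov.br u0 s / of_nat \<gamma>) ^ \<gamma> = exp (cov.br u0 s)"
      using \<gamma> by (simp flip: exp_of_nat_mult)
    finally have "inverse (s ^ \<gamma>) = \<phi> (cov.br u0 s)" by (simp only: \<phi>_def)
    then show ?thesis using s by (simp only: v_def FVW if_True)
  qed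
  have ev: "\<forall>\<^sub>F z in nhds s0. z \<in> U" using U by (intro eventually_nhds_in_open)
  have bv: "based_frame \<gamma> kap m (\<lambda>j u. \<phi> u * g j u) (h_infinity n \<gamma> B) (h_zero_inverse n \<gamma> B) s0 u0 k0 v"
    by unfold_locales (use u0 ev v1 in \<open>auto elim!: eventually_mono\<close>)
  have bw: "based_frame \<gamma> kap m g (h_infinity n \<gamma> B) (h_zero_inverse n \<gamma> B) s0 u0 k0 (\<lambda>j s. s ^ \<gamma> * v j s)"
  proof unfold_locales
    show "\<forall>\<^sub>F z in nhds s0. z ^ \<gamma> * v j z = FW.gk k0 j (cov.br u0 z)" for j
      using ev by eventually_elim (simp add: v_def nz)
  qed (use u0 in auto)
  have "germ_independent m v s0" by (rule based_frame.b_indep[OF bv])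
  note bases = VV_bases[OF U vV[unfolded m_def] this[unfolded m_def], folded m_def]
  show ?thesis unfolding V_def U_def[symmetric] m_def[symmetric]
  proof (intro exI conjI)
    show "is_basis (VV U) m v" "is_basis ((\<lambda>f s. s ^ \<gamma> * f s) ` VV U) m (\<lambda>j s. s ^ \<gamma> * v j s)"
      "cfun.subspace ((\<lambda>f s. s ^ \<gamma> * f s) ` VV U)"
      using bases by simp_all
    show "\<forall>b\<in>{v, \<lambda>j s. s ^ \<gamma> * v j s}. \<exists>g u0 k0. based_frame \<gamma> kap m g (h_infinity n \<gamma> B) (h_zero_inverse n \<gamma> B) s0 u0 k0 b"
      using bv bw by blast
  qed (rule refl)
qed

end

lemma is_basis_dim: assumes "is_basis W m w" shows "cfun.dim W = m"
proof -
  have w: "inj_on w {..<m}" "cfun.independent (w ` {..<m})" "cfun.span (w ` {..<m}) = W"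
    using assms by (auto simp: is_basis_def)
  then have "cfun.span (w ` {..<m}) = cfun.span W" by (metis cfun.span_span)
  then have "cfun.dim W = card (w ` {..<m})" using w(2) by (rule cfun.dim_eq_card)
  then show ?thesis using w(1) by (simp add: card_image)
qed

theorem theorem7p15:
  fixes \<alpha> :: "nat \<Rightarrow> int ^ 'n" and B :: "nat \<Rightarrow> nat" and \<gamma> n m :: nat
    and S X :: "complex set" and G :: "complex mat monoid"
  assumes n: "n = CARD('n)"
    and origin: "\<alpha> (n + 1) = 0"
    and simplex: "int n simplex (convex hull ((\<lambda>i. real_pt (\<alpha> i)) ` {1..n+1}))"
    and interior: "real_pt (\<alpha> (n + 2)) \<in> interior (convex hull ((\<lambda>i. real_pt (\<alpha> i)) ` {1..n+1}))"
    and vol: "real \<gamma> = fact n * measure lebesgue (convex hull ((\<lambda>i. real_pt (\<alpha> i)) ` {1..n+1}))"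
    and vol_B: "\<forall>q\<in>{1..n+1}. real (B q) = fact n *
        measure lebesgue (convex hull ((\<lambda>i. real_pt (\<alpha> i)) ` ({1..n+2} - {q})))"
    and gcd_B: "Gcd (B ` {1..n+1}) = 1"
    and m: "m = gamma_bar n \<gamma> B"
    and S: "S = sing_pts n \<gamma> B"
    and X: "X = - insert 0 S"
    and G: "G = GL TYPE(complex) m"
  shows "bij_betw (omega_pt n \<gamma> B) {..<\<gamma>} S \<and>
    (\<forall>s0 r. r > 0 \<and> ball s0 r \<subseteq> X \<longrightarrow>
      (let V = ker_on (ball s0 r)
                 (Rbar_op n \<gamma> B (kummer n \<gamma> B) (\<lambda>f s. euler_op f s / of_nat \<gamma>));
           W = (\<lambda>f s. s ^ \<gamma> * f s) ` V
       in cfun.subspace W \<and> W \<subseteq> ker_on (ball s0 r) (R_op n \<gamma> B) \<and> cfun.dim W = m \<and>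
          (\<exists>v w. is_basis V m v \<and> is_basis W m w \<and> w = (\<lambda>j s. s ^ \<gamma> * v j s) \<and>
            (\<forall>b\<in>{v, w}.
              (\<forall>p. loop_in X s0 p \<longrightarrow> (\<exists>M. has_monodromy m b p M)) \<and>
              monodromy_group X s0 m b = H_bar n \<gamma> B \<and>
              (\<forall>i<\<gamma>. \<exists>p. loop_around X s0 (omega_pt n \<gamma> B i) p \<and>
                 has_monodromy m b p (M_omega n \<gamma> B i)) \<and>
              (\<exists>p. loop_around_infinity X s0 p \<and> has_monodromy m b p (M_infinity n \<gamma> B)))))) \<and>
    {h_zero_inverse n \<gamma> B, h_infinity n \<gamma> B} \<subseteq> map_mat of_int ` carrier (GL TYPE(int) m) \<and>
    (\<exists>K. subgroup K (GL TYPE(int) m) \<and> H_bar n \<gamma> B = map_mat of_int ` K) \<and>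
    discrete_mats m (H_bar n \<gamma> B) \<and>
    (odd n \<longrightarrow> h_one n \<gamma> B \<otimes>\<^bsub>G\<^esub> h_one n \<gamma> B = \<one>\<^bsub>G\<^esub>)"
proof -
  have vol_facts: "\<gamma> > 0" "\<forall>q\<in>{1..n+1}. B q > 0" "(\<Sum>q=1..n+1. B q) = \<gamma>"
    using volumes[OF n interior vol vol_B] by blast+
  interpret volumes_data n \<gamma> B
    using vol_facts n by unfold_locales (auto simp: Suc_le_eq)
  have Xeq: "X = cov.XX" unfolding X S X_eq ..
  have loc: "let V = ker_on (ball s0 r)
                 (Rbar_op n \<gamma> B (kummer n \<gamma> B) (\<lambda>f s. euler_op f s / of_nat \<gamma>));
           W = (\<lambda>f s. s ^ \<gamma> * f s) ` V
       in cfun.subspace W \<and> W \<subseteq> ker_on (ball s0 r) (R_op n \<gamma> B) \<and> cfun.dim W = m \<and>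
          (\<exists>v w. is_basis V m v \<and> is_basis W m w \<and> w = (\<lambda>j s. s ^ \<gamma> * v j s) \<and>
            (\<forall>b\<in>{v, w}.
              (\<forall>p. loop_in X s0 p \<longrightarrow> (\<exists>M. has_monodromy m b p M)) \<and>
              monodromy_group X s0 m b = H_bar n \<gamma> B \<and>
              (\<forall>i<\<gamma>. \<exists>p. loop_around X s0 (omega_pt n \<gamma> B i) p \<and>
                 has_monodromy m b p (M_omega n \<gamma> B i)) \<and>
              (\<exists>p. loop_around_infinity X s0 p \<and> has_monodromy m b p (M_infinity n \<gamma> B))))"
    if r: "r > 0" and sub: "ball s0 r \<subseteq> X" for s0 r
  proof -
    define V where "V = VV (ball s0 r)"
    define W where "W = (\<lambda>f s. s ^ \<gamma> * f s) ` V"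
    obtain v w where vw: "is_basis V m v" "is_basis W m w" "w = (\<lambda>j s. s ^ \<gamma> * v j s)" "cfun.subspace W"
      and fr: "\<And>b. b \<in> {v, w} \<Longrightarrow> \<exists>g u0 k0. based_frame \<gamma> kap m g (h_infinity n \<gamma> B) (h_zero_inverse n \<gamma> B) s0 u0 k0 b"
      using local_monodromy[OF r sub[unfolded Xeq]] unfolding V_def[symmetric] W_def[symmetric] m[symmetric]
      by (elim exE conjE) (rule that, assumption, assumption, assumption, assumption, erule (1) bspec)
    have mon: "(\<forall>p. loop_in X s0 p \<longrightarrow> (\<exists>M. has_monodromy m b p M)) \<and>
              monodromy_group X s0 m b = H_bar n \<gamma> B \<and>
              (\<forall>i<\<gamma>. \<exists>p. loop_around X s0 (omega_pt n \<gamma> B i) p \<and> has_monodromy m b p (M_omega n \<gamma> B i)) \<and>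
              (\<exists>p. loop_around_infinity X s0 p \<and> has_monodromy m b p (M_infinity n \<gamma> B))" if b: "b \<in> {v, w}" for b
    proof -
      obtain g u0 k0 where "based_frame \<gamma> kap m g (h_infinity n \<gamma> B) (h_zero_inverse n \<gamma> B) s0 u0 k0 b"
        using fr[OF b] by (elim exE)
      then show ?thesis unfolding m Xeq by (rule based_monodromy)
    qed
    have incl: "W \<subseteq> ker_on (ball s0 r) (R_op n \<gamma> B)"
      unfolding W_def V_def VV_def by (rule image_subsetI) (rule reduced_kernel_subset[OF open_ball])
    show ?thesis
      unfolding Let_def VV_def[symmetric] V_def[symmetric] W_def[symmetric]
      by (rule conjI[OF vw(4)], rule conjI[OF incl], rule conjI[OF is_basis_dim[OF vw(2)]],
          rule exI[of _ v], rule exI[of _ w], rule conjI[OF vw(1)], rule conjI[OF vw(2)], rule conjI[OF vw(3)],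
          rule ballI, rule mon)
  qed
  have int: "{h_zero_inverse n \<gamma> B, h_infinity n \<gamma> B} \<subseteq> map_mat of_int ` carrier (GL TYPE(int) m)"
    using h_integral unfolding m by simp
  have sgr: "\<exists>K. subgroup K (GL TYPE(int) m) \<and> H_bar n \<gamma> B = map_mat of_int ` K"
    using H_bar_integral unfolding m .
  have disc: "discrete_mats m (H_bar n \<gamma> B)" using H_bar_discrete unfolding m .
  have invol: "odd n \<Longrightarrow> h_one n \<gamma> B \<otimes>\<^bsub>G\<^esub> h_one n \<gamma> B = \<one>\<^bsub>G\<^esub>"
    unfolding G m by (rule h_one_involution)
  have bij: "bij_betw (omega_pt n \<gamma> B) {..<\<gamma>} S" using bij_omega unfolding S .
  show ?thesis
    by (intro conjI allI impI) (rule bij, elim conjE, rule loc, assumption, assumption,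
        rule int, rule sgr, rule disc, erule invol)
qed

end
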